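(* Let $d\ge3$ and let $Q$ be an external field on $\mathbb{S}^{d-1}$ that is rotationally invariant with respect to rotations about the polar axis, and such that $Q\in C^2(N)$, where $N$ is an open neighborhood of $S_Q$ in $\mathbb{S}^{d-1}$. Assume that $S_Q$ is a spherical cap $C_{S,\alpha}$ centered at the South Pole, with $0<\alpha\le\pi$. Let $$F(\eta)=\frac{\Gamma((d-2)/2)}{2\pi^{(d+2)/2}}\,\frac{1}{\sin\eta}\,\csc^{d-3}\Big(\frac{\eta}{2}\Big)\,\frac{d}{d\eta}\int_\alpha^\eta\frac{g(\zeta)\sin\zeta\,d\zeta}{\sqrt{\cos\zeta-\cos\eta}},\qquad \alpha\le\eta\le\pi,$$ where $$g(\zeta)=\tan^{d-3}\Big(\frac{\zeta}{2}\Big)\,\frac{d}{d\zeta}\int_\zeta^\pi\frac{Q(\theta)\cos^{d-3}(\theta/2)\sin\theta\,d\theta}{\sqrt{\cos\zeta-\cos\theta}},\qquad \alpha\le\zeta\le\pi.$$ Then the density $f$ of the equilibrium measure $\mu_Q$ (that is, $d\mu_Q=f\,d\sigma_d$ with $f$ a function of the polar angle $\eta$) is given by $$f(\eta)=C_Q\Big(\frac{1-\cos\alpha}{1-\cos\eta}\Big)^{\frac{d-1}{2}}\Big(\frac{1-\cos\alpha}{\cos\alpha-\cos\eta}\Big)^{\frac12}\,{}_2F_1\Big(1,\frac{d-1}{2};\frac12;\frac{\cos\alpha-\cos\eta}{1-\cos\eta}\Big)+F(\eta),\qquad \alpha\le\eta\le\pi,$$ where the constant $C_Q$ is uniquely determined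 by $$C_Q=\frac{\Gamma(d/2-1)}{2^{d-2}\sqrt{\pi}\,\Gamma((d-1)/2)}\Big(\mathrm{B}\Big(\cos^2\Big(\frac{\alpha}{2}\Big);\frac{d-2}{2},\frac d2\Big)\Big)^{-1}\Big\{\frac{\Gamma((d-1)/2)}{2\pi^{(d-1)/2}}-\int_\alpha^\pi F(\eta)\sin^{d-2}\eta\,d\eta\Big\}.$$
   Context: $\mathbb{S}^{d-1}=\{x\in\mathbb{R}^d:|x|=1\}$, $d\ge3$, with Lebesgue surface measure $\sigma_d$. For $x=(x_1,\dots,x_d)\in\mathbb{S}^{d-1}$ the polar angle $\theta\in[0,\pi]$ is defined by $x_1=\cos\theta$; the polar axis is the $x_1$-axis, the South Pole is $(-1,0,\dots,0)$. A rotationally invariant $Q$ depends only on the polar angle and is written $Q(\theta)$. For $0<\alpha\le\pi$, $C_{S,\alpha}$ is the set of points of $\mathbb{S}^{d-1}$ with polar angle in $[\alpha,\pi]$. An external field on $\mathbb{S}^{d-1}$ is a non-negative lower semicontinuous function $Q:\mathbb{S}^{d-1}\to[0,\infty]$ with $Q(x)<\infty$ on a set of positive surface measure. For a unit positive Borel measure $\mu$ on $\mathbb{S}^{d-1}$ put $$I(\mu)=\iint\frac{1}{|x-y|^{d-2}}\,d\mu(x)\,d\mu(y),\qquad I_Q(\mu)=I(\mu)+2\int Q\,d\mu,$$ and $V_Q=\inf\{I_Q(\mu)\}$ over all unit positive Borel measures $\mu$ on $\mathbb{S}^{d-1}$. The extremal (or equilibrium) measure $\mu_Q$ is the unit positive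 Borel measure on $\mathbb{S}^{d-1}$ with $I_Q(\mu_Q)=V_Q$, and $S_Q=\operatorname{supp}\mu_Q$. Incomplete Beta function: $\mathrm{B}(z;a,b)=\int_0^z t^{a-1}(1-t)^{b-1}\,dt$. Gauss hypergeometric function: ${}_2F_1(a,b;c;z)=\sum_{n\ge0}\frac{(a)_n(b)_n}{(c)_n}\frac{z^n}{n!}$ for $|z|<1$, with $(a)_0=1$, $(a)_n=a(a+1)\cdots(a+n-1)$. As usual, formulas for densities are understood almost everywhere. *)

theory Defs
  imports "HOL-Probability.Probability"
begin

text \<open>The ambient space is \<open>real ^ 'n\<close>, so \<open>d = CARD('n)\<close>; the coordinate \<open>x $ k\<close> for a fixed index
  \<open>k\<close> plays the role of \<open>x\<^sub>1\<close>.\<close>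

section \<open>The sphere\<close>

text \<open>Lebesgue surface measure, defined through polar coordinates:
  \<open>\<sigma>(A) = d \<cdot> \<lambda>({x. 0 < \<bar>x\<bar> \<le> 1, x/\<bar>x\<bar> \<in> A})\<close>, where \<open>\<lambda>\<close> is Lebesgue measure.  It is not normalised.\<close>

definition sphere_borel :: "(real ^ 'n) measure" where
  "sphere_borel = restrict_space borel (sphere 0 1)"

definition surface_measure :: "(real ^ 'n) measure" where
  "surface_measure =
     scale_measure (of_nat CARD('n))
       (distr (restrict_space lborel (cball 0 1 - {0})) sphere_borel (\<lambda>x. x /\<^sub>R norm x))"

definition polar_angle :: "'n \<Rightarrow> real ^ 'n \<Rightarrow> real" where
  "polar_angle k x = arccos (x $ k)"

definition south_cap :: "'n \<Rightarrow> real \<Rightarrow> (real ^ 'n) set" where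
  "south_cap k \<alpha> = {x \<in> sphere 0 1. polar_angle k x \<in> {\<alpha>..pi}}"

section \<open>External fields\<close>

definition lsc_on :: "'a::topological_space set \<Rightarrow> ('a \<Rightarrow> ennreal) \<Rightarrow> bool" where
  "lsc_on S Q \<longleftrightarrow> (\<forall>a. openin (top_of_set S) {x \<in> S. a < Q x})"

definition external_field :: "(real ^ 'n \<Rightarrow> ennreal) \<Rightarrow> bool" where
  "external_field Q \<longleftrightarrow>
     lsc_on (sphere 0 1) Q \<and> emeasure surface_measure {x \<in> sphere 0 1. Q x < \<infinity>} > 0"

definition rotation_invariant :: "'n \<Rightarrow> (real ^ 'n \<Rightarrow> ennreal) \<Rightarrow> bool" where
  "rotation_invariant k Q \<longleftrightarrow>
     (\<forall>A. rotation_matrix A \<and> A *v axis k 1 = axis k 1 \<longrightarrow>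
          (\<forall>x \<in> sphere 0 1. Q (A *v x) = Q x))"

text \<open>\<open>Q(\<theta>)\<close> is the value of \<open>Q\<close> at any point of the sphere with polar angle \<open>\<theta>\<close>.  The conversion
  \<open>enn2real\<close> sends \<open>\<infinity>\<close> to \<open>0\<close>, so this is meaningful only for angles at which \<open>Q\<close> is finite.\<close>

definition polar_profile :: "'n \<Rightarrow> (real ^ 'n \<Rightarrow> ennreal) \<Rightarrow> real \<Rightarrow> real" where
  "polar_profile k Q \<theta> = enn2real (Q (SOME x. x \<in> sphere 0 1 \<and> polar_angle k x = \<theta>))"

definition C2_on :: "'a::real_normed_vector set \<Rightarrow> ('a \<Rightarrow> real) \<Rightarrow> bool" where
  "C2_on U h \<longleftrightarrow>
     (\<exists>(D :: 'a \<Rightarrow> 'a \<Rightarrow>\<^sub>L real) (D2 :: 'a \<Rightarrow> 'a \<Rightarrow>\<^sub>L 'a \<Rightarrow>\<^sub>L real).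
        (\<forall>x\<in>U. (h has_derivative blinfun_apply (D x)) (at x) \<and>
               (D has_derivative blinfun_apply (D2 x)) (at x)) \<and>
        continuous_on U D2)"

text \<open>\<open>C\<^sup>2\<close> on a relatively open subset \<open>N\<close> of the sphere, as for functions on an embedded submanifold:
  locally the restriction of a \<open>C\<^sup>2\<close> function on an open subset of the ambient space.
  In particular \<open>Q\<close> is finite on \<open>N\<close>.\<close>

definition C2_on_sphere :: "(real ^ 'n) set \<Rightarrow> (real ^ 'n \<Rightarrow> ennreal) \<Rightarrow> bool" where
  "C2_on_sphere N Q \<longleftrightarrow>
     (\<forall>p\<in>N. \<exists>U h. open U \<and> p \<in> U \<and> C2_on U h \<and>
        (\<forall>x \<in> U \<inter> N. Q x < \<infinity> \<and> enn2real (Q x) = h x))"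

section \<open>Weighted energy and equilibrium measure\<close>

text \<open>Division in \<^typ>\<open>ennreal\<close>: the kernel is \<open>\<infinity>\<close> on the diagonal when \<open>d \<ge> 3\<close>.\<close>

definition riesz_kernel :: "real ^ 'n \<Rightarrow> real ^ 'n \<Rightarrow> ennreal" where
  "riesz_kernel x y = 1 / ennreal (norm (x - y)) ^ (CARD('n) - 2)"

definition energy :: "(real ^ 'n) measure \<Rightarrow> ennreal" where
  "energy \<mu> = (\<integral>\<^sup>+ x. \<integral>\<^sup>+ y. riesz_kernel x y \<partial>\<mu> \<partial>\<mu>)"

definition weighted_energy :: "(real ^ 'n \<Rightarrow> ennreal) \<Rightarrow> (real ^ 'n) measure \<Rightarrow> ennreal" where
  "weighted_energy Q \<mu> = energy \<mu> + 2 * (\<integral>\<^sup>+ x. Q x \<partial>\<mu>)"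

definition sphere_prob :: "(real ^ 'n) measure set" where
  "sphere_prob = {\<mu>. sets \<mu> = sets sphere_borel \<and> prob_space \<mu>}"

definition equilibrium_measure :: "(real ^ 'n \<Rightarrow> ennreal) \<Rightarrow> (real ^ 'n) measure \<Rightarrow> bool" where
  "equilibrium_measure Q \<mu> \<longleftrightarrow>
     \<mu> \<in> sphere_prob \<and> weighted_energy Q \<mu> = (INF \<nu>\<in>sphere_prob. weighted_energy Q \<nu>)"

definition sphere_supp :: "(real ^ 'n) measure \<Rightarrow> (real ^ 'n) set" where
  "sphere_supp \<mu> =
     {x \<in> sphere 0 1. \<forall>U. open U \<and> x \<in> U \<longrightarrow> emeasure \<mu> (U \<inter> sphere 0 1) > 0}"

section \<open>Special functions and the explicit density\<close>

definition inc_Beta :: "real \<Rightarrow> real \<Rightarrow> real \<Rightarrow> real" where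
  "inc_Beta z a b = (LBINT t:{0..z}. t powr (a - 1) * (1 - t) powr (b - 1))"

definition hypergeom_2F1 :: "real \<Rightarrow> real \<Rightarrow> real \<Rightarrow> real \<Rightarrow> real" where
  "hypergeom_2F1 a b c z =
     (\<Sum>n. pochhammer a n * pochhammer b n / pochhammer c n * (z ^ n / fact n))"

definition aux_g :: "nat \<Rightarrow> (real \<Rightarrow> real) \<Rightarrow> real \<Rightarrow> real" where
  "aux_g d q \<zeta> =
     tan (\<zeta> / 2) ^ (d - 3) *
     deriv (\<lambda>\<zeta>. LBINT \<theta>:{\<zeta>..pi}.
              q \<theta> * cos (\<theta> / 2) ^ (d - 3) * sin \<theta> / sqrt (cos \<zeta> - cos \<theta>)) \<zeta>"

definition aux_F :: "nat \<Rightarrow> (real \<Rightarrow> real) \<Rightarrow> real \<Rightarrow> real \<Rightarrow> real" where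
  "aux_F d q \<alpha> \<eta> =
     Gamma ((real d - 2) / 2) / (2 * pi powr ((real d + 2) / 2)) *
     (1 / sin \<eta>) * (1 / sin (\<eta> / 2)) ^ (d - 3) *
     deriv (\<lambda>\<eta>. LBINT \<zeta>:{\<alpha>..\<eta>}. aux_g d q \<zeta> * sin \<zeta> / sqrt (cos \<zeta> - cos \<eta>)) \<eta>"

definition const_C :: "nat \<Rightarrow> (real \<Rightarrow> real) \<Rightarrow> real \<Rightarrow> real" where
  "const_C d q \<alpha> =
     Gamma (real d / 2 - 1) / (2 ^ (d - 2) * sqrt pi * Gamma ((real d - 1) / 2)) *
     inverse (inc_Beta ((cos (\<alpha> / 2))\<^sup>2) ((real d - 2) / 2) (real d / 2)) *
     (Gamma ((real d - 1) / 2) / (2 * pi powr ((real d - 1) / 2)) -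
      (LBINT \<eta>:{\<alpha>..pi}. aux_F d q \<alpha> \<eta> * sin \<eta> ^ (d - 2)))"

definition cap_density :: "nat \<Rightarrow> (real \<Rightarrow> real) \<Rightarrow> real \<Rightarrow> real \<Rightarrow> real" where
  "cap_density d q \<alpha> \<eta> =
     const_C d q \<alpha> *
     ((1 - cos \<alpha>) / (1 - cos \<eta>)) powr ((real d - 1) / 2) *
     ((1 - cos \<alpha>) / (cos \<alpha> - cos \<eta>)) powr (1 / 2) *
     hypergeom_2F1 1 ((real d - 1) / 2) (1 / 2) ((cos \<alpha> - cos \<eta>) / (1 - cos \<eta>)) +
     aux_F d q \<alpha> \<eta>"

end

theory Submission
  imports Defs
begin

text \<open>In terms of the heights \<open>s\<close>, \<open>u\<close> of two points, the Riesz kernel averaged over parallels factors (Copson) as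
 \<open>((1+s)(1+u))\<^bsup>-(d-3)/2\<^esup> \<integral>\<^sub>-\<^sub>1\<^bsup>min s u\<^esup> W(\<tau>) (s-\<tau>)\<^bsup>-1/2\<^esup> (u-\<tau>)\<^bsup>-1/2\<^esup> d\<tau>\<close>, with
 \<open>W(\<tau>) = (1+\<tau>)\<^bsup>(d-4)/2\<^esup> (1-\<tau>)\<^bsup>-(d-2)/2\<^esup>\<close>.  By the variational argument of Frostman,
 \<open>U\<^sup>\<mu> + Q\<close> is constant almost everywhere on the support; through the factorisation this determines the law of the
 height under \<open>\<mu>\<close> by two Abel inversions.  The rotationally symmetric measure \<open>\<nu>\<close> with this law of heights has
 a potential that depends on the height only, hence \<open>I(\<nu>) = I(\<mu>,\<nu>)\<close>, while \<open>I(\<mu>,\<nu>) = I(\<mu>)\<close> since \<open>U\<^sup>\<mu> + Q\<close> is constant.  As the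
 energy is strictly positive definite, \<open>\<mu> = \<nu>\<close>.  The density splits linearly into the part of the constant potential, which
 is the hypergeometric term up to a factor, and the part of \<open>-Q\<close>, which is \<open>F\<close>; the factor is found from the total mass.\<close>

section \<open>Copson factorisation of the kernel\<close>

text \<open>Two facts about \<mu> are unknown at the outset: symmetry about the axis, and regularity
  of the law of its heights, which might have atoms or a singular part. Symmetry is not taken from a
  uniqueness theorem. The law is handled as an arbitrary finite measure on the line: both Abel
  transforms act on its integrals by Tonelli in \<open>ennreal\<close>, and a density appears only
  when the resulting tail function turns out to be differentiable.

  Each Abel inversion needs a derivative, which is why the field is C^2: the inverse of the first
  transform is then still differentiable, with bounds up to the rim of the cap, so the second
  transform can be differentiated too. Height is a singular coordinate at the South Pole;
  derivatives in it are controlled only after multiplication by powers of 1 + s, and constants are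
  uniform only away from -1.

  The value of the constant potential is never computed. It enters as a multiplier of the
  hypergeometric term, so total mass 1 fixes it. The case \<alpha> = pi refutes itself: the cap
  would be one point, and finite energy forbids atoms.\<close>

lemma nn_integral_Icc_Ioo:
 "(\<integral>\<^sup>+x\<in>{a..b::real}. f x \<partial>lborel) = (\<integral>\<^sup>+x\<in>{a<..<b}. f x \<partial>lborel)"
proof (rule nn_integral_cong_AE)
 show "AE x in lborel. f x * indicator {a..b} x = f x * indicator {a<..<b} x"
  using AE_lborel_singleton[of a] AE_lborel_singleton[of b]
  by eventually_elim (auto simp: indicator_def)
qed

lemma nn_integral_subst_Ioo:
 fixes f :: "real \<Rightarrow> ennreal"
 assumes "f \<in> borel_measurable borel"
  and "\<And>x. x \<in> {a..b} \<Longrightarrow> (g has_real_derivative g' x) (at x)"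
  and "continuous_on {a..b} g'"
  and "\<And>x. x \<in> {a..b} \<Longrightarrow> g' x \<ge> 0"
  and "a < b"
 shows "(\<integral>\<^sup>+x\<in>{g a<..<g b}. f x \<partial>lborel) = (\<integral>\<^sup>+x\<in>{a<..<b}. f (g x) * ennreal (g' x) \<partial>lborel)"
 using nn_integral_substitution_aux[OF assms(1) _ assms(2-5)]
 by (simp add: nn_integral_Icc_Ioo)

text \<open>Euler's integral moved to an arbitrary interval by an affine map. The exponents are kept
  as \<open>A - 1\<close> and \<open>B - 1\<close>: with B = 1 this integrates pure powers, with A =
  B = 1/2 it is the Abel kernel.\<close>

lemma nn_integral_Beta:
 fixes p q A B :: real
 assumes "p < q" "A > 0" "B > 0"
 shows "(\<integral>\<^sup>+s\<in>{p<..<q}. ennreal ((s - p) powr (A - 1) * (q - s) powr (B - 1)) \<partial>lborel)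
  = ennreal ((q - p) powr (A + B - 1) * Beta A B)"
proof -
 have "((\<lambda>t. t powr (A - 1) * (1 - t) powr (B - 1)) has_integral Beta A B) {0..1}"
  using has_integral_Beta_real[OF assms(2,3)] .
 then have 1: "(\<integral>\<^sup>+t\<in>{0..1}. ennreal (t powr (A - 1) * (1 - t) powr (B - 1)) \<partial>lborel) = ennreal (Beta A B)"
  by (intro nn_integral_has_integral_lebesgue') auto
 have "(\<integral>\<^sup>+s\<in>{p<..<q}. ennreal ((s - p) powr (A - 1) * (q - s) powr (B - 1)) \<partial>lborel)
  = ennreal \<bar>q - p\<bar> * (\<integral>\<^sup>+x. ennreal (((p + (q - p) * x) - p) powr (A - 1) * (q - (p + (q - p) * x)) powr (B - 1))
     * indicator {p<..<q} (p + (q - p) * x) \<partial>lborel)"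
  using assms by (subst nn_integral_real_affine[where t=p and c="q-p"]) auto
 also have "\<dots> = ennreal (q - p) * (\<integral>\<^sup>+x. ennreal ((q - p) powr (A + B - 2)) *
   (ennreal (x powr (A - 1) * (1 - x) powr (B - 1)) * indicator {0<..<1} x) \<partial>lborel)"
 proof (rule arg_cong2[where f="(*)"], use assms in simp, rule nn_integral_cong)
  fix x :: real
  have "x \<in> {0<..<1} \<longleftrightarrow> p + (q - p) * x \<in> {p<..<q}"
   using assms(1) by (auto simp: zero_less_mult_iff) (auto simp: algebra_simps, (sos | smt (verit) mult_le_cancel_left1 mult_less_cancel_left2 left_diff_distrib' mult.commute)+)
  moreover have "((p + (q - p) * x) - p) powr (A - 1) * (q - (p + (q - p) * x)) powr (B - 1)
   = (q - p) powr (A + B - 2) * (x powr (A - 1) * (1 - x) powr (B - 1))" if "x \<in> {0<..<1}"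
  proof -
   have "q - (p + (q - p) * x) = (q - p) * (1 - x)" "p + (q - p) * x - p = (q - p) * x"
    by (simp_all add: algebra_simps)
   moreover have "(q - p) powr (A + B - 2) = (q - p) powr (A - 1) * (q - p) powr (B - 1)"
    by (simp add: powr_add[symmetric])
   ultimately show ?thesis using that assms(1)
    by (simp add: powr_mult mult_ac)
  qed
  ultimately show "ennreal (((p + (q - p) * x) - p) powr (A - 1) * (q - (p + (q - p) * x)) powr (B - 1))
     * indicator {p<..<q} (p + (q - p) * x) = ennreal ((q - p) powr (A + B - 2)) *
   (ennreal (x powr (A - 1) * (1 - x) powr (B - 1)) * indicator {0<..<1} x)"
   by (cases "x \<in> {0<..<1}") (auto simp: ennreal_mult)
 qed
 also have "\<dots> = ennreal (q - p) * (ennreal ((q - p) powr (A + B - 2)) * ennreal (Beta A B))"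
  by (subst nn_integral_cmult) (simp_all add: 1 nn_integral_Icc_Ioo[symmetric])
 also have "\<dots> = ennreal ((q - p) * (q - p) powr (A + B - 2) * Beta A B)"
 proof -
  have "Beta A B \<ge> 0"
   using assms Gamma_real_pos[of A] Gamma_real_pos[of B] Gamma_real_pos[of "A+B"] by (simp add: Beta_def)
  then show ?thesis using assms(1) by (simp add: ennreal_mult'[symmetric] ennreal_mult''[symmetric] mult.assoc)
 qed
 also have "(q - p) * (q - p) powr (A + B - 2) = (q - p) powr (A + B - 1)"
  using assms by (subst powr_mult_base) auto
 finally show ?thesis .
qed

lemma Beta_half_half: "Beta (1/2) (1/2::real) = pi"
 by (simp add: Beta_def Gamma_one_half_real)

text \<open>The value does not depend on the end points: two half-order integrations compose, up to
  the factor pi, to an ordinary integration. Both inversions below rest on this.\<close>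

lemma nn_integral_Abel:
 fixes \<tau> c :: real
 assumes "\<tau> < c"
 shows "(\<integral>\<^sup>+s\<in>{\<tau><..<c}. ennreal ((s - \<tau>) powr (-1/2) * (c - s) powr (-1/2)) \<partial>lborel) = ennreal pi"
 using nn_integral_Beta[OF assms, of "1/2" "1/2"] assms by (simp add: Beta_half_half)

text \<open>Polar coordinates about the point at distance k from the centre of the unit disc. The
  ray that makes an angle of cosine y with the axis meets the circle at distance
  \<open>R y - k y\<close>, in a point of abscissa \<open>p y\<close>. The two quadratic identities
  are the law of cosines for this distance and the equality of the two expressions for the
  ordinate.\<close>

lemma Newton_substitution:
 fixes k y :: real and R p :: "real \<Rightarrow> real"
 assumes "0 \<le> k" "k < 1"
 assumes R_def: "R = (\<lambda>y. sqrt (1 - k\<^sup>2 + k\<^sup>2 * y\<^sup>2))"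
  and p_def: "p = (\<lambda>y. y * R y + k * (1 - y\<^sup>2))"
 shows "R y > 0"
  and "(p has_real_derivative (R y - k * y)\<^sup>2 / R y) (at y)"
  and "p 1 = 1" and "p (-1) = -1"
  and "1 + k\<^sup>2 - 2 * k * p y = (R y - k * y)\<^sup>2"
  and "1 - (p y)\<^sup>2 = (1 - y\<^sup>2) * (R y - k * y)\<^sup>2"
  and "y \<le> 1 \<Longrightarrow> R y - k * y > 0"
proof -
 have k2: "k\<^sup>2 < 1" using assms(1,2) by (simp add: power_less_one_iff abs_square_less_1)
 then have pos: "1 - k\<^sup>2 + k\<^sup>2 * y\<^sup>2 > 0" for y :: real
  by (smt (verit) mult_nonneg_nonneg zero_le_power2)
 then show R0: "R y > 0" by (simp add: R_def)
 have R2: "(R y)\<^sup>2 = 1 - k\<^sup>2 + k\<^sup>2 * y\<^sup>2" using pos[of y] by (simp add: R_def)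
 have R': "(R has_real_derivative (k\<^sup>2 * y) / R y) (at y)"
  unfolding R_def using pos[of y] by (auto intro!: derivative_eq_intros simp: field_simps)
 have "(p has_real_derivative (R y + y * (k\<^sup>2 * y / R y) - 2 * k * y)) (at y)"
  unfolding p_def by (auto intro!: derivative_eq_intros R')
 moreover have "R y + y * (k\<^sup>2 * y / R y) - 2 * k * y = (R y - k * y)\<^sup>2 / R y"
  using R0 by (simp add: field_simps power2_eq_square)
 ultimately show "(p has_real_derivative (R y - k * y)\<^sup>2 / R y) (at y)" by simp
 show "p 1 = 1" "p (-1) = -1" by (simp_all add: p_def R_def)
 show *: "1 + k\<^sup>2 - 2 * k * p y = (R y - k * y)\<^sup>2"
  using R2 unfolding p_def by (simp add: power2_eq_square algebra_simps)
 have "(p y)\<^sup>2 = y\<^sup>2 * (R y)\<^sup>2 + 2 * y * R y * k * (1 - y\<^sup>2) + k\<^sup>2 * (1 - y\<^sup>2)\<^sup>2"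
  unfolding p_def by (simp add: power2_eq_square algebra_simps)
 moreover have "(1 - y\<^sup>2) * (R y - k * y)\<^sup>2 = (1 - y\<^sup>2) * ((R y)\<^sup>2 - 2 * R y * k * y + k\<^sup>2 * y\<^sup>2)"
  by (simp add: power2_eq_square algebra_simps)
 ultimately show "1 - (p y)\<^sup>2 = (1 - y\<^sup>2) * (R y - k * y)\<^sup>2"
  unfolding R2 by (simp add: power2_eq_square algebra_simps)
 show "R y - k * y > 0" if "y \<le> 1"
 proof (cases "y \<le> 0")
  case True
  then show ?thesis using R0 assms(1) by (smt (verit) mult_nonneg_nonpos)
 next
  case False
  have "(k * y)\<^sup>2 < (R y)\<^sup>2" unfolding R2 using k2 by (simp add: power_mult_distrib)
  then show ?thesis using R0 by (simp add: power2_less_imp_less)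
 qed
qed

lemma nn_integral_even:
 fixes f :: "real \<Rightarrow> ennreal"
 assumes [measurable]: "f \<in> borel_measurable borel" and "\<And>x. f (-x) = f x"
 shows "(\<integral>\<^sup>+x\<in>{-c<..<c}. f x \<partial>lborel) = 2 * (\<integral>\<^sup>+x\<in>{0<..<c}. f x \<partial>lborel)"
proof -
 have "(\<integral>\<^sup>+x\<in>{-c<..<c}. f x \<partial>lborel)
  = (\<integral>\<^sup>+x. f x * indicator {-c<..<0} x + f x * indicator {0<..<c} x \<partial>lborel)"
  by (rule nn_integral_cong_AE, use AE_lborel_singleton[of "0::real"] in eventually_elim)
   (auto simp: indicator_def)
 also have "\<dots> = (\<integral>\<^sup>+x\<in>{-c<..<0}. f x \<partial>lborel) + (\<integral>\<^sup>+x\<in>{0<..<c}. f x \<partial>lborel)"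
  by (rule nn_integral_add) auto
 also have "(\<integral>\<^sup>+x\<in>{-c<..<0}. f x \<partial>lborel) = (\<integral>\<^sup>+x\<in>{0<..<c}. f x \<partial>lborel)"
  by (subst nn_integral_real_affine[where t=0 and c="-1"])
   (auto simp: assms(2) indicator_def intro!: nn_integral_cong)
 finally show ?thesis by (simp add: mult_2)
qed

text \<open>The powers of \<open>R y - k y\<close> that come from 1 - p^2, from the distance and
  from the derivative of the substitution cancel exactly, because (D-4)/2 - (D-2)/2 + 1 = 0. What
  remains is even in y, and x = 1 - y^2 gives an algebraic integral in which k occurs only in 1 -
  k^2 x.\<close>

lemma nn_integral_Newton:
 fixes k D :: real
 assumes k: "0 \<le> k" "k < 1"
 shows "(\<integral>\<^sup>+p\<in>{-1<..<1}. ennreal ((1 - p\<^sup>2) powr ((D - 4)/2) * (1 + k\<^sup>2 - 2 * k * p) powr (- ((D - 2)/2))) \<partial>lborel)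
  = (\<integral>\<^sup>+x\<in>{0<..<1}. ennreal (x powr ((D - 4)/2) * (1 - x) powr (-1/2) * (1 - k\<^sup>2 * x) powr (-1/2)) \<partial>lborel)"
proof -
 define R where "R = (\<lambda>y. sqrt (1 - k\<^sup>2 + k\<^sup>2 * y\<^sup>2))"
 define P where "P = (\<lambda>y. y * R y + k * (1 - y\<^sup>2))"
 note N = Newton_substitution[OF k R_def P_def]
 let ?f = "\<lambda>p. ennreal ((1 - p\<^sup>2) powr ((D - 4)/2) * (1 + k\<^sup>2 - 2 * k * p) powr (- ((D - 2)/2)))"
 let ?h = "\<lambda>x. ennreal (x powr ((D - 4)/2) * (1 - x) powr (-1/2) * (1 - k\<^sup>2 * x) powr (-1/2))"
 have contR: "continuous_on A R" for A unfolding R_def by (intro continuous_intros)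
 have Rne: "R y \<noteq> 0" for y using N(1)[of y] by simp
 have "(\<integral>\<^sup>+p\<in>{P (-1)<..<P 1}. ?f p \<partial>lborel) = (\<integral>\<^sup>+y\<in>{-1<..<1}. ?f (P y) * ennreal ((R y - k * y)\<^sup>2 / R y) \<partial>lborel)"
  by (rule nn_integral_subst_Ioo) (auto intro!: N(2) continuous_intros contR simp: Rne N(1) less_imp_le)
 also have "\<dots> = (\<integral>\<^sup>+y\<in>{-1<..<1}. ennreal ((1 - y\<^sup>2) powr ((D - 4)/2) / R y) \<partial>lborel)"
 proof (intro nn_integral_cong)
  fix y :: real
  have "(1 - (P y)\<^sup>2) powr ((D - 4)/2) * (1 + k\<^sup>2 - 2 * k * P y) powr (- ((D - 2)/2)) * ((R y - k * y)\<^sup>2 / R y)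
   = (1 - y\<^sup>2) powr ((D - 4)/2) / R y" if "y \<in> {-1<..<1}"
  proof -
   have r: "(R y - k * y)\<^sup>2 > 0" using N(7)[of y] that by simp
   have y: "1 - y\<^sup>2 > 0" using that by (simp add: abs_square_less_1 abs_less_iff)
   define r where "r = (R y - k * y)\<^sup>2"
   have "r powr ((D - 4)/2) * r powr (- ((D - 2)/2)) * r = 1"
   proof -
    have "r powr ((D - 4)/2) * r powr (- ((D - 2)/2)) * r powr 1 = r powr 0"
     by (simp only: powr_add[symmetric]) (simp add: field_simps)
    then show ?thesis using r by (simp add: r_def)
   qed
   then show ?thesis unfolding N(5,6) using r y unfolding r_def[symmetric]
    by (simp add: powr_mult mult_ac)
  qed
  then show "?f (P y) * ennreal ((R y - k * y)\<^sup>2 / R y) * indicator {-1<..<1} y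
   = ennreal ((1 - y\<^sup>2) powr ((D - 4)/2) / R y) * indicator {-1<..<1} y"
   by (cases "y \<in> {-1<..<1}") (auto simp: ennreal_mult[symmetric] N(1) less_imp_le)
 qed
 also have "\<dots> = 2 * (\<integral>\<^sup>+y\<in>{0<..<1}. ennreal ((1 - y\<^sup>2) powr ((D - 4)/2) / R y) \<partial>lborel)"
  by (rule nn_integral_even) (auto simp: R_def)
 also have "\<dots> = (\<integral>\<^sup>+y. ennreal (2 * ((1 - y\<^sup>2) powr ((D - 4)/2) / R y)) * indicator {0<..<1} y \<partial>lborel)"
 proof -
  have "ennreal (2 * z) = 2 * ennreal z" for z by (simp add: ennreal_mult')
  then show ?thesis
   by (subst nn_integral_cmult[symmetric]) (simp_all only: mult.assoc, auto simp: R_def)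
 qed
 \<comment> \<open>The substitution rule wants an increasing map, so y is reflected to 1 - y before
   x = 1 - (1 - y)^2 is introduced.\<close>
 also have "\<dots> = (\<integral>\<^sup>+y. ennreal (2 * ((1 - (1 - y)\<^sup>2) powr ((D - 4)/2) / R (1 - y))) * indicator {0<..<1} (1 - y) \<partial>lborel)"
  by (subst nn_integral_real_affine[where t=1 and c="-1"]) (auto simp: R_def)
 also have "\<dots> = (\<integral>\<^sup>+y\<in>{0<..<1}. ?h (1 - (1 - y)\<^sup>2) * ennreal (2 * (1 - y)) \<partial>lborel)"
 proof (rule nn_integral_cong)
  fix y :: real
  have "2 * ((1 - (1 - y)\<^sup>2) powr ((D - 4)/2) / R (1 - y))
   = (1 - (1 - y)\<^sup>2) powr ((D - 4)/2) * ((1 - y)\<^sup>2) powr (-1/2) * (1 - k\<^sup>2 * (1 - (1 - y)\<^sup>2)) powr (-1/2) * (2 * (1 - y))"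
   if "y \<in> {0<..<1}"
  proof -
   have e1: "((1 - y)\<^sup>2) powr (-1/2) = 1 / (1 - y)"
    using that by (simp add: powr_minus_divide powr_half_sqrt)
   have e2: "(1 - k\<^sup>2 * (1 - (1 - y)\<^sup>2)) powr (-1/2) = 1 / R (1 - y)"
    using N(1)[of "1 - y"] by (simp add: powr_minus_divide powr_half_sqrt R_def algebra_simps)
   have e3: "X * (1 / (1 - y)) * Y * (2 * (1 - y)) = 2 * (X * Y)" for X Y :: real
    using that by (simp add: field_simps)
   show ?thesis unfolding e1 e2 e3 by simp
  qed
  then show "ennreal (2 * ((1 - (1 - y)\<^sup>2) powr ((D - 4)/2) / R (1 - y))) * indicator {0<..<1} (1 - y)
   = ?h (1 - (1 - y)\<^sup>2) * ennreal (2 * (1 - y)) * indicator {0<..<1} y"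
   by (cases "y \<in> {0<..<1}") (auto simp: ennreal_mult'[symmetric] indicator_def)
 qed
 also have "\<dots> = (\<integral>\<^sup>+x\<in>{1 - (1 - 0)\<^sup>2<..<1 - (1 - 1)\<^sup>2}. ?h x \<partial>lborel)"
  by (rule nn_integral_subst_Ioo[symmetric]) (auto intro!: derivative_eq_intros continuous_intros)
 finally show ?thesis by (simp add: N(3,4))
qed

definition Copson_weight :: "real \<Rightarrow> real \<Rightarrow> real" where
 "Copson_weight D \<tau> = (1 + \<tau>) powr ((D - 4)/2) * (1 - \<tau>) powr (- ((D - 2)/2))"

lemma Copson_weight_measurable [measurable]: "Copson_weight D \<in> borel_measurable borel"
 unfolding Copson_weight_def by measurable

lemma Copson_weight_nonneg [simp]: "Copson_weight D \<tau> \<ge> 0"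
 by (simp add: Copson_weight_def)

text \<open>Let \<rho>(\<tau>) = (1+\<tau>)/(1-\<tau>). Then k^2 = \<rho>(s)/\<rho>(u), which is
  below 1 since s < u, and the substitution is x = \<rho>(\<tau>)/\<rho>(s), hence k^2 x =
  \<rho>(\<tau>)/\<rho>(u). So 1 - x vanishes at \<tau> = s and 1 - k^2 x at \<tau> = u: these
  become the two Abel factors, and s and u come to play symmetric roles.\<close>

lemma nn_integral_Copson_less:
 fixes s u D :: real
 assumes su: "-1 < s" "s < u" "u < 1"
 shows "(\<integral>\<^sup>+p\<in>{-1<..<1}. ennreal ((1 - p\<^sup>2) powr ((D - 4)/2) *
     (2 - 2 * s * u - 2 * sqrt (1 - s\<^sup>2) * sqrt (1 - u\<^sup>2) * p) powr (- ((D - 2)/2))) \<partial>lborel)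
  = (\<integral>\<^sup>+\<tau>\<in>{-1<..<s}. ennreal (((1 + s) * (1 + u)) powr (- ((D - 3)/2)) *
    Copson_weight D \<tau> * (s - \<tau>) powr (-1/2) * (u - \<tau>) powr (-1/2)) \<partial>lborel)"
proof -
 define L where "L = (1 - s) * (1 + u)"
 define k where "k = sqrt (((1 + s) * (1 - u)) / L)"
 have L: "L > 0" using su by (simp add: L_def)
 have k2: "k\<^sup>2 = ((1 + s) * (1 - u)) / L" using su by (simp add: k_def L_def)
 have "(1 + s) * (1 - u) < L" using su by (simp add: L_def algebra_simps)
 then have "k\<^sup>2 < 1\<^sup>2" unfolding k2 using L by simp
 then have k: "0 \<le> k" "k < 1" 
  using su L power2_less_imp_less[of k 1] by (auto simp: k_def)
 have X: "2 - 2 * s * u = L * (1 + k\<^sup>2)"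
  using L unfolding k2 by (simp add: field_simps L_def)
 have "(L * k)\<^sup>2 = L * ((1 + s) * (1 - u))"
  using L unfolding power_mult_distrib k2 by (simp add: power2_eq_square)
 also have "\<dots> = (1 - s\<^sup>2) * (1 - u\<^sup>2)" by (simp add: L_def power2_eq_square algebra_simps)
 finally have Y: "sqrt (1 - s\<^sup>2) * sqrt (1 - u\<^sup>2) = L * k"
  using L k by (metis real_sqrt_mult real_sqrt_unique less_imp_le mult_nonneg_nonneg)
 have XY: "2 - 2 * s * u - 2 * sqrt (1 - s\<^sup>2) * sqrt (1 - u\<^sup>2) * p = L * (1 + k\<^sup>2 - 2 * k * p)" for p
  unfolding X using Y by (simp add: algebra_simps)
 define l where "l = L powr (- ((D - 2)/2))"
 let ?h = "\<lambda>x. ennreal (x powr ((D - 4)/2) * (1 - x) powr (-1/2) * (1 - k\<^sup>2 * x) powr (-1/2))"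
 let ?x = "\<lambda>\<tau>. (1 + \<tau>) * (1 - s) / ((1 - \<tau>) * (1 + s))"
 let ?x' = "\<lambda>\<tau>. 2 * (1 - s) / ((1 - \<tau>)\<^sup>2 * (1 + s))"
 have "(\<integral>\<^sup>+p\<in>{-1<..<1}. ennreal ((1 - p\<^sup>2) powr ((D - 4)/2) *
     (2 - 2 * s * u - 2 * sqrt (1 - s\<^sup>2) * sqrt (1 - u\<^sup>2) * p) powr (- ((D - 2)/2))) \<partial>lborel)
  = (\<integral>\<^sup>+p. ennreal l * (ennreal ((1 - p\<^sup>2) powr ((D - 4)/2) *
     (1 + k\<^sup>2 - 2 * k * p) powr (- ((D - 2)/2))) * indicator {-1<..<1} p) \<partial>lborel)"
 proof (rule nn_integral_cong)
  fix p :: real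
  have "1 + k\<^sup>2 - 2 * k * p \<ge> 0" if "p \<in> {-1<..<1}"
  proof -
   have "1 + k\<^sup>2 - 2 * k * p = (1 - k)\<^sup>2 + 2 * k * (1 - p)" by (simp add: power2_eq_square algebra_simps)
   then show ?thesis using that k by simp
  qed
  then show "ennreal ((1 - p\<^sup>2) powr ((D - 4)/2) *
     (2 - 2 * s * u - 2 * sqrt (1 - s\<^sup>2) * sqrt (1 - u\<^sup>2) * p) powr (- ((D - 2)/2))) * indicator {-1<..<1} p
   = ennreal l * (ennreal ((1 - p\<^sup>2) powr ((D - 4)/2) *
     (1 + k\<^sup>2 - 2 * k * p) powr (- ((D - 2)/2))) * indicator {-1<..<1} p)"
   unfolding XY l_def using L
   by (cases "p \<in> {-1<..<1}") (auto simp: ennreal_mult[symmetric] powr_mult mult_ac)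
 qed
 also have "\<dots> = ennreal l * (\<integral>\<^sup>+x\<in>{0<..<1}. ?h x \<partial>lborel)"
  by (subst nn_integral_cmult) (simp_all add: nn_integral_Newton[OF k])
 also have "(\<integral>\<^sup>+x\<in>{0<..<1}. ?h x \<partial>lborel) = (\<integral>\<^sup>+x\<in>{?x (-1)<..<?x s}. ?h x \<partial>lborel)"
  using su by simp
 also have "\<dots> = (\<integral>\<^sup>+\<tau>\<in>{-1<..<s}. ?h (?x \<tau>) * ennreal (?x' \<tau>) \<partial>lborel)"
 proof (rule nn_integral_subst_Ioo)
  fix \<tau> assume \<tau>: "\<tau> \<in> {-1..s}"
  show "(?x has_real_derivative ?x' \<tau>) (at \<tau>)"
   using \<tau> su by (auto intro!: derivative_eq_intros simp: divide_simps power2_eq_square) (simp add: algebra_simps)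
  show "?x' \<tau> \<ge> 0" using \<tau> su by simp
 qed (use su in \<open>auto intro!: continuous_intros\<close>)
 also have "ennreal l * \<dots> = (\<integral>\<^sup>+\<tau>. ennreal l * (?h (?x \<tau>) * ennreal (?x' \<tau>) * indicator {-1<..<s} \<tau>) \<partial>lborel)"
  by (subst nn_integral_cmult) auto
 also have "\<dots> = (\<integral>\<^sup>+\<tau>\<in>{-1<..<s}. ennreal (((1 + s) * (1 + u)) powr (- ((D - 3)/2)) *
    Copson_weight D \<tau> * (s - \<tau>) powr (-1/2) * (u - \<tau>) powr (-1/2)) \<partial>lborel)"
 proof (rule nn_integral_cong)
  fix \<tau> :: real
  have "l * ((?x \<tau>) powr ((D - 4)/2) * (1 - ?x \<tau>) powr (-1/2) * (1 - k\<^sup>2 * ?x \<tau>) powr (-1/2) * ?x' \<tau>)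
   = ((1 + s) * (1 + u)) powr (- ((D - 3)/2)) *
    Copson_weight D \<tau> * (s - \<tau>) powr (-1/2) * (u - \<tau>) powr (-1/2)" if \<tau>: "\<tau> \<in> {-1<..<s}"
  proof -
   have 1: "1 - ?x \<tau> = 2 * (s - \<tau>) / ((1 - \<tau>) * (1 + s))"
    using \<tau> su by (simp add: divide_simps) (simp add: algebra_simps)
   have kx: "k\<^sup>2 * ?x \<tau> = (1 - u) * (1 + \<tau>) / ((1 + u) * (1 - \<tau>))"
    using \<tau> su unfolding k2 L_def by (simp add: divide_simps)
   have 2: "1 - k\<^sup>2 * ?x \<tau> = 2 * (u - \<tau>) / ((1 + u) * (1 - \<tau>))"
    unfolding kx using \<tau> su by (simp add: divide_simps) (simp add: algebra_simps)
   \<comment> \<open>Both sides are products of real powers of 2 and of these seven positive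
     quantities; in their logarithms the claim is a linear identity.\<close>
   define A B C E G X Y where defs: "A = ln (1 + \<tau>)" "B = ln (1 - \<tau>)" "C = ln (1 + s)"
    "E = ln (1 - s)" "G = ln (1 + u)" "X = ln (s - \<tau>)" "Y = ln (u - \<tau>)"
   define H where "H = ln (2::real)"
   have pos: "1 + \<tau> > 0" "1 - \<tau> > 0" "1 + s > 0" "1 - s > 0" "1 + u > 0" "s - \<tau> > 0" "u - \<tau> > 0"
    using \<tau> su by auto
   have e: "1 + \<tau> = exp A" "1 - \<tau> = exp B" "1 + s = exp C" "1 - s = exp E" "1 + u = exp G"
     "s - \<tau> = exp X" "u - \<tau> = exp Y" "2 = exp H"
    using pos by (simp_all add: defs H_def)
   have pw: "exp x powr y = exp (y * x)" for x y :: real by (simp add: powr_def)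
   have p1: "?x \<tau> = exp (A + E - (B + C))" "?x' \<tau> = exp (H + E - (B + B + C))"
    unfolding e by (simp_all add: exp_add exp_diff exp_double power2_eq_square)
   have p2: "2 * (s - \<tau>) / ((1 - \<tau>) * (1 + s)) = exp (H + X - (B + C))"
    "2 * (u - \<tau>) / ((1 + u) * (1 - \<tau>)) = exp (H + Y - (G + B))"
    "(1 - s) * (1 + u) = exp (E + G)" "(1 + s) * (1 + u) = exp (C + G)"
    unfolding e by (simp_all add: exp_add exp_diff)
   show ?thesis
    unfolding 1 2 unfolding p1 unfolding p2 l_def L_def Copson_weight_def
    unfolding e(1,2,6,7) pw exp_add[symmetric]
    by (rule arg_cong[where f=exp]) (simp add: field_simps)
  qed
  then show "ennreal l * (?h (?x \<tau>) * ennreal (?x' \<tau>) * indicator {-1<..<s} \<tau>) = 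
   ennreal (((1 + s) * (1 + u)) powr (- ((D - 3)/2)) *
    Copson_weight D \<tau> * (s - \<tau>) powr (-1/2) * (u - \<tau>) powr (-1/2)) * indicator {-1<..<s} \<tau>"
   using su by (cases "\<tau> \<in> {-1<..<s}") (auto simp: ennreal_mult[symmetric] l_def)
 qed
 finally show ?thesis .
qed

lemma nn_integral_Copson:
 fixes s u D :: real
 assumes "-1 < s" "s < 1" "-1 < u" "u < 1" "s \<noteq> u"
 shows "(\<integral>\<^sup>+p\<in>{-1<..<1}. ennreal ((1 - p\<^sup>2) powr ((D - 4)/2) *
     (2 - 2 * s * u - 2 * sqrt (1 - s\<^sup>2) * sqrt (1 - u\<^sup>2) * p) powr (- ((D - 2)/2))) \<partial>lborel)
  = (\<integral>\<^sup>+\<tau>\<in>{-1<..<min s u}. ennreal (((1 + s) * (1 + u)) powr (- ((D - 3)/2)) *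
    Copson_weight D \<tau> * (s - \<tau>) powr (-1/2) * (u - \<tau>) powr (-1/2)) \<partial>lborel)"
proof (cases "s < u")
 case True
 then show ?thesis using nn_integral_Copson_less[of s u D] assms by simp
next
 case False
 then have "u < s" using assms by simp
 then show ?thesis using nn_integral_Copson_less[of u s D] assms by (simp add: mult_ac)
qed

section \<open>Integration over the sphere\<close>

lemma nn_integral_Ioi_SUP:
 fixes f :: "real \<Rightarrow> ennreal"
 assumes [measurable]: "f \<in> borel_measurable borel"
  and b: "incseq b" "filterlim b at_top sequentially"
 shows "(\<integral>\<^sup>+x\<in>{a<..}. f x \<partial>lborel) = (SUP n::nat. \<integral>\<^sup>+x\<in>{a<..<b n}. f x \<partial>lborel)"
proof -
 have "(SUP n. f x * indicator {a<..<b n} x) = f x * indicator {a<..} x" for x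
 proof -
  obtain n where n: "b n > x" 
   using b(2) by (metis eventually_sequentially filterlim_at_top_dense order_refl)
  show ?thesis
  proof (intro antisym SUP_least)
   show "f x * indicator {a<..} x \<le> (SUP n. f x * indicator {a<..<b n} x)"
    using n by (intro SUP_upper2[of n]) (auto simp: indicator_def)
  qed (auto simp: indicator_def)
 qed
 then have "(\<integral>\<^sup>+x\<in>{a<..}. f x \<partial>lborel) = (\<integral>\<^sup>+x. (SUP n. f x * indicator {a<..<b n} x) \<partial>lborel)"
  by simp
 also have "\<dots> = (SUP n. \<integral>\<^sup>+x\<in>{a<..<b n}. f x \<partial>lborel)"
  using incseqD[OF b(1)]
  by (intro nn_integral_monotone_convergence_SUP)
   (auto simp: incseq_def le_fun_def indicator_def intro: order_less_le_trans)
 finally show ?thesis .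
qed

text \<open>The image of Lebesgue measure under squaring. The substitution rule covers bounded
  intervals only, so the half-line is exhausted by them; the two half-lines of x contribute
  equally.\<close>

lemma nn_integral_square:
 fixes f :: "real \<Rightarrow> ennreal"
 assumes [measurable]: "f \<in> borel_measurable borel"
 shows "(\<integral>\<^sup>+x. f (x\<^sup>2) \<partial>lborel) = (\<integral>\<^sup>+t\<in>{0<..}. f t * ennreal (t powr (-1/2)) \<partial>lborel)"
proof -
 have *: "2 * (\<integral>\<^sup>+x\<in>{0<..<real (Suc n)}. f (x\<^sup>2) \<partial>lborel)
   = (\<integral>\<^sup>+t\<in>{0<..<(real (Suc n))\<^sup>2}. f t * ennreal (t powr (-1/2)) \<partial>lborel)" for n
 proof -
  have "(\<integral>\<^sup>+t\<in>{0\<^sup>2<..<(real (Suc n))\<^sup>2}. f t * ennreal (t powr (-1/2)) \<partial>lborel)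
   = (\<integral>\<^sup>+x\<in>{0<..<real (Suc n)}. f (x\<^sup>2) * ennreal ((x\<^sup>2) powr (-1/2)) * ennreal (2 * x) \<partial>lborel)"
   by (rule nn_integral_subst_Ioo) (auto intro!: derivative_eq_intros continuous_intros)
  also have "\<dots> = (\<integral>\<^sup>+x. 2 * (f (x\<^sup>2) * indicator {0<..<real (Suc n)} x) \<partial>lborel)"
  proof (rule nn_integral_cong)
   fix x :: real
   have "ennreal ((x\<^sup>2) powr (-1/2)) * ennreal (2 * x) = 2" if "x > 0"
    using that by (simp add: powr_minus_divide powr_half_sqrt ennreal_mult'[symmetric])
   then show "f (x\<^sup>2) * ennreal ((x\<^sup>2) powr (-1/2)) * ennreal (2 * x) * indicator {0<..<real (Suc n)} x
    = 2 * (f (x\<^sup>2) * indicator {0<..<real (Suc n)} x)"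
    by (cases "x \<in> {0<..<real (Suc n)}") (simp_all add: mult.assoc, simp add: mult.commute)
  qed
  finally show ?thesis by (subst nn_integral_cmult[symmetric]) auto
 qed
 have 1: "incseq (\<lambda>n. real (Suc n))" "incseq (\<lambda>n. (real (Suc n))\<^sup>2)"
  by (auto simp: incseq_def intro!: power_mono)
 have 2: "filterlim (\<lambda>n. real (Suc n)) at_top sequentially"
  by (rule filterlim_compose[OF filterlim_real_sequentially filterlim_Suc])
 then have 3: "filterlim (\<lambda>n. (real (Suc n))\<^sup>2) at_top sequentially"
  by (intro filterlim_pow_at_top) auto
 have "(\<integral>\<^sup>+x. f (x\<^sup>2) \<partial>lborel)
  = (\<integral>\<^sup>+x. f (x\<^sup>2) * indicator {0<..} x + f (x\<^sup>2) * indicator {..<0} x \<partial>lborel)"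
  by (rule nn_integral_cong_AE, use AE_lborel_singleton[of "0::real"] in eventually_elim)
   (auto simp: indicator_def)
 also have "\<dots> = (\<integral>\<^sup>+x\<in>{0<..}. f (x\<^sup>2) \<partial>lborel) + (\<integral>\<^sup>+x\<in>{..<0}. f (x\<^sup>2) \<partial>lborel)"
  by (rule nn_integral_add) auto
 also have "(\<integral>\<^sup>+x\<in>{..<0}. f (x\<^sup>2) \<partial>lborel) = (\<integral>\<^sup>+x\<in>{0<..}. f (x\<^sup>2) \<partial>lborel)"
  by (subst nn_integral_real_affine[where t=0 and c="-1"])
   (auto simp: indicator_def intro!: nn_integral_cong)
 also have "(\<integral>\<^sup>+x\<in>{0<..}. f (x\<^sup>2) \<partial>lborel) + (\<integral>\<^sup>+x\<in>{0<..}. f (x\<^sup>2) \<partial>lborel)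
   = 2 * (SUP n. \<integral>\<^sup>+x\<in>{0<..<real (Suc n)}. f (x\<^sup>2) \<partial>lborel)"
 proof -
  have "(\<integral>\<^sup>+x\<in>{0<..}. f (x\<^sup>2) \<partial>lborel) = (SUP n. \<integral>\<^sup>+x\<in>{0<..<real (Suc n)}. f (x\<^sup>2) \<partial>lborel)"
   by (rule nn_integral_Ioi_SUP[OF _ 1(1) 2]) measurable
  then show ?thesis by (simp only: mult_2)
 qed
 also have "\<dots> = (SUP n. 2 * (\<integral>\<^sup>+x\<in>{0<..<real (Suc n)}. f (x\<^sup>2) \<partial>lborel))"
  by (rule SUP_mult_left_ennreal)
 also have "\<dots> = (\<integral>\<^sup>+t\<in>{0<..}. f t * ennreal (t powr (-1/2)) \<partial>lborel)"
  unfolding * by (rule nn_integral_Ioi_SUP[OF _ 1(2) 3, symmetric]) measurable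
 finally show ?thesis .
qed

text \<open>Half the area of the unit sphere in m-space. The half arises because the variable below
  is t = r^2, for which r^(m-1) dr = t^(m/2-1) dt / 2.\<close>

definition half_sphere_area :: "nat \<Rightarrow> real" where
 "half_sphere_area m = pi powr (real m / 2) / Gamma (real m / 2)"

lemma half_sphere_area_pos: "m > 0 \<Longrightarrow> half_sphere_area m > 0"
 by (simp add: half_sphere_area_def Gamma_real_pos)

lemma half_sphere_area_Suc:
 assumes "m > 0"
 shows "half_sphere_area m * Beta (1/2) (real m / 2) = half_sphere_area (Suc m)"
proof -
 have "Gamma (real m / 2) > 0" using assms by (simp add: Gamma_real_pos)
 moreover have "pi powr (real (Suc m) / 2) = pi powr (real m / 2) * sqrt pi"
  by (simp add: add_divide_distrib powr_add powr_half_sqrt)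
 ultimately show ?thesis
  by (simp add: half_sphere_area_def Beta_def Gamma_one_half_real add_divide_distrib)
qed

text \<open>Adding a coordinate convolves the density t^(m/2-1) of the squared norm with t^(-1/2).
  The convolution is a Beta integral, and \<open>half_sphere_area_Suc\<close> absorbs its value into
  the constant.\<close>

lemma nn_integral_PiM_sum_squares:
 fixes G :: "real \<Rightarrow> ennreal" and I :: "'i set"
 assumes "finite I" "I \<noteq> {}" and G[measurable]: "G \<in> borel_measurable borel"
 shows "(\<integral>\<^sup>+x. G (\<Sum>i\<in>I. (x i)\<^sup>2) \<partial>PiM I (\<lambda>_. lborel))
  = ennreal (half_sphere_area (card I)) * (\<integral>\<^sup>+t\<in>{0<..}. G t * ennreal (t powr (real (card I) / 2 - 1)) \<partial>lborel)"
 using assms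
proof (induction I arbitrary: G rule: finite_ne_induct)
 case (singleton i)
 note singleton[measurable]
 interpret product_sigma_finite "\<lambda>_::'i. lborel :: real measure" by standard
 have "(\<integral>\<^sup>+x. G (\<Sum>i\<in>{i}. (x i)\<^sup>2) \<partial>PiM {i} (\<lambda>_. lborel)) = (\<integral>\<^sup>+x. G (x\<^sup>2) \<partial>lborel)"
  using product_nn_integral_singleton[of "\<lambda>x. G (x\<^sup>2)" i] by simp
 also have "\<dots> = (\<integral>\<^sup>+t\<in>{0<..}. G t * ennreal (t powr (-1/2)) \<partial>lborel)"
  by (rule nn_integral_square) simp
 finally show ?case by (simp add: half_sphere_area_def Gamma_one_half_real powr_half_sqrt)
next
 case (insert i J)
 note insert.prems[measurable]
 define m where "m = card J"
 have m: "m > 0" using insert by (simp add: m_def card_gt_0_iff)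
 interpret product_sigma_finite "\<lambda>_::'i. lborel :: real measure" by standard
 have Gm[measurable]: "(\<lambda>x. G (\<Sum>i\<in>insert i J. (x i)\<^sup>2)) \<in> borel_measurable (PiM (insert i J) (\<lambda>_. lborel))"
  by measurable
 have *: "(\<Sum>j\<in>J. ((x(i := y)) j)\<^sup>2) = (\<Sum>j\<in>J. (x j)\<^sup>2)" for x y
  using insert by (intro sum.cong) auto
 have "(\<integral>\<^sup>+x. G (\<Sum>i\<in>insert i J. (x i)\<^sup>2) \<partial>PiM (insert i J) (\<lambda>_. lborel))
  = (\<integral>\<^sup>+y. (\<integral>\<^sup>+x. G (y\<^sup>2 + (\<Sum>j\<in>J. (x j)\<^sup>2)) \<partial>PiM J (\<lambda>_. lborel)) \<partial>lborel)"
  using insert by (subst product_nn_integral_insert_rev) (simp_all add: * fun_upd_same del: fun_upd_apply)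
 also have "\<dots> = (\<integral>\<^sup>+y. ennreal (half_sphere_area m) * (\<integral>\<^sup>+t\<in>{0<..}. G (y\<^sup>2 + t) * ennreal (t powr (real m / 2 - 1)) \<partial>lborel) \<partial>lborel)"
  unfolding m_def by (intro nn_integral_cong insert.IH) simp
 also have "\<dots> = ennreal (half_sphere_area m) * (\<integral>\<^sup>+y. (\<integral>\<^sup>+t\<in>{0<..}. G (y\<^sup>2 + t) * ennreal (t powr (real m / 2 - 1)) \<partial>lborel) \<partial>lborel)"
  by (rule nn_integral_cmult) measurable
 also have "(\<integral>\<^sup>+y. (\<integral>\<^sup>+t\<in>{0<..}. G (y\<^sup>2 + t) * ennreal (t powr (real m / 2 - 1)) \<partial>lborel) \<partial>lborel)
  = (\<integral>\<^sup>+s\<in>{0<..}. (\<integral>\<^sup>+t\<in>{0<..}. G (s + t) * ennreal (t powr (real m / 2 - 1)) \<partial>lborel) * ennreal (s powr (-1/2)) \<partial>lborel)"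
  by (rule nn_integral_square[of "\<lambda>s. (\<integral>\<^sup>+t\<in>{0<..}. G (s + t) * ennreal (t powr (real m / 2 - 1)) \<partial>lborel)"]) measurable
 also have "\<dots> = (\<integral>\<^sup>+s\<in>{0<..}. (\<integral>\<^sup>+r\<in>{s<..}. G r * ennreal ((r - s) powr (real m / 2 - 1)) \<partial>lborel) * ennreal (s powr (-1/2)) \<partial>lborel)"
 proof -
  have "(\<integral>\<^sup>+t\<in>{0<..}. G (s + t) * ennreal (t powr (real m / 2 - 1)) \<partial>lborel)
   = (\<integral>\<^sup>+r\<in>{s<..}. G r * ennreal ((r - s) powr (real m / 2 - 1)) \<partial>lborel)" for s
   by (subst (2) nn_integral_real_affine[where t=s and c=1]) (auto simp: indicator_def)
  then show ?thesis by (simp only:)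
 qed
 also have "\<dots> = (\<integral>\<^sup>+s. (\<integral>\<^sup>+r. G r * ennreal ((r - s) powr (real m / 2 - 1)) * indicator {s<..} r * ennreal (s powr (-1/2)) * indicator {0<..} s \<partial>lborel) \<partial>lborel)"
  by (simp add: nn_integral_multc)
 also have "\<dots> = (\<integral>\<^sup>+r. (\<integral>\<^sup>+s. G r * ennreal ((r - s) powr (real m / 2 - 1)) * indicator {s<..} r * ennreal (s powr (-1/2)) * indicator {0<..} s \<partial>lborel) \<partial>lborel)"
  by (rule lborel_pair.Fubini') (simp add: indicator_def, measurable)
 also have "\<dots> = (\<integral>\<^sup>+r. G r * indicator {0<..} r * ennreal (r powr (real (Suc m) / 2 - 1) * Beta (1/2) (real m / 2)) \<partial>lborel)"
 proof (rule nn_integral_cong)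
  fix r :: real
  have "(\<integral>\<^sup>+s. G r * ennreal ((r - s) powr (real m / 2 - 1)) * indicator {s<..} r * ennreal (s powr (-1/2)) * indicator {0<..} s \<partial>lborel)
   = (\<integral>\<^sup>+s. G r * (ennreal ((s - 0) powr (1/2 - 1) * (r - s) powr (real m / 2 - 1)) * indicator {0<..<r} s) \<partial>lborel)"
   by (intro nn_integral_cong) (auto simp: indicator_def ennreal_mult mult_ac)
  also have "\<dots> = G r * (\<integral>\<^sup>+s\<in>{0<..<r}. ennreal ((s - 0) powr (1/2 - 1) * (r - s) powr (real m / 2 - 1)) \<partial>lborel)"
   by (rule nn_integral_cmult) measurable
  also have "\<dots> = G r * indicator {0<..} r * ennreal (r powr (real (Suc m) / 2 - 1) * Beta (1/2) (real m / 2))"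
  proof (cases "r > 0")
   case True
   have e: "1/2 + real m / 2 - 1 = real (Suc m) / 2 - 1" by (simp add: field_simps)
   have b: "(\<integral>\<^sup>+s\<in>{0<..<r}. ennreal ((s - 0) powr (1/2 - 1) * (r - s) powr (real m / 2 - 1)) \<partial>lborel)
    = ennreal ((r - 0) powr (real (Suc m) / 2 - 1) * Beta (1/2) (real m / 2))"
    using nn_integral_Beta[OF True, of "1/2" "real m / 2", unfolded e] m by simp
   show ?thesis unfolding b using True by simp
  qed auto
  finally show "(\<integral>\<^sup>+s. G r * ennreal ((r - s) powr (real m / 2 - 1)) * indicator {s<..} r * ennreal (s powr (-1/2)) * indicator {0<..} s \<partial>lborel)
   = G r * indicator {0<..} r * ennreal (r powr (real (Suc m) / 2 - 1) * Beta (1/2) (real m / 2))" .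
 qed
 also have "\<dots> = (\<integral>\<^sup>+r. ennreal (Beta (1/2) (real m / 2)) * (G r * ennreal (r powr (real (Suc m) / 2 - 1)) * indicator {0<..} r) \<partial>lborel)"
  by (intro nn_integral_cong) (simp add: ennreal_mult' mult_ac)
 also have "\<dots> = ennreal (Beta (1/2) (real m / 2)) * (\<integral>\<^sup>+r\<in>{0<..}. G r * ennreal (r powr (real (Suc m) / 2 - 1)) \<partial>lborel)"
  by (rule nn_integral_cmult) measurable
 finally show ?case
  using half_sphere_area_pos[OF m] insert
  by (simp add: half_sphere_area_Suc[OF m, symmetric] ennreal_mult' mult.assoc m_def[symmetric])
qed

text \<open>Two coordinates are kept apart: after a rotation about the axis, the kernel with a fixed
  second point involves the height and one further coordinate. All the others enter through the
  norm.\<close>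

lemma nn_integral_lborel_coords:
 fixes G :: "real \<times> real \<times> real \<Rightarrow> ennreal" and k j :: "'n::finite"
 assumes n: "CARD('n) \<ge> 3" and kj: "k \<noteq> j" and [measurable]: "G \<in> borel_measurable borel"
 shows "(\<integral>\<^sup>+(x::real^'n). G (x $ k, x $ j, (norm x)\<^sup>2) \<partial>lborel)
  = ennreal (half_sphere_area (CARD('n) - 2)) * (\<integral>\<^sup>+a. \<integral>\<^sup>+b. (\<integral>\<^sup>+t\<in>{0<..}. G (a, b, a\<^sup>2 + b\<^sup>2 + t) * ennreal (t powr ((real CARD('n) - 4) / 2)) \<partial>lborel) \<partial>lborel \<partial>lborel)"
proof -
 let ?I = "\<lambda>a b. \<integral>\<^sup>+t\<in>{0<..}. G (a, b, a\<^sup>2 + b\<^sup>2 + t) * ennreal (t powr ((real CARD('n) - 4) / 2)) \<partial>lborel"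
 interpret product_sigma_finite "\<lambda>_::real^'n. lborel :: real measure" by standard
 define ek ej :: "real^'n" where e: "ek = axis k 1" "ej = axis j 1"
 have Bk: "ek \<in> Basis" "ej \<in> Basis" by (simp_all add: e axis_in_Basis_iff)
 have ekj: "ek \<noteq> ej" using kj by (simp add: e axis_eq_axis)
 define B0 :: "(real^'n) set" where "B0 = Basis - {ek, ej}"
 have B: "Basis = insert ek (insert ej B0)" using Bk by (auto simp: B0_def)
 have B0: "finite B0" "ek \<notin> insert ej B0" "ej \<notin> B0" using ekj by (auto simp: B0_def)
 have "card (Basis :: (real^'n) set) = CARD('n)" by simp
 then have c: "card B0 = CARD('n) - 2" using B0 unfolding B by simp
 then have ne: "B0 \<noteq> {}" using n by auto
 have co: "(\<Sum>b\<in>Basis. f b *\<^sub>R b) $ k = f ek" "(\<Sum>b\<in>Basis. f b *\<^sub>R b) $ j = f ej" for f :: "real^'n \<Rightarrow> real"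
 proof -
  have "(\<Sum>b\<in>Basis. f b *\<^sub>R b) $ i = (\<Sum>b\<in>Basis. f b *\<^sub>R b) \<bullet> axis i 1" for i
   by (simp add: inner_axis)
  then show "(\<Sum>b\<in>Basis. f b *\<^sub>R b) $ k = f ek" "(\<Sum>b\<in>Basis. f b *\<^sub>R b) $ j = f ej"
   using Bk by (simp_all add: e inner_sum_left_Basis)
 qed
 have no: "(norm (\<Sum>b\<in>Basis. f b *\<^sub>R b))\<^sup>2 = (f ek)\<^sup>2 + (f ej)\<^sup>2 + (\<Sum>b\<in>B0. (f b)\<^sup>2)" for f :: "real^'n \<Rightarrow> real"
 proof -
  have "(norm (\<Sum>b\<in>Basis. f b *\<^sub>R b))\<^sup>2 = (\<Sum>b\<in>Basis. ((\<Sum>b\<in>Basis. f b *\<^sub>R b) \<bullet> b)\<^sup>2)"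
   by (simp only: power2_norm_eq_inner) (subst euclidean_inner, simp add: power2_eq_square)
  also have "\<dots> = (\<Sum>b\<in>Basis. (f b)\<^sup>2)" by (intro sum.cong) (auto simp: inner_sum_left_Basis)
  finally show ?thesis using B0 unfolding B by (simp add: add.assoc)
 qed
 have m1: "(\<lambda>x::real^'n. G (x $ k, x $ j, (norm x)\<^sup>2)) \<in> borel_measurable borel" by measurable
 let ?M = "\<lambda>I. PiM I (\<lambda>_::real^'n. lborel :: real measure)"
 have "(\<integral>\<^sup>+(x::real^'n). G (x $ k, x $ j, (norm x)\<^sup>2) \<partial>lborel)
  = (\<integral>\<^sup>+f. G (f ek, f ej, (f ek)\<^sup>2 + (f ej)\<^sup>2 + (\<Sum>b\<in>B0. (f b)\<^sup>2)) \<partial>?M Basis)"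
  using m1 by (subst lborel_eq, subst nn_integral_distr) (measurable, simp only: co no)
 also have "\<dots> = (\<integral>\<^sup>+a. \<integral>\<^sup>+f. G (a, f ej, a\<^sup>2 + (f ej)\<^sup>2 + (\<Sum>b\<in>B0. (f b)\<^sup>2)) \<partial>?M (insert ej B0) \<partial>lborel)"
 proof -
  have *: "(\<Sum>b\<in>B0. ((f(ek := a)) b)\<^sup>2) = (\<Sum>b\<in>B0. (f b)\<^sup>2)" for f a
   using B0 by (intro sum.cong) auto
  have "(\<lambda>f. G (f ek, f ej, (f ek)\<^sup>2 + (f ej)\<^sup>2 + (\<Sum>b\<in>B0. (f b)\<^sup>2))) \<in> borel_measurable (?M (insert ek (insert ej B0)))"
   by measurable
  then show ?thesis
   unfolding B using B0 ekj ekj[symmetric] by (subst product_nn_integral_insert_rev) (simp_all add: * fun_upd_same fun_upd_other del: fun_upd_apply)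
 qed
 also have "\<dots> = (\<integral>\<^sup>+a. \<integral>\<^sup>+b. \<integral>\<^sup>+f. G (a, b, a\<^sup>2 + b\<^sup>2 + (\<Sum>b\<in>B0. (f b)\<^sup>2)) \<partial>?M B0 \<partial>lborel \<partial>lborel)"
 proof (rule nn_integral_cong)
  fix a :: real
  have *: "(\<Sum>b\<in>B0. ((f(ej := a)) b)\<^sup>2) = (\<Sum>b\<in>B0. (f b)\<^sup>2)" for f a
   using B0 by (intro sum.cong) auto
  have "(\<lambda>f. G (a, f ej, a\<^sup>2 + (f ej)\<^sup>2 + (\<Sum>b\<in>B0. (f b)\<^sup>2))) \<in> borel_measurable (?M (insert ej B0))"
   by measurable
  then show "(\<integral>\<^sup>+f. G (a, f ej, a\<^sup>2 + (f ej)\<^sup>2 + (\<Sum>b\<in>B0. (f b)\<^sup>2)) \<partial>?M (insert ej B0))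
   = (\<integral>\<^sup>+b. \<integral>\<^sup>+f. G (a, b, a\<^sup>2 + b\<^sup>2 + (\<Sum>b\<in>B0. (f b)\<^sup>2)) \<partial>?M B0 \<partial>lborel)"
   using B0 by (subst product_nn_integral_insert_rev) (simp_all add: * fun_upd_same fun_upd_other del: fun_upd_apply)
 qed
 also have "\<dots> = (\<integral>\<^sup>+a. \<integral>\<^sup>+b. ennreal (half_sphere_area (CARD('n) - 2)) * ?I a b \<partial>lborel \<partial>lborel)"
 proof (rule nn_integral_cong, rule nn_integral_cong)
  fix a b :: real
  have e: "real (CARD('n) - 2) / 2 - 1 = (real CARD('n) - 4) / 2"
   using n by (simp add: of_nat_diff field_simps)
  then show "(\<integral>\<^sup>+f. G (a, b, a\<^sup>2 + b\<^sup>2 + (\<Sum>b\<in>B0. (f b)\<^sup>2)) \<partial>?M B0)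
   = ennreal (half_sphere_area (CARD('n) - 2)) * ?I a b"
   using nn_integral_PiM_sum_squares[OF B0(1) ne, of "\<lambda>t. G (a, b, a\<^sup>2 + b\<^sup>2 + t)", unfolded c e] by simp
 qed
 also have "\<dots> = ennreal (half_sphere_area (CARD('n) - 2)) * (\<integral>\<^sup>+a. \<integral>\<^sup>+b. ?I a b \<partial>lborel \<partial>lborel)"
  by (simp add: nn_integral_cmult)
 finally show ?thesis .
qed

lemma nn_integral_lborel_shift:
 fixes f :: "'a::euclidean_space \<Rightarrow> ennreal"
 assumes [measurable]: "f \<in> borel_measurable borel"
 shows "(\<integral>\<^sup>+x. f (t + x) \<partial>lborel) = (\<integral>\<^sup>+x. f x \<partial>lborel)"
 by (subst (2) lborel_distr_plus[symmetric, of t], subst nn_integral_distr) auto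

lemma nn_integral_lborel_uminus:
 fixes f :: "'a::euclidean_space \<Rightarrow> ennreal"
 assumes [measurable]: "f \<in> borel_measurable borel"
 shows "(\<integral>\<^sup>+x. f (- x) \<partial>lborel) = (\<integral>\<^sup>+x. f x \<partial>lborel)"
 by (subst (2) lborel_affine[of "-1" 0], simp, subst nn_integral_density)
  (auto simp: nn_integral_distr)

lemma nn_integral_orthogonal_transformation:
 fixes T :: "'a::euclidean_space \<Rightarrow> 'a" and f :: "'a \<Rightarrow> ennreal"
 assumes T: "orthogonal_transformation T" and f[measurable]: "f \<in> borel_measurable borel"
 shows "(\<integral>\<^sup>+x. f (T x) \<partial>lborel) = (\<integral>\<^sup>+x. f x \<partial>lborel)"
proof -
 \<comment> \<open>Compare \<open>T\<^sub>*\<lambda>\<close> with \<open>\<lambda>\<close> by the usual proof that a translation invariant measure is unique,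
   normalising with the unit ball, which \<open>T\<close> preserves.\<close>
 have lin: "linear T" using T by (rule orthogonal_transformation_linear)
 then have [measurable]: "T \<in> borel_measurable borel"
  by (intro borel_measurable_continuous_onI linear_continuous_on linear_linear[THEN iffD2])
 have surj: "surj T" using T by (rule orthogonal_transformation_surj)
 define g :: "'a \<Rightarrow> ennreal" where "g = indicator (ball 0 1)"
 have [measurable]: "g \<in> borel_measurable borel"
  unfolding g_def by (intro borel_measurable_indicator borel_open open_ball)
 have gT: "g (T x) = g x" for x
  using orthogonal_transformation_norm[OF T, of x] by (simp add: g_def indicator_def)
 define c where "c = (\<integral>\<^sup>+x. g x \<partial>lborel)"
 have c: "c = emeasure lborel (ball (0::'a) 1)" by (simp add: c_def g_def)
 have c0: "c \<noteq> 0" "c \<noteq> \<infinity>"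
  unfolding c using emeasure_lborel_ball_finite[of "0::'a" 1] 
  by (auto simp: emeasure_eq_0_AE) (metis content_ball_pos emeasure_eq_measure2 measure_def enn2real_0 less_irrefl zero_less_one order_less_irrefl c)
 have "(\<integral>\<^sup>+x. f (T x) \<partial>lborel) * c = (\<integral>\<^sup>+y. (\<integral>\<^sup>+x. f (T x) \<partial>lborel) * g y \<partial>lborel)"
  unfolding c_def by (rule nn_integral_cmult[symmetric]) simp
 also have "\<dots> = (\<integral>\<^sup>+y. (\<integral>\<^sup>+x. f (T x + y) * g y \<partial>lborel) \<partial>lborel)"
 proof (rule nn_integral_cong)
  fix y :: 'a
  obtain z where z: "y = T z" using surj by (metis surjD)
  have "(\<integral>\<^sup>+x. f (T x) \<partial>lborel) = (\<integral>\<^sup>+x. f (T (z + x)) \<partial>lborel)"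
   by (rule nn_integral_lborel_shift[symmetric]) simp
  also have "\<dots> = (\<integral>\<^sup>+x. f (T x + y) \<partial>lborel)"
   using lin by (simp add: linear_add z add.commute)
  finally show "(\<integral>\<^sup>+x. f (T x) \<partial>lborel) * g y = (\<integral>\<^sup>+x. f (T x + y) * g y \<partial>lborel)"
   by (simp add: nn_integral_multc)
 qed
 also have "\<dots> = (\<integral>\<^sup>+x. (\<integral>\<^sup>+y. f (T x + y) * g y \<partial>lborel) \<partial>lborel)"
  by (rule lborel_pair.Fubini') measurable
 also have "\<dots> = (\<integral>\<^sup>+x. (\<integral>\<^sup>+y. f y * g (y - T x) \<partial>lborel) \<partial>lborel)"
 proof (rule nn_integral_cong)
  fix x :: 'a
  show "(\<integral>\<^sup>+y. f (T x + y) * g y \<partial>lborel) = (\<integral>\<^sup>+y. f y * g (y - T x) \<partial>lborel)"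
   using nn_integral_lborel_shift[of "\<lambda>y. f y * g (y - T x)" "T x"] by simp
 qed
 also have "\<dots> = (\<integral>\<^sup>+y. (\<integral>\<^sup>+x. f y * g (y - T x) \<partial>lborel) \<partial>lborel)"
  by (rule lborel_pair.Fubini') measurable
 also have "\<dots> = (\<integral>\<^sup>+y. f y * c \<partial>lborel)"
 proof (rule nn_integral_cong)
  fix y :: 'a
  obtain z where z: "y = T z" using surj by (metis surjD)
  have "g (y - T x) = g (z + - x)" for x
   using gT[of "z - x"] lin by (simp add: z linear_diff)
  then have "(\<integral>\<^sup>+x. f y * g (y - T x) \<partial>lborel) = f y * (\<integral>\<^sup>+x. g (z + - x) \<partial>lborel)"
   by (simp add: nn_integral_cmult)
  also have "(\<integral>\<^sup>+x. g (z + - x) \<partial>lborel) = c"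
   unfolding c_def using nn_integral_lborel_uminus[of "\<lambda>x. g (z + x)"] nn_integral_lborel_shift[of g z] by simp
  finally show "(\<integral>\<^sup>+x. f y * g (y - T x) \<partial>lborel) = f y * c" .
 qed
 also have "\<dots> = (\<integral>\<^sup>+x. f x \<partial>lborel) * c" by (simp add: nn_integral_multc)
 finally show ?thesis using c0 by (metis ennreal_mult_divide_eq infinity_ennreal_def mult_divide_eq_ennreal)
qed

lemma measurable_normalize [measurable]:
 "(\<lambda>x::real^'n. x /\<^sub>R norm x) \<in> measurable (restrict_space lborel (cball 0 1 - {0})) sphere_borel"
 unfolding sphere_borel_def
 by (rule measurable_restrict_space2) (auto simp: space_restrict_space intro!: measurable_restrict_space1)

lemma sets_sphere_borel: "A \<in> sets sphere_borel \<longleftrightarrow> A \<in> sets borel \<and> A \<subseteq> sphere 0 1"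
 by (auto simp: sphere_borel_def sets_restrict_space_iff)

lemma space_sphere_borel [simp]: "space sphere_borel = sphere 0 1"
 by (simp add: sphere_borel_def space_restrict_space)

lemma sets_surface_measure [simp, measurable_cong]: "sets surface_measure = sets sphere_borel"
 by (simp add: surface_measure_def)

lemma space_surface_measure [simp]: "space surface_measure = sphere 0 1"
 using sets_eq_imp_space_eq[OF sets_surface_measure] by simp

lemma measurable_sphere_borelI: "f \<in> measurable borel M \<Longrightarrow> f \<in> measurable sphere_borel M"
 unfolding sphere_borel_def by (rule measurable_restrict_space1)

lemma nn_integral_surface_measure:
 fixes f :: "real^'n \<Rightarrow> ennreal"
 assumes [measurable]: "f \<in> borel_measurable sphere_borel"
 shows "(\<integral>\<^sup>+x. f x \<partial>surface_measure)
  = of_nat CARD('n) * (\<integral>\<^sup>+x. f (x /\<^sub>R norm x) * indicator (cball 0 1 - {0}) x \<partial>lborel)"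
 unfolding surface_measure_def
 by (subst nn_integral_scale_measure, simp, subst nn_integral_distr, simp, simp, subst nn_integral_restrict_space) auto

lemma nn_integral_surface_orthogonal:
 fixes f :: "real^'n \<Rightarrow> ennreal" and T :: "real^'n \<Rightarrow> real^'n"
 assumes T: "orthogonal_transformation T" and f[measurable]: "f \<in> borel_measurable borel"
 shows "(\<integral>\<^sup>+x. f (T x) \<partial>surface_measure) = (\<integral>\<^sup>+x. f x \<partial>surface_measure)"
proof -
 have lin: "linear T" using T by (rule orthogonal_transformation_linear)
 then have [measurable]: "T \<in> borel_measurable borel"
  by (intro borel_measurable_continuous_onI linear_continuous_on linear_linear[THEN iffD2])
 have [measurable]: "cball 0 1 - {0 :: real^'n} \<in> sets borel" by simp
 have "(\<integral>\<^sup>+x. f (T (x /\<^sub>R norm x)) * indicator (cball 0 1 - {0}) x \<partial>lborel)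
  = (\<integral>\<^sup>+x. (\<lambda>x. f (x /\<^sub>R norm x) * indicator (cball 0 1 - {0}) x) (T x) \<partial>lborel)"
  using lin orthogonal_transformation_norm[OF T]
  by (intro nn_integral_cong) (simp add: linear_cmul indicator_def, metis norm_eq_zero)
 also have "\<dots> = (\<integral>\<^sup>+x. f (x /\<^sub>R norm x) * indicator (cball 0 1 - {0}) x \<partial>lborel)"
  by (rule nn_integral_orthogonal_transformation[OF T]) measurable
 finally show ?thesis
  by (simp add: nn_integral_surface_measure measurable_sphere_borelI)
qed

text \<open>The surface measure is defined by cones, so the integrand depends on x / |x| only.
  Writing R for the squared norm and scaling a and b by sqrt R splits off the factor R^(d/2-1),
  whose integral over (0,1) is 2/d; this cancels the d of \<open>surface_measure\<close> and leaves
  the 2 in front.\<close>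

lemma nn_integral_surface_coords:
 fixes \<Psi> :: "real \<times> real \<Rightarrow> ennreal" and k j :: "'n::finite"
 assumes n: "CARD('n) \<ge> 3" and kj: "k \<noteq> j" and \<Psi>: "\<Psi> \<in> borel_measurable borel"
 shows "(\<integral>\<^sup>+(x::real^'n). \<Psi> (x $ k, x $ j) \<partial>surface_measure)
  = ennreal (2 * half_sphere_area (CARD('n) - 2)) * (\<integral>\<^sup>+a. \<integral>\<^sup>+b. \<Psi> (a, b) *
    ennreal ((1 - a\<^sup>2 - b\<^sup>2) powr ((real CARD('n) - 4) / 2)) * indicator {0<..} (1 - a\<^sup>2 - b\<^sup>2) \<partial>lborel \<partial>lborel)"
proof -
 define e where "e = (real CARD('n) - 4) / 2"
 define c where "c = half_sphere_area (CARD('n) - 2)"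
 have c: "c > 0" using n by (simp add: c_def half_sphere_area_pos)
 define \<phi> :: "real \<Rightarrow> ennreal" where "\<phi> x = ennreal (x powr e) * indicator {0<..} x" for x
 have [measurable]: "\<phi> \<in> borel_measurable borel" unfolding \<phi>_def by measurable
 define \<Phi> where "\<Phi> R a b = \<Psi> (a / sqrt R, b / sqrt R) * indicator {0<..1} R" for R a b
 let ?J = "\<lambda>a b. \<integral>\<^sup>+t\<in>{0<..}. (\<lambda>(a, b, R). \<Phi> R a b) (a, b, a\<^sup>2 + b\<^sup>2 + t) * ennreal (t powr e) \<partial>lborel"
 have [measurable]: "\<Psi> \<in> borel_measurable (borel \<Otimes>\<^sub>M borel)" using \<Psi> by (simp add: borel_prod)
 define M where "M = (\<integral>\<^sup>+a. \<integral>\<^sup>+b. \<Psi> (a, b) * \<phi> (1 - a\<^sup>2 - b\<^sup>2) \<partial>lborel \<partial>lborel)"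

 have "(\<integral>\<^sup>+(x::real^'n). \<Psi> (x $ k, x $ j) \<partial>surface_measure)
   = of_nat CARD('n) * (\<integral>\<^sup>+(x::real^'n). \<Psi> ((x /\<^sub>R norm x) $ k, (x /\<^sub>R norm x) $ j) * indicator (cball 0 1 - {0}) x \<partial>lborel)"
  by (intro nn_integral_surface_measure measurable_sphere_borelI) measurable
 also have "(\<integral>\<^sup>+(x::real^'n). \<Psi> ((x /\<^sub>R norm x) $ k, (x /\<^sub>R norm x) $ j) * indicator (cball 0 1 - {0}) x \<partial>lborel)
  = (\<integral>\<^sup>+(x::real^'n). (\<lambda>(a, b, R). \<Phi> R a b) (x $ k, x $ j, (norm x)\<^sup>2) \<partial>lborel)"
 proof (rule nn_integral_cong)
  fix x :: "real^'n"
  have "(norm x)\<^sup>2 \<le> 1 \<longleftrightarrow> norm x \<le> 1" by (simp add: abs_square_le_1)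
  then show "\<Psi> ((x /\<^sub>R norm x) $ k, (x /\<^sub>R norm x) $ j) * indicator (cball 0 1 - {0}) x
   = (\<lambda>(a, b, R). \<Phi> R a b) (x $ k, x $ j, (norm x)\<^sup>2)"
   by (auto simp: \<Phi>_def indicator_def divide_inverse mult.commute)
 qed
 also have "\<dots> = ennreal c * (\<integral>\<^sup>+a. \<integral>\<^sup>+b. ?J a b \<partial>lborel \<partial>lborel)"
  unfolding c_def e_def by (rule nn_integral_lborel_coords[OF n kj]) (simp only: \<Phi>_def borel_prod[symmetric] split_beta', measurable)
 also have "(\<integral>\<^sup>+a. \<integral>\<^sup>+b. ?J a b \<partial>lborel \<partial>lborel)
  = (\<integral>\<^sup>+a. \<integral>\<^sup>+b. \<integral>\<^sup>+R. \<Phi> R a b * \<phi> (R - a\<^sup>2 - b\<^sup>2) \<partial>lborel \<partial>lborel \<partial>lborel)"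
 proof (rule nn_integral_cong, rule nn_integral_cong)
  fix a b :: real
  show "?J a b
   = (\<integral>\<^sup>+R. \<Phi> R a b * \<phi> (R - a\<^sup>2 - b\<^sup>2) \<partial>lborel)"
  proof -
   have "(\<lambda>R. \<Phi> R a b * \<phi> (R - a\<^sup>2 - b\<^sup>2)) \<in> borel_measurable borel" unfolding \<Phi>_def by measurable
   from nn_integral_lborel_shift[OF this, of "a\<^sup>2 + b\<^sup>2"]
   have "(\<integral>\<^sup>+R. \<Phi> R a b * \<phi> (R - a\<^sup>2 - b\<^sup>2) \<partial>lborel)
    = (\<integral>\<^sup>+t. \<Phi> (a\<^sup>2 + b\<^sup>2 + t) a b * \<phi> t \<partial>lborel)" by simp
   also have "\<dots> = ?J a b"
    unfolding \<phi>_def by (simp only: mult.assoc prod.case)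
   finally show ?thesis by simp
  qed
 qed
 also have "\<dots> = (\<integral>\<^sup>+a. \<integral>\<^sup>+R. \<integral>\<^sup>+b. \<Phi> R a b * \<phi> (R - a\<^sup>2 - b\<^sup>2) \<partial>lborel \<partial>lborel \<partial>lborel)"
 proof (rule nn_integral_cong)
  fix a :: real
  have "(\<lambda>(b, R). \<Phi> R a b * \<phi> (R - a\<^sup>2 - b\<^sup>2)) \<in> borel_measurable (lborel \<Otimes>\<^sub>M lborel)"
   unfolding \<Phi>_def by measurable
  from lborel_pair.Fubini'[OF this, symmetric] show "(\<integral>\<^sup>+b. \<integral>\<^sup>+R. \<Phi> R a b * \<phi> (R - a\<^sup>2 - b\<^sup>2) \<partial>lborel \<partial>lborel)
   = (\<integral>\<^sup>+R. \<integral>\<^sup>+b. \<Phi> R a b * \<phi> (R - a\<^sup>2 - b\<^sup>2) \<partial>lborel \<partial>lborel)" .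
 qed
 also have "\<dots> = (\<integral>\<^sup>+R. \<integral>\<^sup>+a. \<integral>\<^sup>+b. \<Phi> R a b * \<phi> (R - a\<^sup>2 - b\<^sup>2) \<partial>lborel \<partial>lborel \<partial>lborel)"
 proof -
  have "(\<lambda>(a, R). \<integral>\<^sup>+b. \<Phi> R a b * \<phi> (R - a\<^sup>2 - b\<^sup>2) \<partial>lborel) \<in> borel_measurable (lborel \<Otimes>\<^sub>M lborel)"
   unfolding \<Phi>_def by measurable
  from lborel_pair.Fubini'[OF this, symmetric] show ?thesis .
 qed
 also have "\<dots> = (\<integral>\<^sup>+R\<in>{0<..<1}. ennreal (R powr (e + 1)) * M \<partial>lborel)"
 proof (rule nn_integral_cong_AE, use AE_lborel_singleton[of "1::real"] in eventually_elim)
  fix R :: real assume R1: "R \<noteq> 1"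
  show "(\<integral>\<^sup>+a. \<integral>\<^sup>+b. \<Phi> R a b * \<phi> (R - a\<^sup>2 - b\<^sup>2) \<partial>lborel \<partial>lborel)
   = ennreal (R powr (e + 1)) * M * indicator {0<..<1} R"
  proof (cases "R \<in> {0<..<1}")
   case True
   have \<phi>: "\<phi> (R - (sqrt R * a)\<^sup>2 - (sqrt R * b)\<^sup>2) = ennreal (R powr e) * \<phi> (1 - a\<^sup>2 - b\<^sup>2)" for a b
   proof -
    have "R - (sqrt R * a)\<^sup>2 - (sqrt R * b)\<^sup>2 = R * (1 - a\<^sup>2 - b\<^sup>2)"
     using True by (simp add: power_mult_distrib algebra_simps)
    moreover have "R * (1 - a\<^sup>2 - b\<^sup>2) > 0 \<longleftrightarrow> 1 - a\<^sup>2 - b\<^sup>2 > 0"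
     using True by (simp add: zero_less_mult_iff)
    ultimately show ?thesis using True
     by (cases "1 - a\<^sup>2 - b\<^sup>2 > 0") (simp_all add: \<phi>_def powr_mult ennreal_mult)
   qed
   have "(\<integral>\<^sup>+a. \<integral>\<^sup>+b. \<Phi> R a b * \<phi> (R - a\<^sup>2 - b\<^sup>2) \<partial>lborel \<partial>lborel)
    = (\<integral>\<^sup>+a. ennreal (sqrt R) * (\<integral>\<^sup>+b. \<Phi> R a (sqrt R * b) * \<phi> (R - a\<^sup>2 - (sqrt R * b)\<^sup>2) \<partial>lborel) \<partial>lborel)"
   proof (rule nn_integral_cong)
    fix a :: real
    have "(\<lambda>b. \<Phi> R a b * \<phi> (R - a\<^sup>2 - b\<^sup>2)) \<in> borel_measurable borel" unfolding \<Phi>_def by measurable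
    from nn_integral_real_affine[OF this, of "sqrt R" 0] True
    show "(\<integral>\<^sup>+b. \<Phi> R a b * \<phi> (R - a\<^sup>2 - b\<^sup>2) \<partial>lborel)
     = ennreal (sqrt R) * (\<integral>\<^sup>+b. \<Phi> R a (sqrt R * b) * \<phi> (R - a\<^sup>2 - (sqrt R * b)\<^sup>2) \<partial>lborel)" by simp
   qed
   also have "\<dots> = ennreal (sqrt R) * (\<integral>\<^sup>+a. ennreal (sqrt R) * (\<integral>\<^sup>+b. \<Phi> R (sqrt R * a) (sqrt R * b) * \<phi> (R - (sqrt R * a)\<^sup>2 - (sqrt R * b)\<^sup>2) \<partial>lborel) \<partial>lborel)"
   proof -
    have "(\<lambda>a. ennreal (sqrt R) * (\<integral>\<^sup>+b. \<Phi> R a (sqrt R * b) * \<phi> (R - a\<^sup>2 - (sqrt R * b)\<^sup>2) \<partial>lborel)) \<in> borel_measurable borel"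
     unfolding \<Phi>_def by measurable
    from nn_integral_real_affine[OF this, of "sqrt R" 0] True show ?thesis by simp
   qed
   also have "\<dots> = ennreal (sqrt R) * (\<integral>\<^sup>+a. ennreal (sqrt R) * (\<integral>\<^sup>+b. ennreal (R powr e) * (\<Psi> (a, b) * \<phi> (1 - a\<^sup>2 - b\<^sup>2)) \<partial>lborel) \<partial>lborel)"
    using True unfolding \<phi> by (simp add: \<Phi>_def mult_ac)
   also have "\<dots> = ennreal (sqrt R) * (ennreal (sqrt R) * (ennreal (R powr e) * M))"
    unfolding M_def by (simp add: nn_integral_cmult)
   also have "\<dots> = ennreal (sqrt R * sqrt R * R powr e) * M"
   proof -
    have "ennreal (x * x * y) = ennreal x * (ennreal x * ennreal y)" if "x \<ge> 0" "y \<ge> 0" for x y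
     using that by (simp add: ennreal_mult mult.assoc)
    from this[of "sqrt R" "R powr e"] show ?thesis using True by (simp only: mult.assoc) (simp add: mult.assoc)
   qed
   also have "sqrt R * sqrt R * R powr e = R powr (e + 1)"
    using True by (simp add: powr_add mult.commute)
   finally show ?thesis using True by simp
  next
   case False
   then show ?thesis using R1 by (auto simp: \<Phi>_def indicator_def)
  qed
 qed
 also have "\<dots> = (\<integral>\<^sup>+R\<in>{0<..<1}. ennreal ((R - 0) powr ((e + 2) - 1) * (1 - R) powr (1 - 1)) \<partial>lborel) * M"
 proof -
  have "(\<integral>\<^sup>+R\<in>{0<..<1}. ennreal (R powr (e + 1)) * M \<partial>lborel)
   = (\<integral>\<^sup>+R. ennreal ((R - 0) powr ((e + 2) - 1) * (1 - R) powr (1 - 1)) * indicator {0<..<1} R * M \<partial>lborel)"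
   by (rule nn_integral_cong) (simp add: indicator_def add.commute)
  also have "\<dots> = (\<integral>\<^sup>+R\<in>{0<..<1}. ennreal ((R - 0) powr ((e + 2) - 1) * (1 - R) powr (1 - 1)) \<partial>lborel) * M"
   by (rule nn_integral_multc) measurable
  finally show ?thesis .
 qed
 also have "(\<integral>\<^sup>+R\<in>{0<..<1}. ennreal ((R - 0) powr ((e + 2) - 1) * (1 - R) powr (1 - 1)) \<partial>lborel) = ennreal (2 / real CARD('n))"
 proof -
  have e2: "e + 2 = real CARD('n) / 2" by (simp add: e_def field_simps)
  then have e0: "e + 2 > 0" using n by simp
  define E where "E = e + 2"
  have E: "E > 0" using e0 by (simp add: E_def)
  have "Gamma (E + 1) = E * Gamma E"
   using E by (intro Gamma_plus1) (auto elim!: nonpos_Ints_cases)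
  moreover have "Gamma E \<noteq> 0" using Gamma_real_pos[OF E] by simp
  ultimately have "Beta E 1 = 1 / E" using E by (simp add: Beta_def)
  then have b: "Beta E 1 = 2 / real CARD('n)" unfolding E_def e2 by simp
  show ?thesis
   unfolding E_def[symmetric] using nn_integral_Beta[of 0 1 E 1, unfolded b] E by simp
 qed
 finally have "(\<integral>\<^sup>+(x::real^'n). \<Psi> (x $ k, x $ j) \<partial>surface_measure)
  = of_nat CARD('n) * (ennreal c * (ennreal (2 / real CARD('n)) * M))" .
 also have "\<dots> = ennreal (real CARD('n) * (c * (2 / real CARD('n)))) * M"
 proof -
  have "ennreal x * (ennreal y * (ennreal z * M)) = ennreal (x * (y * z)) * M" if "x \<ge> 0" "y \<ge> 0" "z \<ge> 0" for x y z
   using that by (simp add: ennreal_mult mult.assoc)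
  from this[of "real CARD('n)" c "2 / real CARD('n)"] show ?thesis
   unfolding ennreal_of_nat_eq_real_of_nat using c by simp
 qed
 also have "real CARD('n) * (c * (2 / real CARD('n))) = 2 * c" using n by simp
 finally show ?thesis by (simp add: M_def \<phi>_def c_def e_def mult.assoc)
qed

lemma other_coordinate:
 fixes k :: "'n::finite"
 assumes "CARD('n) \<ge> 3"
 obtains j where "k \<noteq> j"
proof -
 have "\<not> (UNIV :: 'n set) \<subseteq> {k}" using assms card_mono[of "{k}" "UNIV::'n set"] by auto
 then obtain j where "j \<notin> {k}" by blast
 then show ?thesis using that[of j] by auto
qed

text \<open>The hat-box law of Archimedes in dimension d. The constant is the area of the unit
  sphere in (d-1)-space, to which every parallel is similar.\<close>

lemma nn_integral_surface_height:
 fixes \<phi> :: "real \<Rightarrow> ennreal" and k :: "'n::finite"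
 assumes n: "CARD('n) \<ge> 3" and [measurable]: "\<phi> \<in> borel_measurable borel"
 shows "(\<integral>\<^sup>+(x::real^'n). \<phi> (x $ k) \<partial>surface_measure)
  = ennreal (2 * half_sphere_area (CARD('n) - 1)) * (\<integral>\<^sup>+s\<in>{-1<..<1}. \<phi> s * ennreal ((1 - s\<^sup>2) powr ((real CARD('n) - 3) / 2)) \<partial>lborel)"
proof -
 obtain j where j: "k \<noteq> j" using other_coordinate[OF n] .
 define e where "e = (real CARD('n) - 4) / 2"
 define c where "c = half_sphere_area (CARD('n) - 2)"
 have c: "c > 0" using n by (simp add: c_def half_sphere_area_pos)
 have e0: "e + 1 > 0" using n by (simp add: e_def field_simps)
 have inner: "(\<integral>\<^sup>+b. ennreal ((1 - a\<^sup>2 - b\<^sup>2) powr e) * indicator {0<..} (1 - a\<^sup>2 - b\<^sup>2) \<partial>lborel)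
  = ennreal ((1 - a\<^sup>2) powr (e + 1/2) * Beta (1/2) (e + 1)) * indicator {-1<..<1} a" for a :: real
 proof -
  have "(\<integral>\<^sup>+b. ennreal ((1 - a\<^sup>2 - b\<^sup>2) powr e) * indicator {0<..} (1 - a\<^sup>2 - b\<^sup>2) \<partial>lborel)
   = (\<integral>\<^sup>+t\<in>{0<..}. ennreal ((1 - a\<^sup>2 - t) powr e) * indicator {0<..} (1 - a\<^sup>2 - t) * ennreal (t powr (-1/2)) \<partial>lborel)"
   by (rule nn_integral_square[of "\<lambda>t. ennreal ((1 - a\<^sup>2 - t) powr e) * indicator {0<..} (1 - a\<^sup>2 - t)"]) measurable
  also have "\<dots> = (\<integral>\<^sup>+t\<in>{0<..<1 - a\<^sup>2}. ennreal ((t - 0) powr (1/2 - 1) * ((1 - a\<^sup>2) - t) powr ((e + 1) - 1)) \<partial>lborel)"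
   by (intro nn_integral_cong) (auto simp: indicator_def ennreal_mult mult_ac)
  also have "\<dots> = ennreal ((1 - a\<^sup>2) powr (e + 1/2) * Beta (1/2) (e + 1)) * indicator {-1<..<1} a"
  proof (cases "1 - a\<^sup>2 > 0")
   case True
   then have "a \<in> {-1<..<1}" by (simp add: abs_square_less_1 abs_less_iff)
   then show ?thesis using nn_integral_Beta[OF True, of "1/2" "e + 1"] e0 by (simp add: add.commute)
  next
   case False
   then have "a \<notin> {-1<..<1}" by (auto simp: abs_square_less_1 abs_less_iff)
   then show ?thesis using False by simp
  qed
  finally show ?thesis .
 qed
 have B0: "Beta (1/2) (e + 1) > 0"
  using e0 by (simp add: Beta_def Gamma_real_pos)
 have "(\<integral>\<^sup>+(x::real^'n). \<phi> (x $ k) \<partial>surface_measure) = ennreal (2 * c) * (\<integral>\<^sup>+a. \<integral>\<^sup>+b. \<phi> a *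
    ennreal ((1 - a\<^sup>2 - b\<^sup>2) powr e) * indicator {0<..} (1 - a\<^sup>2 - b\<^sup>2) \<partial>lborel \<partial>lborel)"
 proof -
  have "(\<lambda>(a, b). \<phi> a) \<in> borel_measurable (borel :: (real \<times> real) measure)"
   unfolding borel_prod[symmetric] by measurable
  from nn_integral_surface_coords[OF n j this] show ?thesis by (simp add: c_def e_def)
 qed
 also have "(\<integral>\<^sup>+a. \<integral>\<^sup>+b. \<phi> a *
    ennreal ((1 - a\<^sup>2 - b\<^sup>2) powr e) * indicator {0<..} (1 - a\<^sup>2 - b\<^sup>2) \<partial>lborel \<partial>lborel)
  = (\<integral>\<^sup>+a. ennreal (Beta (1/2) (e + 1)) * (\<phi> a * ennreal ((1 - a\<^sup>2) powr (e + 1/2)) * indicator {-1<..<1} a) \<partial>lborel)"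
 proof (rule nn_integral_cong)
  fix a :: real
  have "(\<integral>\<^sup>+b. \<phi> a * ennreal ((1 - a\<^sup>2 - b\<^sup>2) powr e) * indicator {0<..} (1 - a\<^sup>2 - b\<^sup>2) \<partial>lborel)
   = \<phi> a * (\<integral>\<^sup>+b. ennreal ((1 - a\<^sup>2 - b\<^sup>2) powr e) * indicator {0<..} (1 - a\<^sup>2 - b\<^sup>2) \<partial>lborel)"
   by (subst nn_integral_cmult[symmetric]) (auto simp: mult.assoc)
  then show "(\<integral>\<^sup>+b. \<phi> a * ennreal ((1 - a\<^sup>2 - b\<^sup>2) powr e) * indicator {0<..} (1 - a\<^sup>2 - b\<^sup>2) \<partial>lborel)
   = ennreal (Beta (1/2) (e + 1)) * (\<phi> a * ennreal ((1 - a\<^sup>2) powr (e + 1/2)) * indicator {-1<..<1} a)"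
   unfolding inner using B0 by (simp add: ennreal_mult mult_ac)
 qed
 also have "\<dots> = ennreal (Beta (1/2) (e + 1)) * (\<integral>\<^sup>+s\<in>{-1<..<1}. \<phi> s * ennreal ((1 - s\<^sup>2) powr (e + 1/2)) \<partial>lborel)"
  by (rule nn_integral_cmult) measurable
 also have "ennreal (2 * c) * \<dots> = ennreal (2 * (c * Beta (1/2) (e + 1))) * (\<integral>\<^sup>+s\<in>{-1<..<1}. \<phi> s * ennreal ((1 - s\<^sup>2) powr (e + 1/2)) \<partial>lborel)"
  using c B0 by (simp add: ennreal_mult mult.assoc)
 also have "c * Beta (1/2) (e + 1) = half_sphere_area (CARD('n) - 1)"
 proof -
  have "e + 1 = real (CARD('n) - 2) / 2" using n by (simp add: e_def of_nat_diff field_simps)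
  moreover have "Suc (CARD('n) - 2) = CARD('n) - 1" using n by simp
  ultimately show ?thesis using half_sphere_area_Suc[of "CARD('n) - 2"] n
   by (simp only: c_def)
 qed
 also have "e + 1/2 = (real CARD('n) - 3) / 2" by (simp add: e_def field_simps)
 finally show ?thesis .
qed

section \<open>The Riesz kernel averaged over parallels\<close>

lemma orthogonal_transformation_Householder:
 fixes v :: "'a::real_inner"
 shows "orthogonal_transformation (\<lambda>x. x - (2 * (x \<bullet> v) / (v \<bullet> v)) *\<^sub>R v)"
proof (cases "v = 0")
 case True
 then show ?thesis by (simp add: orthogonal_transformation_def linear_id[unfolded id_def])
next
 case False
 then have v: "v \<bullet> v \<noteq> 0" by simp
 show ?thesis unfolding orthogonal_transformation_def
 proof (intro conjI allI linearI)
  fix x y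
  show "(x - (2 * (x \<bullet> v) / (v \<bullet> v)) *\<^sub>R v) \<bullet> (y - (2 * (y \<bullet> v) / (v \<bullet> v)) *\<^sub>R v) = x \<bullet> y"
   using v by (simp add: inner_diff_left inner_diff_right inner_commute field_simps)
 qed (simp_all add: algebra_simps inner_add_left add_divide_distrib)
qed

text \<open>The reflection that exchanges e and p fixes every vector orthogonal to both.\<close>

lemma orthogonal_transformation_fixing:
 fixes a e p :: "'a::real_inner"
 assumes "norm e = 1" "norm p = 1" "a \<bullet> e = 0" "a \<bullet> p = 0"
 obtains T where "orthogonal_transformation T" "T a = a" "T e = p"
proof
 let ?v = "p - e"
 let ?T = "\<lambda>x. x - (2 * (x \<bullet> ?v) / (?v \<bullet> ?v)) *\<^sub>R ?v"
 show "orthogonal_transformation ?T" by (rule orthogonal_transformation_Householder)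
 show "?T a = a" using assms(3,4) by (simp add: inner_diff_right)
 show "?T e = p"
 proof (cases "p = e")
  case False
  have ee: "e \<bullet> e = 1" "p \<bullet> p = 1" using assms(1,2) by (simp_all add: norm_eq_1)
  have "?v \<bullet> ?v = - 2 * (e \<bullet> ?v)"
   using ee by (simp add: inner_diff_left inner_diff_right inner_commute[of p e])
  moreover have "?v \<bullet> ?v \<noteq> 0" using False by simp
  ultimately have "2 * (e \<bullet> ?v) / (?v \<bullet> ?v) = -1" by (simp add: field_simps)
  then show ?thesis by simp
 qed simp
qed

text \<open>The kernel as a function of the squared distance. The division in \<open>ennreal\<close>
  keeps the value \<infinity> at 0, so that the passage to the profile is exact on the diagonal as
  well.\<close>

definition riesz_profile :: "nat \<Rightarrow> real \<Rightarrow> ennreal" where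
 "riesz_profile m r = 1 / ennreal (sqrt r) ^ m"

lemma riesz_profile_measurable [measurable]: "riesz_profile m \<in> borel_measurable borel"
 unfolding riesz_profile_def by measurable

lemma riesz_profile_pos_eq: "r > 0 \<Longrightarrow> riesz_profile m r = ennreal (r powr (- (real m / 2)))"
proof -
 assume r: "r > 0"
 have "sqrt r ^ m = r powr (real m / 2)"
  using r by (simp add: powr_half_sqrt[symmetric] powr_power)
 moreover have "1 / ennreal (r powr (real m / 2)) = ennreal (1 / r powr (real m / 2))"
  using divide_ennreal[of 1 "r powr (real m / 2)"] r by simp
 ultimately show ?thesis using r
  by (simp add: riesz_profile_def ennreal_power powr_minus_divide)
qed

lemma riesz_kernel_eq_profile:
 fixes x y :: "real^'n"
 assumes "x \<in> sphere 0 1" "y \<in> sphere 0 1"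
 shows "riesz_kernel x y = riesz_profile (CARD('n) - 2) (2 - 2 * (x \<bullet> y))"
proof -
 have "(norm (x - y))\<^sup>2 = 2 - 2 * (x \<bullet> y)"
  using assms by (simp add: norm_eq_1 power2_norm_eq_inner inner_diff_left inner_diff_right inner_commute)
 then have "norm (x - y) = sqrt (2 - 2 * (x \<bullet> y))" by (metis norm_ge_zero real_sqrt_unique)
 then show ?thesis by (simp add: riesz_kernel_def riesz_profile_def)
qed

text \<open>Up to constants, the mean of the Riesz kernel over the parallel of height s, seen from a
  point of height u. Here p is the cosine of the angle between the components orthogonal to the
  axis, and the second base is the squared distance.\<close>

definition zonal_kernel :: "real \<Rightarrow> real \<Rightarrow> real \<Rightarrow> ennreal" where
 "zonal_kernel D s u = (\<integral>\<^sup>+p\<in>{-1<..<1}. ennreal ((1 - p\<^sup>2) powr ((D - 4)/2) *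
   (2 - 2 * s * u - 2 * sqrt (1 - s\<^sup>2) * sqrt (1 - u\<^sup>2) * p) powr (- ((D - 2)/2))) \<partial>lborel)"

lemma zonal_kernel_measurable [measurable]: 
 "(\<lambda>x. zonal_kernel D (f x) (g x)) \<in> borel_measurable M"
 if "f \<in> borel_measurable M" "g \<in> borel_measurable M"
 using that unfolding zonal_kernel_def by measurable

text \<open>An orthogonal map that fixes the axis carries y into the plane of the coordinates k and
  j, so the inner product with y involves only these two coordinates of x. Then b = r p, with r the
  radius of the parallel of height s, produces the zonal kernel.\<close>

lemma nn_integral_riesz_kernel_surface:
 fixes \<phi> :: "real \<Rightarrow> ennreal" and k :: "'n::finite" and y :: "real^'n"
 assumes n: "CARD('n) \<ge> 3" and [measurable]: "\<phi> \<in> borel_measurable borel"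
  and y: "y \<in> sphere 0 1" and yk: "-1 < y $ k" "y $ k < 1"
 shows "(\<integral>\<^sup>+x. \<phi> (x $ k) * riesz_kernel x y \<partial>surface_measure)
  = ennreal (2 * half_sphere_area (CARD('n) - 2)) *
   (\<integral>\<^sup>+s\<in>{-1<..<1}. \<phi> s * ennreal ((1 - s\<^sup>2) powr ((real CARD('n) - 3) / 2)) * zonal_kernel (real CARD('n)) s (y $ k) \<partial>lborel)"
proof -
 obtain j where j: "k \<noteq> j" using other_coordinate[OF n] .
 define u where "u = y $ k"
 define w where "w = sqrt (1 - u\<^sup>2)"
 have u: "-1 < u" "u < 1" using yk by (simp_all add: u_def)
 then have u2: "1 - u\<^sup>2 > 0" by (simp add: abs_square_less_1 abs_less_iff)
 then have w: "w > 0" "w\<^sup>2 = 1 - u\<^sup>2" by (simp_all add: w_def)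
 define ek ej :: "real^'n" where e: "ek = axis k 1" "ej = axis j 1"
 have ee: "norm ek = 1" "norm ej = 1" "ek \<bullet> ej = 0" "ek \<bullet> ek = 1" "ej \<bullet> ej = 1"
  using j by (simp_all add: e inner_axis_axis)
 have ix: "x \<bullet> ek = x $ k" "x \<bullet> ej = x $ j" for x by (simp_all add: e inner_axis)
 have yy: "y \<bullet> y = 1" using y by (simp add: norm_eq_1)
 define p where "p = (1 / w) *\<^sub>R (y - u *\<^sub>R ek)"
 have "(y - u *\<^sub>R ek) \<bullet> (y - u *\<^sub>R ek) = w\<^sup>2"
  using ee yy ix[of y] w(2) by (simp add: inner_diff_left inner_diff_right inner_commute[of ek y] u_def[symmetric] power2_eq_square)
 then have "p \<bullet> p = 1" using w(1) unfolding p_def by (simp add: power2_eq_square)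
 then have p1: "norm p = 1" by (simp add: norm_eq_1)
 have pk: "ek \<bullet> p = 0" using ee ix[of y] by (simp add: p_def inner_diff_right inner_commute[of ek y] u_def)
 obtain T where T: "orthogonal_transformation T" "T ek = ek" "T ej = p"
  using orthogonal_transformation_fixing[OF ee(2) p1 ee(3) pk] .
 have lin: "linear T" using T(1) by (rule orthogonal_transformation_linear)
 define y0 where "y0 = u *\<^sub>R ek + w *\<^sub>R ej"
 have Ty: "T y0 = y" using w(1) by (simp add: y0_def linear_add[OF lin] linear_cmul[OF lin] T p_def)
 have Tin: "T a \<bullet> T b = a \<bullet> b" for a b using T(1) by (simp add: orthogonal_transformation_def)
 have Tk: "T x $ k = x $ k" for x using Tin[of x ek] by (simp add: T(2) ix)
 define m where "m = CARD('n) - 2"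
 define e where "e = (real CARD('n) - 4) / 2"
 define c where "c = half_sphere_area (CARD('n) - 2)"
 define \<Psi> where "\<Psi> = (\<lambda>(a, b). \<phi> a * riesz_profile m (2 - 2 * (u * a + w * b)))"
 have [measurable]: "\<Psi> \<in> borel_measurable borel" unfolding \<Psi>_def split_beta' borel_prod[symmetric] by measurable
 have rm[measurable]: "(\<lambda>x. \<phi> (x $ k) * riesz_profile m (2 - 2 * (x \<bullet> y))) \<in> borel_measurable borel" by measurable
 have "(\<integral>\<^sup>+x. \<phi> (x $ k) * riesz_kernel x y \<partial>surface_measure)
  = (\<integral>\<^sup>+x. \<phi> (x $ k) * riesz_profile m (2 - 2 * (x \<bullet> y)) \<partial>surface_measure)"
  using y by (intro nn_integral_cong) (simp add: riesz_kernel_eq_profile m_def)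
 also have "\<dots> = (\<integral>\<^sup>+x. \<phi> (T x $ k) * riesz_profile m (2 - 2 * (T x \<bullet> y)) \<partial>surface_measure)"
  by (rule nn_integral_surface_orthogonal[OF T(1) rm, symmetric])
 also have "\<dots> = (\<integral>\<^sup>+x. \<Psi> (x $ k, x $ j) \<partial>surface_measure)"
 proof (rule nn_integral_cong)
  fix x
  have "T x \<bullet> y = u * x $ k + w * x $ j"
   by (simp add: Ty[symmetric] Tin) (simp add: y0_def inner_add_right ix)
  then show "\<phi> (T x $ k) * riesz_profile m (2 - 2 * (T x \<bullet> y)) = \<Psi> (x $ k, x $ j)"
   by (simp add: \<Psi>_def Tk)
 qed
 also have "\<dots> = ennreal (2 * c) * (\<integral>\<^sup>+a. \<integral>\<^sup>+b. \<Psi> (a, b) *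
    ennreal ((1 - a\<^sup>2 - b\<^sup>2) powr e) * indicator {0<..} (1 - a\<^sup>2 - b\<^sup>2) \<partial>lborel \<partial>lborel)"
  unfolding c_def e_def by (rule nn_integral_surface_coords[OF n j]) measurable
 also have "(\<integral>\<^sup>+a. \<integral>\<^sup>+b. \<Psi> (a, b) *
    ennreal ((1 - a\<^sup>2 - b\<^sup>2) powr e) * indicator {0<..} (1 - a\<^sup>2 - b\<^sup>2) \<partial>lborel \<partial>lborel)
  = (\<integral>\<^sup>+s\<in>{-1<..<1}. \<phi> s * ennreal ((1 - s\<^sup>2) powr (e + 1/2)) * zonal_kernel (real CARD('n)) s u \<partial>lborel)"
 proof (rule nn_integral_cong)
  fix s :: real
  show "(\<integral>\<^sup>+b. \<Psi> (s, b) * ennreal ((1 - s\<^sup>2 - b\<^sup>2) powr e) * indicator {0<..} (1 - s\<^sup>2 - b\<^sup>2) \<partial>lborel)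
   = \<phi> s * ennreal ((1 - s\<^sup>2) powr (e + 1/2)) * zonal_kernel (real CARD('n)) s u * indicator {-1<..<1} s"
  proof (cases "s \<in> {-1<..<1}")
   case False
   then have "\<not> 1 - s\<^sup>2 > 0" by (auto simp: abs_square_less_1 abs_less_iff)
   then have "\<not> 1 - s\<^sup>2 - b\<^sup>2 > 0" for b by (smt (verit) zero_le_power2)
   then show ?thesis using False by simp
  next
   case True
   then have s2: "1 - s\<^sup>2 > 0" by (simp add: abs_square_less_1 abs_less_iff)
   define r where "r = sqrt (1 - s\<^sup>2)"
   have r: "r > 0" "r\<^sup>2 = 1 - s\<^sup>2" using s2 by (simp_all add: r_def)
   \<comment> \<open>Cauchy-Schwarz for the unit vectors (u, w) and (s, r). It makes the squared
     distance strictly positive for p < 1, so the infinite value of the profile is not met.\<close>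
   have us: "u * s + w * r \<le> 1"
   proof -
    have "2 * (u * s + w * r) \<le> (u\<^sup>2 + s\<^sup>2) + (w\<^sup>2 + r\<^sup>2)"
     using sum_squares_bound[of u s] sum_squares_bound[of w r] by simp
    then show ?thesis by (simp add: w r)
   qed
   let ?q = "\<lambda>p. 2 - 2 * s * u - 2 * r * w * p"
   have q: "?q p > 0" if "p \<in> {-1<..<1}" for p
   proof -
    have "w * r * p < w * r" using that w r by simp
    then have "1 - u * s - w * r * p > 0" using us by simp
    then have "2 * (1 - u * s - w * r * p) > 0" by simp
    then show ?thesis by (simp add: algebra_simps)
   qed
   have "(\<integral>\<^sup>+b. \<Psi> (s, b) * ennreal ((1 - s\<^sup>2 - b\<^sup>2) powr e) * indicator {0<..} (1 - s\<^sup>2 - b\<^sup>2) \<partial>lborel)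
    = ennreal r * (\<integral>\<^sup>+p. \<Psi> (s, r * p) * ennreal ((1 - s\<^sup>2 - (r * p)\<^sup>2) powr e) * indicator {0<..} (1 - s\<^sup>2 - (r * p)\<^sup>2) \<partial>lborel)"
   proof -
    have "(\<lambda>b. \<Psi> (s, b) * ennreal ((1 - s\<^sup>2 - b\<^sup>2) powr e) * indicator {0<..} (1 - s\<^sup>2 - b\<^sup>2)) \<in> borel_measurable borel"
     by measurable
    from nn_integral_real_affine[OF this, of r 0] r(1) show ?thesis by simp
   qed
   also have "\<dots> = ennreal r * (\<integral>\<^sup>+p. \<phi> s * ennreal ((r\<^sup>2) powr e) * (ennreal ((1 - p\<^sup>2) powr e *
     (?q p) powr (- ((real CARD('n) - 2)/2))) * indicator {-1<..<1} p) \<partial>lborel)"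
   proof -
    have "\<Psi> (s, r * p) * ennreal ((1 - s\<^sup>2 - (r * p)\<^sup>2) powr e) * indicator {0<..} (1 - s\<^sup>2 - (r * p)\<^sup>2)
     = \<phi> s * ennreal ((r\<^sup>2) powr e) * (ennreal ((1 - p\<^sup>2) powr e * (?q p) powr (- ((real CARD('n) - 2)/2))) * indicator {-1<..<1} p)" for p
    proof -
    have sp: "1 - s\<^sup>2 - (r * p)\<^sup>2 = r\<^sup>2 * (1 - p\<^sup>2)" by (simp add: r(2)[symmetric] power_mult_distrib algebra_simps)
    show ?thesis
    proof (cases "p \<in> {-1<..<1}")
     case True
     then have p2: "1 - p\<^sup>2 > 0" by (simp add: abs_square_less_1 abs_less_iff)
     have "2 - 2 * (u * s + w * (r * p)) = ?q p" by (simp add: algebra_simps)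
     moreover have "- (real m / 2) = - ((real CARD('n) - 2)/2)" using n by (simp add: m_def of_nat_diff)
     ultimately have "riesz_profile m (2 - 2 * (u * s + w * (r * p))) = ennreal ((?q p) powr (- ((real CARD('n) - 2)/2)))"
      using riesz_profile_pos_eq[OF q[OF True], of m] by metis
     moreover have "r\<^sup>2 * (1 - p\<^sup>2) > 0" using p2 r(1) by simp
     ultimately show ?thesis using True p2 r(1) unfolding sp \<Psi>_def
      by (simp add: powr_mult ennreal_mult mult_ac)
    next
     case False
     then have "\<not> 1 - p\<^sup>2 > 0" by (auto simp: abs_square_less_1 abs_less_iff)
     then have "r\<^sup>2 * (1 - p\<^sup>2) \<le> 0" by (intro mult_nonneg_nonpos) simp_all
     then have "indicator {0<..} (1 - s\<^sup>2 - (r * p)\<^sup>2) = (0::ennreal)"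
      unfolding sp by (simp only: indicator_def greaterThan_iff) simp
     then show ?thesis using False by simp
    qed
    qed
    then show ?thesis by (simp only:)
   qed
   also have "\<dots> = ennreal r * (\<phi> s * ennreal ((r\<^sup>2) powr e) * zonal_kernel (real CARD('n)) s u)"
    unfolding zonal_kernel_def e_def w_def[symmetric] r_def[symmetric]
    by (rule arg_cong[where f="\<lambda>x. ennreal r * x"], rule nn_integral_cmult) measurable
   also have "\<dots> = \<phi> s * ennreal (r * (r\<^sup>2) powr e) * zonal_kernel (real CARD('n)) s u"
    using r by (simp add: ennreal_mult mult_ac)
   also have "r * (r\<^sup>2) powr e = (1 - s\<^sup>2) powr (e + 1/2)"
    using s2 unfolding r(2) by (simp add: r_def powr_add powr_half_sqrt mult.commute)
   finally show ?thesis using True by simp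
  qed
 qed
 also have "e + 1/2 = (real CARD('n) - 3) / 2" by (simp add: e_def field_simps)
 finally show ?thesis by (simp add: c_def u_def)
qed

section \<open>Energies, the Frostman condition and strict positivity\<close>

definition sphere_fin :: "(real ^ 'n) measure set" where
 "sphere_fin = {M. sets M = sets sphere_borel \<and> finite_measure M}"

lemma sphere_fin_sets: "M \<in> sphere_fin \<Longrightarrow> sets M = sets sphere_borel"
 by (simp add: sphere_fin_def)

lemma sphere_fin_finite: "M \<in> sphere_fin \<Longrightarrow> finite_measure M"
 by (simp add: sphere_fin_def)

lemma sphere_fin_space: "M \<in> sphere_fin \<Longrightarrow> space M = sphere 0 1"
 using sets_eq_imp_space_eq[OF sphere_fin_sets] by force

lemma sphere_fin_sigma_finite: "M \<in> sphere_fin \<Longrightarrow> sigma_finite_measure M"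
 using finite_measure.sigma_finite_measure sphere_fin_finite by blast

lemma sphere_prob_fin: "sphere_prob \<subseteq> sphere_fin"
 by (auto simp: sphere_prob_def sphere_fin_def prob_space_def)

lemma sphere_fin_borel_measurable:
 "M \<in> sphere_fin \<Longrightarrow> f \<in> measurable borel N \<Longrightarrow> f \<in> measurable M N"
 using measurable_cong_sets[OF sphere_fin_sets refl] measurable_sphere_borelI by blast

lemma sphere_fin_measurable_iff:
 "M \<in> sphere_fin \<Longrightarrow> f \<in> measurable M N \<longleftrightarrow> f \<in> measurable sphere_borel N"
 using measurable_cong_sets[OF sphere_fin_sets refl] by blast

lemma sphere_fin_borel_measurable_pair:
 assumes M: "M \<in> sphere_fin" and N: "N \<in> sphere_fin" and f: "f \<in> measurable (borel \<Otimes>\<^sub>M borel) L"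
 shows "f \<in> measurable (M \<Otimes>\<^sub>M N) L"
proof -
 have "(\<lambda>p. (fst p, snd p)) \<in> measurable (M \<Otimes>\<^sub>M N) (borel \<Otimes>\<^sub>M borel)"
  by (intro measurable_Pair measurable_compose[OF measurable_fst] measurable_compose[OF measurable_snd]
    sphere_fin_borel_measurable[OF M] sphere_fin_borel_measurable[OF N]) auto
 from measurable_compose[OF this f] show ?thesis by simp
qed

lemma riesz_kernel_measurable [measurable]:
 "(\<lambda>(x, y). riesz_kernel x y) \<in> borel_measurable (borel \<Otimes>\<^sub>M (borel :: (real^'n) measure))"
 unfolding riesz_kernel_def by measurable

lemma riesz_kernel_commute: "riesz_kernel x y = riesz_kernel y x"
 by (simp add: riesz_kernel_def norm_minus_commute)

definition potential :: "(real^'n) measure \<Rightarrow> real^'n \<Rightarrow> ennreal" where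
 "potential M x = (\<integral>\<^sup>+y. riesz_kernel x y \<partial>M)"

definition mutual_energy :: "(real^'n) measure \<Rightarrow> (real^'n) measure \<Rightarrow> ennreal" where
 "mutual_energy M N = (\<integral>\<^sup>+x. potential N x \<partial>M)"

lemma energy_eq: "energy M = mutual_energy M M"
 by (simp add: energy_def mutual_energy_def potential_def)

lemma potential_measurable:
 assumes M: "M \<in> sphere_fin"
 shows "potential M \<in> borel_measurable borel"
proof -
 interpret sigma_finite_measure M using M by (rule sphere_fin_sigma_finite)
 have "(\<lambda>p. (fst p, snd p)) \<in> measurable (borel \<Otimes>\<^sub>M M) (borel \<Otimes>\<^sub>M borel)"
  by (intro measurable_Pair measurable_compose[OF measurable_fst] measurable_compose[OF measurable_snd]
    sphere_fin_borel_measurable[OF M]) auto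
 from measurable_compose[OF this riesz_kernel_measurable]
 have "(\<lambda>(x, y). riesz_kernel x y) \<in> borel_measurable (borel \<Otimes>\<^sub>M M)" by (simp add: split_beta')
 then show ?thesis unfolding potential_def by (rule borel_measurable_nn_integral)
qed

lemma mutual_energy_commute:
 assumes M: "M \<in> sphere_fin" and N: "N \<in> sphere_fin"
 shows "mutual_energy M N = mutual_energy N M"
proof -
 interpret pair_sigma_finite N M
  using M N by (simp add: pair_sigma_finite_def sphere_fin_sigma_finite)
 have "(\<lambda>(x, y). riesz_kernel x y) \<in> borel_measurable (N \<Otimes>\<^sub>M M)"
  by (rule sphere_fin_borel_measurable_pair[OF N M riesz_kernel_measurable])
 from Fubini'[OF this] have "(\<integral>\<^sup>+x. \<integral>\<^sup>+y. riesz_kernel y x \<partial>N \<partial>M) = (\<integral>\<^sup>+x. \<integral>\<^sup>+y. riesz_kernel x y \<partial>M \<partial>N)" .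
 moreover have "(\<integral>\<^sup>+x. \<integral>\<^sup>+y. riesz_kernel y x \<partial>N \<partial>M) = (\<integral>\<^sup>+x. \<integral>\<^sup>+y. riesz_kernel x y \<partial>N \<partial>M)"
  by (intro nn_integral_cong riesz_kernel_commute)
 ultimately show ?thesis unfolding mutual_energy_def potential_def by metis
qed

text \<open>A rotation moves y to the axis, and the integral over heights is a Beta integral. What
  counts later is that the value is finite and independent of y, so the constant is left as the
  integral delivers it.\<close>

lemma potential_surface_measure:
 fixes y :: "real^'n"
 assumes n: "CARD('n) \<ge> 3" and y: "y \<in> sphere 0 1"
 shows "potential surface_measure y = ennreal (2 * half_sphere_area (CARD('n) - 1) *
  (2 powr (- ((real CARD('n) - 2) / 2)) * (2 powr ((real CARD('n) - 2) / 2) * Beta ((real CARD('n) - 1) / 2) (1/2))))"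
proof -
 define D where "D = real CARD('n)"
 have D: "D \<ge> 3" using n by (simp add: D_def)
 obtain k :: 'n where True by simp
 define ek :: "real^'n" where "ek = axis k 1"
 have ek: "norm ek = 1" "ek \<in> sphere 0 1" by (simp_all add: ek_def)
 have ix: "x \<bullet> ek = x $ k" for x by (simp add: ek_def inner_axis)
 have y1: "norm y = 1" using y by simp
 obtain T where T: "orthogonal_transformation T" "T ek = y"
  using orthogonal_transformation_fixing[OF ek(1) y1, of 0] by auto
 have Tin: "T a \<bullet> T b = a \<bullet> b" for a b using T(1) by (simp add: orthogonal_transformation_def)
 define m where "m = CARD('n) - 2"
 have m: "real m = D - 2" using n by (simp add: m_def D_def of_nat_diff)
 have rm: "(\<lambda>x. riesz_profile m (2 - 2 * (x \<bullet> y))) \<in> borel_measurable borel" by measurable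
 have rp: "(\<lambda>s::real. riesz_profile m (2 - 2 * s)) \<in> borel_measurable borel" by measurable
 have "potential surface_measure y = (\<integral>\<^sup>+x. riesz_profile m (2 - 2 * (x \<bullet> y)) \<partial>surface_measure)"
  unfolding potential_def m_def using y by (intro nn_integral_cong) (simp add: riesz_kernel_eq_profile inner_commute)
 also have "\<dots> = (\<integral>\<^sup>+x. riesz_profile m (2 - 2 * (T x \<bullet> y)) \<partial>surface_measure)"
  by (rule nn_integral_surface_orthogonal[OF T(1) rm, symmetric])
 also have "\<dots> = (\<integral>\<^sup>+x. riesz_profile m (2 - 2 * (x $ k)) \<partial>surface_measure)"
  by (simp add: T(2)[symmetric] Tin ix)
 also have "\<dots> = ennreal (2 * half_sphere_area (CARD('n) - 1)) * (\<integral>\<^sup>+s\<in>{-1<..<1}. riesz_profile m (2 - 2 * s) * ennreal ((1 - s\<^sup>2) powr ((D - 3) / 2)) \<partial>lborel)"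
  unfolding D_def by (rule nn_integral_surface_height[OF n rp])
 also have "(\<integral>\<^sup>+s\<in>{-1<..<1}. riesz_profile m (2 - 2 * s) * ennreal ((1 - s\<^sup>2) powr ((D - 3) / 2)) \<partial>lborel)
  = (\<integral>\<^sup>+s. ennreal (2 powr (- ((D - 2) / 2))) * (ennreal ((s - (-1)) powr ((D - 1) / 2 - 1) * (1 - s) powr (1/2 - 1)) * indicator {-1<..<1} s) \<partial>lborel)"
 proof (rule nn_integral_cong)
  fix s :: real
  show "riesz_profile m (2 - 2 * s) * ennreal ((1 - s\<^sup>2) powr ((D - 3) / 2)) * indicator {-1<..<1} s
   = ennreal (2 powr (- ((D - 2) / 2))) * (ennreal ((s - (-1)) powr ((D - 1) / 2 - 1) * (1 - s) powr (1/2 - 1)) * indicator {-1<..<1} s)"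
  proof (cases "s \<in> {-1<..<1}")
   case True
   then have pos: "1 - s > 0" "1 + s > 0" by auto
   have "riesz_profile m (2 - 2 * s) = ennreal ((2 * (1 - s)) powr (- ((D - 2) / 2)))"
    using riesz_profile_pos_eq[of "2 - 2 * s" m] pos by (simp add: m algebra_simps)
   moreover have "(2 * (1 - s)) powr (- ((D - 2) / 2)) * (1 - s\<^sup>2) powr ((D - 3) / 2)
    = 2 powr (- ((D - 2) / 2)) * ((s - (-1)) powr ((D - 1) / 2 - 1) * (1 - s) powr (1/2 - 1))"
   proof -
    have a: "1 - s\<^sup>2 = (1 + s) * (1 - s)" by (simp add: power2_eq_square algebra_simps)
    have b: "(D - 1) / 2 - 1 = (D - 3) / 2" by (simp add: field_simps)
    have c: "(1 - s) powr (- ((D - 2) / 2)) * (1 - s) powr ((D - 3) / 2) = (1 - s) powr (1/2 - 1)"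
     by (simp only: powr_add[symmetric], (simp add: field_simps)?)
    have d: "(2 * (1 - s)) powr z = 2 powr z * (1 - s) powr z" for z by (rule powr_mult)
    show ?thesis unfolding a b c[symmetric] d using pos by (simp add: powr_mult add.commute)
   qed
   ultimately show ?thesis using True by (simp add: ennreal_mult'[symmetric] del: diff_minus_eq_add)
  qed simp
 qed
 also have "\<dots> = ennreal (2 powr (- ((D - 2) / 2))) * (\<integral>\<^sup>+s\<in>{-1<..<1}. ennreal ((s - (-1)) powr ((D - 1) / 2 - 1) * (1 - s) powr (1/2 - 1)) \<partial>lborel)"
  by (rule nn_integral_cmult) measurable
 also have "(\<integral>\<^sup>+s\<in>{-1<..<1}. ennreal ((s - (-1)) powr ((D - 1) / 2 - 1) * (1 - s) powr (1/2 - 1)) \<partial>lborel)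
  = ennreal ((1 - (-1)) powr ((D - 1) / 2 + 1/2 - 1) * Beta ((D - 1) / 2) (1/2))"
  by (rule nn_integral_Beta) (use D in auto)
 also have "(D - 1) / 2 + 1/2 - 1 = (D - 2) / 2" by (simp add: field_simps)
 finally show ?thesis
 proof -
  assume *: "potential surface_measure y = ennreal (2 * half_sphere_area (CARD('n) - 1)) *
   (ennreal (2 powr (- ((D - 2) / 2))) * ennreal ((1 - (-1)) powr ((D - 2) / 2) * Beta ((D - 1) / 2) (1/2)))"
  have "half_sphere_area (CARD('n) - 1) > 0" using n by (intro half_sphere_area_pos) simp
  then show ?thesis unfolding * D_def by (simp add: ennreal_mult'[symmetric])
 qed
qed

lemma surface_measure_fin: 
 assumes n: "CARD('n) \<ge> 3"
 shows "(surface_measure :: (real^'n) measure) \<in> sphere_fin"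
proof -
 have "emeasure lborel (cball (0::real^'n) 1 - {0}) \<le> emeasure lborel (cball (0::real^'n) 1)"
  by (intro emeasure_mono) auto
 also have "\<dots> < \<infinity>" by (rule emeasure_lborel_cball_finite)
 finally have f: "emeasure lborel (cball (0::real^'n) 1 - {0}) < \<infinity>" .
 have "emeasure surface_measure (space (surface_measure :: (real^'n) measure)) = (\<integral>\<^sup>+(x::real^'n). 1 \<partial>surface_measure)"
  by simp
 also have "\<dots> = of_nat CARD('n) * (\<integral>\<^sup>+(x::real^'n). 1 * indicator (cball 0 1 - {0}) x \<partial>lborel)"
  by (rule nn_integral_surface_measure) simp
 also have "(\<integral>\<^sup>+(x::real^'n). 1 * indicator (cball 0 1 - {0}) x \<partial>lborel) = emeasure lborel (cball (0::real^'n) 1 - {0})"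
  by simp
 finally have "emeasure surface_measure (space (surface_measure :: (real^'n) measure)) \<noteq> \<infinity>"
  using f by (simp add: ennreal_mult_eq_top_iff)
 then show ?thesis by (auto simp: sphere_fin_def intro: finite_measureI)
qed

lemma energy_surface_measure:
 assumes n: "CARD('n) \<ge> 3"
 shows "energy (surface_measure :: (real^'n) measure) < \<infinity>"
proof -
 obtain C where C: "\<And>y::real^'n. y \<in> sphere 0 1 \<Longrightarrow> potential surface_measure y = ennreal C"
  using potential_surface_measure[OF n] by metis
 interpret finite_measure "surface_measure :: (real^'n) measure"
  using surface_measure_fin[OF n] by (rule sphere_fin_finite)
 have "energy (surface_measure :: (real^'n) measure) = (\<integral>\<^sup>+(y::real^'n). ennreal C \<partial>surface_measure)"
  unfolding energy_eq mutual_energy_def by (intro nn_integral_cong) (simp add: C)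
 then show ?thesis using emeasure_finite[of "sphere 0 1 :: (real^'n) set"] 
  by (auto simp: ennreal_mult_eq_top_iff less_top[symmetric])
qed

lemma uniform_measure_sphere_prob:
 assumes M: "M \<in> sphere_fin" and A: "A \<in> sets M" "emeasure M A > 0"
 shows "uniform_measure M A \<in> sphere_prob"
  and "f \<in> borel_measurable sphere_borel \<Longrightarrow> (\<integral>\<^sup>+x. f x \<partial>uniform_measure M A) = (\<integral>\<^sup>+x. f x * indicator A x \<partial>M) / emeasure M A"
proof -
 interpret finite_measure M using M by (rule sphere_fin_finite)
 show "uniform_measure M A \<in> sphere_prob"
  using A by (auto simp: sphere_prob_def sphere_fin_sets[OF M] intro!: prob_space_uniform_measure)
 show "(\<integral>\<^sup>+x. f x \<partial>uniform_measure M A) = (\<integral>\<^sup>+x. f x * indicator A x \<partial>M) / emeasure M A"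
  if "f \<in> borel_measurable sphere_borel"
  using that A by (intro nn_integral_uniform_measure) (simp_all add: sphere_fin_measurable_iff[OF M])
qed

text \<open>Conditioning on A multiplies the potential by at most 1 / M(A), hence the energy by at
  most the square of this number.\<close>

lemma energy_uniform_measure:
 assumes M: "M \<in> sphere_fin" and A: "A \<in> sets M" "emeasure M A > 0" and I: "energy M < \<infinity>"
 shows "energy (uniform_measure M A) < \<infinity>"
proof -
 interpret finite_measure M using M by (rule sphere_fin_finite)
 let ?N = "uniform_measure M A"
 note U = uniform_measure_sphere_prob[OF M A]
 define c where "c = emeasure M A"
 have c: "c \<noteq> 0" "c \<noteq> \<infinity>" using A by (simp_all add: c_def)
 have pot: "potential ?N x \<le> potential M x / c" for x
 proof -
  have "riesz_kernel x \<in> borel_measurable sphere_borel"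
   by (rule measurable_sphere_borelI) (unfold riesz_kernel_def, measurable)
  then have "potential ?N x = (\<integral>\<^sup>+y. riesz_kernel x y * indicator A y \<partial>M) / c"
   unfolding potential_def c_def by (rule U(2))
  also have "\<dots> \<le> potential M x / c"
   unfolding potential_def by (intro divide_right_mono_ennreal nn_integral_mono) (auto simp: indicator_def)
  finally show ?thesis .
 qed
 have pm: "potential M \<in> borel_measurable sphere_borel"
  using potential_measurable[OF M] by (rule measurable_sphere_borelI)
 have "energy ?N \<le> (\<integral>\<^sup>+x. potential M x / c \<partial>?N)"
  unfolding energy_eq mutual_energy_def by (intro nn_integral_mono pot)
 also have "\<dots> = (\<integral>\<^sup>+x. potential M x / c * indicator A x \<partial>M) / c"
 proof -
  have pc: "(\<lambda>x. potential M x / c) \<in> borel_measurable sphere_borel" using pm by measurable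
  show ?thesis by (rule U(2)[OF pc, folded c_def])
 qed
 also have "\<dots> \<le> (\<integral>\<^sup>+x. potential M x / c \<partial>M) / c"
  by (intro divide_right_mono_ennreal nn_integral_mono) (auto simp: indicator_def)
 also have "(\<integral>\<^sup>+x. potential M x / c \<partial>M) = energy M / c"
  unfolding energy_eq mutual_energy_def
  by (rule nn_integral_divide) (simp add: pm sphere_fin_measurable_iff[OF M])
 moreover have "inverse c < \<infinity>"
  using c by (cases c) (auto simp: inverse_ennreal ennreal_neq_top less_top)
 ultimately show ?thesis using I
  by (auto simp: divide_ennreal_def ennreal_mult_less_top elim!: le_less_trans)
qed

text \<open>The kernel is infinite on the diagonal, so an atom at x makes the potential infinite at
  x, and the same atom then makes the energy infinite.\<close>

lemma energy_zero_on_singletons: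
 fixes M :: "(real^'n) measure"
 assumes n: "CARD('n) \<ge> 3" and M: "M \<in> sphere_fin" and I: "energy M < \<infinity>" and x: "x \<in> sphere 0 1"
 shows "emeasure M {x} = 0"
proof (rule ccontr)
 assume ne: "emeasure M {x} \<noteq> 0"
 have sx: "{x} \<in> sets M" using x by (simp add: sphere_fin_sets[OF M] sets_sphere_borel)
 have Kxx: "riesz_kernel x x = \<infinity>" using n by (simp add: riesz_kernel_def power_0_left)
 have i: "\<infinity> = (\<integral>\<^sup>+y. \<infinity> * indicator {x} y \<partial>M)" 
  unfolding nn_integral_cmult_indicator[OF sx] using ne by (simp add: ennreal_top_mult)
 also have "\<dots> \<le> potential M x"
  unfolding potential_def using Kxx by (intro nn_integral_mono) (auto simp: indicator_def)
 finally have px: "potential M x = \<infinity>" by (simp add: top_unique)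
 note i
 also have "(\<integral>\<^sup>+y. \<infinity> * indicator {x} y \<partial>M) \<le> energy M"
  unfolding energy_eq mutual_energy_def using px by (intro nn_integral_mono) (auto simp: indicator_def)
 finally show False using I by simp
qed

text \<open>By Lindelof's theorem the complement of the support is covered by countably many open
  sets of measure zero.\<close>

lemma sphere_supp_null:
 assumes M: "M \<in> sphere_fin"
 shows "AE x in M. x \<in> sphere_supp M"
proof -
 define \<U> where "\<U> = {U. open U \<and> emeasure M (U \<inter> sphere 0 1) = 0}"
 obtain \<F> where F: "\<F> \<subseteq> \<U>" "countable \<F>" "\<Union>\<F> = \<Union>\<U>"
  using Lindelof[of \<U>] by (auto simp: \<U>_def)
 have "(\<Union>U\<in>\<F>. U \<inter> sphere 0 1) \<in> null_sets M"
 proof (rule null_sets_UN')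
  fix U assume "U \<in> \<F>"
  then have "open U" "emeasure M (U \<inter> sphere 0 1) = 0" using F by (auto simp: \<U>_def)
  then show "U \<inter> sphere 0 1 \<in> null_sets M"
   by (simp add: null_sets_def sphere_fin_sets[OF M] sets_sphere_borel)
 qed fact
 then have "AE x in M. x \<notin> (\<Union>U\<in>\<F>. U \<inter> sphere 0 1)" by (rule AE_not_in)
 then show ?thesis
 proof (rule AE_mp, intro AE_I2 impI)
  fix x assume x: "x \<in> space M" "x \<notin> (\<Union>U\<in>\<F>. U \<inter> sphere 0 1)"
  then have "x \<in> sphere 0 1" "x \<notin> \<Union>\<U>" using F(3) by (auto simp: sphere_fin_space[OF M])
  then show "x \<in> sphere_supp M" by (auto simp: sphere_supp_def \<U>_def zero_less_iff_neq_zero)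
 qed
qed

section \<open>Minimality and its first variation\<close>

lemma lsc_on_measurable:
 assumes "lsc_on (sphere 0 1) Q"
 shows "Q \<in> borel_measurable sphere_borel"
proof (rule borel_measurableI_greater)
 fix a
 have "openin (top_of_set (sphere 0 1)) {x \<in> sphere 0 1. a < Q x}"
  using assms by (simp add: lsc_on_def)
 then obtain T where "open T" "{x \<in> sphere 0 1. a < Q x} = sphere 0 1 \<inter> T"
  by (auto simp: openin_open)
 then show "{x \<in> space sphere_borel. a < Q x} \<in> sets sphere_borel"
  by (auto simp: sets_sphere_borel)
qed

text \<open>The field is finite on a set of positive area, hence bounded by some integer m on a set
  of positive area; the surface measure conditioned on that set is a competitor of finite weighted
  energy.\<close>

lemma exists_finite_weighted_energy:
 fixes Q :: "real^'n \<Rightarrow> ennreal"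
 assumes n: "CARD('n) \<ge> 3" and Q: "external_field Q"
 shows "\<exists>\<nu>\<in>sphere_prob. weighted_energy Q \<nu> < \<infinity>"
proof -
 have Qm[measurable]: "Q \<in> borel_measurable sphere_borel"
  using Q lsc_on_measurable by (auto simp: external_field_def)
 note S = surface_measure_fin[OF n]
 interpret finite_measure "surface_measure :: (real^'n) measure"
  using S by (rule sphere_fin_finite)
 define A where "A m = {x \<in> space sphere_borel. Q x \<le> of_nat m}" for m
 have A: "A m \<in> sets (surface_measure :: (real^'n) measure)" for m
  unfolding A_def sets_surface_measure by measurable
 have "{x \<in> sphere 0 1. Q x < \<infinity>} = (\<Union>m. A m)"
 proof -
  have "\<exists>m. Q x \<le> of_nat m" if "Q x < \<infinity>" for x
   using ennreal_Ex_less_of_nat[of "Q x"] that by (auto intro: less_imp_le)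
  moreover have "Q x < \<infinity>" if "Q x \<le> of_nat m" for x m
   by (metis infinity_ennreal_def le_less_trans of_nat_less_top that)
  ultimately show ?thesis by (auto simp: A_def)
 qed
 then have "emeasure surface_measure (\<Union>m. A m) > 0" using Q by (simp add: external_field_def)
 then obtain m where m: "emeasure surface_measure (A m) > 0"
  using emeasure_UN_eq_0[of surface_measure A] A by (auto simp: zero_less_iff_neq_zero)
 let ?\<nu> = "uniform_measure surface_measure (A m)"
 note U = uniform_measure_sphere_prob[OF S A m]
 have "(\<integral>\<^sup>+x. Q x \<partial>?\<nu>) = (\<integral>\<^sup>+x. Q x * indicator (A m) x \<partial>surface_measure) / emeasure surface_measure (A m)"
  by (rule U(2)) simp
 also have "\<dots> \<le> (\<integral>\<^sup>+x. of_nat m * indicator (A m) x \<partial>surface_measure) / emeasure surface_measure (A m)"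
  by (intro divide_right_mono_ennreal nn_integral_mono) (auto simp: indicator_def A_def)
 also have "\<dots> = of_nat m"
  using m A by (simp add: nn_integral_cmult_indicator ennreal_mult_divide_eq)
 finally have "(\<integral>\<^sup>+x. Q x \<partial>?\<nu>) \<le> of_nat m" .
 then have "(\<integral>\<^sup>+x. Q x \<partial>?\<nu>) < \<infinity>"
  using of_nat_less_top[of m] by (metis infinity_ennreal_def le_less_trans)
 moreover have "energy ?\<nu> < \<infinity>"
  by (rule energy_uniform_measure[OF S A m energy_surface_measure[OF n]])
 ultimately have "weighted_energy Q ?\<nu> < \<infinity>"
  by (auto simp: weighted_energy_def ennreal_mult_less_top)
 then show ?thesis using U(1) by blast
qed

text \<open>The convex combination is realised as the law of a random choice: a coin with parameter
  t decides between independent samples of M and N. Its integrals then follow from Fubini, without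
  building a sum of measures.\<close>

lemma sphere_prob_mixture:
 fixes M N :: "(real^'n) measure"
 assumes M: "M \<in> sphere_prob" and N: "N \<in> sphere_prob" and t: "0 \<le> t" "t \<le> 1"
 obtains L where "L \<in> sphere_prob"
  "\<And>f. f \<in> borel_measurable sphere_borel \<Longrightarrow> (\<integral>\<^sup>+x. f x \<partial>L) = ennreal (1 - t) * (\<integral>\<^sup>+x. f x \<partial>M) + ennreal t * (\<integral>\<^sup>+x. f x \<partial>N)"
proof
 interpret M: prob_space M using M by (simp add: sphere_prob_def)
 interpret N: prob_space N using N by (simp add: sphere_prob_def)
 have sets[measurable_cong]: "sets M = sets sphere_borel" "sets N = sets sphere_borel"
  using M N by (auto simp: sphere_prob_def)
 let ?B = "measure_pmf (bernoulli_pmf t)"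
 let ?P = "?B \<Otimes>\<^sub>M (M \<Otimes>\<^sub>M N)"
 let ?g = "\<lambda>(b, x, y). if b then y else x :: real^'n"
 interpret MN: pair_prob_space M N ..
 interpret B: prob_space ?B by (rule measure_pmf.prob_space_axioms)
 interpret P: pair_prob_space ?B "M \<Otimes>\<^sub>M N" ..
 have g[measurable]: "?g \<in> measurable ?P sphere_borel"
 proof -
  have "(\<lambda>p. if fst p then snd (snd p) else fst (snd p)) \<in> measurable ?P sphere_borel"
   by measurable
  then show ?thesis by (simp add: split_beta')
 qed
 show "distr ?P sphere_borel ?g \<in> sphere_prob"
  by (auto simp: sphere_prob_def intro!: P.prob_space_distr g)
 fix f :: "real^'n \<Rightarrow> ennreal" assume f[measurable]: "f \<in> borel_measurable sphere_borel"
 have "(\<integral>\<^sup>+x. f x \<partial>distr ?P sphere_borel ?g) = (\<integral>\<^sup>+p. f (?g p) \<partial>?P)"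
  by (rule nn_integral_distr) measurable
 also have "\<dots> = (\<integral>\<^sup>+b. \<integral>\<^sup>+q. f (?g (b, q)) \<partial>(M \<Otimes>\<^sub>M N) \<partial>?B)"
  by (rule MN.nn_integral_fst[symmetric]) measurable
 also have "\<dots> = (\<integral>\<^sup>+q. f (?g (True, q)) \<partial>(M \<Otimes>\<^sub>M N)) * ennreal t + (\<integral>\<^sup>+q. f (?g (False, q)) \<partial>(M \<Otimes>\<^sub>M N)) * ennreal (1 - t)"
  using t by simp
 also have "(\<integral>\<^sup>+q. f (?g (True, q)) \<partial>(M \<Otimes>\<^sub>M N)) = (\<integral>\<^sup>+x. \<integral>\<^sup>+y. f y \<partial>N \<partial>M)"
  by (subst N.nn_integral_fst[symmetric]) (simp_all add: split_beta')
 also have "\<dots> = (\<integral>\<^sup>+y. f y \<partial>N)" by (simp add: M.emeasure_space_1)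
 also have "(\<integral>\<^sup>+q. f (?g (False, q)) \<partial>(M \<Otimes>\<^sub>M N)) = (\<integral>\<^sup>+x. \<integral>\<^sup>+y. f x \<partial>N \<partial>M)"
  by (subst N.nn_integral_fst[symmetric]) (simp_all add: split_beta')
 also have "\<dots> = (\<integral>\<^sup>+x. f x \<partial>M)" by (simp add: N.emeasure_space_1)
 finally show "(\<integral>\<^sup>+x. f x \<partial>distr ?P sphere_borel ?g) = ennreal (1 - t) * (\<integral>\<^sup>+x. f x \<partial>M) + ennreal t * (\<integral>\<^sup>+x. f x \<partial>N)"
  by (simp add: mult.commute add.commute)
qed

lemma quadratic_variation_nonneg:
 fixes a b c :: real
 assumes "\<And>t. 0 < t \<Longrightarrow> t \<le> 1 \<Longrightarrow> 0 \<le> t * b + t\<^sup>2 * c"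
 shows "0 \<le> b"
proof (rule ccontr)
 assume b: "\<not> 0 \<le> b"
 define t where "t = min 1 (- b / (2 * (\<bar>c\<bar> + 1)))"
 have t: "0 < t" "t \<le> 1" using b by (simp_all add: t_def divide_neg_pos)
 have "0 \<le> t * (b + t * c)" using assms[OF t] by (simp add: power2_eq_square algebra_simps)
 then have "0 \<le> b + t * c" using t by (simp add: zero_le_mult_iff)
 moreover have "t * c \<le> t * (\<bar>c\<bar> + 1)" using t by simp
 moreover have "t * (\<bar>c\<bar> + 1) \<le> - b / (2 * (\<bar>c\<bar> + 1)) * (\<bar>c\<bar> + 1)"
  by (rule mult_right_mono) (auto simp: t_def)
 moreover have "- b / (2 * (\<bar>c\<bar> + 1)) * (\<bar>c\<bar> + 1) = - b / 2" by (simp add: field_simps)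
 ultimately show False using b by linarith
qed

text \<open>The weighted energy of (1-t)\<mu> + t\<nu> is a quadratic polynomial in t, minimal on
  [0,1] at t = 0, so its slope there is non-negative; half the slope is the difference of the two
  sides. The finiteness assumptions allow the computation to be carried out with real
  numbers.\<close>

lemma equilibrium_variation:
 fixes Q :: "real^'n \<Rightarrow> ennreal"
 assumes Q: "Q \<in> borel_measurable sphere_borel" and \<mu>: "\<mu> \<in> sphere_prob" and \<nu>: "\<nu> \<in> sphere_prob"
  and min: "\<And>\<rho>. \<rho> \<in> sphere_prob \<Longrightarrow> weighted_energy Q \<mu> \<le> weighted_energy Q \<rho>"
  and fin: "weighted_energy Q \<mu> < \<infinity>" "energy \<nu> < \<infinity>" "mutual_energy \<nu> \<mu> < \<infinity>" "(\<integral>\<^sup>+x. Q x \<partial>\<nu>) < \<infinity>"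
 shows "energy \<mu> + (\<integral>\<^sup>+x. Q x \<partial>\<mu>) \<le> mutual_energy \<nu> \<mu> + (\<integral>\<^sup>+x. Q x \<partial>\<nu>)"
proof -
 have fM: "\<mu> \<in> sphere_fin" "\<nu> \<in> sphere_fin" using \<mu> \<nu> sphere_prob_fin by auto
 have I: "energy \<mu> < \<infinity>" "(\<integral>\<^sup>+x. Q x \<partial>\<mu>) < \<infinity>"
  using fin(1) by (auto simp: weighted_energy_def ennreal_mult_less_top)
 define a where "a = enn2real (energy \<mu>)"
 define b where "b = enn2real (mutual_energy \<nu> \<mu>)"
 define c where "c = enn2real (energy \<nu>)"
 define p where "p = enn2real (\<integral>\<^sup>+x. Q x \<partial>\<mu>)"
 define q where "q = enn2real (\<integral>\<^sup>+x. Q x \<partial>\<nu>)"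
 have nn: "0 \<le> a" "0 \<le> b" "0 \<le> c" "0 \<le> p" "0 \<le> q" by (simp_all add: a_def b_def c_def p_def q_def)
 have e: "mutual_energy \<mu> \<mu> = ennreal a" "mutual_energy \<nu> \<mu> = ennreal b" "mutual_energy \<mu> \<nu> = ennreal b" "mutual_energy \<nu> \<nu> = ennreal c"
  "(\<integral>\<^sup>+x. Q x \<partial>\<mu>) = ennreal p" "(\<integral>\<^sup>+x. Q x \<partial>\<nu>) = ennreal q"
  using I fin mutual_energy_commute[OF fM] by (simp_all add: a_def b_def c_def p_def q_def energy_eq)
 have "0 \<le> t * (2 * (b + q) - 2 * (a + p)) + t\<^sup>2 * (a - 2 * b + c)" if t: "0 < t" "t \<le> 1" for t
 proof -
  obtain L where L: "L \<in> sphere_prob"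
   "\<And>f. f \<in> borel_measurable sphere_borel \<Longrightarrow> (\<integral>\<^sup>+x. f x \<partial>L) = ennreal (1 - t) * (\<integral>\<^sup>+x. f x \<partial>\<mu>) + ennreal t * (\<integral>\<^sup>+x. f x \<partial>\<nu>)"
   using sphere_prob_mixture[OF \<mu> \<nu>, of t] t by auto
  have pm[measurable]: "potential \<mu> \<in> borel_measurable sphere_borel" "potential \<nu> \<in> borel_measurable sphere_borel"
   using potential_measurable[OF fM(1)] potential_measurable[OF fM(2)] by (simp_all add: measurable_sphere_borelI)
  have pL: "potential L x = ennreal (1 - t) * potential \<mu> x + ennreal t * potential \<nu> x" for x
   unfolding potential_def by (rule L(2)[OF measurable_sphere_borelI]) (unfold riesz_kernel_def, measurable)
  have "energy L = (\<integral>\<^sup>+x. ennreal (1 - t) * potential \<mu> x + ennreal t * potential \<nu> x \<partial>L)"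
   unfolding energy_eq mutual_energy_def pL ..
  also have "\<dots> = ennreal (1 - t) * (\<integral>\<^sup>+x. ennreal (1 - t) * potential \<mu> x + ennreal t * potential \<nu> x \<partial>\<mu>)
   + ennreal t * (\<integral>\<^sup>+x. ennreal (1 - t) * potential \<mu> x + ennreal t * potential \<nu> x \<partial>\<nu>)"
   by (rule L(2)) measurable
  also have "(\<integral>\<^sup>+x. ennreal (1 - t) * potential \<mu> x + ennreal t * potential \<nu> x \<partial>\<mu>)
   = ennreal (1 - t) * mutual_energy \<mu> \<mu> + ennreal t * mutual_energy \<mu> \<nu>"
   unfolding mutual_energy_def using pm 
   by (simp add: nn_integral_add nn_integral_cmult sphere_fin_measurable_iff[OF fM(1)])
  also have "(\<integral>\<^sup>+x. ennreal (1 - t) * potential \<mu> x + ennreal t * potential \<nu> x \<partial>\<nu>)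
   = ennreal (1 - t) * mutual_energy \<nu> \<mu> + ennreal t * mutual_energy \<nu> \<nu>"
   unfolding mutual_energy_def using pm 
   by (simp add: nn_integral_add nn_integral_cmult sphere_fin_measurable_iff[OF fM(2)])
  finally have EL: "energy L = ennreal ((1 - t) * ((1 - t) * a + t * b) + t * ((1 - t) * b + t * c))"
   unfolding e using t nn by (simp add: ennreal_mult ennreal_plus)
  have QL: "(\<integral>\<^sup>+x. Q x \<partial>L) = ennreal ((1 - t) * p + t * q)"
   using L(2)[OF Q] t nn unfolding e by (simp add: ennreal_mult ennreal_plus)
  have "ennreal (a + 2 * p) \<le> ennreal ((1 - t) * ((1 - t) * a + t * b) + t * ((1 - t) * b + t * c) + 2 * ((1 - t) * p + t * q))"
   using min[OF L(1)] t nn unfolding weighted_energy_def EL QL unfolding energy_eq e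
   by (simp add: ennreal_plus ennreal_mult)
  then have "a + 2 * p \<le> (1 - t) * ((1 - t) * a + t * b) + t * ((1 - t) * b + t * c) + 2 * ((1 - t) * p + t * q)"
   using t nn by (subst (asm) ennreal_le_iff) auto
  then show ?thesis by (simp add: power2_eq_square algebra_simps)
 qed
 from quadratic_variation_nonneg[OF this] have "a + p \<le> b + q" by simp
 then show ?thesis unfolding energy_eq e using nn by (simp add: ennreal_plus[symmetric] del: ennreal_plus)
qed


lemma ennreal_divide_lessI:
 fixes x f c :: ennreal
 assumes "x < f * c" "0 < c" "c < \<infinity>" "f < \<infinity>"
 shows "x / c < f"
proof -
 obtain c' where c: "c = ennreal c'" "0 < c'" using assms(2,3) by (cases c) auto
 obtain f' where f: "f = ennreal f'" "0 \<le> f'" using assms(4) by (cases f) auto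
 have "x \<noteq> \<infinity>" using assms(1) by auto
 then obtain x' where x: "x = ennreal x'" "0 \<le> x'" by (cases x) auto
 have "x' < f' * c'" using assms(1) c f x by (simp add: ennreal_mult[symmetric] ennreal_less_iff)
 then have "x' / c' < f'" using c by (simp add: field_simps)
 then show ?thesis using c f x by (simp add: divide_ennreal ennreal_less_iff)
qed

lemma ennreal_le_minus_real:
 assumes "a + ennreal b \<le> ennreal c" "0 \<le> b"
 shows "a \<le> ennreal (c - b)" and "b \<le> c \<or> c < 0"
proof -
 have a: "a \<noteq> \<infinity>" using assms(1) by (auto simp: top_unique)
 then obtain r where r: "a = ennreal r" "0 \<le> r" by (cases a) auto
 have "ennreal (r + b) \<le> ennreal c" using assms r by (simp add: ennreal_plus)
 then have "r + b \<le> c \<or> r + b = 0" using assms(2) r unfolding ennreal_le_iff2 by auto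
 then have "r + b \<le> c \<or> (r = 0 \<and> b = 0)" using assms(2) r by linarith
 then show "a \<le> ennreal (c - b)" "b \<le> c \<or> c < 0" using assms(2) r by (auto simp: ennreal_leI)
qed

text \<open>True on the diagonal too, since inversion is continuous at 0 as a map into
  \<open>ennreal\<close>. This is the input to Fatou's lemma in \<open>frostman\<close>.\<close>

lemma riesz_kernel_tendsto:
 fixes x :: "nat \<Rightarrow> real^'n"
 assumes "x \<longlonglongrightarrow> p"
 shows "(\<lambda>m. riesz_kernel (x m) y) \<longlonglongrightarrow> riesz_kernel p y"
proof -
 have K: "riesz_kernel z y = inverse (ennreal (norm (z - y) ^ (CARD('n) - 2)))" for z
  by (simp add: riesz_kernel_def divide_ennreal_def ennreal_power)
 have "continuous_on UNIV (\<lambda>z. inverse (ennreal (norm (z - y) ^ (CARD('n) - 2))))"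
  by (intro continuous_intros continuous_on_ennreal)
 then show ?thesis unfolding K
  by (rule continuous_on_tendsto_compose[OF _ assms]) auto
qed

text \<open>If potential plus field were below the constant F on a set charged by a measure of
  finite energy, that measure conditioned on the set would violate the variational inequality.
  Applied to the surface measure, this yields the lower bound almost everywhere. The upper bound is
  proved at every point of the support.\<close>

lemma frostman:
 fixes Q :: "real^'n \<Rightarrow> ennreal"
 assumes n: "CARD('n) \<ge> 3" and Q: "external_field Q" and eq: "equilibrium_measure Q \<mu>"
  and cont: "\<And>p. p \<in> sphere_supp \<mu> \<Longrightarrow> \<exists>U h. open U \<and> p \<in> U \<and> continuous_on U h \<and>
    (\<forall>x\<in>U \<inter> sphere 0 1. 0 \<le> h x \<and> Q x = ennreal (h x))"
 shows "energy \<mu> + (\<integral>\<^sup>+x. Q x \<partial>\<mu>) < \<infinity>"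
  and "AE x in surface_measure. x \<in> sphere_supp \<mu> \<longrightarrow> potential \<mu> x + Q x = energy \<mu> + (\<integral>\<^sup>+x. Q x \<partial>\<mu>)"
proof -
 have Qm[measurable]: "Q \<in> borel_measurable sphere_borel"
  using Q lsc_on_measurable by (auto simp: external_field_def)
 have \<mu>: "\<mu> \<in> sphere_prob" using eq by (simp add: equilibrium_measure_def)
 then have f\<mu>: "\<mu> \<in> sphere_fin" using sphere_prob_fin by auto
 interpret \<mu>: prob_space \<mu> using \<mu> by (simp add: sphere_prob_def)
 have min: "weighted_energy Q \<mu> \<le> weighted_energy Q \<rho>" if "\<rho> \<in> sphere_prob" for \<rho>
  using eq that by (auto simp: equilibrium_measure_def intro: INF_lower)
 have fin: "weighted_energy Q \<mu> < \<infinity>"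
  using exists_finite_weighted_energy[OF n Q] min le_less_trans by blast
 then have I: "energy \<mu> < \<infinity>" "(\<integral>\<^sup>+x. Q x \<partial>\<mu>) < \<infinity>"
  by (auto simp: weighted_energy_def ennreal_mult_less_top)
 define F where "F = energy \<mu> + (\<integral>\<^sup>+x. Q x \<partial>\<mu>)"
 show F: "energy \<mu> + (\<integral>\<^sup>+x. Q x \<partial>\<mu>) < \<infinity>" using I by simp
 then have F': "F < \<infinity>" by (simp add: F_def)
 have pm[measurable]: "potential \<mu> \<in> borel_measurable sphere_borel"
  using potential_measurable[OF f\<mu>] by (rule measurable_sphere_borelI)
 define G where "G x = potential \<mu> x + Q x" for x
 have Gm[measurable]: "G \<in> borel_measurable sphere_borel" unfolding G_def by measurable
 define A where "A = {x \<in> space sphere_borel. G x < F}"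
 have Am: "A \<in> sets sphere_borel" unfolding A_def by measurable
 have key: "AE x in M. F \<le> G x" if M: "M \<in> sphere_fin" and IM: "energy M < \<infinity>" for M :: "(real^'n) measure"
 proof -
  have AM: "A \<in> sets M" using Am by (simp add: sphere_fin_sets[OF M])
  interpret M: finite_measure M using M by (rule sphere_fin_finite)
  have GM[measurable]: "G \<in> borel_measurable M" using Gm by (simp add: sphere_fin_measurable_iff[OF M])
  have "emeasure M A = 0"
  proof (rule ccontr)
   assume "emeasure M A \<noteq> 0"
   then have A0: "emeasure M A > 0" by (simp add: zero_less_iff_neq_zero)
   note U = uniform_measure_sphere_prob[OF M AM A0]
   let ?\<nu> = "uniform_measure M A"
   have F\<nu>: "(\<integral>\<^sup>+x. F * indicator A x \<partial>M) = F * emeasure M A"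
    by (rule nn_integral_cmult_indicator[OF AM])
   have "(\<integral>\<^sup>+x. G x * indicator A x \<partial>M) < (\<integral>\<^sup>+x. F * indicator A x \<partial>M)"
   proof (rule nn_integral_less)
    have le: "G x * indicator A x \<le> F * indicator A x" for x by (auto simp: A_def indicator_def)
    then have "(\<integral>\<^sup>+x. G x * indicator A x \<partial>M) \<le> (\<integral>\<^sup>+x. F * indicator A x \<partial>M)" by (intro nn_integral_mono)
    also have "\<dots> < \<infinity>" unfolding F\<nu> ennreal_mult_less_top infinity_ennreal_def
     using F' M.emeasure_finite[of A] by (simp only: less_top infinity_ennreal_def simp_thms)
    finally show "(\<integral>\<^sup>+x. G x * indicator A x \<partial>M) \<noteq> \<infinity>" by simp
    show "AE x in M. G x * indicator A x \<le> F * indicator A x" using le by simp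
    show "\<not> (AE x in M. F * indicator A x \<le> G x * indicator A x)"
    proof
     assume "AE x in M. F * indicator A x \<le> G x * indicator A x"
     then have "AE x in M. x \<notin> A" by eventually_elim (auto simp: A_def indicator_def split: if_splits)
     then show False using A0 AM by (simp add: AE_iff_measurable[OF AM, of "\<lambda>x. x \<notin> A"] sets.sets_into_space[OF AM] Collect_conj_eq Int_absorb1 set_eq_subset)
    qed
   qed (use AM in \<open>simp_all add: borel_measurable_times borel_measurable_indicator\<close>)
   then have "(\<integral>\<^sup>+x. G x * indicator A x \<partial>M) / emeasure M A < F"
    unfolding F\<nu> using A0 M.emeasure_finite[of A] F'
    by (intro ennreal_divide_lessI) (auto simp: less_top[symmetric])
   then have l: "(\<integral>\<^sup>+x. G x \<partial>?\<nu>) < F" using U(2)[OF Gm] by simp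
   have f\<nu>: "?\<nu> \<in> sphere_fin" using U(1) sphere_prob_fin by auto
   have s: "(\<integral>\<^sup>+x. G x \<partial>?\<nu>) = mutual_energy ?\<nu> \<mu> + (\<integral>\<^sup>+x. Q x \<partial>?\<nu>)"
    unfolding G_def mutual_energy_def
    by (rule nn_integral_add) (simp_all add: sphere_fin_measurable_iff[OF f\<nu>])
   have "mutual_energy ?\<nu> \<mu> + (\<integral>\<^sup>+x. Q x \<partial>?\<nu>) < \<infinity>" using l F' unfolding s by (rule less_trans)
   then have fi: "mutual_energy ?\<nu> \<mu> < \<infinity>" "(\<integral>\<^sup>+x. Q x \<partial>?\<nu>) < \<infinity>" by auto
   have "F \<le> (\<integral>\<^sup>+x. G x \<partial>?\<nu>)" unfolding s F_def
    by (rule equilibrium_variation[OF Qm \<mu> U(1) min fin energy_uniform_measure[OF M AM A0 IM] fi])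
   then show False using l by simp
  qed
  then have "A \<in> null_sets M" using AM by (simp add: null_sets_def)
  then have "AE x in M. x \<notin> A" by (rule AE_not_in)
  with AE_space show ?thesis by eventually_elim (auto simp: A_def sphere_fin_space[OF M])
 qed
 have G\<mu>[measurable]: "G \<in> borel_measurable \<mu>" using Gm by (simp add: sphere_fin_measurable_iff[OF f\<mu>])
 have "(\<integral>\<^sup>+x. G x \<partial>\<mu>) = F"
  unfolding G_def F_def energy_eq mutual_energy_def
  by (rule nn_integral_add) (simp_all add: sphere_fin_measurable_iff[OF f\<mu>])
 \<comment> \<open>\<open>key\<close> applied to \<mu> itself gives G \<ge> F almost everywhere,
   while the mean of G under \<mu> is F; so G cannot exceed F on a set of positive measure.\<close>
 have AEle: "AE x in \<mu>. G x \<le> F"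
 proof (rule ccontr)
  assume "\<not> (AE x in \<mu>. G x \<le> F)"
  then have "(\<integral>\<^sup>+x. F \<partial>\<mu>) < (\<integral>\<^sup>+x. G x \<partial>\<mu>)"
   using key[OF f\<mu> I(1)] F' by (intro nn_integral_less) (auto simp: \<mu>.emeasure_space_1)
  then show False using \<open>(\<integral>\<^sup>+x. G x \<partial>\<mu>) = F\<close> by (simp add: \<mu>.emeasure_space_1)
 qed
 obtain Fr where Fr: "F = ennreal Fr" "0 \<le> Fr" using F' by (cases F) auto
 \<comment> \<open>Every neighbourhood of a support point p has positive measure, so there are
   points x m tending to p with G (x m) \<le> F. The field is continuous near p, and Fatou's lemma
   makes the potential lower semicontinuous, so the inequality passes to p.\<close>
 have upper: "G p \<le> F" if p: "p \<in> sphere_supp \<mu>" for p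
 proof -
  obtain U h where U: "open U" "p \<in> U" "continuous_on U h" "\<And>x. x \<in> U \<Longrightarrow> x \<in> sphere 0 1 \<Longrightarrow> 0 \<le> h x \<and> Q x = ennreal (h x)"
   using cont[OF p] by blast
  have ps: "p \<in> sphere 0 1" using p by (simp add: sphere_supp_def)
  have "\<exists>x. x \<in> ball p (1 / real (Suc m)) \<inter> U \<inter> sphere 0 1 \<and> G x \<le> F" for m
  proof (rule ccontr)
   assume no: "\<not> ?thesis"
   let ?B = "ball p (1 / real (Suc m)) \<inter> U"
   have B: "?B \<inter> sphere 0 1 \<in> sets \<mu>" using U(1) by (simp add: sphere_fin_sets[OF f\<mu>] sets_sphere_borel)
   have "AE x in \<mu>. x \<notin> ?B \<inter> sphere 0 1"
    using AEle by eventually_elim (use no in auto)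
   then have "emeasure \<mu> (?B \<inter> sphere 0 1) = 0" using AE_iff_null_sets[OF B] by (simp add: null_setsD1)
   moreover have "open ?B" "p \<in> ?B" using U by auto
   ultimately show False using p by (auto simp: sphere_supp_def)
  qed
  then obtain x where x: "\<And>m. x m \<in> ball p (1 / real (Suc m)) \<inter> U \<inter> sphere 0 1" "\<And>m. G (x m) \<le> F" by metis
  have xp: "x \<longlonglongrightarrow> p"
  proof (rule metric_LIMSEQ_I)
   fix e :: real assume "0 < e"
   then obtain N where N: "1 / real (Suc N) < e" using nat_approx_posE by blast
   have "dist (x m) p < e" if "m \<ge> N" for m
   proof -
    have "dist (x m) p < 1 / real (Suc m)" using x(1)[of m] by (simp add: dist_commute)
    also have "\<dots> \<le> 1 / real (Suc N)" using that by (simp add: frac_le)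
    finally show ?thesis using N by simp
   qed
   then show "\<exists>N. \<forall>m\<ge>N. dist (x m) p < e" by blast
  qed
  have hp: "(\<lambda>m. h (x m)) \<longlonglongrightarrow> h p"
   using x(1) U by (intro continuous_on_tendsto_compose[OF U(3) xp]) auto
  have xle: "potential \<mu> (x m) \<le> ennreal (Fr - h (x m))" "h (x m) \<le> Fr" for m
  proof -
   have "potential \<mu> (x m) + ennreal (h (x m)) \<le> ennreal Fr" "0 \<le> h (x m)"
    using x(1)[of m] x(2)[of m] U(4)[of "x m"] by (auto simp: G_def Fr)
   from ennreal_le_minus_real[OF this] Fr show "potential \<mu> (x m) \<le> ennreal (Fr - h (x m))" "h (x m) \<le> Fr" by auto
  qed
  have Km: "riesz_kernel z \<in> borel_measurable \<mu>" for z
   by (rule sphere_fin_borel_measurable[OF f\<mu>]) (unfold riesz_kernel_def, measurable)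
  have "potential \<mu> p = (\<integral>\<^sup>+y. liminf (\<lambda>m. riesz_kernel (x m) y) \<partial>\<mu>)"
   unfolding potential_def
   by (intro nn_integral_cong lim_imp_Liminf[symmetric] riesz_kernel_tendsto xp) simp
  also have "\<dots> \<le> liminf (\<lambda>m. potential \<mu> (x m))"
   unfolding potential_def by (rule nn_integral_liminf[OF Km])
  also have "\<dots> \<le> liminf (\<lambda>m. ennreal (Fr - h (x m)))"
   by (rule Liminf_mono) (simp add: xle)
  also have "\<dots> = ennreal (Fr - h p)"
   by (intro lim_imp_Liminf tendsto_intros tendsto_ennrealI hp) simp
  finally have pp: "potential \<mu> p \<le> ennreal (Fr - h p)" .
  have "h p \<le> Fr" by (rule LIMSEQ_le_const2[OF hp]) (use xle in auto)
  moreover have hp0: "0 \<le> h p" "Q p = ennreal (h p)" using U ps by auto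
  ultimately have "ennreal (Fr - h p) + Q p = ennreal Fr" by (simp add: ennreal_plus[symmetric] del: ennreal_plus)
  then show ?thesis using pp by (metis G_def Fr(1) add_right_mono)
 qed
 show "AE x in surface_measure. x \<in> sphere_supp \<mu> \<longrightarrow> potential \<mu> x + Q x = energy \<mu> + (\<integral>\<^sup>+x. Q x \<partial>\<mu>)"
  using key[OF surface_measure_fin[OF n] energy_surface_measure[OF n]]
  unfolding F_def[symmetric] G_def[symmetric] by eventually_elim (use upper in \<open>auto intro: antisym\<close>)
qed

section \<open>Strict positive definiteness of the energy through Laplace transforms\<close>

definition gauss :: "real^'n \<Rightarrow> real" where
 "gauss z = (\<Prod>b\<in>Basis. std_normal_density (z \<bullet> b))"

lemma gauss_measurable [measurable]: "gauss \<in> borel_measurable borel"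
 unfolding gauss_def by measurable

lemma gauss_pos: "gauss z > 0"
 unfolding gauss_def by (intro prod_pos) (simp add: normal_density_pos)

lemma gauss_Laplace:
 fixes w :: "real^'n"
 shows "(\<integral>\<^sup>+z. ennreal (gauss z * exp (z \<bullet> w)) \<partial>lborel) = ennreal (exp ((norm w)\<^sup>2 / 2))"
proof -
 have one: "(\<integral>\<^sup>+x. ennreal (std_normal_density x * exp (x * h)) \<partial>lborel) = ennreal (exp (h\<^sup>2 / 2))" for h :: real
 proof -
  interpret prob_space "density lborel (normal_density h 1)" by (rule prob_space_normal_density) simp
  have "std_normal_density x * exp (x * h) = exp (h\<^sup>2 / 2) * normal_density h 1 x" for x
  proof -
   have "exp (- x\<^sup>2 / 2) * exp (x * h) = exp (h\<^sup>2 / 2) * exp (- (x - h)\<^sup>2 / 2)"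
    by (simp only: exp_add[symmetric]) (simp add: power2_eq_square field_simps)
   then show ?thesis by (simp add: normal_density_def) 
  qed
  then have "(\<integral>\<^sup>+x. ennreal (std_normal_density x * exp (x * h)) \<partial>lborel)
   = ennreal (exp (h\<^sup>2 / 2)) * (\<integral>\<^sup>+x. ennreal (normal_density h 1 x) \<partial>lborel)"
   by (simp add: ennreal_mult nn_integral_cmult)
  also have "(\<integral>\<^sup>+x. ennreal (normal_density h 1 x) \<partial>lborel) = 1"
   using emeasure_space_1 by (simp add: emeasure_density)
  finally show ?thesis by simp
 qed
 have zw: "z \<bullet> w = (\<Sum>b\<in>Basis. (z \<bullet> b) * (w \<bullet> b))" for z by (rule euclidean_inner)
 have "(\<integral>\<^sup>+z. ennreal (gauss z * exp (z \<bullet> w)) \<partial>lborel)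
  = (\<integral>\<^sup>+z. (\<Prod>b\<in>Basis. ennreal (std_normal_density (z \<bullet> b) * exp ((z \<bullet> b) * (w \<bullet> b)))) \<partial>lborel)"
 proof (rule nn_integral_cong)
  fix z :: "real^'n"
  have "gauss z * exp (z \<bullet> w) = (\<Prod>b\<in>Basis. std_normal_density (z \<bullet> b) * exp ((z \<bullet> b) * (w \<bullet> b)))"
   unfolding zw gauss_def by (simp add: exp_sum prod.distrib)
  then show "ennreal (gauss z * exp (z \<bullet> w)) = (\<Prod>b\<in>Basis. ennreal (std_normal_density (z \<bullet> b) * exp ((z \<bullet> b) * (w \<bullet> b))))"
   by (simp add: prod_ennreal normal_density_pos less_imp_le)
 qed
 also have "\<dots> = (\<Prod>b\<in>Basis. \<integral>\<^sup>+x. ennreal (std_normal_density x * exp (x * (w \<bullet> b))) \<partial>lborel)"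
  by (rule nn_integral_lborel_prod[where f="\<lambda>b x. ennreal (std_normal_density x * exp (x * (w \<bullet> b)))"]) auto
 also have "\<dots> = ennreal (\<Prod>b\<in>Basis. exp ((w \<bullet> b)\<^sup>2 / 2))"
  unfolding one by (simp add: prod_ennreal)
 also have "(\<Prod>b\<in>Basis. exp ((w \<bullet> b)\<^sup>2 / 2)) = exp ((norm w)\<^sup>2 / 2)"
  by (simp add: exp_sum[symmetric] sum_divide_distrib[symmetric] power2_norm_eq_inner)
   (simp add: euclidean_inner[of w w] power2_eq_square)
 finally show ?thesis .
qed

lemma nn_integral_Gamma_scaled:
 fixes l a :: real
 assumes l: "l > 0" and a: "a > 0"
 shows "(\<integral>\<^sup>+t\<in>{0<..}. ennreal (t powr (l - 1) * exp (- (t * a))) \<partial>lborel) = ennreal (Gamma l * a powr (- l))"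
proof -
 have "ennreal (Gamma l) = (\<integral>\<^sup>+t. ennreal (indicator {0..} t * t powr (l - 1) / exp t) \<partial>lborel)"
  by (rule Gamma_conv_nn_integral_real[OF l])
 also have "\<dots> = (\<integral>\<^sup>+t. ennreal (t powr (l - 1) * exp (- t)) * indicator {0<..} t \<partial>lborel)"
  by (rule nn_integral_cong) (auto simp: indicator_def exp_minus divide_inverse)
 also have "\<dots> = ennreal a * (\<integral>\<^sup>+t. ennreal ((a * t) powr (l - 1) * exp (- (a * t))) * indicator {0<..} (a * t) \<partial>lborel)"
  using a by (subst nn_integral_real_affine[where t=0 and c=a]) auto
 also have "\<dots> = ennreal a * (\<integral>\<^sup>+t. ennreal (a powr (l - 1)) * (ennreal (t powr (l - 1) * exp (- (t * a))) * indicator {0<..} t) \<partial>lborel)"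
 proof -
  have "ennreal ((a * t) powr (l - 1) * exp (- (a * t))) * indicator {0<..} (a * t)
   = ennreal (a powr (l - 1)) * (ennreal (t powr (l - 1) * exp (- (t * a))) * indicator {0<..} t)" for t
   using a by (cases "t > 0") (auto simp: zero_less_mult_iff powr_mult ennreal_mult mult_ac)
  then show ?thesis by (simp only:)
 qed
 also have "\<dots> = ennreal a * (ennreal (a powr (l - 1)) * (\<integral>\<^sup>+t\<in>{0<..}. ennreal (t powr (l - 1) * exp (- (t * a))) \<partial>lborel))"
  by (subst nn_integral_cmult) auto
 also have "\<dots> = ennreal (a powr l) * (\<integral>\<^sup>+t\<in>{0<..}. ennreal (t powr (l - 1) * exp (- (t * a))) \<partial>lborel)"
  using a by (simp add: mult.assoc[symmetric] ennreal_mult[symmetric] powr_mult_base)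
 finally have "ennreal (a powr (- l)) * ennreal (Gamma l) = ennreal (a powr (- l)) * (ennreal (a powr l) * (\<integral>\<^sup>+t\<in>{0<..}. ennreal (t powr (l - 1) * exp (- (t * a))) \<partial>lborel))"
  by simp
 also have "\<dots> = (\<integral>\<^sup>+t\<in>{0<..}. ennreal (t powr (l - 1) * exp (- (t * a))) \<partial>lborel)"
  using a by (simp add: mult.assoc[symmetric] ennreal_mult[symmetric] powr_add[symmetric])
 finally show ?thesis using Gamma_real_pos[OF l] by (simp add: ennreal_mult[symmetric] mult.commute)
qed

text \<open>The Gamma integral for a power of a. At a = 0 both sides are infinite, and this case is
  needed because the double integral of the energy includes the diagonal.\<close>

lemma riesz_profile_Gamma:
 assumes m: "m > 0" and a: "a \<ge> 0"
 shows "ennreal (Gamma (real m / 2)) * riesz_profile m a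
  = (\<integral>\<^sup>+t\<in>{0<..}. ennreal (t powr (real m / 2 - 1) * exp (- (t * a))) \<partial>lborel)"
proof (cases "a > 0")
 case True
 then show ?thesis
  using nn_integral_Gamma_scaled[of "real m / 2" a] m Gamma_real_pos[of "real m / 2"]
  by (simp add: riesz_profile_pos_eq ennreal_mult[symmetric])
next
 case False
 let ?I = "\<lambda>a. (\<integral>\<^sup>+t\<in>{0<..}. ennreal (t powr (real m / 2 - 1) * exp (- (t * a))) \<partial>lborel)"
 have g: "Gamma (real m / 2) > 0" using m by (simp add: Gamma_real_pos)
 have "?I 0 = \<infinity>"
 proof (rule ccontr)
  assume "?I 0 \<noteq> \<infinity>"
  then obtain C where C: "?I 0 = ennreal C" "0 \<le> C" by (cases "?I 0") auto
  have le: "Gamma (real m / 2) * a powr (- (real m / 2)) \<le> C" if "a > 0" for a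
  proof -
   have "?I a \<le> ?I 0"
    using that by (intro nn_integral_mono) (auto simp: indicator_def intro!: ennreal_leI mult_left_le)
   then show ?thesis
    using nn_integral_Gamma_scaled[of "real m / 2" a] m that C by simp
  qed
  \<comment> \<open>Chosen so that Gamma (m/2) * a powr (- (m/2)) equals C + 1, in contradiction to
    the bound C that a finite integral at 0 would impose for all a > 0.\<close>
  define a where "a = ((C + 1) / Gamma (real m / 2)) powr (- (2 / real m))"
  have pos: "(C + 1) / Gamma (real m / 2) > 0" using C g by simp
  then have "a powr (- (real m / 2)) = (C + 1) / Gamma (real m / 2)"
  proof -
   have "C + 1 > 0" "Gamma (real m / 2) \<noteq> 0" using C(2) g by auto
   then show ?thesis using m by (simp add: a_def powr_powr)
  qed
  moreover have "a > 0" using C(2) g by (simp add: a_def)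
  ultimately show False using le[of a] g by (simp add: field_simps)
 qed
 moreover have "riesz_profile m 0 = \<infinity>" using m by (simp add: riesz_profile_def power_0_left)
 ultimately show ?thesis using False a g by (simp add: ennreal_mult_top)
qed


text \<open>Laplace instead of Fourier transform: the integrand is real and positive, so Tonelli
  applies in \<open>ennreal\<close> throughout, and convergence is no issue on a compact
  sphere.\<close>

definition Laplace :: "(real^'n) measure \<Rightarrow> real^'n \<Rightarrow> real" where
 "Laplace M \<xi> = (\<integral>x. exp (\<xi> \<bullet> x) \<partial>M)"

lemma sphere_fin_integrable_exp:
 assumes M: "M \<in> sphere_fin" and f: "f \<in> borel_measurable borel" "\<And>x. x \<in> sphere 0 1 \<Longrightarrow> \<bar>f x\<bar> \<le> C"
 shows "integrable M (f :: real^'n \<Rightarrow> real)"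
proof -
 interpret finite_measure M using M by (rule sphere_fin_finite)
 show ?thesis
  by (rule integrable_const_bound[of _ C])
   (auto simp: f(2) sphere_fin_space[OF M] intro!: AE_I2 sphere_fin_borel_measurable[OF M f(1)])
qed

lemma exp_inner_bound: 
 fixes x :: "real^'n"
 assumes "x \<in> sphere 0 1"
 shows "exp (\<xi> \<bullet> x) \<le> exp (norm \<xi>)"
 using norm_cauchy_schwarz[of \<xi> x] assms by simp

lemma Laplace_nn_integral:
 assumes M: "M \<in> sphere_fin"
 shows "(\<integral>\<^sup>+x. ennreal (exp (\<xi> \<bullet> x)) \<partial>M) = ennreal (Laplace M \<xi>)" and "0 \<le> Laplace M \<xi>"
proof -
 have "integrable M (\<lambda>x. exp (\<xi> \<bullet> x))"
 proof (rule sphere_fin_integrable_exp[OF M])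
  show "\<bar>exp (\<xi> \<bullet> x)\<bar> \<le> exp (norm \<xi>)" if "x \<in> sphere 0 1" for x
   using exp_inner_bound[OF that] by simp
 qed measurable
 then show "(\<integral>\<^sup>+x. ennreal (exp (\<xi> \<bullet> x)) \<partial>M) = ennreal (Laplace M \<xi>)"
  unfolding Laplace_def by (intro nn_integral_eq_integral) auto
 show "0 \<le> Laplace M \<xi>" unfolding Laplace_def by (rule integral_nonneg_AE) auto
qed

lemma Laplace_continuous:
 assumes M: "M \<in> sphere_fin"
 shows "continuous_on UNIV (Laplace M)"
proof -
 interpret finite_measure M using M by (rule sphere_fin_finite)
 have "isCont (Laplace M) \<xi>" for \<xi>
  unfolding continuous_at_sequentially
 proof (intro allI impI)
  fix X assume X: "X \<longlonglongrightarrow> \<xi>"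
  then have "Bseq X" by (intro convergent_imp_Bseq convergentI)
  then obtain C where C: "\<And>n. norm (X n) \<le> C" by (auto simp: Bseq_def)
  have m: "(\<lambda>x. exp (\<xi> \<bullet> x)) \<in> borel_measurable M" for \<xi>
   by (rule sphere_fin_borel_measurable[OF M]) measurable
  have "(\<lambda>n. \<integral>x. exp (X n \<bullet> x) \<partial>M) \<longlonglongrightarrow> (\<integral>x. exp (\<xi> \<bullet> x) \<partial>M)"
  proof (rule integral_dominated_convergence[where w="\<lambda>_. exp C"])
   show "AE x in M. (\<lambda>n. exp (X n \<bullet> x)) \<longlonglongrightarrow> exp (\<xi> \<bullet> x)"
    by (intro AE_I2 tendsto_intros X)
   show "AE x in M. norm (exp (X n \<bullet> x)) \<le> exp C" for n
   proof (rule AE_I2)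
    fix x assume "x \<in> space M"
    then have "exp (X n \<bullet> x) \<le> exp (norm (X n))" by (simp only: sphere_fin_space[OF M] exp_inner_bound)
    also have "\<dots> \<le> exp C" using C by simp
    finally show "norm (exp (X n \<bullet> x)) \<le> exp C" by simp
   qed
  qed (simp_all add: m)
  then show "(Laplace M \<circ> X) \<longlonglongrightarrow> Laplace M \<xi>" by (simp add: Laplace_def comp_def)
 qed
 then show ?thesis by (simp add: continuous_at_imp_continuous_on)
qed

text \<open>Constants and exponentials of linear forms generate an algebra that separates points, as
  Stone-Weierstrass requires. The rule \<open>cexp\<close> multiplies an element already present by
  one exponential, which makes closure under products a plain induction.\<close>

inductive_set exp_algebra :: "(real^'n \<Rightarrow> real) set" where
 const: "(\<lambda>_. c) \<in> exp_algebra"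
| add: "f \<in> exp_algebra \<Longrightarrow> g \<in> exp_algebra \<Longrightarrow> (\<lambda>x. f x + g x) \<in> exp_algebra"
| cexp: "f \<in> exp_algebra \<Longrightarrow> (\<lambda>x. c * exp (\<xi> \<bullet> x) * f x) \<in> exp_algebra"

lemma exp_algebra_mult:
 assumes "f \<in> exp_algebra" "g \<in> exp_algebra"
 shows "(\<lambda>x. f x * g x) \<in> exp_algebra"
 using assms(1)
proof induction
 case (const c)
 then show ?case using exp_algebra.cexp[OF assms(2), of c 0] by simp
next
 case (add f h)
 then show ?case using exp_algebra.add[OF add.IH] by (simp add: algebra_simps)
next
 case (cexp f c \<xi>)
 then show ?case using exp_algebra.cexp[OF cexp.IH, of c \<xi>] by (simp add: mult.assoc)
qed

lemma exp_algebra_continuous: "f \<in> exp_algebra \<Longrightarrow> continuous_on A f"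
 by (induction rule: exp_algebra.induct) (auto intro!: continuous_intros)

lemma continuous_sphere_integrable:
 assumes M: "M \<in> sphere_fin" and f: "continuous_on UNIV f"
 shows "integrable M (f :: real^'n \<Rightarrow> real)"
proof -
 have "compact (f ` sphere 0 1)"
  by (intro compact_continuous_image continuous_on_subset[OF f]) auto
 then have "bounded (f ` sphere 0 1)" by (rule compact_imp_bounded)
 then obtain C where "\<forall>x\<in>f ` sphere 0 1. norm x \<le> C" unfolding bounded_iff by blast
 then have "\<bar>f x\<bar> \<le> C" if "x \<in> sphere 0 1" for x using that by (metis image_eqI real_norm_def)
 then show ?thesis
  using f by (intro sphere_fin_integrable_exp[OF M, of _ C] borel_measurable_continuous_onI) auto
qed

text \<open>The extra factor exp(\<xi> \<bullet> x), with \<xi> arbitrary, is the strengthening that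
  carries the induction: a further exponential only shifts \<xi>.\<close>

lemma exp_algebra_integral_eq:
 assumes M: "M \<in> sphere_fin" and N: "N \<in> sphere_fin" and eq: "Laplace M = Laplace N" and f: "f \<in> exp_algebra"
 shows "(\<integral>x. f x * exp (\<xi> \<bullet> x) \<partial>M) = (\<integral>x. f x * exp (\<xi> \<bullet> x) \<partial>N)"
 using f
proof (induction arbitrary: \<xi>)
 case (const c)
 then show ?case using fun_cong[OF eq, of \<xi>] by (simp add: Laplace_def)
next
 case (add f g)
 have i: "integrable L (\<lambda>x. h x * exp (\<xi> \<bullet> x))" if "L \<in> sphere_fin" "h \<in> exp_algebra" for L h
  using that by (intro continuous_sphere_integrable continuous_intros exp_algebra_continuous)
 show ?case using add M N i by (simp add: distrib_right)
next
 case (cexp f c \<eta>)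
 have "(\<integral>x. c * exp (\<eta> \<bullet> x) * f x * exp (\<xi> \<bullet> x) \<partial>L) = c * (\<integral>x. f x * exp ((\<eta> + \<xi>) \<bullet> x) \<partial>L)" for L
  by (subst integral_mult_right_zero[symmetric]) (auto intro!: Bochner_Integration.integral_cong simp: inner_add_left exp_add mult_ac)
 then show ?case using cexp.IH by simp
qed

text \<open>Integrals agree on the exponential algebra, hence by uniform approximation on continuous
  functions, hence by a decreasing limit on indicators of closed sets, and these generate the Borel
  sets.\<close>

lemma sphere_measure_eqI_Laplace:
 fixes M N :: "(real^'n) measure"
 assumes M: "M \<in> sphere_fin" and N: "N \<in> sphere_fin" and eq: "Laplace M = Laplace N"
 shows "M = N"
proof -
 interpret M: finite_measure M using M by (rule sphere_fin_finite)
 interpret N: finite_measure N using N by (rule sphere_fin_finite)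
 interpret function_ring_on "exp_algebra :: (real^'n \<Rightarrow> real) set" "sphere 0 1"
 proof
  fix x y :: "real^'n" assume xy: "x \<in> sphere 0 1" "y \<in> sphere 0 1" "x \<noteq> y"
  have "(\<lambda>z. 1 * exp ((x - y) \<bullet> z) * 1) \<in> exp_algebra" by (intro exp_algebra.intros)
  moreover have "(x - y) \<bullet> x \<noteq> (x - y) \<bullet> y"
  proof
   assume "(x - y) \<bullet> x = (x - y) \<bullet> y"
   then have "(x - y) \<bullet> (x - y) = 0" by (simp add: inner_diff_right)
   then show False using xy by simp
  qed
  ultimately show "\<exists>f\<in>exp_algebra. f x \<noteq> f y"
   by (intro bexI[where x="\<lambda>z. 1 * exp ((x - y) \<bullet> z) * 1"]) simp_all
 qed (auto intro: exp_algebra.intros exp_algebra_mult exp_algebra_continuous)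
 have alg: "(\<integral>x. f x \<partial>M) = (\<integral>x. f x \<partial>N)" if "f \<in> exp_algebra" for f
  using exp_algebra_integral_eq[OF M N eq that, of 0] by simp
 have cont: "(\<integral>x. f x \<partial>M) = (\<integral>x. f x \<partial>N)" if f: "continuous_on UNIV f" for f :: "real^'n \<Rightarrow> real"
 proof (rule ccontr)
  assume ne: "(\<integral>x. f x \<partial>M) \<noteq> (\<integral>x. f x \<partial>N)"
  \<comment> \<open>The extra 1 makes e times the sum of the two masses strictly smaller than the
    assumed gap e * C, which is the contradiction.\<close>
  define C where "C = measure M (space M) + measure N (space N) + 1"
  have C: "C > 0" unfolding C_def by (simp add: add_nonneg_pos)
  define e where "e = \<bar>(\<integral>x. f x \<partial>M) - (\<integral>x. f x \<partial>N)\<bar> / C"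
  have e: "e > 0" using ne C by (simp add: e_def)
  obtain g where g: "g \<in> exp_algebra" "\<And>x. x \<in> sphere 0 1 \<Longrightarrow> \<bar>f x - g x\<bar> < e"
   using Stone_Weierstrass_basic[OF continuous_on_subset[OF f] e] by auto
  have gc: "continuous_on UNIV g" using g(1) by (rule exp_algebra_continuous)
  have d: "\<bar>(\<integral>x. f x \<partial>L) - (\<integral>x. g x \<partial>L)\<bar> \<le> e * measure L (space L)" if L: "L \<in> sphere_fin" for L
  proof -
   interpret L: finite_measure L using L by (rule sphere_fin_finite)
   have fg: "integrable L f" "integrable L g" using L f gc by (auto intro: continuous_sphere_integrable)
   have "\<bar>(\<integral>x. f x \<partial>L) - (\<integral>x. g x \<partial>L)\<bar> = \<bar>\<integral>x. f x - g x \<partial>L\<bar>" using fg by simp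
   also have "\<dots> \<le> (\<integral>x. \<bar>f x - g x\<bar> \<partial>L)" by (rule integral_abs_bound)
   also have "\<dots> \<le> (\<integral>x. e \<partial>L)"
    using fg g(2) by (intro integral_mono) (auto simp: sphere_fin_space[OF L] less_imp_le)
   finally show ?thesis by (simp add: mult.commute)
  qed
  have "\<bar>(\<integral>x. f x \<partial>M) - (\<integral>x. f x \<partial>N)\<bar> \<le> e * measure M (space M) + e * measure N (space N)"
   using d[OF M] d[OF N] alg[OF g(1)] by linarith
  also have "\<dots> < e * C" using e by (simp add: C_def algebra_simps)
  also have "\<dots> = \<bar>(\<integral>x. f x \<partial>M) - (\<integral>x. f x \<partial>N)\<bar>" using C by (simp add: e_def)
  finally show False by simp
 qed
 have idM: "(\<lambda>x. x) \<in> measurable M borel" "(\<lambda>x. x) \<in> measurable N borel"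
  by (auto intro!: sphere_fin_borel_measurable[OF M] sphere_fin_borel_measurable[OF N])
 have em: "emeasure M A = emeasure (distr M borel (\<lambda>x. x)) A" "emeasure N A = emeasure (distr N borel (\<lambda>x. x)) A"
  if "A \<in> sets borel" "A \<subseteq> sphere 0 1" for A
  using that by (simp_all add: emeasure_distr[OF idM(1)] emeasure_distr[OF idM(2)] sphere_fin_space[OF M] sphere_fin_space[OF N] Int_absorb2)
 have closed: "emeasure (distr M borel (\<lambda>x. x)) A = emeasure (distr N borel (\<lambda>x. x)) A" if A: "closed A" for A
 proof (cases "A = {}")
  case False
  define f where "f m x = max 0 (1 - real m * infdist x A)" for m x
  have fc: "continuous_on UNIV (f m)" for m unfolding f_def by (intro continuous_intros)
  have f01: "0 \<le> f m x" "f m x \<le> 1" for m x using infdist_nonneg[of x A] by (simp_all add: f_def)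
  have flim: "(\<lambda>m. f m x) \<longlonglongrightarrow> indicator A x" for x
  proof (cases "x \<in> A")
   case True
   then show ?thesis by (simp add: f_def)
  next
   case F: False
   then have pos: "infdist x A > 0" using in_closed_iff_infdist_zero[OF A False, of x] infdist_nonneg[of x A] by linarith
   obtain m0 where m0: "1 / infdist x A < real m0" using reals_Archimedean2 by blast
   have "f m x = 0" if "m \<ge> m0" for m
   proof -
    have "1 < real m0 * infdist x A" using m0 pos by (simp add: field_simps)
    also have "\<dots> \<le> real m * infdist x A" using that pos by (intro mult_right_mono) auto
    finally show ?thesis by (simp add: f_def)
   qed
   then have "eventually (\<lambda>m. f m x = indicator A x) sequentially"
    using F by (auto simp: eventually_sequentially)
   then show ?thesis by (rule tendsto_eventually)
  qed
  have lim: "(\<lambda>m. \<integral>x. f m x \<partial>L) \<longlonglongrightarrow> (\<integral>x. indicator A x \<partial>L)" if L: "L \<in> sphere_fin" for L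
  proof (rule integral_dominated_convergence[where w="\<lambda>_. 1"])
   interpret L: finite_measure L using L by (rule sphere_fin_finite)
   show "integrable L (\<lambda>_. 1 :: real)" by simp
   show "indicator A \<in> borel_measurable L" 
    using A by (intro sphere_fin_borel_measurable[OF L]) auto
   show "f m \<in> borel_measurable L" for m
    using fc by (intro sphere_fin_borel_measurable[OF L] borel_measurable_continuous_onI)
  qed (use flim f01 in auto)
  have "(\<integral>x. indicator A x \<partial>M) = (\<integral>x. (indicator A x :: real) \<partial>N)"
   using LIMSEQ_unique[OF lim[OF M]] lim[OF N] cont[OF fc] by simp
  moreover have "(\<integral>x. (indicator A x :: real) \<partial>L) = measure L (A \<inter> sphere 0 1)" if L: "L \<in> sphere_fin" for L
   by (simp add: sphere_fin_space[OF L])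
  ultimately have "measure M (A \<inter> sphere 0 1) = measure N (A \<inter> sphere 0 1)" using M N by simp
  then show ?thesis using A
   by (simp add: emeasure_distr[OF idM(1)] emeasure_distr[OF idM(2)] sphere_fin_space[OF M] sphere_fin_space[OF N]
     M.emeasure_eq_measure N.emeasure_eq_measure)
 qed simp
 have "distr M borel (\<lambda>x. x) = distr N borel (\<lambda>x. x)"
 proof (rule measure_eqI_generator_eq[where E="Collect closed" and \<Omega>=UNIV and A="\<lambda>_. UNIV"])
  show "Int_stable (Collect closed :: (real^'n) set set)" by (auto simp: Int_stable_def)
  show "emeasure (distr M borel (\<lambda>x. x)) UNIV \<noteq> \<infinity>" 
   using M.emeasure_finite by (simp add: emeasure_distr[OF idM(1)])
 qed (use closed in \<open>auto simp: borel_eq_closed\<close>)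
 then show "M = N"
  using em by (intro measure_eqI) (auto simp: sphere_fin_sets[OF M] sphere_fin_sets[OF N] sets_sphere_borel)
qed


text \<open>For unit vectors |x-y|^2 = 4 - |x+y|^2, so exp(-t|x-y|^2) = exp(-4t) exp(t|x+y|^2). The
  last factor is the Gaussian mean of exp(sqrt(2t) z \<bullet> (x+y)), and this is a product of a
  function of x and a function of y. Together with the Gamma integral the kernel becomes a positive
  mixture of such products.\<close>

lemma riesz_kernel_Gauss:
 fixes x y :: "real^'n"
 assumes n: "CARD('n) \<ge> 3" and xy: "x \<in> sphere 0 1" "y \<in> sphere 0 1"
 shows "ennreal (Gamma ((real CARD('n) - 2) / 2)) * riesz_kernel x y
  = (\<integral>\<^sup>+p. ennreal (indicator {0<..} (fst p) * fst p powr ((real CARD('n) - 2) / 2 - 1) * exp (- 4 * fst p) * gauss (snd p)) *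
    (ennreal (exp ((sqrt (2 * fst p) *\<^sub>R snd p) \<bullet> x)) * ennreal (exp ((sqrt (2 * fst p) *\<^sub>R snd p) \<bullet> y))) \<partial>lborel)"
proof -
 define l where "l = (real CARD('n) - 2) / 2"
 define m where "m = CARD('n) - 2"
 have lm: "real m / 2 = l" using n by (simp add: m_def l_def of_nat_diff)
 have m0: "m > 0" using n by (simp add: m_def)
 have xx: "x \<bullet> x = 1" "y \<bullet> y = 1" using xy by (simp_all add: norm_eq_1)
 have a0: "2 - 2 * (x \<bullet> y) \<ge> 0"
  using norm_cauchy_schwarz[of x y] xy by simp
 have "ennreal (Gamma l) * riesz_kernel x y
  = (\<integral>\<^sup>+t\<in>{0<..}. ennreal (t powr (l - 1) * exp (- (t * (2 - 2 * (x \<bullet> y))))) \<partial>lborel)"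
  using riesz_profile_Gamma[OF m0 a0] by (simp add: riesz_kernel_eq_profile[OF xy] lm m_def[symmetric])
 also have "\<dots> = (\<integral>\<^sup>+t. \<integral>\<^sup>+z. ennreal (indicator {0<..} t * t powr (l - 1) * exp (- 4 * t) * gauss z) *
    (ennreal (exp ((sqrt (2 * t) *\<^sub>R z) \<bullet> x)) * ennreal (exp ((sqrt (2 * t) *\<^sub>R z) \<bullet> y))) \<partial>lborel \<partial>lborel)"
 proof (rule nn_integral_cong)
  fix t :: real
  show "ennreal (t powr (l - 1) * exp (- (t * (2 - 2 * (x \<bullet> y))))) * indicator {0<..} t
   = (\<integral>\<^sup>+z. ennreal (indicator {0<..} t * t powr (l - 1) * exp (- 4 * t) * gauss z) *
    (ennreal (exp ((sqrt (2 * t) *\<^sub>R z) \<bullet> x)) * ennreal (exp ((sqrt (2 * t) *\<^sub>R z) \<bullet> y))) \<partial>lborel)"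
  proof (cases "t > 0")
   case True
   define w where "w = sqrt (2 * t) *\<^sub>R (x + y)"
   have nw: "(norm w)\<^sup>2 / 2 = t * (2 + 2 * (x \<bullet> y))"
    using True unfolding w_def by (simp add: power_mult_distrib power2_norm_eq_inner[of "x + y"] inner_add_left inner_add_right xx inner_commute)
   have eq: "ennreal (indicator {0<..} t * t powr (l - 1) * exp (- 4 * t) * gauss z) *
    (ennreal (exp ((sqrt (2 * t) *\<^sub>R z) \<bullet> x)) * ennreal (exp ((sqrt (2 * t) *\<^sub>R z) \<bullet> y)))
    = ennreal (t powr (l - 1) * exp (- 4 * t)) * ennreal (gauss z * exp (z \<bullet> w))" for z :: "real^'n"
   proof -
    have "z \<bullet> w = (sqrt (2 * t) *\<^sub>R z) \<bullet> x + (sqrt (2 * t) *\<^sub>R z) \<bullet> y"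
     by (simp add: w_def inner_add_right distrib_left)
    then show ?thesis using True gauss_pos[of z]
     by (simp add: ennreal_mult[symmetric] exp_add less_imp_le mult_ac del: inner_scaleR_left)
   qed
   have "(\<integral>\<^sup>+z. ennreal (t powr (l - 1) * exp (- 4 * t)) * ennreal (gauss z * exp (z \<bullet> w)) \<partial>lborel)
    = ennreal (t powr (l - 1) * exp (- 4 * t)) * ennreal (exp (t * (2 + 2 * (x \<bullet> y))))"
    unfolding nw[symmetric] gauss_Laplace[symmetric] by (rule nn_integral_cmult) measurable
   also have "\<dots> = ennreal (t powr (l - 1) * (exp (- 4 * t) * exp (t * (2 + 2 * (x \<bullet> y)))))"
    by (simp add: ennreal_mult[symmetric] mult.assoc)
   also have "exp (- 4 * t) * exp (t * (2 + 2 * (x \<bullet> y))) = exp (- (t * (2 - 2 * (x \<bullet> y))))"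
    by (simp add: exp_add[symmetric] algebra_simps)
   finally show ?thesis unfolding eq using True by simp
  qed simp
 qed
 also have "\<dots> = (\<integral>\<^sup>+p. ennreal (indicator {0<..} (fst p) * fst p powr (l - 1) * exp (- 4 * fst p) * gauss (snd p)) *
    (ennreal (exp ((sqrt (2 * fst p) *\<^sub>R snd p) \<bullet> x)) * ennreal (exp ((sqrt (2 * fst p) *\<^sub>R snd p) \<bullet> y))) \<partial>(lborel \<Otimes>\<^sub>M lborel))"
 proof -
  have "(\<lambda>p. ennreal (indicator {0<..} (fst p) * fst p powr (l - 1) * exp (- 4 * fst p) * gauss (snd p)) *
    (ennreal (exp ((sqrt (2 * fst p) *\<^sub>R snd p) \<bullet> x)) * ennreal (exp ((sqrt (2 * fst p) *\<^sub>R snd p) \<bullet> y))))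
   \<in> borel_measurable (lborel \<Otimes>\<^sub>M lborel)"
   by measurable
  from lborel.nn_integral_fst[OF this] show ?thesis by (simp only: fst_conv snd_conv)
 qed
 finally show ?thesis by (simp add: lborel_prod l_def)
qed

text \<open>After Tonelli the energy is an inner product of Laplace transforms in a weighted L^2
  space over (t, z). The weight is positive for every t > 0, which gives strictness later.\<close>

lemma mutual_energy_Laplace:
 fixes M N :: "(real^'n) measure"
 assumes n: "CARD('n) \<ge> 3" and M: "M \<in> sphere_fin" and N: "N \<in> sphere_fin"
 shows "ennreal (Gamma ((real CARD('n) - 2) / 2)) * mutual_energy M N
  = (\<integral>\<^sup>+p. ennreal (indicator {0<..} (fst p) * fst p powr ((real CARD('n) - 2) / 2 - 1) * exp (- 4 * fst p) * gauss (snd p) *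
    (Laplace M (sqrt (2 * fst p) *\<^sub>R snd p) * Laplace N (sqrt (2 * fst p) *\<^sub>R snd p))) \<partial>lborel)"
proof -
 define W where "W p = indicator {0<..} (fst p) * fst p powr ((real CARD('n) - 2) / 2 - 1) * exp (- 4 * fst p) * gauss (snd p)"
  for p :: "real \<times> (real^'n)"
 define \<xi> where "\<xi> p = sqrt (2 * fst p) *\<^sub>R snd p" for p :: "real \<times> (real^'n)"
 define e where "e x p = ennreal (exp (\<xi> p \<bullet> x))" for x p
 have [measurable]: "W \<in> borel_measurable borel" "\<xi> \<in> borel_measurable borel"
  unfolding W_def \<xi>_def borel_prod[symmetric] by measurable
 have W0: "W p \<ge> 0" for p using gauss_pos[of "snd p"] by (auto simp: W_def indicator_def)
 interpret M: sigma_finite_measure M using M by (rule sphere_fin_sigma_finite)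
 interpret N: sigma_finite_measure N using N by (rule sphere_fin_sigma_finite)
 interpret PM: pair_sigma_finite M "lborel :: (real \<times> (real^'n)) measure" ..
 interpret PN: pair_sigma_finite N "lborel :: (real \<times> (real^'n)) measure" ..
 define c where "c = ennreal (Gamma ((real CARD('n) - 2) / 2))"
 have em: "(\<lambda>(x, p). e x p) \<in> borel_measurable (borel \<Otimes>\<^sub>M borel)"
  unfolding e_def by measurable
 have emL: "(\<lambda>q. e (fst q) (snd q)) \<in> borel_measurable (L \<Otimes>\<^sub>M lborel)" if L: "L \<in> sphere_fin" for L
 proof -
  have "(\<lambda>p. (fst p, snd p)) \<in> measurable (L \<Otimes>\<^sub>M lborel) (borel \<Otimes>\<^sub>M borel)"
   by (intro measurable_Pair measurable_compose[OF measurable_fst] measurable_compose[OF measurable_snd]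
     sphere_fin_borel_measurable[OF L]) auto
  from measurable_compose[OF this em] show ?thesis by simp
 qed
 note [measurable] = emL[OF M] emL[OF N]
 have ex: "(\<lambda>x. e x p) \<in> borel_measurable L" if L: "L \<in> sphere_fin" for L p
  unfolding e_def by (rule sphere_fin_borel_measurable[OF L]) measurable
 have ep[measurable]: "(\<lambda>p. e x p) \<in> borel_measurable borel" for x
  unfolding e_def by measurable
 have LL: "(\<integral>\<^sup>+x. e x p \<partial>L) = ennreal (Laplace L (\<xi> p))" if "L \<in> sphere_fin" for L p
  unfolding e_def by (rule Laplace_nn_integral[OF that])
 have "Laplace L \<in> borel_measurable borel" if "L \<in> sphere_fin" for L :: "(real^'n) measure"
  using Laplace_continuous[OF that] by (rule borel_measurable_continuous_onI)
 note [measurable] = this[OF M] this[OF N]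
 have pm: "potential N \<in> borel_measurable M"
  using potential_measurable[OF N] by (rule sphere_fin_borel_measurable[OF M])
 have pot: "c * potential N x = (\<integral>\<^sup>+p. ennreal (W p) * (e x p * ennreal (Laplace N (\<xi> p))) \<partial>lborel)" if x: "x \<in> sphere 0 1" for x
 proof -
  have "c * potential N x = (\<integral>\<^sup>+y. c * riesz_kernel x y \<partial>N)"
   unfolding potential_def 
   by (rule nn_integral_cmult[symmetric], rule sphere_fin_borel_measurable[OF N]) (unfold riesz_kernel_def, measurable)
  also have "\<dots> = (\<integral>\<^sup>+y. \<integral>\<^sup>+p. ennreal (W p) * (e x p * e y p) \<partial>lborel \<partial>N)"
   unfolding c_def W_def e_def \<xi>_def 
   by (rule nn_integral_cong, rule riesz_kernel_Gauss[OF n x]) (simp only: sphere_fin_space[OF N])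
  also have "\<dots> = (\<integral>\<^sup>+p. \<integral>\<^sup>+y. ennreal (W p) * (e x p * e y p) \<partial>N \<partial>lborel)"
   by (rule PN.Fubini'[symmetric]) (simp add: split_beta')
  also have "\<dots> = (\<integral>\<^sup>+p. ennreal (W p) * (e x p * ennreal (Laplace N (\<xi> p))) \<partial>lborel)"
  proof (rule nn_integral_cong)
   fix p
   have "(\<integral>\<^sup>+y. ennreal (W p) * (e x p * e y p) \<partial>N) = (\<integral>\<^sup>+y. (ennreal (W p) * e x p) * e y p \<partial>N)"
    by (simp only: mult.assoc)
   also have "\<dots> = (ennreal (W p) * e x p) * ennreal (Laplace N (\<xi> p))"
    unfolding LL[OF N, symmetric] by (rule nn_integral_cmult[OF ex[OF N]])
   finally show "(\<integral>\<^sup>+y. ennreal (W p) * (e x p * e y p) \<partial>N) = ennreal (W p) * (e x p * ennreal (Laplace N (\<xi> p)))"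
    by (simp only: mult.assoc)
  qed
  finally show ?thesis .
 qed
 have "c * mutual_energy M N = (\<integral>\<^sup>+x. c * potential N x \<partial>M)"
  unfolding mutual_energy_def by (rule nn_integral_cmult[symmetric, OF pm])
 also have "\<dots> = (\<integral>\<^sup>+x. \<integral>\<^sup>+p. ennreal (W p) * (e x p * ennreal (Laplace N (\<xi> p))) \<partial>lborel \<partial>M)"
  by (rule nn_integral_cong, rule pot) (simp only: sphere_fin_space[OF M])
 also have "\<dots> = (\<integral>\<^sup>+p. \<integral>\<^sup>+x. ennreal (W p) * (e x p * ennreal (Laplace N (\<xi> p))) \<partial>M \<partial>lborel)"
  by (rule PM.Fubini'[symmetric]) (simp add: split_beta')
 also have "\<dots> = (\<integral>\<^sup>+p. ennreal (W p * (Laplace M (\<xi> p) * Laplace N (\<xi> p))) \<partial>lborel)"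
 proof (rule nn_integral_cong)
  fix p
  have "(\<integral>\<^sup>+x. ennreal (W p) * (e x p * ennreal (Laplace N (\<xi> p))) \<partial>M)
   = (\<integral>\<^sup>+x. (ennreal (W p) * ennreal (Laplace N (\<xi> p))) * e x p \<partial>M)"
   by (rule nn_integral_cong) (simp add: mult_ac)
  also have "\<dots> = (ennreal (W p) * ennreal (Laplace N (\<xi> p))) * ennreal (Laplace M (\<xi> p))"
   by (subst nn_integral_cmult[OF ex[OF M]]) (simp add: LL[OF M])
  finally show "(\<integral>\<^sup>+x. ennreal (W p) * (e x p * ennreal (Laplace N (\<xi> p))) \<partial>M)
   = ennreal (W p * (Laplace M (\<xi> p) * Laplace N (\<xi> p)))"
   using W0 Laplace_nn_integral(2)[OF M] Laplace_nn_integral(2)[OF N] by (simp add: ennreal_mult mult_ac)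
 qed
 finally show ?thesis unfolding c_def W_def \<xi>_def .
qed

lemma AE_lborel_continuous_eq:
 fixes S :: "'a::euclidean_space set" and f g :: "'a \<Rightarrow> real"
 assumes ae: "AE x in lborel. x \<in> S \<longrightarrow> f x = g x" and S: "open S"
  and c: "continuous_on S f" "continuous_on S g" and x: "x \<in> S"
 shows "f x = g x"
proof -
 define B where "B = S \<inter> (\<lambda>x. f x - g x) -` (- {0})"
 have B: "open B" unfolding B_def
  by (rule continuous_open_preimage[OF _ S]) (auto intro: continuous_intros c)
 then have "B \<in> sets lborel" by simp
 moreover have "AE x in lborel. x \<notin> B" using ae by eventually_elim (auto simp: B_def)
 ultimately have "B \<in> null_sets lborel" using AE_iff_null_sets by blast
 then have "negligible B" by (simp add: negligible_iff_null_sets null_sets_completionI)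
 then have "B = {}" using open_not_negligible[OF B] by blast
 then show ?thesis using x by (auto simp: B_def)
qed

text \<open>The hypotheses express, without signed measures, that M - N has energy zero. For the
  transforms a and b they say that 2ab and a^2 + b^2 have the same finite weighted integral; as 2ab
  \<le> a^2 + b^2, equality holds almost everywhere, and by continuity everywhere.\<close>

lemma energy_strictly_positive:
 fixes M N :: "(real^'n) measure"
 assumes n: "CARD('n) \<ge> 3" and M: "M \<in> sphere_fin" and N: "N \<in> sphere_fin"
  and fin: "mutual_energy M N < \<infinity>" and eq: "energy M = mutual_energy M N" "energy N = mutual_energy M N"
 shows "M = N"
proof -
 define W where "W p = indicator {0<..} (fst p) * fst p powr ((real CARD('n) - 2) / 2 - 1) * exp (- 4 * fst p) * gauss (snd p)"
  for p :: "real \<times> (real^'n)"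
 define \<xi> where "\<xi> p = sqrt (2 * fst p) *\<^sub>R snd p" for p :: "real \<times> (real^'n)"
 have [measurable]: "W \<in> borel_measurable borel" "\<xi> \<in> borel_measurable borel"
  unfolding W_def \<xi>_def borel_prod[symmetric] by measurable
 have W0: "W p \<ge> 0" for p using gauss_pos[of "snd p"] by (auto simp: W_def indicator_def)
 define a where "a p = Laplace M (\<xi> p)" for p
 define b where "b p = Laplace N (\<xi> p)" for p
 have "Laplace L \<in> borel_measurable borel" if "L \<in> sphere_fin" for L :: "(real^'n) measure"
  using Laplace_continuous[OF that] by (rule borel_measurable_continuous_onI)
 note [measurable] = this[OF M] this[OF N]
 have [measurable]: "a \<in> borel_measurable borel" "b \<in> borel_measurable borel"
  unfolding a_def b_def by measurable
 have ab: "a p \<ge> 0" "b p \<ge> 0" for p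
  using Laplace_nn_integral(2)[OF M] Laplace_nn_integral(2)[OF N] by (simp_all add: a_def b_def)
 define c where "c = ennreal (Gamma ((real CARD('n) - 2) / 2))"
 have I: "c * energy M = (\<integral>\<^sup>+p. ennreal (W p * (a p * a p)) \<partial>lborel)"
  "c * energy N = (\<integral>\<^sup>+p. ennreal (W p * (b p * b p)) \<partial>lborel)"
  "c * mutual_energy M N = (\<integral>\<^sup>+p. ennreal (W p * (a p * b p)) \<partial>lborel)"
  unfolding energy_eq c_def W_def a_def b_def \<xi>_def by (rule mutual_energy_Laplace[OF n] M N)+
 have le: "2 * (a p * b p) \<le> a p * a p + b p * b p" for p
  using sum_squares_bound[of "a p" "b p"] by (simp add: power2_eq_square)
 have sum1: "(\<integral>\<^sup>+p. ennreal (W p * (a p * a p + b p * b p)) \<partial>lborel) = c * mutual_energy M N + c * mutual_energy M N"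
 proof -
  have "(\<integral>\<^sup>+p. ennreal (W p * (a p * a p + b p * b p)) \<partial>lborel)
   = (\<integral>\<^sup>+p. ennreal (W p * (a p * a p)) + ennreal (W p * (b p * b p)) \<partial>lborel)"
   using W0 by (intro nn_integral_cong) (simp add: distrib_left ennreal_plus)
  also have "\<dots> = c * energy M + c * energy N"
   unfolding I by (rule nn_integral_add) measurable
  finally show ?thesis by (simp add: eq)
 qed
 have sum2: "(\<integral>\<^sup>+p. ennreal (W p * (2 * (a p * b p))) \<partial>lborel) = c * mutual_energy M N + c * mutual_energy M N"
 proof -
  have "(\<integral>\<^sup>+p. ennreal (W p * (2 * (a p * b p))) \<partial>lborel)
   = (\<integral>\<^sup>+p. ennreal (W p * (a p * b p)) + ennreal (W p * (a p * b p)) \<partial>lborel)"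
  proof (rule nn_integral_cong)
   fix p
   have "W p * (2 * (a p * b p)) = W p * (a p * b p) + W p * (a p * b p)" by simp
   then show "ennreal (W p * (2 * (a p * b p))) = ennreal (W p * (a p * b p)) + ennreal (W p * (a p * b p))"
    using W0[of p] ab[of p] by (simp only: ennreal_plus mult_nonneg_nonneg)
  qed
  also have "\<dots> = c * mutual_energy M N + c * mutual_energy M N"
   unfolding I by (rule nn_integral_add) measurable
  finally show ?thesis .
 qed
 \<comment> \<open>Were the inequality strict on a set of positive measure, the integrals
   \<open>sum1\<close> and \<open>sum2\<close> would differ; finiteness of the smaller one is what
   allows this conclusion.\<close>
 have ae: "AE p in lborel. ennreal (W p * (a p * a p + b p * b p)) \<le> ennreal (W p * (2 * (a p * b p)))"
 proof (rule ccontr)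
  assume nae: "\<not> ?thesis"
  have "(\<integral>\<^sup>+p. ennreal (W p * (2 * (a p * b p))) \<partial>lborel) < (\<integral>\<^sup>+p. ennreal (W p * (a p * a p + b p * b p)) \<partial>lborel)"
  proof (rule nn_integral_less)
   have "c * mutual_energy M N < \<infinity>"
    using fin unfolding c_def infinity_ennreal_def ennreal_mult_less_top by (simp add: ennreal_less_top)
   then show "(\<integral>\<^sup>+p. ennreal (W p * (2 * (a p * b p))) \<partial>lborel) \<noteq> \<infinity>"
    unfolding sum2 by simp
   show "AE p in lborel. ennreal (W p * (2 * (a p * b p))) \<le> ennreal (W p * (a p * a p + b p * b p))"
    by (intro AE_I2 ennreal_leI mult_left_mono le W0)
  qed (measurable, rule nae)
  then show False unfolding sum1 sum2 by simp
 qed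
 have ab_eq: "AE p in lborel. p \<in> {0<..} \<times> UNIV \<longrightarrow> a p = b p"
  using ae
 proof eventually_elim
  fix p :: "real \<times> (real^'n)"
  assume *: "ennreal (W p * (a p * a p + b p * b p)) \<le> ennreal (W p * (2 * (a p * b p)))"
  show "p \<in> {0<..} \<times> UNIV \<longrightarrow> a p = b p"
  proof
   assume "p \<in> {0<..} \<times> (UNIV :: (real^'n) set)"
   then have "fst p > 0" by auto
   then have W: "W p > 0" using gauss_pos[of "snd p"] by (simp add: W_def)
   have "W p * (a p * a p + b p * b p) \<le> W p * (2 * (a p * b p))"
    using * W0[of p] ab[of p] by (simp add: ennreal_le_iff)
   then have "a p * a p + b p * b p \<le> 2 * (a p * b p)" using W by simp
   then have "(a p - b p)\<^sup>2 \<le> 0" by (simp add: power2_eq_square algebra_simps)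
   then show "a p = b p" by simp
  qed
 qed
 have cont: "continuous_on ({0<..} \<times> UNIV) (\<lambda>p. Laplace L (\<xi> p))" if "L \<in> sphere_fin" for L :: "(real^'n) measure"
  unfolding \<xi>_def
  by (rule continuous_on_compose2[OF Laplace_continuous[OF that]]) (auto intro!: continuous_intros)
 have "Laplace M \<eta> = Laplace N \<eta>" for \<eta>
 proof -
  \<comment> \<open>At t = 1/2 the factor sqrt(2t) is 1, so this single slice already contains every
    argument of the transforms.\<close>
  have "a (1/2, \<eta>) = b (1/2, \<eta>)"
  proof (rule AE_lborel_continuous_eq[OF ab_eq])
   show "open ({0::real<..} \<times> (UNIV :: (real^'n) set))" by (intro open_Times) auto
  qed (use cont[OF M] cont[OF N] in \<open>auto simp: a_def b_def\<close>)
  then show ?thesis by (simp add: a_def b_def \<xi>_def)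
 qed
 then show ?thesis by (intro sphere_measure_eqI_Laplace[OF M N]) auto
qed

section \<open>Measures on the line and parameter integrals\<close>

lemma measure_eqI_Ioc:
 fixes M N :: "real measure"
 assumes sets: "sets M = sets borel" "sets N = sets borel"
  and eq: "\<And>c d. emeasure M {c<..d} = emeasure N {c<..d}" and fin: "\<And>c d. emeasure M {c<..d} \<noteq> \<infinity>"
 shows "M = N"
proof (rule measure_eqI_generator_eq[where E="range (\<lambda>(i, j). {i<..j})" and \<Omega>=UNIV and A="\<lambda>i. {- real i<..real i}"])
 show "Int_stable (range (\<lambda>(i, j). {i<..j::real}))"
  by (auto simp: Int_stable_def)
 show "sets M = sigma_sets UNIV (range (\<lambda>(i, j). {i<..j}))" "sets N = sigma_sets UNIV (range (\<lambda>(i, j). {i<..j}))"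
  unfolding sets borel_sigma_sets_Ioc by simp_all
 show "(\<Union>i. {- real i<..real i}) = UNIV"
 proof safe
  fix x :: real
  obtain i where "\<bar>x\<bar> < real i" using reals_Archimedean2 by blast
  then have "x \<in> {- real i<..real i}" by auto
  then show "x \<in> (\<Union>i. {- real i<..real i})" by blast
 qed auto
qed (use eq fin in auto)

text \<open>Information is available on compact pieces of the open interval only, and masses may be
  unbounded towards its ends. The measures are therefore compared on an exhaustion C n, each
  restricted measure being determined by its values on half-open intervals.\<close>

lemma measure_eqI_Ioo:
 fixes M N :: "real measure"
 assumes sets: "sets M = sets borel" "sets N = sets borel" and lr: "l < r"
  and eq: "\<And>c d. l < c \<Longrightarrow> c < d \<Longrightarrow> d < r \<Longrightarrow> emeasure M {c<..d} = emeasure N {c<..d}"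
  and fin: "\<And>c d. l < c \<Longrightarrow> c < d \<Longrightarrow> d < r \<Longrightarrow> emeasure M {c<..d} \<noteq> \<infinity>"
  and null: "emeasure M (- {l<..<r}) = 0" "emeasure N (- {l<..<r}) = 0"
 shows "M = N"
proof -
 define C where "C n = {l + (r - l) / real (n + 3)<..r - (r - l) / real (n + 3)}" for n :: nat
 define B where "B n L = density L (indicator (C n) :: real \<Rightarrow> ennreal)" for n and L :: "real measure"
 have BL: "emeasure (B n L) X = emeasure L (C n \<inter> X)" if "sets L = sets borel" "X \<in> sets borel" for n L X
 proof -
  have Cn: "C n \<in> sets L" using that(1) by (simp add: C_def)
  have "emeasure (B n L) X = (\<integral>\<^sup>+x. indicator (C n) x * indicator X x \<partial>L)"
   unfolding B_def using that Cn by (intro emeasure_density) auto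
  also have "\<dots> = (\<integral>\<^sup>+x. indicator (C n \<inter> X) x \<partial>L)"
   by (simp only: indicator_inter_arith)
  also have "\<dots> = emeasure L (C n \<inter> X)" using that Cn by simp
  finally show ?thesis .
 qed
 have Cc: "l < l + (r - l) / real (n + 3)" "r - (r - l) / real (n + 3) < r" for n
  using lr by simp_all
 have Bn: "B n M = B n N" for n
 proof (rule measure_eqI_Ioc)
  fix c d :: real
  define c' where "c' = max (l + (r - l) / real (n + 3)) c"
  define d' where "d' = min (r - (r - l) / real (n + 3)) d"
  have CI: "C n \<inter> {c<..d} = {c'<..d'}" by (auto simp: C_def c'_def d'_def)
  have l': "l < c'" "d' < r" using Cc[of n] by (auto simp: c'_def d'_def)
  show "emeasure (B n M) {c<..d} = emeasure (B n N) {c<..d}" 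
   using eq[OF l'(1) _ l'(2)] by (cases "c' < d'") (simp_all add: BL sets CI)
  show "emeasure (B n M) {c<..d} \<noteq> \<infinity>"
   using fin[OF l'(1) _ l'(2)] by (cases "c' < d'") (simp_all add: BL sets CI)
 qed (simp_all add: B_def sets)
 have U: "(\<Union>n. C n) = {l<..<r}"
 proof safe
  fix x n assume "x \<in> C n" then show "x \<in> {l<..<r}" using Cc[of n] by (auto simp: C_def)
 next
  fix x assume x: "x \<in> {l<..<r}"
  define e where "e = min (x - l) (r - x)"
  have e: "e > 0" using x by (simp add: e_def)
  obtain n :: nat where "(r - l) / e < real n" using reals_Archimedean2 by blast
  then have "(r - l) / e < real (n + 3)" by simp
  then have "(r - l) / real (n + 3) < e" using e by (simp add: field_simps)
  then have "x \<in> C n" by (auto simp: C_def e_def)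
  then show "x \<in> (\<Union>n. C n)" by blast
 qed
 have inc: "incseq C"
 proof (rule incseq_SucI)
  fix n
  have "(r - l) / real (Suc n + 3) \<le> (r - l) / real (n + 3)" using lr by (intro divide_left_mono) auto
  then show "C n \<subseteq> C (Suc n)" by (auto simp: C_def)
 qed
 have em: "emeasure L A = (SUP n. emeasure (B n L) A)" if L: "sets L = sets borel" "emeasure L (- {l<..<r}) = 0" and A: "A \<in> sets borel" for L A
 proof -
  have AL: "A \<in> sets L" "{l<..<r} \<in> sets L" using L A by auto
  have "emeasure L A = emeasure L (A - (- {l<..<r}))"
   using L A by (intro emeasure_Diff_null_set[symmetric]) (auto simp: null_sets_def)
  also have "A - (- {l<..<r}) = (\<Union>n. C n \<inter> A)" using U by auto
  also have "emeasure L (\<Union>n. C n \<inter> A) = (SUP n. emeasure L (C n \<inter> A))"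
   using L A inc by (intro SUP_emeasure_incseq[symmetric]) (auto simp: C_def incseq_def)
  finally show ?thesis by (simp add: BL L A)
 qed
 show ?thesis
  by (rule measure_eqI) (simp_all add: sets em null Bn)
qed

lemma AE_eq_from_integrals:
 fixes f g :: "real \<Rightarrow> ennreal"
 assumes [measurable]: "f \<in> borel_measurable borel" "g \<in> borel_measurable borel" and lr: "l < r"
  and eq: "\<And>c d. l < c \<Longrightarrow> c < d \<Longrightarrow> d < r \<Longrightarrow> (\<integral>\<^sup>+x\<in>{c<..d}. f x \<partial>lborel) = (\<integral>\<^sup>+x\<in>{c<..d}. g x \<partial>lborel)"
  and fin: "\<And>c d. l < c \<Longrightarrow> c < d \<Longrightarrow> d < r \<Longrightarrow> (\<integral>\<^sup>+x\<in>{c<..d}. f x \<partial>lborel) \<noteq> \<infinity>"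
 shows "AE x in lborel. x \<in> {l<..<r} \<longrightarrow> f x = g x"
proof -
 let ?M = "\<lambda>f. density lborel (\<lambda>x. f x * indicator {l<..<r} x)"
 have i: "emeasure (?M h) {c<..d} = (\<integral>\<^sup>+x\<in>{c<..d}. h x \<partial>lborel)"
  if [measurable]: "h \<in> borel_measurable borel" and "l < c" "d < r" for h c d
  using that(2,3) by (subst emeasure_density) (auto intro!: nn_integral_cong simp: indicator_def)
 have "?M f = ?M g"
 proof (rule measure_eqI_Ioo[OF _ _ lr])
  fix c d assume cd: "l < c" "c < d" "d < r"
  show "emeasure (?M f) {c<..d} = emeasure (?M g) {c<..d}" using eq[OF cd] i cd assms(1,2) by simp
  show "emeasure (?M f) {c<..d} \<noteq> \<infinity>" using fin[OF cd] i[OF assms(1) cd(1,3)] by simp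
 next
  have "emeasure (?M h) (- {l<..<r}) = 0" if [measurable]: "h \<in> borel_measurable borel" for h
  proof -
   have "emeasure (?M h) (- {l<..<r}) = (\<integral>\<^sup>+x. h x * indicator {l<..<r} x * indicator (- {l<..<r}) x \<partial>lborel)"
    by (rule emeasure_density) auto
   also have "\<dots> = (\<integral>\<^sup>+(x::real). 0 \<partial>lborel)" by (rule nn_integral_cong) (simp add: indicator_def)
   finally show ?thesis by simp
  qed
  then show "emeasure (?M f) (- {l<..<r}) = 0" "emeasure (?M g) (- {l<..<r}) = 0" by simp_all
 qed auto
 then have "AE x in lborel. f x * indicator {l<..<r} x = g x * indicator {l<..<r} x"
  by (intro sigma_finite_measure.density_unique[OF lborel.sigma_finite_measure_axioms]) auto
 then show ?thesis by eventually_elim (auto simp: indicator_def)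
qed

lemma LIMSEQ_divide_add_two: "(\<lambda>n. A / (real n + 2)) \<longlonglongrightarrow> 0"
proof -
 have "(\<lambda>n. A * inverse (real (Suc (n + 1)))) \<longlonglongrightarrow> A * 0"
  by (intro tendsto_mult tendsto_const LIMSEQ_ignore_initial_segment[OF LIMSEQ_inverse_real_of_nat])
 then show ?thesis by (simp add: divide_inverse add.commute)
qed

text \<open>A derivative is a pointwise limit of difference quotients of a continuous function. The
  increment (r - v) / (n + 2) depends on v, so that v + h stays inside the interval for all n at
  once.\<close>

lemma derivative_measurable:
 fixes B B' :: "real \<Rightarrow> real"
 assumes "\<And>v. l < v \<Longrightarrow> v < r \<Longrightarrow> (B has_real_derivative B' v) (at v)"
 shows "(\<lambda>v. B' v * indicator {l<..<r} v) \<in> borel_measurable borel"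
proof -
 have cont: "continuous_on {l<..<r} B"
  using assms by (auto intro!: continuous_at_imp_continuous_on DERIV_isCont)
 define h where "h n v = (r - v) / (real n + 2)" for n v
 define f where "f n v = (B (v + h n v) - B v) / h n v * indicator {l<..<r} v" for n v
 have in_I: "v + h n v \<in> {l<..<r}" "h n v > 0" if "v \<in> {l<..<r}" for v n
 proof -
  have h: "0 < h n v" using that by (simp add: h_def)
  have "h n v < (r - v) / 1" unfolding h_def using that by (intro divide_strict_left_mono) auto
  then show "v + h n v \<in> {l<..<r}" "h n v > 0" using that h by auto
 qed
 have f: "f n \<in> borel_measurable borel" for n
 proof -
  have "continuous_on {l<..<r} (h n)" unfolding h_def by (intro continuous_intros) auto
  moreover have "continuous_on {l<..<r} (\<lambda>v. B (v + h n v))"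
   by (rule continuous_on_compose2[OF cont]) (auto intro!: continuous_intros calculation dest: in_I(1)[of _ n])
  ultimately have "continuous_on {l<..<r} (\<lambda>v. (B (v + h n v) - B v) / h n v)"
   using in_I(2) by (intro continuous_intros cont) (auto simp: less_imp_neq[symmetric] dest!: in_I(2)[of _ n])
  moreover have "f n = (\<lambda>v. indicator {l<..<r} v *\<^sub>R ((B (v + h n v) - B v) / h n v))"
   by (simp add: f_def fun_eq_iff)
  ultimately show ?thesis
   using borel_measurable_continuous_on_indicator[OF borel_open[OF open_greaterThanLessThan]] by metis
 qed
 have "(\<lambda>n. f n v) \<longlonglongrightarrow> B' v * indicator {l<..<r} v" for v
 proof (cases "v \<in> {l<..<r}")
  case True
  have "(\<lambda>n. h n v) \<longlonglongrightarrow> 0" unfolding h_def by (rule LIMSEQ_divide_add_two)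
  then have "filterlim (\<lambda>n. h n v) (at 0) sequentially"
   using in_I(2)[OF True] by (intro filterlim_atI) (auto simp: less_imp_neq[symmetric])
  moreover have "((\<lambda>t. (B (v + t) - B v) / t) \<longlongrightarrow> B' v) (at 0)"
   using assms[of v] True by (simp add: DERIV_def)
  ultimately have "(\<lambda>n. (B (v + h n v) - B v) / h n v) \<longlonglongrightarrow> B' v" by (rule filterlim_compose[rotated])
  then show ?thesis using True by (simp add: f_def)
 qed (simp add: f_def)
 then show ?thesis using f by (rule borel_measurable_LIMSEQ_real)
qed

text \<open>Differentiation under the integral sign, with the singularities collected in an
  integrable weight w. By the mean value theorem the bound K on f' bounds the difference quotients
  as well, so K * w dominates.\<close>

lemma has_derivative_integral_param:
 fixes f f' :: "real \<Rightarrow> 'a \<Rightarrow> real"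
 assumes w: "integrable M w" "\<And>x. x \<in> space M \<Longrightarrow> 0 \<le> w x"
  and fm: "\<And>c. c \<in> {l<..<r} \<Longrightarrow> f c \<in> borel_measurable M"
  and fd: "\<And>c x. c \<in> {l<..<r} \<Longrightarrow> x \<in> space M \<Longrightarrow> ((\<lambda>c. f c x) has_real_derivative f' c x) (at c)"
  and fb: "\<And>c x. c \<in> {l<..<r} \<Longrightarrow> x \<in> space M \<Longrightarrow> \<bar>f c x\<bar> \<le> K"
  and f'b: "\<And>c x. c \<in> {l<..<r} \<Longrightarrow> x \<in> space M \<Longrightarrow> \<bar>f' c x\<bar> \<le> K"
  and c: "c \<in> {l<..<r}"
 shows "((\<lambda>c. \<integral>x. f c x * w x \<partial>M) has_real_derivative (\<integral>x. f' c x * w x \<partial>M)) (at c)"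
  and "f' c \<in> borel_measurable M"
proof -
 have wm[measurable]: "w \<in> borel_measurable M" using w by auto
 have int: "integrable M (\<lambda>x. f c x * w x)" if "c \<in> {l<..<r}" for c
 proof (rule Bochner_Integration.integrable_bound[where f="\<lambda>x. K * w x"])
  show "integrable M (\<lambda>x. K * w x)" using w by simp
  show "AE x in M. norm (f c x * w x) \<le> norm (K * w x)"
  proof (rule AE_I2)
   fix x assume x: "x \<in> space M"
   then have "\<bar>f c x\<bar> \<le> \<bar>K\<bar>" using fb[OF that x] by linarith
   then show "norm (f c x * w x) \<le> norm (K * w x)" by (simp add: abs_mult mult_right_mono)
  qed
  show "(\<lambda>x. f c x * w x) \<in> borel_measurable M" using fm[OF that] by measurable
 qed
 have quot: "(\<lambda>n. (f (X n) x - f c x) / (X n - c)) \<longlonglongrightarrow> f' c x"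
  if X: "\<And>n. X n \<in> {l<..<r} - {c}" "X \<longlonglongrightarrow> c" and x: "x \<in> space M" for X x
 proof -
  have "((\<lambda>y. (f y x - f c x) / (y - c)) \<longlongrightarrow> f' c x) (at c)"
   using fd[OF c x] by (simp add: has_field_derivative_iff)
  moreover have "filterlim X (at c) sequentially" using X by (intro filterlim_atI) auto
  ultimately show ?thesis by (rule filterlim_compose)
 qed
 have mvt: "\<bar>(f y x - f c x) / (y - c)\<bar> \<le> K" if y: "y \<in> {l<..<r} - {c}" and x: "x \<in> space M" for y x
 proof -
  have "norm (f y x - f c x) \<le> K * norm (y - c)"
  proof (rule field_differentiable_bound[where S="{l<..<r}" and f'="\<lambda>c. f' c x"])
   show "((\<lambda>c. f c x) has_field_derivative f' z x) (at z within {l<..<r})" if "z \<in> {l<..<r}" for z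
    using fd[OF that x] by (rule has_field_derivative_at_within)
  qed (use y c x f'b in auto)
  then show ?thesis using y by (simp add: abs_divide divide_le_eq)
 qed
 \<comment> \<open>A sequence that tends to c inside the interval and avoids c; it exhibits f' c as
   a limit of measurable quotients.\<close>
 define Z where "Z n = c + (r - c) / (real n + 2)" for n
 have Zin: "Z n \<in> {l<..<r} - {c}" for n
 proof -
  have "0 < (r - c) / (real n + 2)" using c by simp
  moreover have "(r - c) / (real n + 2) < (r - c) / 1" using c by (intro divide_strict_left_mono) auto
  ultimately show ?thesis using c by (auto simp: Z_def)
 qed
 have Zlim: "Z \<longlonglongrightarrow> c" unfolding Z_def
  using tendsto_add[OF tendsto_const LIMSEQ_divide_add_two, of c "r - c"] by simp
 show f'm: "f' c \<in> borel_measurable M"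
 proof (rule borel_measurable_LIMSEQ_real)
  show "(\<lambda>n. (f (Z n) x - f c x) / (Z n - c)) \<longlonglongrightarrow> f' c x" if "x \<in> space M" for x
   by (rule quot[OF Zin Zlim that])
  show "(\<lambda>x. (f (Z n) x - f c x) / (Z n - c)) \<in> borel_measurable M" for n
  proof -
   have [measurable]: "f (Z n) \<in> borel_measurable M" "f c \<in> borel_measurable M"
    using Zin[of n] by (auto intro: fm c)
   show ?thesis by measurable
  qed
 qed
 have "((\<lambda>y. ((\<integral>x. f y x * w x \<partial>M) - (\<integral>x. f c x * w x \<partial>M)) / (y - c)) \<longlongrightarrow> (\<integral>x. f' c x * w x \<partial>M)) (at c within {l<..<r})"
  unfolding tendsto_at_iff_sequentially
 proof (intro allI impI)
  fix X assume X: "\<forall>i. X i \<in> {l<..<r} - {c}" "X \<longlonglongrightarrow> c"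
  have "((\<integral>x. f (X n) x * w x \<partial>M) - (\<integral>x. f c x * w x \<partial>M)) / (X n - c)
   = (\<integral>x. (f (X n) x - f c x) / (X n - c) * w x \<partial>M)" for n
  proof -
   have Xn: "X n \<in> {l<..<r}" using X by auto
   have "(\<integral>x. f (X n) x * w x \<partial>M) - (\<integral>x. f c x * w x \<partial>M) = (\<integral>x. f (X n) x * w x - f c x * w x \<partial>M)"
    by (rule Bochner_Integration.integral_diff[symmetric]) (intro int Xn c)+
   then show ?thesis
    by (simp add: integral_divide_zero[symmetric] left_diff_distrib diff_divide_distrib del: integral_divide_zero)
  qed
  moreover have "(\<lambda>n. \<integral>x. (f (X n) x - f c x) / (X n - c) * w x \<partial>M) \<longlonglongrightarrow> (\<integral>x. f' c x * w x \<partial>M)"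
  proof (rule integral_dominated_convergence[where w="\<lambda>x. K * w x"])
   show "integrable M (\<lambda>x. K * w x)" using w by simp
   show "AE x in M. (\<lambda>n. (f (X n) x - f c x) / (X n - c) * w x) \<longlonglongrightarrow> f' c x * w x"
    using X by (intro AE_I2 tendsto_intros quot) auto
   show "AE x in M. norm ((f (X n) x - f c x) / (X n - c) * w x) \<le> K * w x" for n
   proof (rule AE_I2)
    fix x assume x: "x \<in> space M"
    have "norm ((f (X n) x - f c x) / (X n - c) * w x) = \<bar>(f (X n) x - f c x) / (X n - c)\<bar> * w x"
     using w(2)[OF x] by (simp add: abs_mult)
    also have "\<dots> \<le> K * w x" using X by (intro mult_right_mono mvt w(2) x) auto
    finally show "norm ((f (X n) x - f c x) / (X n - c) * w x) \<le> K * w x" .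
   qed
   show "(\<lambda>x. f' c x * w x) \<in> borel_measurable M" using f'm by measurable
   show "(\<lambda>x. (f (X n) x - f c x) / (X n - c) * w x) \<in> borel_measurable M" for n
   proof -
    have [measurable]: "f (X n) \<in> borel_measurable M" "f c \<in> borel_measurable M"
     using X by (auto intro: fm c)
    show ?thesis by measurable
   qed
  qed
  ultimately have "(\<lambda>n. ((\<integral>x. f (X n) x * w x \<partial>M) - (\<integral>x. f c x * w x \<partial>M)) / (X n - c)) \<longlonglongrightarrow> (\<integral>x. f' c x * w x \<partial>M)"
   by (simp only:)
  then show "((\<lambda>y. ((\<integral>x. f y x * w x \<partial>M) - (\<integral>x. f c x * w x \<partial>M)) / (y - c)) \<circ> X) \<longlonglongrightarrow> (\<integral>x. f' c x * w x \<partial>M)"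
   by (simp add: comp_def)
 qed
 then show "((\<lambda>c. \<integral>x. f c x * w x \<partial>M) has_real_derivative (\<integral>x. f' c x * w x \<partial>M)) (at c)"
  using c by (simp add: has_field_derivative_iff at_within_open[of c "{l<..<r}"])
qed

text \<open>Also true without integrability, because the Bochner integral of a non-integrable
  function is 0 by convention.\<close>

lemma integral_param_bound:
 fixes f :: "'a \<Rightarrow> real"
 assumes w: "integrable M w" "\<And>x. x \<in> space M \<Longrightarrow> 0 \<le> w x" and K: "\<And>x. x \<in> space M \<Longrightarrow> \<bar>f x\<bar> \<le> K"
 shows "\<bar>\<integral>x. f x * w x \<partial>M\<bar> \<le> K * (\<integral>x. w x \<partial>M)"
proof (cases "integrable M (\<lambda>x. f x * w x)")
 case True
 have "\<bar>\<integral>x. f x * w x \<partial>M\<bar> \<le> (\<integral>x. \<bar>f x * w x\<bar> \<partial>M)" by (rule integral_abs_bound)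
 also have "\<dots> \<le> (\<integral>x. K * w x \<partial>M)"
 proof (rule integral_mono)
  show "integrable M (\<lambda>x. \<bar>f x * w x\<bar>)" using True by (rule integrable_abs)
  show "integrable M (\<lambda>x. K * w x)" using w(1) by simp
  show "\<bar>f x * w x\<bar> \<le> K * w x" if "x \<in> space M" for x
   using K[OF that] w(2)[OF that] by (simp add: abs_mult mult_right_mono)
 qed
 finally show ?thesis by simp
next
 case False
 have "0 \<le> (\<integral>x. K * w x \<partial>M)"
  using w K by (intro integral_nonneg_AE AE_I2 mult_nonneg_nonneg) (auto intro: order_trans[OF abs_ge_zero])
 then show ?thesis using False by (simp add: not_integrable_integral_eq)
qed

text \<open>The interval is open, so the singular weights and the functions they multiply need to be
  controlled at interior points only.\<close>

definition unit_ivl :: "real measure" where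
 "unit_ivl = restrict_space lborel {0<..<1}"

lemma space_unit_ivl [simp]: "space unit_ivl = {0<..<1}"
 by (simp add: unit_ivl_def space_restrict_space)

lemma continuous_on_unit_ivl_measurable:
 "continuous_on {0<..<1} f \<Longrightarrow> (f :: real \<Rightarrow> real) \<in> borel_measurable unit_ivl"
 unfolding unit_ivl_def
 by (subst measurable_cong_sets[OF sets_restrict_space_cong[OF sets_lborel] refl]) (rule borel_measurable_continuous_on_restrict)

lemma Beta_weight:
 fixes A B :: real
 assumes "A > 0" "B > 0"
 shows "integrable unit_ivl (\<lambda>x. x powr (A - 1) * (1 - x) powr (B - 1))"
  and "(\<integral>x. x powr (A - 1) * (1 - x) powr (B - 1) \<partial>unit_ivl) = Beta A B"
proof -
 have B: "Beta A B > 0" using assms by (simp add: Beta_def Gamma_real_pos)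
 have m: "(\<lambda>x. x powr (A - 1) * (1 - x) powr (B - 1)) \<in> borel_measurable unit_ivl"
  unfolding unit_ivl_def by (rule measurable_restrict_space1) measurable
 have "(\<integral>\<^sup>+x. ennreal (x powr (A - 1) * (1 - x) powr (B - 1)) \<partial>unit_ivl) = ennreal (Beta A B)"
  unfolding unit_ivl_def using nn_integral_Beta[of 0 1 A B] assms by (subst nn_integral_restrict_space) auto
 then have "has_bochner_integral unit_ivl (\<lambda>x. x powr (A - 1) * (1 - x) powr (B - 1)) (Beta A B)"
  using B m by (intro has_bochner_integral_nn_integral) auto
 then show "integrable unit_ivl (\<lambda>x. x powr (A - 1) * (1 - x) powr (B - 1))"
  "(\<integral>x. x powr (A - 1) * (1 - x) powr (B - 1) \<partial>unit_ivl) = Beta A B"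
  by (auto simp: has_bochner_integral_iff)
qed

lemma LBINT_scale_unit_ivl:
 fixes f :: "real \<Rightarrow> real"
 assumes "p < q"
 shows "(LBINT s:{p..q}. f s) = (q - p) * (\<integral>x. f (p + (q - p) * x) \<partial>unit_ivl)"
  and "set_integrable lborel {p..q} f \<longleftrightarrow> integrable unit_ivl (\<lambda>x. f (p + (q - p) * x))"
proof -
 have ind: "indicator {p..q} (p + (q - p) * x) = (indicator {0..1} x :: real)" for x
 proof -
  have "p + (q - p) * x \<le> q \<longleftrightarrow> (q - p) * x \<le> (q - p) * 1" by (simp add: algebra_simps)
  also have "\<dots> \<longleftrightarrow> x \<le> 1" using assms by (intro mult_le_cancel_left_pos) simp
  finally have "p + (q - p) * x \<le> q \<longleftrightarrow> x \<le> 1" .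
  moreover have "p \<le> p + (q - p) * x \<longleftrightarrow> 0 \<le> x" using assms by (simp add: zero_le_mult_iff)
  ultimately show ?thesis by (simp add: indicator_def)
 qed
 have i: "integrable lborel (\<lambda>x. indicator {0..1} x *\<^sub>R f (p + (q - p) * x)) \<longleftrightarrow> integrable lborel (\<lambda>x. indicator {0<..<1} x *\<^sub>R f (p + (q - p) * x))"
  by (rule integrable_discrete_difference[where X="{0, 1}"]) (auto simp: indicator_def)
 have e: "(\<integral>x. indicator {0..1} x *\<^sub>R f (p + (q - p) * x) \<partial>lborel) = (\<integral>x. indicator {0<..<1} x *\<^sub>R f (p + (q - p) * x) \<partial>lborel)"
  by (rule integral_discrete_difference[where X="{0, 1}"]) (auto simp: indicator_def)
 show "(LBINT s:{p..q}. f s) = (q - p) * (\<integral>x. f (p + (q - p) * x) \<partial>unit_ivl)"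
  unfolding set_lebesgue_integral_def unit_ivl_def
  using assms by (subst lborel_integral_real_affine[where t=p and c="q - p"]) (simp_all add: ind e[unfolded real_scaleR_def] integral_restrict_space)
 show "set_integrable lborel {p..q} f \<longleftrightarrow> integrable unit_ivl (\<lambda>x. f (p + (q - p) * x))"
  unfolding set_integrable_def unit_ivl_def
  using assms lborel_integrable_real_affine_iff[where t=p and c="q - p" and f="\<lambda>x. indicator {p..q} x *\<^sub>R f x"]
  by (simp add: ind i[unfolded real_scaleR_def] integrable_restrict_space)
qed

section \<open>Abel transforms\<close>

text \<open>What C^2 in the polar angle becomes in the height s = cos \<theta>: derivatives in s may
  blow up at -1. The weights fit the rescaling s = -1 + (1+c) x, under which x^j times the j-th
  derivative at s is bounded by K / (1+c)^j.\<close>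

definition C2_weighted :: "real \<Rightarrow> (real \<Rightarrow> real) \<Rightarrow> (real \<Rightarrow> real) \<Rightarrow> (real \<Rightarrow> real) \<Rightarrow> real \<Rightarrow> bool" where
 "C2_weighted a y y1 y2 K \<longleftrightarrow> (\<forall>s\<in>{-1<..<a}. (y has_real_derivative y1 s) (at s) \<and>
  (y1 has_real_derivative y2 s) (at s) \<and> \<bar>y s\<bar> \<le> K \<and> (1 + s) * \<bar>y1 s\<bar> \<le> K \<and> (1 + s)\<^sup>2 * \<bar>y2 s\<bar> \<le> K)"

text \<open>The first Abel transform rescaled to the unit interval and freed of its power of 1 + c.
  With the j-th derivative of the potential in place of f it is the j-th derivative in c; the factor
  x^j comes from the chain rule.\<close>

definition Abel_moment :: "real \<Rightarrow> nat \<Rightarrow> (real \<Rightarrow> real) \<Rightarrow> real \<Rightarrow> real" where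
 "Abel_moment D j f c = (\<integral>x. (x ^ j * f (-1 + (1 + c) * x)) *
   (x powr ((D - 1) / 2 - 1) * (1 - x) powr (1/2 - 1)) \<partial>unit_ivl)"

lemma C2_weightedD:
 assumes "C2_weighted a y y1 y2 K" "-1 < s" "s < a"
 shows "(y has_real_derivative y1 s) (at s)" "(y1 has_real_derivative y2 s) (at s)"
  "\<bar>y s\<bar> \<le> K" "(1 + s) * \<bar>y1 s\<bar> \<le> K" "(1 + s)\<^sup>2 * \<bar>y2 s\<bar> \<le> K"
 using assms unfolding C2_weighted_def by auto

lemma unit_ivl_scaled:
 assumes "x \<in> {0<..<1::real}" "-1 < c" "c < a"
 shows "-1 + (1 + c) * x \<in> {-1<..<a}"
proof -
 have "0 < (1 + c) * x" using assms by simp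
 moreover have "(1 + c) * x < (1 + c) * 1" using assms by (intro mult_strict_left_mono) auto
 ultimately show ?thesis using assms(3) unfolding greaterThanLessThan_iff mult_1_right by linarith
qed

context
 fixes D a K :: real and y y1 y2 :: "real \<Rightarrow> real"
 assumes D: "D \<ge> 3" and C2: "C2_weighted a y y1 y2 K"
begin

lemma C2_weighted_scaled_bounds:
 assumes x: "x \<in> {0<..<1}" and c: "-1 < l" "l < c" "c < a" 
 shows "\<bar>y (-1 + (1 + c) * x)\<bar> \<le> K" "\<bar>x * y1 (-1 + (1 + c) * x)\<bar> \<le> K / (1 + l)"
  "\<bar>x\<^sup>2 * y2 (-1 + (1 + c) * x)\<bar> \<le> K / (1 + l)\<^sup>2" "0 \<le> K"
proof -
 define s where "s = -1 + (1 + c) * x"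
 have s: "-1 < s" "s < a" using unit_ivl_scaled[OF x _ c(3)] c by (auto simp: s_def)
 note b = C2_weightedD[OF C2 s]
 show K: "\<bar>y (-1 + (1 + c) * x)\<bar> \<le> K" using b(3) by (simp add: s_def)
 show K0: "0 \<le> K" using b(3) by linarith
 have sc: "1 + s = (1 + c) * x" by (simp add: s_def)
 have "(1 + l) * \<bar>x * y1 s\<bar> \<le> (1 + c) * \<bar>x * y1 s\<bar>" using c by (intro mult_right_mono) auto
 also have "\<dots> = (1 + s) * \<bar>y1 s\<bar>" using x by (simp add: sc abs_mult mult.assoc)
 also have "\<dots> \<le> K" by (rule b(4))
 finally show "\<bar>x * y1 (-1 + (1 + c) * x)\<bar> \<le> K / (1 + l)" using c by (simp only: s_def[symmetric]) (simp add: pos_le_divide_eq mult.commute)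
 have "(1 + l)\<^sup>2 * \<bar>x\<^sup>2 * y2 s\<bar> \<le> (1 + c)\<^sup>2 * \<bar>x\<^sup>2 * y2 s\<bar>" using c by (intro mult_right_mono power_mono) auto
 also have "\<dots> = (1 + s)\<^sup>2 * \<bar>y2 s\<bar>" unfolding sc by (simp add: abs_mult power_mult_distrib mult.assoc)
 also have "\<dots> \<le> K" by (rule b(5))
 finally show "\<bar>x\<^sup>2 * y2 (-1 + (1 + c) * x)\<bar> \<le> K / (1 + l)\<^sup>2" using c by (simp only: s_def[symmetric]) (simp add: pos_le_divide_eq mult.commute)
qed

lemma C2_weighted_scaled_measurable:
 assumes c: "-1 < c" "c < a"
 shows "(\<lambda>x. y (-1 + (1 + c) * x)) \<in> borel_measurable unit_ivl"
  "(\<lambda>x. y1 (-1 + (1 + c) * x)) \<in> borel_measurable unit_ivl"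
proof -
 have cy: "continuous_on {-1<..<a} y" "continuous_on {-1<..<a} y1"
  using C2_weightedD(1,2)[OF C2] by (auto intro!: continuous_at_imp_continuous_on DERIV_isCont)
 have sub: "continuous_on {0<..<1} (\<lambda>x. -1 + (1 + c) * x)" "(\<lambda>x. -1 + (1 + c) * x) ` {0<..<1} \<subseteq> {-1<..<a}"
  using unit_ivl_scaled[OF _ c] by (auto intro!: continuous_intros)
 show "(\<lambda>x. y (-1 + (1 + c) * x)) \<in> borel_measurable unit_ivl" "(\<lambda>x. y1 (-1 + (1 + c) * x)) \<in> borel_measurable unit_ivl"
  by (rule continuous_on_unit_ivl_measurable, rule continuous_on_compose2[OF _ sub], rule cy)+
qed

text \<open>The bounds are uniform for parameters above l, the midpoint of -1 and c, which leaves
  room on both sides of c to differentiate under the integral sign.\<close>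

lemma Abel_moment_derivative:
 assumes c: "-1 < c" "c < a"
 shows "(Abel_moment D 0 y has_real_derivative Abel_moment D 1 y1 c) (at c)"
  and "(Abel_moment D 1 y1 has_real_derivative Abel_moment D 2 y2 c) (at c)"
proof -
 define l where "l = (-1 + c) / 2"
 have l: "-1 < l" "l < c" using c by (auto simp: l_def field_simps)
 define K' where "K' = max K (max (K / (1 + l)) (K / (1 + l)\<^sup>2))"
 have W: "integrable unit_ivl (\<lambda>x. x powr ((D - 1) / 2 - 1) * (1 - x) powr (1/2 - 1))"
  using D by (intro Beta_weight) auto
 have I: "-1 < c'" "l < c'" "c' < a" if "c' \<in> {l<..<a}" for c' using that l by auto
 have xm: "(\<lambda>x. x) \<in> borel_measurable unit_ivl" by (rule continuous_on_unit_ivl_measurable) (rule continuous_on_id)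
 have aff: "((\<lambda>c. -1 + (1 + c) * x) has_real_derivative x) (at c')" for c' x :: real
  by (auto intro!: derivative_eq_intros)
 have d0: "((\<lambda>c. y (-1 + (1 + c) * x)) has_real_derivative x * y1 (-1 + (1 + c') * x)) (at c')"
  if "c' \<in> {l<..<a}" "x \<in> {0<..<1}" for c' x
 proof -
  have "-1 < -1 + (1 + c') * x" "-1 + (1 + c') * x < a"
   using unit_ivl_scaled[OF that(2) I(1,3)[OF that(1)]] by auto
  from DERIV_chain2[OF C2_weightedD(1)[OF C2 this] aff] show ?thesis by (simp only: mult.commute)
 qed
 have d1: "((\<lambda>c. x * y1 (-1 + (1 + c) * x)) has_real_derivative x\<^sup>2 * y2 (-1 + (1 + c') * x)) (at c')"
  if "c' \<in> {l<..<a}" "x \<in> {0<..<1}" for c' x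
 proof -
  have "-1 < -1 + (1 + c') * x" "-1 + (1 + c') * x < a"
   using unit_ivl_scaled[OF that(2) I(1,3)[OF that(1)]] by auto
  from DERIV_cmult[OF DERIV_chain2[OF C2_weightedD(2)[OF C2 this] aff], of x] show ?thesis
   by (simp only: power2_eq_square mult_ac)
 qed
 note b = C2_weighted_scaled_bounds[OF _ l(1)]
 have "((\<lambda>c. \<integral>x. y (-1 + (1 + c) * x) * (x powr ((D - 1) / 2 - 1) * (1 - x) powr (1/2 - 1)) \<partial>unit_ivl)
  has_real_derivative (\<integral>x. (x * y1 (-1 + (1 + c) * x)) * (x powr ((D - 1) / 2 - 1) * (1 - x) powr (1/2 - 1)) \<partial>unit_ivl)) (at c)"
 proof (rule has_derivative_integral_param(1)[where l=l and r=a and K=K'])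
  show "\<bar>y (-1 + (1 + c') * x)\<bar> \<le> K'" "\<bar>x * y1 (-1 + (1 + c') * x)\<bar> \<le> K'" if "c' \<in> {l<..<a}" "x \<in> space unit_ivl" for c' x
   using b(1,2)[OF _ I(2,3)[OF that(1)], of x] that(2) by (auto simp: K'_def)
  show "(\<lambda>x. y (-1 + (1 + c') * x)) \<in> borel_measurable unit_ivl" if "c' \<in> {l<..<a}" for c'
   by (rule C2_weighted_scaled_measurable(1)[OF I(1,3)[OF that]])
  show "((\<lambda>c. y (-1 + (1 + c) * x)) has_real_derivative x * y1 (-1 + (1 + c') * x)) (at c')"
   if "c' \<in> {l<..<a}" "x \<in> space unit_ivl" for c' x
   by (rule d0[OF that[unfolded space_unit_ivl]])
  show "c \<in> {l<..<a}" using l c by simp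
 qed (rule W, simp)
 then show "(Abel_moment D 0 y has_real_derivative Abel_moment D 1 y1 c) (at c)"
  by (simp only: Abel_moment_def[abs_def] power_0 power_one_right mult_1_left)
 have "((\<lambda>c. \<integral>x. (x * y1 (-1 + (1 + c) * x)) * (x powr ((D - 1) / 2 - 1) * (1 - x) powr (1/2 - 1)) \<partial>unit_ivl)
  has_real_derivative (\<integral>x. (x\<^sup>2 * y2 (-1 + (1 + c) * x)) * (x powr ((D - 1) / 2 - 1) * (1 - x) powr (1/2 - 1)) \<partial>unit_ivl)) (at c)"
 proof (rule has_derivative_integral_param(1)[where l=l and r=a and K=K'])
  show "\<bar>x * y1 (-1 + (1 + c') * x)\<bar> \<le> K'" "\<bar>x\<^sup>2 * y2 (-1 + (1 + c') * x)\<bar> \<le> K'" if "c' \<in> {l<..<a}" "x \<in> space unit_ivl" for c' x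
   using b(2,3)[OF _ I(2,3)[OF that(1)], of x] that(2) by (auto simp: K'_def)
  show "(\<lambda>x. x * y1 (-1 + (1 + c') * x)) \<in> borel_measurable unit_ivl" if "c' \<in> {l<..<a}" for c'
   by (rule borel_measurable_times[OF xm C2_weighted_scaled_measurable(2)[OF I(1,3)[OF that]]])
  show "((\<lambda>c. x * y1 (-1 + (1 + c) * x)) has_real_derivative x\<^sup>2 * y2 (-1 + (1 + c') * x)) (at c')"
   if "c' \<in> {l<..<a}" "x \<in> space unit_ivl" for c' x
   by (rule d1[OF that[unfolded space_unit_ivl]])
  show "c \<in> {l<..<a}" using l c by simp
 qed (rule W, simp)
 then show "(Abel_moment D 1 y1 has_real_derivative Abel_moment D 2 y2 c) (at c)"
  by (simp only: Abel_moment_def[abs_def] power_0 power_one_right mult_1_left)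
qed

lemma Abel_moment_bounds:
 assumes c: "-1 < l" "l < c" "c < a"
 shows "\<bar>Abel_moment D 0 y c\<bar> \<le> K * Beta ((D - 1) / 2) (1/2)"
  "\<bar>Abel_moment D 1 y1 c\<bar> \<le> K / (1 + l) * Beta ((D - 1) / 2) (1/2)"
  "\<bar>Abel_moment D 2 y2 c\<bar> \<le> K / (1 + l)\<^sup>2 * Beta ((D - 1) / 2) (1/2)"
proof -
 have W: "integrable unit_ivl (\<lambda>x. x powr ((D - 1) / 2 - 1) * (1 - x) powr (1/2 - 1))"
  "(\<integral>x. x powr ((D - 1) / 2 - 1) * (1 - x) powr (1/2 - 1) \<partial>unit_ivl) = Beta ((D - 1) / 2) (1/2)"
  using D by (intro Beta_weight; simp)+
 note b = C2_weighted_scaled_bounds[OF _ c]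
 show "\<bar>Abel_moment D 0 y c\<bar> \<le> K * Beta ((D - 1) / 2) (1/2)"
  "\<bar>Abel_moment D 1 y1 c\<bar> \<le> K / (1 + l) * Beta ((D - 1) / 2) (1/2)"
  "\<bar>Abel_moment D 2 y2 c\<bar> \<le> K / (1 + l)\<^sup>2 * Beta ((D - 1) / 2) (1/2)"
  unfolding Abel_moment_def W(2)[symmetric]
  by (rule integral_param_bound[OF W(1)]; use b in auto)+
qed

end

definition lower_Abel :: "real \<Rightarrow> (real \<Rightarrow> real) \<Rightarrow> real \<Rightarrow> real" where
 "lower_Abel D y c = (LBINT s:{-1..c}. y s * (1 + s) powr ((D - 3) / 2) * (c - s) powr (-1/2))"

definition upper_Abel :: "real \<Rightarrow> (real \<Rightarrow> real) \<Rightarrow> real \<Rightarrow> real" where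
 "upper_Abel a G v = (LBINT \<tau>:{v..a}. G \<tau> * (\<tau> - v) powr (-1/2))"

text \<open>The derivative of \<open>lower_Abel\<close> divided by the Copson weight, that is, the
  result of the first inversion. It is \<open>aux_g\<close> in the height variable, up to sign and a
  power of 2.\<close>

definition Abel_g :: "real \<Rightarrow> (real \<Rightarrow> real) \<Rightarrow> (real \<Rightarrow> real) \<Rightarrow> real \<Rightarrow> real" where
 "Abel_g D y y1 c = (1 - c) powr ((D - 2) / 2) * ((D - 2) / 2 * Abel_moment D 0 y c + (1 + c) * Abel_moment D 1 y1 c)"

text \<open>The substitution s = -1 + (1+c) x fixes the interval of integration and the singular
  weight, so that the singular moving end point need not be differentiated.\<close>

lemma lower_Abel_scaled:
 assumes c: "-1 < c"
 shows "lower_Abel D y c = (1 + c) powr ((D - 2) / 2) * Abel_moment D 0 y c"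
  and "set_integrable lborel {-1..c} (\<lambda>s. y s * (1 + s) powr ((D - 3) / 2) * (c - s) powr (-1/2))
   \<longleftrightarrow> integrable unit_ivl (\<lambda>x. y (-1 + (1 + c) * x) * (x powr ((D - 1) / 2 - 1) * (1 - x) powr (1/2 - 1)))"
proof -
 let ?f = "\<lambda>s. y s * (1 + s) powr ((D - 3) / 2) * (c - s) powr (-1/2)"
 let ?w = "\<lambda>x. x powr ((D - 1) / 2 - 1) * (1 - x) powr (1/2 - 1)"
 define C where "C = (1 + c) powr ((D - 4) / 2)"
 have C: "C > 0" using c by (simp add: C_def)
 have eq: "?f (-1 + (c - -1) * x) = C * (y (-1 + (1 + c) * x) * ?w x)" if "x \<in> space unit_ivl" for x
 proof -
  have x: "0 < x" "x < 1" using that by auto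
  have e1: "1 + (-1 + (c - -1) * x) = (1 + c) * x" "c - (-1 + (c - -1) * x) = (1 + c) * (1 - x)"
   by (simp_all add: algebra_simps)
  have e2: "(D - 1) / 2 - 1 = (D - 3) / 2" "1/2 - 1 = (-1/2 :: real)" by (simp_all add: field_simps)
  have "(D - 4) / 2 = (D - 3) / 2 + (-1/2)" by (simp add: field_simps)
  then have "C = (1 + c) powr ((D - 3) / 2) * (1 + c) powr (-1/2)"
   unfolding C_def by (simp only: powr_add)
  then show ?thesis unfolding e1 e2 by (simp add: powr_mult mult_ac add.commute)
 qed
 have "lower_Abel D y c = (c - -1) * (\<integral>x. ?f (-1 + (c - -1) * x) \<partial>unit_ivl)"
  unfolding lower_Abel_def using c by (intro LBINT_scale_unit_ivl(1)) simp
 also have "(\<integral>x. ?f (-1 + (c - -1) * x) \<partial>unit_ivl) = (\<integral>x. C * (y (-1 + (1 + c) * x) * ?w x) \<partial>unit_ivl)"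
  by (rule Bochner_Integration.integral_cong[OF refl eq])
 also have "\<dots> = C * Abel_moment D 0 y c" by (simp add: Abel_moment_def)
 also have "(c - -1) * (C * Abel_moment D 0 y c) = ((1 + c) * C) * Abel_moment D 0 y c" by simp
 also have "(1 + c) * C = (1 + c) powr ((D - 2) / 2)"
  using c unfolding C_def by (subst powr_mult_base) (auto simp: field_simps)
 finally show "lower_Abel D y c = (1 + c) powr ((D - 2) / 2) * Abel_moment D 0 y c" .
 have "set_integrable lborel {-1..c} ?f \<longleftrightarrow> integrable unit_ivl (\<lambda>x. ?f (-1 + (c - -1) * x))"
  using c by (intro LBINT_scale_unit_ivl(2)) simp
 also have "\<dots> \<longleftrightarrow> integrable unit_ivl (\<lambda>x. C * (y (-1 + (1 + c) * x) * ?w x))"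
  by (rule Bochner_Integration.integrable_cong[OF refl eq])
 also have "\<dots> \<longleftrightarrow> integrable unit_ivl (\<lambda>x. y (-1 + (1 + c) * x) * ?w x)" using C by simp
 finally show "set_integrable lborel {-1..c} ?f \<longleftrightarrow> integrable unit_ivl (\<lambda>x. y (-1 + (1 + c) * x) * ?w x)" .
qed

lemma lower_Abel_derivative:
 assumes D: "D \<ge> 3" and C2: "C2_weighted a y y1 y2 K" and a: "a < 1" and c: "-1 < c" "c < a"
 shows "(lower_Abel D y has_real_derivative Copson_weight D c * Abel_g D y y1 c) (at c)"
proof -
 define p where "p = (D - 2) / 2"
 have "((\<lambda>c. (1 + c) powr p * Abel_moment D 0 y c) has_real_derivative
   (p * (1 + c) powr (p - 1)) * Abel_moment D 0 y c + (1 + c) powr p * Abel_moment D 1 y1 c) (at c)"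
  using c by (auto intro!: derivative_eq_intros Abel_moment_derivative(1)[OF D C2])
 also have "(p * (1 + c) powr (p - 1)) * Abel_moment D 0 y c + (1 + c) powr p * Abel_moment D 1 y1 c
  = Copson_weight D c * Abel_g D y y1 c"
 proof -
  have e: "(D - 4) / 2 = p - 1" "(D - 2) / 2 = p" by (simp_all add: p_def field_simps)
  have w: "(1 - c) powr (- p) * (1 - c) powr p = 1" using c a by (simp add: powr_add[symmetric])
  have u: "(1 + c) powr p = (1 + c) powr (p - 1) * (1 + c)"
   using c powr_mult_base[of "1 + c" "p - 1"] by (simp add: mult.commute)
  have "Copson_weight D c * Abel_g D y y1 c = ((1 - c) powr (- p) * (1 - c) powr p) * ((1 + c) powr (p - 1) * (p * Abel_moment D 0 y c + (1 + c) * Abel_moment D 1 y1 c))"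
   unfolding Copson_weight_def Abel_g_def e by (simp only: mult_ac)
  then show ?thesis unfolding w u by (simp add: algebra_simps)
 qed
 finally have "((\<lambda>c. (1 + c) powr p * Abel_moment D 0 y c) has_real_derivative Copson_weight D c * Abel_g D y y1 c) (at c)" .
 then show ?thesis
 proof (rule has_field_derivative_transform_within_open[where S="{-1<..}"])
  show "(1 + x) powr p * Abel_moment D 0 y x = lower_Abel D y x" if "x \<in> {-1<..}" for x
   using lower_Abel_scaled(1)[of x D y] that by (simp add: p_def)
 qed (use c in auto)
qed

section \<open>Regularity of the first inversion and of the second transform\<close>

lemma powr_bounded_on_Icc:
 fixes q :: real assumes "a < 1"
 obtains C where "\<And>c. -1 < c \<Longrightarrow> c < a \<Longrightarrow> \<bar>(1 - c) powr q\<bar> \<le> C" "0 \<le> C"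
proof -
 have "compact ((\<lambda>c. (1 - c) powr q) ` {-1..a})"
  using assms by (intro compact_continuous_image continuous_intros) auto
 then obtain C where "\<forall>x\<in>(\<lambda>c. (1 - c) powr q) ` {-1..a}. norm x \<le> C"
  using compact_imp_bounded bounded_iff by metis
 then have "norm ((1 - c) powr q) \<le> C" if "-1 < c" "c < a" for c using that by auto
 then have "\<bar>(1 - c) powr q\<bar> \<le> max C 0" if "-1 < c" "c < a" for c using that by fastforce
 then show ?thesis using that[of "max C 0"] by simp
qed

text \<open>Differentiable with bounds that reach up to the rim a but may degenerate at -1. The rim
  is where the upper Abel integral ends, so uniformity is needed on that side.\<close>

definition nice_on :: "real \<Rightarrow> (real \<Rightarrow> real) \<Rightarrow> (real \<Rightarrow> real) \<Rightarrow> bool" where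
 "nice_on a G G' \<longleftrightarrow> (\<forall>c\<in>{-1<..<a}. (G has_real_derivative G' c) (at c)) \<and>
  (\<forall>l>-1. \<exists>C. \<forall>c\<in>{l<..<a}. \<bar>G c\<bar> \<le> C \<and> \<bar>G' c\<bar> \<le> C)"

lemma nice_onI:
 assumes "\<And>c. -1 < c \<Longrightarrow> c < a \<Longrightarrow> (G has_real_derivative G' c) (at c)"
  "\<And>l. -1 < l \<Longrightarrow> \<exists>C. \<forall>c\<in>{l<..<a}. \<bar>G c\<bar> \<le> C" "\<And>l. -1 < l \<Longrightarrow> \<exists>C. \<forall>c\<in>{l<..<a}. \<bar>G' c\<bar> \<le> C"
 shows "nice_on a G G'"
 unfolding nice_on_def
proof (intro conjI ballI allI impI)
 fix l :: real assume l: "-1 < l"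
 obtain C1 C2 where "\<forall>c\<in>{l<..<a}. \<bar>G c\<bar> \<le> C1" "\<forall>c\<in>{l<..<a}. \<bar>G' c\<bar> \<le> C2"
  using assms(2,3)[OF l] by blast
 then show "\<exists>C. \<forall>c\<in>{l<..<a}. \<bar>G c\<bar> \<le> C \<and> \<bar>G' c\<bar> \<le> C"
  by (intro exI[of _ "max C1 C2"]) fastforce
qed (use assms(1) in auto)

text \<open>\<open>Abel_g\<close> contains first derivatives of y, so its own derivative uses the
  second: this is where the C^2 hypothesis is spent. The powers of 1 - c are harmless because a <
  1.\<close>

lemma nice_on_Abel_g:
 assumes D: "D \<ge> 3" and C2: "C2_weighted a y y1 y2 K" and a: "a < 1"
 shows "\<exists>G'. nice_on a (Abel_g D y y1) G'"
proof -
 define p where "p = (D - 2) / 2"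
 define \<beta> where "\<beta> = Beta ((D - 1) / 2) (1/2)"
 have e: "(D - 2) / 2 = p" by (simp add: p_def)
 have p: "p > 0" using D by (simp add: p_def)
 define H where "H c = p * Abel_moment D 0 y c + (1 + c) * Abel_moment D 1 y1 c" for c
 define H' where "H' c = p * Abel_moment D 1 y1 c + (Abel_moment D 1 y1 c + (1 + c) * Abel_moment D 2 y2 c)" for c
 have dH: "(H has_real_derivative H' c) (at c)" if "-1 < c" "c < a" for c
  unfolding H_def[abs_def] H'_def
  using that by (auto intro!: derivative_eq_intros Abel_moment_derivative[OF D C2] simp del: One_nat_def)
 have g: "Abel_g D y y1 = (\<lambda>c. (1 - c) powr p * H c)" by (simp add: fun_eq_iff Abel_g_def H_def e)
 define G' where "G' c = - (p * (1 - c) powr (p - 1)) * H c + (1 - c) powr p * H' c" for c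
 have Hb: "\<exists>C\<ge>0. \<forall>c\<in>{l<..<a}. \<bar>H c\<bar> \<le> C \<and> \<bar>H' c\<bar> \<le> C" if l: "-1 < l" for l
 proof (cases "l < a")
  case True
  define B where "B = max (\<bar>K * \<beta>\<bar>) (max \<bar>K / (1 + l) * \<beta>\<bar> \<bar>K / (1 + l)\<^sup>2 * \<beta>\<bar>)"
  have B: "\<bar>Abel_moment D 0 y c\<bar> \<le> B" "\<bar>Abel_moment D 1 y1 c\<bar> \<le> B" "\<bar>Abel_moment D 2 y2 c\<bar> \<le> B" if "c \<in> {l<..<a}" for c
  proof -
   have "K * \<beta> \<le> B" "K / (1 + l) * \<beta> \<le> B" "K / (1 + l)\<^sup>2 * \<beta> \<le> B" unfolding B_def by linarith+
   moreover have "l < c" "c < a" using that by auto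
   note Abel_moment_bounds[OF D C2 l this, folded \<beta>_def]
   ultimately show "\<bar>Abel_moment D 0 y c\<bar> \<le> B" "\<bar>Abel_moment D 1 y1 c\<bar> \<le> B" "\<bar>Abel_moment D 2 y2 c\<bar> \<le> B"
    by (blast intro: order_trans)+
  qed
  have B0: "B \<ge> 0" by (simp add: B_def)
  show ?thesis
  proof (intro exI[of _ "(p + 5) * B"] conjI ballI)
   show "0 \<le> (p + 5) * B" using B0 p by simp
   fix c assume c: "c \<in> {l<..<a}"
   have c1: "0 \<le> 1 + c" "1 + c \<le> 2" using c l a by auto
   have m: "\<bar>p * x\<bar> \<le> p * B" "\<bar>(1 + c) * x\<bar> \<le> 2 * B" if "\<bar>x\<bar> \<le> B" for x
    using that p c1 B0 by (simp_all add: abs_mult mult_left_mono mult_mono)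
   have "\<bar>H c\<bar> \<le> p * B + 2 * B" "\<bar>H' c\<bar> \<le> p * B + (B + 2 * B)"
    unfolding H_def H'_def using m[OF B(1)[OF c]] m[OF B(2)[OF c]] m[OF B(3)[OF c]] B(2)[OF c] by linarith+
   moreover have "p * B + 2 * B \<le> (p + 5) * B" "p * B + (B + 2 * B) \<le> (p + 5) * B"
    using B0 by (simp_all add: algebra_simps)
   ultimately show "\<bar>H c\<bar> \<le> (p + 5) * B" "\<bar>H' c\<bar> \<le> (p + 5) * B" by linarith+
  qed
 qed auto
 obtain C1 where C1: "\<And>c. -1 < c \<Longrightarrow> c < a \<Longrightarrow> \<bar>(1 - c) powr p\<bar> \<le> C1" "0 \<le> C1"
  using powr_bounded_on_Icc[OF a] by blast
 obtain C2 where C2: "\<And>c. -1 < c \<Longrightarrow> c < a \<Longrightarrow> \<bar>(1 - c) powr (p - 1)\<bar> \<le> C2" "0 \<le> C2"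
  using powr_bounded_on_Icc[OF a] by blast
 have "nice_on a (Abel_g D y y1) G'"
 proof (rule nice_onI)
  show "(Abel_g D y y1 has_real_derivative G' c) (at c)" if "-1 < c" "c < a" for c
   unfolding g G'_def using that a
   by (auto intro!: derivative_eq_intros dH)
  fix l :: real assume l: "-1 < l"
  obtain B where B: "0 \<le> B" "\<And>c. c \<in> {l<..<a} \<Longrightarrow> \<bar>H c\<bar> \<le> B" "\<And>c. c \<in> {l<..<a} \<Longrightarrow> \<bar>H' c\<bar> \<le> B" using Hb[OF l] by blast
  have b1: "\<bar>(1 - c) powr p * H c\<bar> \<le> C1 * B" "\<bar>(1 - c) powr p * H' c\<bar> \<le> C1 * B"
   "\<bar>(1 - c) powr (p - 1) * H c\<bar> \<le> C2 * B" if "c \<in> {l<..<a}" for c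
   unfolding abs_mult using that l C1 C2 B by (auto intro!: mult_mono)
  then show "\<exists>C. \<forall>c\<in>{l<..<a}. \<bar>Abel_g D y y1 c\<bar> \<le> C" unfolding g by blast
  have "\<bar>G' c\<bar> \<le> p * (C2 * B) + C1 * B" if "c \<in> {l<..<a}" for c
  proof -
   have "\<bar>G' c\<bar> \<le> \<bar>p * ((1 - c) powr (p - 1) * H c)\<bar> + \<bar>(1 - c) powr p * H' c\<bar>"
    unfolding G'_def by (rule order_trans[OF abs_triangle_ineq]) (simp add: abs_mult)
   also have "\<bar>p * ((1 - c) powr (p - 1) * H c)\<bar> \<le> p * (C2 * B)"
    using p b1(3)[OF that] by (simp add: abs_mult[of p] mult_left_mono del: abs_mult)
   finally show ?thesis using b1(2)[OF that] by linarith
  qed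
  then show "\<exists>C. \<forall>c\<in>{l<..<a}. \<bar>G' c\<bar> \<le> C" by blast
 qed
 then show ?thesis by blast
qed

text \<open>The factor \<open>(1 - x) powr (1 - 1)\<close> equals 1 on the open interval; it is
  written so that \<open>Beta_weight\<close> applies literally.\<close>

lemma upper_Abel_scaled:
 assumes v: "v < a"
 shows "upper_Abel a G v = sqrt (a - v) * (\<integral>x. G (v + (a - v) * x) * (x powr (1/2 - 1) * (1 - x) powr (1 - 1)) \<partial>unit_ivl)"
  and "set_integrable lborel {v..a} (\<lambda>\<tau>. G \<tau> * (\<tau> - v) powr (-1/2)) \<longleftrightarrow>
   integrable unit_ivl (\<lambda>x. G (v + (a - v) * x) * (x powr (1/2 - 1) * (1 - x) powr (1 - 1)))"
proof -
 let ?f = "\<lambda>\<tau>. G \<tau> * (\<tau> - v) powr (-1/2)"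
 let ?w = "\<lambda>x::real. x powr (1/2 - 1) * (1 - x) powr (1 - 1)"
 define C where "C = (a - v) powr (-1/2)"
 have C: "C > 0" using v by (simp add: C_def)
 have eq: "?f (v + (a - v) * x) = C * (G (v + (a - v) * x) * ?w x)" if "x \<in> space unit_ivl" for x
  using that v by (simp add: C_def powr_mult)
 have "upper_Abel a G v = (a - v) * (\<integral>x. ?f (v + (a - v) * x) \<partial>unit_ivl)"
  unfolding upper_Abel_def using v by (intro LBINT_scale_unit_ivl(1)) simp
 also have "(\<integral>x. ?f (v + (a - v) * x) \<partial>unit_ivl) = (\<integral>x. C * (G (v + (a - v) * x) * ?w x) \<partial>unit_ivl)"
  by (rule Bochner_Integration.integral_cong[OF refl eq])
 also have "\<dots> = C * (\<integral>x. G (v + (a - v) * x) * ?w x \<partial>unit_ivl)" by simp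
 also have "(a - v) * (C * (\<integral>x. G (v + (a - v) * x) * ?w x \<partial>unit_ivl)) = ((a - v) * C) * (\<integral>x. G (v + (a - v) * x) * ?w x \<partial>unit_ivl)" by simp
 also have "(a - v) * C = sqrt (a - v)"
  using v unfolding C_def by (subst powr_mult_base) (auto simp: powr_half_sqrt)
 finally show "upper_Abel a G v = sqrt (a - v) * (\<integral>x. G (v + (a - v) * x) * ?w x \<partial>unit_ivl)" .
 have "set_integrable lborel {v..a} ?f \<longleftrightarrow> integrable unit_ivl (\<lambda>x. ?f (v + (a - v) * x))"
  using v by (intro LBINT_scale_unit_ivl(2)) simp
 also have "\<dots> \<longleftrightarrow> integrable unit_ivl (\<lambda>x. C * (G (v + (a - v) * x) * ?w x))"
  by (rule Bochner_Integration.integrable_cong[OF refl eq])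
 also have "\<dots> \<longleftrightarrow> integrable unit_ivl (\<lambda>x. G (v + (a - v) * x) * ?w x)" using C by simp
 finally show "set_integrable lborel {v..a} ?f \<longleftrightarrow> integrable unit_ivl (\<lambda>x. G (v + (a - v) * x) * ?w x)" .
qed

lemma unit_ivl_scaled_upper:
 assumes "x \<in> {0<..<1::real}" "v < a"
 shows "v + (a - v) * x \<in> {v<..<a}"
proof -
 have "0 < (a - v) * x" using assms by simp
 moreover have "(a - v) * x < (a - v) * 1" using assms by (intro mult_strict_left_mono) auto
 ultimately show ?thesis unfolding greaterThanLessThan_iff mult_1_right by linarith
qed

text \<open>After rescaling, the transform is sqrt(a - v) times a smooth function of v that stays
  bounded at the rim, whence the limit 0. The derivative is left as an unspecified function, since
  the theorem itself expresses F through a derivative.\<close>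

lemma nice_on_upper_Abel:
 assumes G: "nice_on a G G'"
 shows "\<exists>B'. \<forall>v\<in>{-1<..<a}. (upper_Abel a G has_real_derivative B' v) (at v)"
  and "-1 < a \<Longrightarrow> (upper_Abel a G \<longlongrightarrow> 0) (at_left a)"
  and "-1 < v \<Longrightarrow> v < a \<Longrightarrow> set_integrable lborel {v..a} (\<lambda>\<tau>. G \<tau> * (\<tau> - v) powr (-1/2))"
proof -
 let ?w = "\<lambda>x::real. x powr (1/2 - 1) * (1 - x) powr (1 - 1)"
 have W: "integrable unit_ivl ?w" by (rule Beta_weight(1)) auto
 have dG: "(G has_real_derivative G' c) (at c)" if "-1 < c" "c < a" for c
  using G that by (auto simp: nice_on_def)
 then have cG: "continuous_on {-1<..<a} G"
  by (auto intro!: continuous_at_imp_continuous_on DERIV_isCont)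
 define R where "R v = (\<integral>x. G (v + (a - v) * x) * ?w x \<partial>unit_ivl)" for v
 have m: "(\<lambda>x. G (v + (a - v) * x)) \<in> borel_measurable unit_ivl" if v: "-1 < v" "v < a" for v
 proof (rule continuous_on_unit_ivl_measurable, rule continuous_on_compose2[OF cG])
  show "(\<lambda>x. v + (a - v) * x) ` {0<..<1} \<subseteq> {-1<..<a}"
   using unit_ivl_scaled_upper[OF _ v(2)] v(1) by fastforce
 qed (intro continuous_intros)
 have bd: "\<exists>C. \<forall>v\<in>{l<..<a}. \<forall>x\<in>{0<..<1}. \<bar>G (v + (a - v) * x)\<bar> \<le> C \<and> \<bar>(1 - x) * G' (v + (a - v) * x)\<bar> \<le> C" if l: "-1 < l" for l
 proof -
  obtain C where C: "\<forall>c\<in>{l<..<a}. \<bar>G c\<bar> \<le> C \<and> \<bar>G' c\<bar> \<le> C" using G l by (auto simp: nice_on_def)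
  have "\<bar>G (v + (a - v) * x)\<bar> \<le> C \<and> \<bar>(1 - x) * G' (v + (a - v) * x)\<bar> \<le> C" if v: "v \<in> {l<..<a}" and x: "x \<in> {0<..<1}" for v x
  proof -
   have "v + (a - v) * x \<in> {l<..<a}" using unit_ivl_scaled_upper[OF x, of v a] v by auto
   then have b: "\<bar>G (v + (a - v) * x)\<bar> \<le> C" "\<bar>G' (v + (a - v) * x)\<bar> \<le> C" using C by auto
   have "\<bar>(1 - x) * G' (v + (a - v) * x)\<bar> \<le> 1 * \<bar>G' (v + (a - v) * x)\<bar>"
    unfolding abs_mult using x by (intro mult_right_mono) auto
   then show ?thesis using b by linarith
  qed
  then show ?thesis by blast
 qed
 have dR: "\<exists>d. (R has_real_derivative d) (at v)" if v: "-1 < v" "v < a" for v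
 proof -
  define l where "l = (-1 + v) / 2"
  have l: "-1 < l" "l < v" using v by (auto simp: l_def field_simps)
  obtain C where C: "\<forall>v\<in>{l<..<a}. \<forall>x\<in>{0<..<1}. \<bar>G (v + (a - v) * x)\<bar> \<le> C \<and> \<bar>(1 - x) * G' (v + (a - v) * x)\<bar> \<le> C" using bd[OF l(1)] by blast
  have "(R has_real_derivative (\<integral>x. ((1 - x) * G' (v + (a - v) * x)) * ?w x \<partial>unit_ivl)) (at v)"
   unfolding R_def[abs_def]
  proof (rule has_derivative_integral_param(1)[where l=l and r=a and K=C])
   fix v' x assume v': "v' \<in> {l<..<a}" and x: "x \<in> space unit_ivl"
   have "v' + (a - v') * x \<in> {v'<..<a}" using unit_ivl_scaled_upper[of x v' a] v' x by auto
   then have d: "(G has_real_derivative G' (v' + (a - v') * x)) (at (v' + (a - v') * x))" using v' l by (intro dG) auto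
   have "((\<lambda>v. v + (a - v) * x) has_real_derivative (1 - x)) (at v')"
    by (auto intro!: derivative_eq_intros)
   from DERIV_chain2[OF d this]
   show "((\<lambda>v. G (v + (a - v) * x)) has_real_derivative (1 - x) * G' (v' + (a - v') * x)) (at v')"
    by (simp only: mult.commute)
  next
   show "(\<lambda>x. G (v' + (a - v') * x)) \<in> borel_measurable unit_ivl" if "v' \<in> {l<..<a}" for v'
    using that l by (intro m) auto
   show "\<bar>G (v' + (a - v') * x)\<bar> \<le> C" "\<bar>(1 - x) * G' (v' + (a - v') * x)\<bar> \<le> C"
    if "v' \<in> {l<..<a}" "x \<in> space unit_ivl" for v' x
    using C that by (simp_all only: space_unit_ivl)
   show "v \<in> {l<..<a}" using l v by simp
  qed (rule W, simp)
  then show ?thesis by blast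
 qed
 have "\<exists>d. (upper_Abel a G has_real_derivative d) (at v)" if v: "v \<in> {-1<..<a}" for v
 proof -
  obtain d where d: "(R has_real_derivative d) (at v)" using dR v by auto
  have "((\<lambda>v. sqrt (a - v) * R v) has_real_derivative (- inverse (sqrt (a - v)) / 2 * R v + sqrt (a - v) * d)) (at v)"
   using v by (auto intro!: derivative_eq_intros d)
  then have "(upper_Abel a G has_real_derivative (- inverse (sqrt (a - v)) / 2 * R v + sqrt (a - v) * d)) (at v)"
   by (rule has_field_derivative_transform_within_open[where S="{..<a}"]) (use v in \<open>auto simp: upper_Abel_scaled(1) R_def\<close>)
  then show ?thesis by blast
 qed
 then show "\<exists>B'. \<forall>v\<in>{-1<..<a}. (upper_Abel a G has_real_derivative B' v) (at v)" by metis
 show "set_integrable lborel {v..a} (\<lambda>\<tau>. G \<tau> * (\<tau> - v) powr (-1/2))" if v: "-1 < v" "v < a"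
 proof -
  define l where "l = (-1 + v) / 2"
  have l: "-1 < l" "l < v" using v by (auto simp: l_def field_simps)
  obtain C where C: "\<forall>v\<in>{l<..<a}. \<forall>x\<in>{0<..<1}. \<bar>G (v + (a - v) * x)\<bar> \<le> C \<and> \<bar>(1 - x) * G' (v + (a - v) * x)\<bar> \<le> C" using bd[OF l(1)] by blast
  have "integrable unit_ivl (\<lambda>x. G (v + (a - v) * x) * ?w x)"
  proof (rule Bochner_Integration.integrable_bound[where f="\<lambda>x. C * ?w x"])
   show "integrable unit_ivl (\<lambda>x. C * ?w x)" using W by simp
   show "(\<lambda>x. G (v + (a - v) * x) * ?w x) \<in> borel_measurable unit_ivl"
    by (rule borel_measurable_times[OF m[OF v] borel_measurable_integrable[OF W]])
   show "AE x in unit_ivl. norm (G (v + (a - v) * x) * ?w x) \<le> norm (C * ?w x)"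
   proof (rule AE_I2)
    fix x assume "x \<in> space unit_ivl"
    then have "\<bar>G (v + (a - v) * x)\<bar> \<le> C" using C v l by simp
    then have "\<bar>G (v + (a - v) * x)\<bar> \<le> \<bar>C\<bar>" by linarith
    then show "norm (G (v + (a - v) * x) * ?w x) \<le> norm (C * ?w x)"
     unfolding real_norm_def abs_mult by (intro mult_right_mono) auto
   qed
  qed
  then show ?thesis using upper_Abel_scaled(2)[OF v(2)] by blast
 qed
 show "(upper_Abel a G \<longlongrightarrow> 0) (at_left a)" if a: "-1 < a"
 proof -
  define l where "l = (-1 + a) / 2"
  have l: "-1 < l" "l < a" using a by (auto simp: l_def field_simps)
  obtain C where C: "\<forall>v\<in>{l<..<a}. \<forall>x\<in>{0<..<1}. \<bar>G (v + (a - v) * x)\<bar> \<le> C \<and> \<bar>(1 - x) * G' (v + (a - v) * x)\<bar> \<le> C" using bd[OF l(1)] by blast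
  define M where "M = C * (\<integral>x. ?w x \<partial>unit_ivl)"
  have "\<bar>upper_Abel a G v\<bar> \<le> sqrt (a - v) * M" if "v \<in> {l<..<a}" for v
  proof -
   have "\<bar>R v\<bar> \<le> M" unfolding R_def M_def
    by (rule integral_param_bound[OF W]) (use C that in auto)
   moreover have "upper_Abel a G v = sqrt (a - v) * R v"
    unfolding R_def by (rule upper_Abel_scaled(1)) (use that in simp)
   ultimately show ?thesis using that by (simp add: abs_mult mult_left_mono)
  qed
  moreover have "((\<lambda>v. sqrt (a - v) * M) \<longlongrightarrow> sqrt (a - a) * M) (at_left a)"
   by (intro tendsto_intros)
  moreover have "eventually (\<lambda>v. v \<in> {l<..<a}) (at_left a)"
   using l by (simp add: eventually_at_left_field) auto
  ultimately show ?thesis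
   by (intro Lim_null_comparison[of "upper_Abel a G" "\<lambda>v. sqrt (a - v) * M"]) (auto elim: eventually_mono)
 qed
qed

section \<open>The density for a constant potential\<close>

text \<open>The derivative may be unbounded at a, as the density in the theorem is at the rim; so
  the fundamental theorem is used on compact subintervals, followed by a monotone limit.\<close>

lemma nn_integral_FTC_Ioo_decreasing:
 fixes B \<beta> :: "real \<Rightarrow> real"
 assumes ca: "c < a" and \<beta>m: "\<beta> \<in> borel_measurable borel"
  and d: "\<And>v. c \<le> v \<Longrightarrow> v < a \<Longrightarrow> (B has_real_derivative - \<beta> v) (at v)"
  and nn: "\<And>v. c \<le> v \<Longrightarrow> v < a \<Longrightarrow> 0 \<le> \<beta> v"
  and lim: "(B \<longlongrightarrow> 0) (at_left a)"
 shows "(\<integral>\<^sup>+v\<in>{c<..<a}. ennreal (\<beta> v) \<partial>lborel) = ennreal (B c)"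
proof -
 define dn where "dn n = a - (a - c) / (real n + 2)" for n
 have dn: "c < dn n" "dn n < a" for n
 proof -
  have "(a - c) / (real n + 2) < (a - c) / 1" using ca by (intro divide_strict_left_mono) auto
  then show "c < dn n" by (simp add: dn_def)
  show "dn n < a" using ca by (simp add: dn_def)
 qed
 have dnlim: "dn \<longlonglongrightarrow> a" unfolding dn_def
  using tendsto_diff[OF tendsto_const LIMSEQ_divide_add_two, of a "a - c"] by simp
 have inc: "mono dn"
 proof (rule monoI)
  fix m n :: nat assume "m \<le> n"
  then have "(a - c) / (real n + 2) \<le> (a - c) / (real m + 2)" using ca by (intro divide_left_mono) auto
  then show "dn m \<le> dn n" by (simp add: dn_def)
 qed
 have I: "(\<integral>\<^sup>+v\<in>{c..dn n}. ennreal (\<beta> v) \<partial>lborel) = ennreal (B c - B (dn n))" for n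
 proof -
  have "(\<integral>\<^sup>+v\<in>{c..dn n}. ennreal (\<beta> v) \<partial>lborel) = ennreal ((- B (dn n)) - (- B c))"
  proof (rule nn_integral_FTC_Icc[OF \<beta>m])
   show "((\<lambda>x. - B x) has_real_derivative \<beta> x) (at x)" if "x \<in> {c..dn n}" for x
   proof -
    have "c \<le> x" "x < a" using that dn[of n] by auto
    from DERIV_minus[OF d[OF this]] show ?thesis by simp
   qed
   show "c \<le> dn n" using dn[of n] by simp
   show "0 \<le> \<beta> x" if "x \<in> {c..dn n}" for x using that dn[of n] by (intro nn) auto
  qed
  then show ?thesis by simp
 qed
 have "(\<integral>\<^sup>+v\<in>{c<..<a}. ennreal (\<beta> v) \<partial>lborel) = (\<integral>\<^sup>+v. (SUP n. ennreal (\<beta> v) * indicator {c..dn n} v) \<partial>lborel)"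
 proof (rule nn_integral_cong_AE, use AE_lborel_singleton[of c] in eventually_elim)
  fix v assume vc: "v \<noteq> c"
  show "ennreal (\<beta> v) * indicator {c<..<a} v = (SUP n. ennreal (\<beta> v) * indicator {c..dn n} v)"
  proof (cases "v \<in> {c<..<a}")
   case True
   have "eventually (\<lambda>n. v < dn n) sequentially" using dnlim True by (auto dest: order_tendstoD)
   then obtain n where n: "v < dn n" by (auto simp: eventually_sequentially)
   show ?thesis
   proof (intro antisym SUP_least)
    show "ennreal (\<beta> v) * indicator {c<..<a} v \<le> (SUP n. ennreal (\<beta> v) * indicator {c..dn n} v)"
     using True n by (intro SUP_upper2[of n]) (auto simp: indicator_def)
   qed (use True in \<open>auto simp: indicator_def\<close>)
  next
   case False
   then have "v \<notin> {c..dn n}" for n using vc dn[of n] by auto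
   then show ?thesis using False by simp
  qed
 qed
 also have "\<dots> = (SUP n. \<integral>\<^sup>+v\<in>{c..dn n}. ennreal (\<beta> v) \<partial>lborel)"
  using \<beta>m monoD[OF inc]
  by (intro nn_integral_monotone_convergence_SUP) (auto simp: incseq_def le_fun_def indicator_def intro: order_trans)
 also have "\<dots> = ennreal (B c)"
 proof (rule LIMSEQ_unique)
  show "(\<lambda>n. \<integral>\<^sup>+v\<in>{c..dn n}. ennreal (\<beta> v) \<partial>lborel) \<longlonglongrightarrow> (SUP n. \<integral>\<^sup>+v\<in>{c..dn n}. ennreal (\<beta> v) \<partial>lborel)"
  proof (intro LIMSEQ_SUP incseq_SucI nn_integral_mono mult_left_mono)
   show "indicator {c..dn n} x \<le> (indicator {c..dn (Suc n)} x :: ennreal)" for n x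
    using monoD[OF inc, of n "Suc n"] by (auto simp: indicator_def)
  qed simp
  have "(\<lambda>n. B (dn n)) \<longlonglongrightarrow> 0"
  proof (rule filterlim_compose[OF lim])
   show "filterlim dn (at_left a) sequentially"
    using dnlim dn(2) by (intro tendsto_imp_filterlim_at_left) auto
  qed
  then have "(\<lambda>n. ennreal (B c - B (dn n))) \<longlonglongrightarrow> ennreal (B c - 0)"
   by (intro tendsto_ennrealI tendsto_diff tendsto_const)
  then show "(\<lambda>n. \<integral>\<^sup>+v\<in>{c..dn n}. ennreal (\<beta> v) \<partial>lborel) \<longlonglongrightarrow> ennreal (B c)" unfolding I by simp
 qed
 finally show ?thesis .
qed

section \<open>The hypergeometric function as an incomplete Beta integral\<close>

definition hyp_coeff :: "real \<Rightarrow> nat \<Rightarrow> real" where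
 "hyp_coeff b n = pochhammer b n / pochhammer (1/2) n"

lemma hypergeom_2F1_eq: "hypergeom_2F1 1 b (1/2) z = (\<Sum>n. hyp_coeff b n * z ^ n)"
 unfolding hypergeom_2F1_def hyp_coeff_def by (simp add: pochhammer_fact[symmetric])

lemma hyp_coeff_Suc: "hyp_coeff b (Suc n) * (1/2 + real n) = hyp_coeff b n * (b + real n)"
 by (simp add: hyp_coeff_def pochhammer_Suc divide_simps)

lemma hyp_coeff_nonneg: "b > 0 \<Longrightarrow> hyp_coeff b n \<ge> 0"
 by (simp add: hyp_coeff_def pochhammer_nonneg)

lemma hyp_summable:
 assumes b: "b > 0" and z: "\<bar>z\<bar> < 1"
 shows "summable (\<lambda>n. hyp_coeff b n * z ^ n)"
proof -
 define r where "r = \<bar>z\<bar>"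
 define c where "c = (1 + r) / 2"
 have r: "0 \<le> r" "r < 1" using z by (auto simp: r_def)
 have c: "r < c" "c < 1" using r by (auto simp: c_def)
 \<comment> \<open>Beyond N the coefficient ratio (b + n) / (1/2 + n), multiplied by r, is at most c
   < 1.\<close>
 obtain N where N: "b * r / (c - r) < real N" using reals_Archimedean2 by blast
 show ?thesis
 proof (rule summable_ratio_test[OF c(2)])
  fix n assume n: "N \<le> n"
  have "b * r < real N * (c - r)" using N c by (simp add: field_simps)
  also have "\<dots> \<le> real n * (c - r)" using n c by (intro mult_right_mono) auto
  finally have "(b + real n) * r \<le> c * (1/2 + real n)"
   using c r by (simp add: algebra_simps)
  then have "hyp_coeff b n * ((b + real n) * r) \<le> hyp_coeff b n * (c * (1/2 + real n))"
   using hyp_coeff_nonneg[OF b] by (intro mult_left_mono)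
  then have "hyp_coeff b (Suc n) * r * (1/2 + real n) \<le> c * hyp_coeff b n * (1/2 + real n)"
   using hyp_coeff_Suc[of b n] by (simp add: mult_ac)
  then have "hyp_coeff b (Suc n) * r \<le> c * hyp_coeff b n" by (rule mult_right_le_imp_le) simp
  then have "hyp_coeff b (Suc n) * r * r ^ n \<le> c * hyp_coeff b n * r ^ n" using r by (intro mult_right_mono) auto
  then show "norm (hyp_coeff b (Suc n) * z ^ Suc n) \<le> c * norm (hyp_coeff b n * z ^ n)"
   using hyp_coeff_nonneg[OF b] by (simp add: abs_mult power_abs r_def mult_ac)
 qed
qed

text \<open>The differential equation \<open>(1 - z) y' = b y + (y - 1) / (2 z)\<close> of \<open>y = \<^sub>2F\<^sub>1(1, b; 1/2; z)\<close> is first order,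
 because one numerator parameter is \<open>1\<close>.\<close>

lemma hypergeom_2F1_ODE:
 assumes b: "b > 0" and z: "0 < z" "z < 1"
 shows "\<exists>d. (hypergeom_2F1 1 b (1/2) has_real_derivative d) (at z) \<and>
  (1 - z) * d = b * hypergeom_2F1 1 b (1/2) z + (hypergeom_2F1 1 b (1/2) z - 1) / (2 * z)"
proof -
 let ?T = "hyp_coeff b"
 define F where "F z = (\<Sum>n. ?T n * z ^ n)" for z
 have Feq: "hypergeom_2F1 1 b (1/2) = F" by (simp add: fun_eq_iff hypergeom_2F1_eq F_def)
 define K where "K = (1 + z) / 2"
 have K: "z < K" "K < 1" using z by (auto simp: K_def)
 have sK: "summable (\<lambda>n. ?T n * K ^ n)" using hyp_summable[OF b, of K] K z by simp
 have zK: "norm z < norm K" using K z by simp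
 define d where "d = (\<Sum>n. diffs ?T n * z ^ n)"
 have der: "(F has_real_derivative d) (at z)" unfolding F_def[abs_def] d_def
  by (rule termdiffs_strong[OF sK zK])
 have sd: "(\<lambda>n. diffs ?T n * z ^ n) sums d" unfolding d_def
  by (intro summable_sums termdiff_converges[of z K]) (use K z hyp_summable[OF b] in auto)
 have sF: "(\<lambda>n. ?T n * z ^ n) sums F z" unfolding F_def
  using hyp_summable[OF b, of z] z by (intro summable_sums) auto
 have s1: "(\<lambda>n. real n * ?T n * z ^ n) sums (z * d)"
 proof -
  have "(\<lambda>n. z * (diffs ?T n * z ^ n)) sums (z * d)" by (rule sums_mult[OF sd])
  then have "(\<lambda>n. real (Suc n) * ?T (Suc n) * z ^ Suc n) sums (z * d)"
   by (simp add: diffs_def mult_ac)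
  then show ?thesis by (subst (asm) sums_Suc_iff) simp
 qed
 have s2: "(\<lambda>n. ?T (Suc n) * z ^ n) sums ((F z - 1) / z)"
 proof -
  have "(\<lambda>n. ?T (Suc n) * z ^ Suc n) sums (F z - 1)"
   using sF by (subst sums_Suc_iff) (simp add: hyp_coeff_def)
  then have "(\<lambda>n. ?T (Suc n) * z ^ Suc n / z) sums ((F z - 1) / z)" by (rule sums_divide)
  then show ?thesis using z by simp
 qed
 have "(\<lambda>n. b * (?T n * z ^ n) + real n * ?T n * z ^ n + 1/2 * (?T (Suc n) * z ^ n)) sums (b * F z + z * d + 1/2 * ((F z - 1) / z))"
  by (intro sums_add sums_mult sF s1 s2)
 moreover have "b * (?T n * z ^ n) + real n * ?T n * z ^ n + 1/2 * (?T (Suc n) * z ^ n) = diffs ?T n * z ^ n" for n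
 proof -
  have "diffs ?T n = ?T (Suc n) * (1/2 + real n) + 1/2 * ?T (Suc n)" by (simp add: diffs_def algebra_simps)
  then show ?thesis unfolding hyp_coeff_Suc by (simp add: algebra_simps)
 qed
 ultimately have "d = b * F z + z * d + 1/2 * ((F z - 1) / z)" using sd sums_unique2 by simp
 then have "(1 - z) * d = b * F z + (F z - 1) / (2 * z)" using z by (simp add: field_simps)
 then show ?thesis using der unfolding Feq by blast
qed

lemma hypergeom_2F1_nonneg:
 assumes "b > 0" "0 \<le> z" "z < 1"
 shows "hypergeom_2F1 1 b (1/2) z \<ge> 0"
 unfolding hypergeom_2F1_eq using assms hyp_summable[of b z] hyp_coeff_nonneg
 by (intro suminf_nonneg) auto

text \<open>The incomplete Beta function with parameters 1/2 and p + 1, expressed through the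
  hypergeometric function. Subtracting 1 removes the singularity of z^(-1/2) at 0.\<close>

definition Beta_antideriv :: "real \<Rightarrow> real \<Rightarrow> real" where
 "Beta_antideriv p z = 1 / (p + 1/2) * (z powr (-1/2) * (1 - z) powr (p + 1) * (hypergeom_2F1 1 (p + 1/2) (1/2) z - 1))"

lemma Beta_antideriv_derivative:
 assumes p: "p > 0" and z: "0 < z" "z < 1"
 shows "(Beta_antideriv p has_real_derivative z powr (-1/2) * (1 - z) powr p) (at z)"
proof -
 define b where "b = p + 1/2"
 have b: "b > 0" using p by (simp add: b_def)
 let ?F = "hypergeom_2F1 1 b (1/2)"
 obtain d where d: "(?F has_real_derivative d) (at z)" "(1 - z) * d = b * ?F z + (?F z - 1) / (2 * z)"
  using hypergeom_2F1_ODE[OF b z] by blast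
 define P where "P = z powr (-1/2)"
 define Q where "Q = (1 - z) powr p"
 have PP: "z powr (-1/2 - 1) = P / z" using z powr_diff[of z "-1/2" 1] by (simp add: P_def)
 have QQ: "(1 - z) powr (p + 1) = Q * (1 - z)" using z by (simp add: Q_def powr_add)
 have "((\<lambda>z. 1 / b * (z powr (-1/2) * (1 - z) powr (p + 1) * (?F z - 1))) has_real_derivative
  1 / b * (((-1/2) * z powr (-1/2 - 1) * (1 - z) powr (p + 1) + z powr (-1/2) * (- ((p + 1) * (1 - z) powr p))) * (?F z - 1)
    + z powr (-1/2) * (1 - z) powr (p + 1) * d)) (at z)"
  using z b by (auto intro!: derivative_eq_intros d(1))
 also have "1 / b * (((-1/2) * z powr (-1/2 - 1) * (1 - z) powr (p + 1) + z powr (-1/2) * (- ((p + 1) * (1 - z) powr p))) * (?F z - 1)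
    + z powr (-1/2) * (1 - z) powr (p + 1) * d) = P * Q"
 proof -
  have "((-1/2) * (P / z) * (Q * (1 - z)) + P * (- ((p + 1) * Q))) * (?F z - 1) + P * (Q * (1 - z)) * d
   = P * Q * (((-1/2) * ((1 - z) / z) - (p + 1)) * (?F z - 1) + (1 - z) * d)"
   using z by (simp add: field_simps)
  \<comment> \<open>The differential equation replaces (1 - z) d; all terms in F - 1 then combine to
    -b (F - 1), and adding b F leaves b.\<close>
  also have "((-1/2) * ((1 - z) / z) - (p + 1)) * (?F z - 1) + (1 - z) * d = b"
   unfolding d(2) using z by (simp add: b_def field_simps)
  finally show ?thesis unfolding PP QQ P_def[symmetric] Q_def[symmetric] using b by simp
 qed
 finally show ?thesis unfolding Beta_antideriv_def[abs_def] b_def P_def Q_def .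
qed

lemma Beta_antideriv_tendsto_0:
 assumes p: "p > 0"
 shows "(Beta_antideriv p \<longlongrightarrow> 0) (at_right 0)"
proof -
 define b where "b = p + 1/2"
 have b: "b > 0" using p by (simp add: b_def)
 let ?F = "hypergeom_2F1 1 b (1/2)"
 define K :: real where "K = 1/2"
 \<comment> \<open>\<open>?F z - 1\<close> is \<open>O(z)\<close>, which beats \<open>z\<^sup>-\<^sup>1\<^sup>/\<^sup>2\<close>.\<close>
 have s: "summable (\<lambda>n. hyp_coeff b (Suc n) * K ^ n)"
 proof -
  have "summable (\<lambda>n. hyp_coeff b (Suc n) * K ^ Suc n)"
   using hyp_summable[OF b, of K] by (subst summable_Suc_iff) (simp add: K_def)
  then have "summable (\<lambda>n. hyp_coeff b (Suc n) * K ^ Suc n / K)" by (rule summable_divide)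
  then show ?thesis by (simp add: K_def)
 qed
 define G where "G z = (\<Sum>n. hyp_coeff b (Suc n) * z ^ n)" for z
 have "isCont G 0" unfolding G_def[abs_def] by (rule isCont_powser[OF s]) (simp add: K_def)
 then have G: "(G \<longlongrightarrow> G 0) (at_right 0)"
  unfolding isCont_def by (rule tendsto_mono[OF at_le, rotated]) simp
 have FG: "?F z - 1 = z * G z" if z: "0 < z" "z < 1/2" for z
 proof -
  have sz: "summable (\<lambda>n. hyp_coeff b n * z ^ n)" using hyp_summable[OF b, of z] z by simp
  have "?F z = hyp_coeff b 0 + (\<Sum>n. hyp_coeff b (Suc n) * z ^ Suc n)"
   unfolding hypergeom_2F1_eq using suminf_split_head[OF sz] by simp
  also have "(\<Sum>n. hyp_coeff b (Suc n) * z ^ Suc n) = (\<Sum>n. z * (hyp_coeff b (Suc n) * z ^ n))"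
   by (simp add: mult_ac)
  also have "\<dots> = z * G z" unfolding G_def
   using powser_inside[OF s, of z] z by (intro suminf_mult) (simp add: K_def)
  finally show ?thesis by (simp add: hyp_coeff_def)
 qed
 have "((\<lambda>z. 1 / b * (sqrt z * (1 - z) powr (p + 1) * G z)) \<longlongrightarrow> 1 / b * (sqrt 0 * (1 - 0) powr (p + 1) * G 0)) (at_right 0)"
  by (intro tendsto_intros G) auto
 moreover have "eventually (\<lambda>z. 1 / b * (sqrt z * (1 - z) powr (p + 1) * G z) = Beta_antideriv p z) (at_right 0)"
  unfolding eventually_at_right_field
 proof (intro exI[of _ "1/2"] conjI allI impI)
  fix z :: real assume z: "0 < z" "z < 1/2"
  have "z powr (-1/2) * z = sqrt z"
   using z powr_mult_base[of z "-1/2"] by (simp add: powr_half_sqrt mult.commute)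
  then show "1 / b * (sqrt z * (1 - z) powr (p + 1) * G z) = Beta_antideriv p z"
   unfolding Beta_antideriv_def b_def[symmetric] FG[OF z] by (simp add: mult_ac)
 qed simp
 ultimately show ?thesis by (simp add: filterlim_cong)
qed


text \<open>With z = (\<tau> - v)/(1 - v) the integrand becomes z^(-1/2) (1 - z)^p, whose
  antiderivative is known. A constant potential leads to exactly this power of 1 - \<tau>.\<close>

lemma upper_Abel_power:
 assumes p: "p > 0" and v: "v < a" "a < 1"
 shows "set_integrable lborel {v<..<a} (\<lambda>\<tau>. (1 - \<tau>) powr p * (\<tau> - v) powr (-1/2))"
  and "upper_Abel a (\<lambda>\<tau>. (1 - \<tau>) powr p) v = (1 - v) powr (p + 1/2) * Beta_antideriv p ((a - v) / (1 - v))"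
proof -
 define B where "B \<tau> = (1 - v) powr (p + 1/2) * Beta_antideriv p ((\<tau> - v) / (1 - v))" for \<tau>
 define f where "f \<tau> = (1 - \<tau>) powr p * (\<tau> - v) powr (-1/2)" for \<tau>
 have der: "(B has_real_derivative f \<tau>) (at \<tau>)" if t: "v < \<tau>" "\<tau> < 1" for \<tau>
 proof -
  let ?z = "(\<tau> - v) / (1 - v)"
  have z: "0 < ?z" "?z < 1" using t v by auto
  have z1: "1 - ?z = (1 - \<tau>) / (1 - v)" using v by (simp add: field_simps)
  have "((\<lambda>\<tau>. Beta_antideriv p ((\<tau> - v) / (1 - v))) has_real_derivative
    ?z powr (-1/2) * (1 - ?z) powr p * (1 / (1 - v))) (at \<tau>)"
   by (rule DERIV_chain2[where f = "Beta_antideriv p" and g = "\<lambda>\<tau>. (\<tau> - v) / (1 - v)", OF Beta_antideriv_derivative[OF p z]])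
    (use v in \<open>auto intro!: derivative_eq_intros\<close>)
  then have "(B has_real_derivative (1 - v) powr (p + 1/2) * (?z powr (-1/2) * (1 - ?z) powr p * (1 / (1 - v)))) (at \<tau>)"
   unfolding B_def[abs_def] by (rule DERIV_cmult)
  also have "(1 - v) powr (p + 1/2) * (?z powr (-1/2) * (1 - ?z) powr p * (1 / (1 - v))) = f \<tau>"
  proof -
   have "(1 - v) powr (p + 1/2) = (1 - v) powr p * (1 - v) * (1 - v) powr (-1/2)"
    using v powr_add[of "1 - v" "p + 1" "-1/2"] by (simp add: powr_add)
   then show ?thesis unfolding z1 f_def using t v by (simp add: powr_divide)
  qed
  finally show ?thesis .
 qed
 have limv: "(B \<longlongrightarrow> 0) (at_right v)"
 proof -
  have "filterlim (\<lambda>\<tau>. (\<tau> - v) / (1 - v)) (at_right 0) (at_right v)"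
   unfolding filterlim_at
  proof
   have "((\<lambda>\<tau>. (\<tau> - v) / (1 - v)) \<longlongrightarrow> (v - v) / (1 - v)) (at_right v)" by (intro tendsto_intros) (use v in auto)
   then show "((\<lambda>\<tau>. (\<tau> - v) / (1 - v)) \<longlongrightarrow> 0) (at_right v)" by simp
   show "eventually (\<lambda>\<tau>. (\<tau> - v) / (1 - v) \<in> {0<..} \<and> (\<tau> - v) / (1 - v) \<noteq> 0) (at_right v)"
    unfolding eventually_at_right_field using v by (intro exI[of _ 1]) auto
  qed
  from tendsto_mult[OF tendsto_const filterlim_compose[OF Beta_antideriv_tendsto_0[OF p] this]]
  show ?thesis unfolding B_def[abs_def] by simp
 qed
 have lima: "(B \<longlongrightarrow> B a) (at_left a)"
 proof -
  have "isCont B a" using der[of a] v by (auto intro: DERIV_isCont)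
  then show ?thesis unfolding isCont_def by (rule tendsto_mono[OF at_le, rotated]) simp
 qed
 have *: "((B \<circ> real_of_ereal) \<longlongrightarrow> 0) (at_right (ereal v))" "((B \<circ> real_of_ereal) \<longlongrightarrow> B a) (at_left (ereal a))"
  using limv lima by (simp_all add: ereal_tendsto_simps)
 have c: "isCont f x" if "v < x" "x < a" for x
  unfolding f_def using that v by (intro continuous_intros) auto
 have I: "set_integrable lborel (einterval v a) f" "(LBINT x=v..a. f x) = B a - 0"
  using v by (intro interval_integral_FTC_nonneg[OF _ der c _ *]; simp add: f_def)+
 show "set_integrable lborel {v<..<a} (\<lambda>\<tau>. (1 - \<tau>) powr p * (\<tau> - v) powr (-1/2))"
  using I(1) by (simp add: f_def[abs_def])
 show "upper_Abel a (\<lambda>\<tau>. (1 - \<tau>) powr p) v = (1 - v) powr (p + 1/2) * Beta_antideriv p ((a - v) / (1 - v))"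
  using I(2) v unfolding upper_Abel_def f_def B_def by (simp add: interval_integral_Icc)
qed

text \<open>The hypergeometric term of \<open>cap_density\<close> without its constant, for a = cos
  \<alpha> and v = cos \<eta>.\<close>

definition cap_hyp :: "real \<Rightarrow> real \<Rightarrow> real \<Rightarrow> real" where
 "cap_hyp D a v = ((1 - a) / (1 - v)) powr ((D - 1) / 2) * ((1 - a) / (a - v)) powr (1/2) *
  hypergeom_2F1 1 ((D - 1) / 2) (1/2) ((a - v) / (1 - v))"

lemma cap_hyp_nonneg:
 assumes "D > 1" "v < a" "a < 1"
 shows "cap_hyp D a v \<ge> 0"
 unfolding cap_hyp_def using assms by (intro mult_nonneg_nonneg hypergeom_2F1_nonneg) auto

text \<open>The origin of the hypergeometric function in the density. Of the two terms of the
  product rule, the one that differentiates the argument of \<open>Beta_antideriv\<close> exactly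
  compensates the subtracted 1, so the full function F remains.\<close>

lemma upper_Abel_power_derivative:
 assumes D: "D > 2" and v: "v < a" "a < 1"
 shows "(upper_Abel a (\<lambda>\<tau>. (1 - \<tau>) powr ((D - 2) / 2)) has_real_derivative
  - ((1 - v) powr ((D - 3) / 2) * cap_hyp D a v)) (at v)"
proof -
 define p where "p = (D - 2) / 2"
 have p: "p > 0" using D by (simp add: p_def)
 define b where "b = p + 1/2"
 have b: "b > 0" using p by (simp add: b_def)
 let ?z = "(a - v) / (1 - v)"
 let ?F = "hypergeom_2F1 1 b (1/2) ?z"
 have z: "0 < ?z" "?z < 1" using v by auto
 have z1: "1 - ?z = (1 - a) / (1 - v)" using v by (simp add: field_simps)
 let ?d = "?z powr (-1/2) * (1 - ?z) powr p * ((a - 1) / (1 - v)\<^sup>2)"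
 have "((\<lambda>v. (a - v) / (1 - v)) has_real_derivative (a - 1) / (1 - v)\<^sup>2) (at v)"
  using v by (auto intro!: derivative_eq_intros simp: power2_eq_square field_simps)
 then have "((\<lambda>v. Beta_antideriv p ((a - v) / (1 - v))) has_real_derivative ?d) (at v)"
  by (rule DERIV_chain2[where f = "Beta_antideriv p" and g = "\<lambda>v. (a - v) / (1 - v)", OF Beta_antideriv_derivative[OF p z]])
 moreover have "((\<lambda>v. (1 - v) powr b) has_real_derivative - (b * (1 - v) powr (b - 1))) (at v)"
  using v by (auto intro!: derivative_eq_intros)
 ultimately have "((\<lambda>v. (1 - v) powr b * Beta_antideriv p ((a - v) / (1 - v))) has_real_derivative
   - (b * (1 - v) powr (b - 1)) * Beta_antideriv p ?z + ?d * (1 - v) powr b) (at v)"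
  by (intro DERIV_mult)
 also have "- (b * (1 - v) powr (b - 1)) * Beta_antideriv p ?z + ?d * (1 - v) powr b
   = - ((1 - v) powr (b - 1) * (?z powr (-1/2) * (1 - ?z) powr (p + 1) * ?F))"
 proof -
  have 1: "(1 - v) powr b = (1 - v) powr (b - 1) * (1 - v)" using v powr_add[of "1 - v" "b - 1" 1] by simp
  have 2: "(1 - ?z) powr (p + 1) = (1 - ?z) powr p * (1 - ?z)" using z by (simp add: powr_add)
  have "(a - 1) / u\<^sup>2 * u = - ((1 - a) / u)" if "u \<noteq> 0" for u :: real
   using that by (simp add: power2_eq_square field_simps)
  from this[of "1 - v"] have 3: "(a - 1) / (1 - v)\<^sup>2 * (1 - v) = - (1 - ?z)" unfolding z1 using v by simp
  have "?d * (1 - v) powr b = (1 - v) powr (b - 1) * (?z powr (-1/2) * (1 - ?z) powr p * ((a - 1) / (1 - v)\<^sup>2 * (1 - v)))"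
   unfolding 1 by (simp only: mult_ac)
  also have "\<dots> = - ((1 - v) powr (b - 1) * (?z powr (-1/2) * (1 - ?z) powr (p + 1)))" unfolding 2 3
   by (simp only: mult_minus_right mult_ac)
  finally have 4: "?d * (1 - v) powr b = - ((1 - v) powr (b - 1) * (?z powr (-1/2) * (1 - ?z) powr (p + 1)))" .
  have 5: "b * Beta_antideriv p ?z = ?z powr (-1/2) * (1 - ?z) powr (p + 1) * (?F - 1)"
   unfolding Beta_antideriv_def b_def[symmetric] using b by simp
  have "- (b * (1 - v) powr (b - 1)) * Beta_antideriv p ?z = - ((1 - v) powr (b - 1) * (b * Beta_antideriv p ?z))" by simp
  then show ?thesis unfolding 4 5 by (simp add: algebra_simps)
 qed
 also have "?z powr (-1/2) * (1 - ?z) powr (p + 1) * ?F = cap_hyp D a v"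
 proof -
  have q: "(1 - a) / (a - v) = (1 - ?z) / ?z" unfolding z1 using v by simp
  have "((1 - a) / (a - v)) powr (1/2) = (1 - ?z) powr (1/2) * ?z powr (-1/2)"
   unfolding q using z powr_minus_divide[of ?z "1/2"] by (subst powr_divide) auto
  moreover have "(1 - ?z) powr (p + 1) = (1 - ?z) powr b * (1 - ?z) powr (1/2)"
   by (simp add: b_def powr_add[symmetric] add.commute)
  moreover have bD: "(D - 1) / 2 = b" by (simp add: b_def p_def field_simps)
  ultimately show ?thesis unfolding cap_hyp_def z1[symmetric] bD by simp
 qed
 finally have d: "((\<lambda>v. (1 - v) powr b * Beta_antideriv p ((a - v) / (1 - v))) has_real_derivative
   - ((1 - v) powr (b - 1) * cap_hyp D a v)) (at v)" .
 have bD: "(D - 3) / 2 = b - 1" by (simp add: b_def p_def field_simps)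
 have "(upper_Abel a (\<lambda>\<tau>. (1 - \<tau>) powr p) has_real_derivative - ((1 - v) powr (b - 1) * cap_hyp D a v)) (at v)"
 proof (rule has_field_derivative_transform_within_open[OF d, of "{..<a}"])
  show "(1 - x) powr b * Beta_antideriv p ((a - x) / (1 - x)) = upper_Abel a (\<lambda>\<tau>. (1 - \<tau>) powr p) x" if "x \<in> {..<a}" for x
   using upper_Abel_power(2)[OF p _ v(2), of x] that by (simp add: b_def)
 qed (use v in auto)
 then show ?thesis unfolding bD p_def .
qed

lemma upper_Abel_power_tendsto_0:
 assumes D: "D > 2" and a: "a < 1"
 shows "(upper_Abel a (\<lambda>\<tau>. (1 - \<tau>) powr ((D - 2) / 2)) \<longlongrightarrow> 0) (at_left a)"
proof -
 define p where "p = (D - 2) / 2"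
 have p: "p > 0" using D by (simp add: p_def)
 have "filterlim (\<lambda>v. (a - v) / (1 - v)) (at_right 0) (at_left a)"
  unfolding filterlim_at
 proof
  have "((\<lambda>v. (a - v) / (1 - v)) \<longlongrightarrow> (a - a) / (1 - a)) (at_left a)" by (intro tendsto_intros) (use a in auto)
  then show "((\<lambda>v. (a - v) / (1 - v)) \<longlongrightarrow> 0) (at_left a)" by simp
  show "eventually (\<lambda>v. (a - v) / (1 - v) \<in> {0<..} \<and> (a - v) / (1 - v) \<noteq> 0) (at_left a)"
   unfolding eventually_at_left_field using a by (intro exI[of _ "a - 1"]) auto
 qed
 note BA = filterlim_compose[OF Beta_antideriv_tendsto_0[OF p] this]
 have "((\<lambda>v. (1 - v) powr (p + 1/2)) \<longlongrightarrow> (1 - a) powr (p + 1/2)) (at_left a)"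
  using a by (intro tendsto_intros) auto
 from tendsto_mult[OF this BA]
 have L: "((\<lambda>v. (1 - v) powr (p + 1/2) * Beta_antideriv p ((a - v) / (1 - v))) \<longlongrightarrow> 0) (at_left a)" by simp
 have "eventually (\<lambda>v. (1 - v) powr (p + 1/2) * Beta_antideriv p ((a - v) / (1 - v)) = upper_Abel a (\<lambda>\<tau>. (1 - \<tau>) powr p) v) (at_left a)"
  unfolding eventually_at_left_field using upper_Abel_power(2)[OF p _ a] by (intro exI[of _ "a - 1"]) auto
 from Lim_transform_eventually[OF L this] show ?thesis by (simp add: p_def)
qed

section \<open>The total mass of the hypergeometric density\<close>

lemma hypergeom_2F1_measurable:
 "(\<lambda>z. hypergeom_2F1 a b c z) \<in> borel_measurable borel"
 unfolding hypergeom_2F1_def by measurable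

lemma cap_hyp_measurable [measurable]: "cap_hyp D a \<in> borel_measurable borel"
proof -
 note [measurable] = hypergeom_2F1_measurable
 show ?thesis unfolding cap_hyp_def[abs_def] by measurable
qed

lemma nn_integral_upper_Abel_power:
 assumes D: "D > 2" and v: "v < a" "a < 1"
 shows "(\<integral>\<^sup>+\<tau>\<in>{v<..<a}. ennreal ((1 - \<tau>) powr ((D - 2) / 2) * (\<tau> - v) powr (-1/2)) \<partial>lborel)
  = ennreal (upper_Abel a (\<lambda>\<tau>. (1 - \<tau>) powr ((D - 2) / 2)) v)"
proof -
 define p where "p = (D - 2) / 2"
 have p: "p > 0" using D by (simp add: p_def)
 let ?f = "\<lambda>\<tau>. (1 - \<tau>) powr p * (\<tau> - v) powr (-1/2)"
 have i: "integrable lborel (\<lambda>\<tau>. indicator {v<..<a} \<tau> *\<^sub>R ?f \<tau>)"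
  using upper_Abel_power(1)[OF p v] by (simp add: set_integrable_def)
 have "(\<integral>\<^sup>+\<tau>\<in>{v<..<a}. ennreal (?f \<tau>) \<partial>lborel) = (\<integral>\<^sup>+\<tau>. ennreal (indicator {v<..<a} \<tau> *\<^sub>R ?f \<tau>) \<partial>lborel)"
  by (rule nn_integral_cong) (auto simp: indicator_def)
 also have "\<dots> = ennreal (\<integral>\<tau>. indicator {v<..<a} \<tau> *\<^sub>R ?f \<tau> \<partial>lborel)"
  by (rule nn_integral_eq_integral[OF i]) (auto simp: indicator_def)
 also have "(\<integral>\<tau>. indicator {v<..<a} \<tau> *\<^sub>R ?f \<tau> \<partial>lborel) = upper_Abel a (\<lambda>\<tau>. (1 - \<tau>) powr p) v"
  unfolding upper_Abel_def set_lebesgue_integral_def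
 proof (rule integral_cong_AE)
  show "AE x in lborel. indicator {v<..<a} x *\<^sub>R ?f x = indicator {v..a} x *\<^sub>R ?f x"
   using AE_lborel_singleton[of v] AE_lborel_singleton[of a] by eventually_elim (auto simp: indicator_def)
 qed simp_all
 finally show ?thesis unfolding p_def .
qed

lemma inc_Beta_pos:
 assumes z: "0 < z" "z < 1" and A: "A > 0" and B: "B > 0"
 shows "inc_Beta z A B > 0"
  and "(\<integral>\<^sup>+t\<in>{0<..<z}. ennreal (t powr (A - 1) * (1 - t) powr (B - 1)) \<partial>lborel) = ennreal (inc_Beta z A B)"
proof -
 let ?f = "\<lambda>t::real. t powr (A - 1) * (1 - t) powr (B - 1)"
 let ?h = "\<lambda>t. indicator {0<..<z} t *\<^sub>R ?f t"
 have e: "(\<integral>\<^sup>+t. ennreal (?h t) \<partial>lborel) = (\<integral>\<^sup>+t\<in>{0<..<z}. ennreal (?f t) \<partial>lborel)"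
  by (rule nn_integral_cong) (auto simp: indicator_def)
 have "(\<integral>\<^sup>+t\<in>{0<..<z}. ennreal (?f t) \<partial>lborel) \<le> (\<integral>\<^sup>+t\<in>{0<..<1}. ennreal ((t - 0) powr (A - 1) * (1 - t) powr (B - 1)) \<partial>lborel)"
  using z by (intro nn_integral_mono) (auto simp: indicator_def)
 also have "\<dots> < \<infinity>" by (subst nn_integral_Beta) (use A B in auto)
 finally have fin: "(\<integral>\<^sup>+t. ennreal (?h t) \<partial>lborel) < \<infinity>" unfolding e .
 have i: "integrable lborel ?h" using fin by (intro integrableI_nonneg) (auto simp: indicator_def)
 have I: "inc_Beta z A B = (\<integral>t. ?h t \<partial>lborel)"
  unfolding inc_Beta_def set_lebesgue_integral_def
 proof (rule integral_cong_AE)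
  show "AE x in lborel. indicator {0..z} x *\<^sub>R ?f x = ?h x"
   using AE_lborel_singleton[of 0] AE_lborel_singleton[of z] by eventually_elim (auto simp: indicator_def)
 qed simp_all
 show eq: "(\<integral>\<^sup>+t\<in>{0<..<z}. ennreal (?f t) \<partial>lborel) = ennreal (inc_Beta z A B)"
  unfolding I e[symmetric] by (rule nn_integral_eq_integral[OF i]) (auto simp: indicator_def)
 show "inc_Beta z A B > 0"
 proof (rule ccontr)
  assume "\<not> inc_Beta z A B > 0"
  then have "(\<integral>\<^sup>+t\<in>{0<..<z}. ennreal (?f t) \<partial>lborel) = 0" unfolding eq by (simp add: ennreal_neg)
  then have "AE t in lborel. ennreal (?f t) * indicator {0<..<z} t = 0"
   by (subst (asm) nn_integral_0_iff_AE) auto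
  then have "AE t in lborel. t \<notin> {0<..<z}"
  proof eventually_elim
   fix t :: real assume t: "ennreal (?f t) * indicator {0<..<z} t = 0"
   have "0 < t \<Longrightarrow> t < z \<Longrightarrow> 0 < ?f t" using z by simp
   then show "t \<notin> {0<..<z}" using t by (auto simp: indicator_def ennreal_eq_0_iff not_le[symmetric])
  qed
  then have "emeasure lborel {0<..<z} = 0" by (subst (asm) AE_iff_measurable[of "{0<..<z}"]) auto
  then show False using z by simp
 qed
qed

text \<open>The factor (1 - v)^e \<open>cap_hyp\<close> is minus the derivative of an upper Abel
  transform, so its integral over (s, a) is that transform at s. Writing (1 + v)^e as an integral
  over s \<in> (-1, v) and exchanging the order brings in these tails; a second exchange leaves an
  elementary Beta integral in s and an incomplete one in \<tau>, brought to standard form by \<tau>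
  = -1 + 2t.\<close>

lemma nn_integral_cap_hyp:
 assumes D: "D \<ge> 3" and a: "-1 < a" "a < 1"
 shows "(\<integral>\<^sup>+v\<in>{-1<..<a}. ennreal (cap_hyp D a v * (1 - v\<^sup>2) powr ((D - 3) / 2)) \<partial>lborel)
  = ennreal (2 powr (D - 2) * sqrt pi * Gamma ((D - 1) / 2) / Gamma (D / 2 - 1) * inc_Beta ((1 + a) / 2) ((D - 2) / 2) (D / 2))"
proof -
 define p where "p = (D - 2) / 2"
 define e where "e = (D - 3) / 2"
 have pe: "p = e + 1/2" "e \<ge> 0" "p > 0" using D by (auto simp: p_def e_def field_simps)
 define \<beta> where "\<beta> v = (1 - v) powr e * cap_hyp D a v" for v
 have \<beta>m [measurable]: "\<beta> \<in> borel_measurable borel" unfolding \<beta>_def[abs_def] by measurable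
 have \<beta>0: "\<beta> v \<ge> 0" if "v < a" for v
  unfolding \<beta>_def using that D a by (intro mult_nonneg_nonneg cap_hyp_nonneg) auto
 have inner: "(\<integral>\<^sup>+v\<in>{s<..<a}. ennreal (\<beta> v) \<partial>lborel) =
   (\<integral>\<^sup>+\<tau>\<in>{s<..<a}. ennreal ((1 - \<tau>) powr p * (\<tau> - s) powr (-1/2)) \<partial>lborel)" if s: "s < a" for s
 proof -
  have "(\<integral>\<^sup>+v\<in>{s<..<a}. ennreal (\<beta> v) \<partial>lborel) = ennreal (upper_Abel a (\<lambda>\<tau>. (1 - \<tau>) powr ((D - 2) / 2)) s)"
  proof (rule nn_integral_FTC_Ioo_decreasing[OF s \<beta>m])
   show "(upper_Abel a (\<lambda>\<tau>. (1 - \<tau>) powr ((D - 2) / 2)) has_real_derivative - \<beta> v) (at v)" if "v < a" for v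
    unfolding \<beta>_def e_def by (rule upper_Abel_power_derivative) (use that a D in auto)
   show "(upper_Abel a (\<lambda>\<tau>. (1 - \<tau>) powr ((D - 2) / 2)) \<longlongrightarrow> 0) (at_left a)"
    by (rule upper_Abel_power_tendsto_0) (use a D in auto)
  qed (rule \<beta>0)
  also have "\<dots> = (\<integral>\<^sup>+\<tau>\<in>{s<..<a}. ennreal ((1 - \<tau>) powr p * (\<tau> - s) powr (-1/2)) \<partial>lborel)"
   unfolding p_def by (rule nn_integral_upper_Abel_power[symmetric]) (use s a D in auto)
  finally show ?thesis .
 qed
 let ?C = "Gamma ((D - 1) / 2) * sqrt pi / Gamma p"
 have C0: "?C \<ge> 0" using D pe by (simp add: Gamma_real_pos less_imp_le)
 let ?k = "\<lambda>s v x. ennreal (e * (1 + s) powr (e - 1)) * ennreal x * (if -1 < s \<and> s < v \<and> v < a then 1 else 0)"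
 let ?T = "\<integral>\<^sup>+\<tau>\<in>{-1<..<a}. ennreal ((1 - \<tau>) powr p * (1 + \<tau>) powr (p - 1)) \<partial>lborel"
 let ?R = "\<integral>\<^sup>+v\<in>{-1<..<a}. ennreal (\<beta> v * (1 + v) powr e) \<partial>lborel"
 have L: "(\<integral>\<^sup>+v\<in>{-1<..<a}. ennreal (cap_hyp D a v * (1 - v\<^sup>2) powr ((D - 3) / 2)) \<partial>lborel)
   = ?R"
 proof (rule nn_integral_cong)
  fix v :: real
  show "ennreal (cap_hyp D a v * (1 - v\<^sup>2) powr ((D - 3) / 2)) * indicator {-1<..<a} v = ennreal (\<beta> v * (1 + v) powr e) * indicator {-1<..<a} v"
  proof (cases "v \<in> {-1<..<a}")
   case True
   have "1 - v\<^sup>2 = (1 - v) * (1 + v)" by (simp add: power2_eq_square algebra_simps)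
   then have "(1 - v\<^sup>2) powr e = (1 - v) powr e * (1 + v) powr e" using True a by (simp add: powr_mult)
   then show ?thesis by (simp add: \<beta>_def e_def[symmetric] mult_ac)
  qed simp
 qed
 have R: "?R
   = ennreal ?C * ?T"
 \<comment> \<open>For d = 3 the weight (1 + v)^e is 1 and is not the integral of its derivative
   from -1; a single tail, the one at s = -1, then suffices.\<close>
 proof (cases "e = 0")
  case True
  then have "p = 1/2" "D = 3" using pe by (auto simp: e_def)
  have "?R = (\<integral>\<^sup>+v\<in>{-1<..<a}. ennreal (\<beta> v) \<partial>lborel)"
   using True by (intro nn_integral_cong) (auto simp: indicator_def)
  also have "\<dots> = ?T"
   unfolding inner[OF a(1)] \<open>p = 1/2\<close> by (simp add: add.commute)
  finally show ?thesis unfolding \<open>p = 1/2\<close> \<open>D = 3\<close> by (simp add: Gamma_one_half_real)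
 next
  case False
  then have e: "e > 0" using pe by simp
  have pw: "ennreal ((1 + v) powr e) = (\<integral>\<^sup>+s\<in>{-1<..<v}. ennreal (e * (1 + s) powr (e - 1)) \<partial>lborel)" if "v > -1" for v
  proof -
   have "(\<integral>\<^sup>+s\<in>{-1<..<v}. ennreal (e * (1 + s) powr (e - 1)) \<partial>lborel)
    = (\<integral>\<^sup>+s. ennreal e * (ennreal ((s - (-1)) powr (e - 1) * (v - s) powr (1 - 1)) * indicator {-1<..<v} s) \<partial>lborel)"
    using e by (intro nn_integral_cong) (auto simp: indicator_def ennreal_mult'[symmetric] add.commute)
   also have "\<dots> = ennreal e * ennreal ((v - (-1)) powr (e + 1 - 1) * Beta e 1)"
    by (subst nn_integral_cmult) (use that e in \<open>auto simp: nn_integral_Beta[of "-1" v e 1, simplified]\<close>)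
   also have "\<dots> = ennreal ((1 + v) powr e)"
   proof -
    have "e * Beta e 1 = 1" using e Gamma_plus1[of e] by (auto simp: Beta_def nonpos_Ints_def Gamma_eq_zero_iff)
    then have eq: "e * ((1 + v) powr e * Beta e 1) = (1 + v) powr e" by (simp add: mult.left_commute)
    show ?thesis using e by (simp add: ennreal_mult'[symmetric] add.commute eq)
   qed
   finally show ?thesis ..
  qed
  have "?R
   = (\<integral>\<^sup>+v. \<integral>\<^sup>+s. ?k s v (\<beta> v) \<partial>lborel \<partial>lborel)"
  proof (rule nn_integral_cong)
   fix v :: real
   show "ennreal (\<beta> v * (1 + v) powr e) * indicator {-1<..<a} v = (\<integral>\<^sup>+s. ?k s v (\<beta> v) \<partial>lborel)"
   proof (cases "v \<in> {-1<..<a}")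
    case True
    have "ennreal (\<beta> v * (1 + v) powr e) = ennreal (\<beta> v) * ennreal ((1 + v) powr e)"
     using True \<beta>0 by (simp add: ennreal_mult')
    also have "\<dots> = (\<integral>\<^sup>+s. ennreal (\<beta> v) * (ennreal (e * (1 + s) powr (e - 1)) * indicator {-1<..<v} s) \<partial>lborel)"
     using True by (subst pw) (auto simp: nn_integral_cmult)
    also have "\<dots> = (\<integral>\<^sup>+s. ?k s v (\<beta> v) \<partial>lborel)"
     using True by (intro nn_integral_cong) (auto simp: indicator_def mult_ac)
    finally show ?thesis using True by simp
   next
    case False
    then have z: "(if -1 < s \<and> s < v \<and> v < a then 1 else 0 :: ennreal) = 0" for s by auto
    show ?thesis unfolding z using False by simp
   qed
  qed
  also have "\<dots> = (\<integral>\<^sup>+s. \<integral>\<^sup>+v. ?k s v (\<beta> v) \<partial>lborel \<partial>lborel)"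
   by (rule lborel_pair.Fubini'[symmetric]) measurable
  also have "\<dots> = (\<integral>\<^sup>+s. \<integral>\<^sup>+\<tau>. ?k s \<tau> ((1 - \<tau>) powr p * (\<tau> - s) powr (-1/2)) \<partial>lborel \<partial>lborel)"
  proof (rule nn_integral_cong)
   fix s :: real
   show "(\<integral>\<^sup>+v. ?k s v (\<beta> v) \<partial>lborel) =
    (\<integral>\<^sup>+\<tau>. ?k s \<tau> ((1 - \<tau>) powr p * (\<tau> - s) powr (-1/2)) \<partial>lborel)"
   proof (cases "-1 < s \<and> s < a")
    case True
    have eq: "(\<integral>\<^sup>+v. ?k s v (h v) \<partial>lborel)
     = ennreal (e * (1 + s) powr (e - 1)) * (\<integral>\<^sup>+v\<in>{s<..<a}. ennreal (h v) \<partial>lborel)" if [measurable]: "h \<in> borel_measurable borel" for h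
    proof -
     have "ennreal (e * (1 + s) powr (e - 1)) * (\<integral>\<^sup>+v\<in>{s<..<a}. ennreal (h v) \<partial>lborel)
      = (\<integral>\<^sup>+v. ennreal (e * (1 + s) powr (e - 1)) * (ennreal (h v) * indicator {s<..<a} v) \<partial>lborel)"
      by (rule nn_integral_cmult[symmetric]) measurable
     also have "\<dots> = (\<integral>\<^sup>+v. ?k s v (h v) \<partial>lborel)"
      using True by (intro nn_integral_cong) (auto simp: indicator_def)
     finally show ?thesis ..
    qed
    show ?thesis using True inner[of s] by (subst (1 2) eq) simp_all
   next
    case False
    then have z: "(if -1 < s \<and> s < v \<and> v < a then 1 else 0 :: ennreal) = 0" for v by auto
    show ?thesis unfolding z using False by simp
   qed
  qed
  also have "\<dots> = (\<integral>\<^sup>+\<tau>. \<integral>\<^sup>+s. ?k s \<tau> ((1 - \<tau>) powr p * (\<tau> - s) powr (-1/2)) \<partial>lborel \<partial>lborel)"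
   by (rule lborel_pair.Fubini') measurable
  also have "\<dots> = (\<integral>\<^sup>+\<tau>. ennreal ?C * (ennreal ((1 - \<tau>) powr p * (1 + \<tau>) powr (p - 1)) * indicator {-1<..<a} \<tau>) \<partial>lborel)"
  proof (rule nn_integral_cong)
   fix \<tau> :: real
   show "(\<integral>\<^sup>+s. ?k s \<tau> ((1 - \<tau>) powr p * (\<tau> - s) powr (-1/2)) \<partial>lborel)
    = ennreal ?C * (ennreal ((1 - \<tau>) powr p * (1 + \<tau>) powr (p - 1)) * indicator {-1<..<a} \<tau>)"
   proof (cases "\<tau> \<in> {-1<..<a}")
    case True
    have "(\<integral>\<^sup>+s. ?k s \<tau> ((1 - \<tau>) powr p * (\<tau> - s) powr (-1/2)) \<partial>lborel)
     = (\<integral>\<^sup>+s. ennreal (e * (1 - \<tau>) powr p) * (ennreal ((s - (-1)) powr (e - 1) * (\<tau> - s) powr (1/2 - 1)) * indicator {-1<..<\<tau>} s) \<partial>lborel)"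
     using True e by (intro nn_integral_cong) (auto simp: indicator_def ennreal_mult'[symmetric] add.commute mult_ac)
    also have "\<dots> = ennreal (e * (1 - \<tau>) powr p) * (\<integral>\<^sup>+s\<in>{-1<..<\<tau>}. ennreal ((s - (-1)) powr (e - 1) * (\<tau> - s) powr (1/2 - 1)) \<partial>lborel)"
     by (rule nn_integral_cmult) measurable
    also have "\<dots> = ennreal (e * (1 - \<tau>) powr p) * ennreal ((\<tau> - (-1)) powr (e + 1/2 - 1) * Beta e (1/2))"
     using True e by (subst nn_integral_Beta) auto
    also have "\<dots> = ennreal (e * Beta e (1/2) * ((1 - \<tau>) powr p * (1 + \<tau>) powr (p - 1)))"
     using e pe by (simp add: ennreal_mult'[symmetric] mult_ac add.commute)
    also have "e * Beta e (1/2) = ?C"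
    proof -
     have "Gamma (e + 1) = e * Gamma e" using e by (intro Gamma_plus1) (auto simp: nonpos_Ints_def)
     moreover have De: "(D - 1) / 2 = e + 1" by (simp add: e_def field_simps)
     ultimately show ?thesis unfolding De using pe by (simp add: Beta_def Gamma_one_half_real)
    qed
    also have "ennreal (?C * ((1 - \<tau>) powr p * (1 + \<tau>) powr (p - 1))) = ennreal ?C * ennreal ((1 - \<tau>) powr p * (1 + \<tau>) powr (p - 1))"
     by (rule ennreal_mult'[OF C0])
    finally show ?thesis using True by (simp only: indicator_simps mult_1_right)
   next
    case False
    then have z: "(if -1 < s \<and> s < \<tau> \<and> \<tau> < a then 1 else 0 :: ennreal) = 0" for s by auto
    show ?thesis unfolding z using False by simp
   qed
  qed
  also have "\<dots> = ennreal ?C * ?T"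
   by (rule nn_integral_cmult) measurable
  finally show ?thesis .
 qed
 have S: "?T
  = ennreal (2 powr (2 * p) * inc_Beta ((1 + a) / 2) p (p + 1))"
 proof -
  have "?T
   = ennreal \<bar>2\<bar> * (\<integral>\<^sup>+t. ennreal ((1 - (-1 + 2 * t)) powr p * (1 + (-1 + 2 * t)) powr (p - 1)) * indicator {-1<..<a} (-1 + 2 * t) \<partial>lborel)"
   by (rule nn_integral_real_affine) auto
  also have "(\<integral>\<^sup>+t. ennreal ((1 - (-1 + 2 * t)) powr p * (1 + (-1 + 2 * t)) powr (p - 1)) * indicator {-1<..<a} (-1 + 2 * t) \<partial>lborel)
   = (\<integral>\<^sup>+t. ennreal (2 powr (2 * p - 1)) * (ennreal (t powr (p - 1) * (1 - t) powr ((p + 1) - 1)) * indicator {0<..<(1 + a) / 2} t) \<partial>lborel)"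
  proof (rule nn_integral_cong)
   fix t :: real
   show "ennreal ((1 - (-1 + 2 * t)) powr p * (1 + (-1 + 2 * t)) powr (p - 1)) * indicator {-1<..<a} (-1 + 2 * t)
    = ennreal (2 powr (2 * p - 1)) * (ennreal (t powr (p - 1) * (1 - t) powr ((p + 1) - 1)) * indicator {0<..<(1 + a) / 2} t)"
   proof (cases "t \<in> {0<..<(1 + a) / 2}")
    case True
    then have t: "0 < t" "t < 1" using a by auto
    have "1 - (-1 + 2 * t) = 2 * (1 - t)" by simp
    then have "(1 - (-1 + 2 * t)) powr p * (1 + (-1 + 2 * t)) powr (p - 1) = (2 * (1 - t)) powr p * (2 * t) powr (p - 1)" by simp
    also have "\<dots> = 2 powr p * 2 powr (p - 1) * (t powr (p - 1) * (1 - t) powr p)"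
     unfolding powr_mult by (simp only: mult_ac)
    also have "2 powr p * 2 powr (p - 1) = (2::real) powr (2 * p - 1)" by (simp add: powr_add[symmetric])
    finally show ?thesis using True by (simp add: ennreal_mult'[symmetric])
   next
    case False
    then have "-1 + 2 * t \<notin> {-1<..<a}" by (auto simp: field_simps)
    then show ?thesis using False by simp
   qed
  qed
  also have "\<dots> = ennreal (2 powr (2 * p - 1)) * (\<integral>\<^sup>+t\<in>{0<..<(1 + a) / 2}. ennreal (t powr (p - 1) * (1 - t) powr ((p + 1) - 1)) \<partial>lborel)"
   by (rule nn_integral_cmult) measurable
  also have "\<dots> = ennreal (2 powr (2 * p - 1)) * ennreal (inc_Beta ((1 + a) / 2) p (p + 1))"
   by (subst inc_Beta_pos(2)) (use a pe in auto)
  also have "ennreal \<bar>2\<bar> * (ennreal (2 powr (2 * p - 1)) * ennreal (inc_Beta ((1 + a) / 2) p (p + 1)))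
   = ennreal (2 * (2 powr (2 * p - 1) * inc_Beta ((1 + a) / 2) p (p + 1)))"
   unfolding abs_numeral by (subst ennreal_mult', simp, subst ennreal_mult', simp) simp
  also have "2 * (2 powr (2 * p - 1) * inc_Beta ((1 + a) / 2) p (p + 1)) = 2 powr (2 * p) * inc_Beta ((1 + a) / 2) p (p + 1)"
   using powr_mult_base[of 2 "2 * p - 1"] by simp
  finally show ?thesis .
 qed
 have Dp: "D / 2 - 1 = p" "D - 2 = 2 * p" "(2 * p) / 2 = p" "D / 2 = p + 1" by (auto simp: p_def field_simps)
 show ?thesis unfolding L R S ennreal_mult'[OF C0, symmetric] Dp(1) unfolding Dp(2,4) Dp(3)
  by (rule arg_cong[where f = ennreal]) (simp add: mult_ac)
qed

section \<open>Inversion of the zonal potential\<close>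

text \<open>The u-integral that the Copson factorisation leaves for a law m of heights. Up to the
  factor (1 + s)^(-(D-3)/2), the zonal potential of m at height s is the lower Abel integral of
  \<open>Copson_weight\<close> times this function.\<close>

definition upper_moment :: "real \<Rightarrow> real measure \<Rightarrow> real \<Rightarrow> ennreal" where
 "upper_moment D m t = (\<integral>\<^sup>+u\<in>{t<..}. ennreal ((1 + u) powr (- ((D - 3) / 2)) * (u - t) powr (-1/2)) \<partial>m)"

context
 fixes m :: "real measure" and D :: real
 assumes sets_m: "sets m = sets borel" and fin_m: "finite_measure m"
begin

interpretation m: finite_measure m by (rule fin_m)
interpretation pm: pair_sigma_finite lborel m by standard
interpretation mp: pair_sigma_finite m lborel by standard

lemma upper_moment_measurable: "upper_moment D m \<in> borel_measurable borel"
proof -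
 note sets_m[measurable_cong]
 have "(\<lambda>t. \<integral>\<^sup>+u. ennreal ((1 + u) powr (- ((D - 3) / 2)) * (u - t) powr (-1/2)) * (if t < u then 1 else 0) \<partial>m) \<in> borel_measurable borel"
  by measurable
 moreover have "(if t < u then 1 else 0) = (indicator {t<..} u :: ennreal)" for t u :: real by (simp add: indicator_def)
 ultimately show ?thesis unfolding upper_moment_def[abs_def] by simp
qed

lemma nn_integral_upper_moment:
 assumes h: "h \<in> borel_measurable borel"
 shows "(\<integral>\<^sup>+t. h t * upper_moment D m t \<partial>lborel) =
  (\<integral>\<^sup>+u. ennreal ((1 + u) powr (- ((D - 3) / 2))) * (\<integral>\<^sup>+t\<in>{..<u}. h t * ennreal ((u - t) powr (-1/2)) \<partial>lborel) \<partial>m)"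
proof -
 note sets_m[measurable_cong] h[measurable]
 let ?f = "\<lambda>t u. h t * (ennreal ((1 + u) powr (- ((D - 3) / 2)) * (u - t) powr (-1/2)) * (if t < u then 1 else 0))"
 have "(\<integral>\<^sup>+t. h t * upper_moment D m t \<partial>lborel) = (\<integral>\<^sup>+t. \<integral>\<^sup>+u. ?f t u \<partial>m \<partial>lborel)"
 proof (rule nn_integral_cong)
  fix t :: real
  have "upper_moment D m t = (\<integral>\<^sup>+u. ennreal ((1 + u) powr (- ((D - 3) / 2)) * (u - t) powr (-1/2)) * (if t < u then 1 else 0) \<partial>m)"
   unfolding upper_moment_def by (rule nn_integral_cong) (simp add: indicator_def)
  then show "h t * upper_moment D m t = (\<integral>\<^sup>+u. ?f t u \<partial>m)"
   by (simp add: nn_integral_cmult)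
 qed
 also have "\<dots> = (\<integral>\<^sup>+u. \<integral>\<^sup>+t. ?f t u \<partial>lborel \<partial>m)" by (rule pm.Fubini'[symmetric]) measurable
 also have "\<dots> = (\<integral>\<^sup>+u. ennreal ((1 + u) powr (- ((D - 3) / 2))) * (\<integral>\<^sup>+t\<in>{..<u}. h t * ennreal ((u - t) powr (-1/2)) \<partial>lborel) \<partial>m)"
 proof (rule nn_integral_cong)
  fix u :: real
  have "(\<integral>\<^sup>+t. ?f t u \<partial>lborel) = (\<integral>\<^sup>+t. ennreal ((1 + u) powr (- ((D - 3) / 2))) * (h t * ennreal ((u - t) powr (-1/2)) * indicator {..<u} t) \<partial>lborel)"
   by (rule nn_integral_cong) (simp add: indicator_def ennreal_mult mult_ac)
  then show "(\<integral>\<^sup>+t. ?f t u \<partial>lborel) = ennreal ((1 + u) powr (- ((D - 3) / 2))) * (\<integral>\<^sup>+t\<in>{..<u}. h t * ennreal ((u - t) powr (-1/2)) \<partial>lborel)"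
   by (simp add: nn_integral_cmult)
 qed
 finally show ?thesis .
qed

text \<open>The weight (1 + s)^e cancels the same factor of the kernel. What depends on s is then
  the Abel kernel between t and c, whose integral is pi, so the transform of the potential becomes a
  plain cumulative integral up to c.\<close>

lemma Abel_transform_zonal:
 assumes m1: "AE u in m. -1 < u \<and> u < 1" and c: "-1 < c" "c < 1"
 shows "(\<integral>\<^sup>+s\<in>{-1<..<c}. ennreal ((1 + s) powr ((D - 3) / 2) * (c - s) powr (-1/2)) * (\<integral>\<^sup>+u. zonal_kernel D s u \<partial>m) \<partial>lborel)
  = ennreal pi * (\<integral>\<^sup>+t\<in>{-1<..<c}. ennreal (Copson_weight D t) * upper_moment D m t \<partial>lborel)"
proof -
 let ?W = "Copson_weight D" and ?q = "\<lambda>x::real. x powr (-1/2)"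
 note sets_m[measurable_cong]
 define e where "e = (D - 3) / 2"
 define k1 where "k1 u t = ennreal ((1 + u) powr (- e) * ?W t * ?q (u - t)) * (if -1 < t \<and> t < c \<and> t < u then 1 else 0)" for u t
 define k2 where "k2 t s = ennreal (?q (s - t) * ?q (c - s)) * (if t < s \<and> s < c then 1 else 0)" for t s
 have k1m [measurable]: "(\<lambda>x. k1 (f x) (g x)) \<in> borel_measurable M" if [measurable]: "f \<in> borel_measurable M" "g \<in> borel_measurable M" for f g and M :: "'z measure"
  unfolding k1_def by measurable
 have k2m [measurable]: "(\<lambda>x. k2 (f x) (g x)) \<in> borel_measurable M" if [measurable]: "f \<in> borel_measurable M" "g \<in> borel_measurable M" for f g and M :: "'z measure"
  unfolding k2_def by measurable
 let ?f = "\<lambda>s u. ennreal ((1 + s) powr e * ?q (c - s)) * (if -1 < s \<and> s < c then 1 else 0) * zonal_kernel D s u"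
 have "(\<integral>\<^sup>+s\<in>{-1<..<c}. ennreal ((1 + s) powr e * ?q (c - s)) * (\<integral>\<^sup>+u. zonal_kernel D s u \<partial>m) \<partial>lborel)
  = (\<integral>\<^sup>+s. \<integral>\<^sup>+u. ?f s u \<partial>m \<partial>lborel)"
 proof (rule nn_integral_cong)
  fix s :: real
  have "(\<integral>\<^sup>+u. ?f s u \<partial>m) = ennreal ((1 + s) powr e * ?q (c - s)) * (if -1 < s \<and> s < c then 1 else 0) * (\<integral>\<^sup>+u. zonal_kernel D s u \<partial>m)"
   by (rule nn_integral_cmult) measurable
  then show "ennreal ((1 + s) powr e * ?q (c - s)) * (\<integral>\<^sup>+u. zonal_kernel D s u \<partial>m) * indicator {-1<..<c} s = (\<integral>\<^sup>+u. ?f s u \<partial>m)"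
   by (simp add: indicator_def)
 qed
 also have "\<dots> = (\<integral>\<^sup>+u. \<integral>\<^sup>+s. ?f s u \<partial>lborel \<partial>m)" by (rule pm.Fubini'[symmetric]) measurable
 also have "\<dots> = (\<integral>\<^sup>+u. \<integral>\<^sup>+t. ennreal pi * k1 u t \<partial>lborel \<partial>m)"
 proof (rule nn_integral_cong_AE, use m1 in eventually_elim)
  fix u :: real assume u: "-1 < u \<and> u < 1"
  have "(\<integral>\<^sup>+s. ?f s u \<partial>lborel) = (\<integral>\<^sup>+s. \<integral>\<^sup>+t. k1 u t * k2 t s \<partial>lborel \<partial>lborel)"
  \<comment> \<open>The factorisation holds for s different from u; the exceptional height is a null
    set.\<close>
  proof (rule nn_integral_cong_AE, use AE_lborel_singleton[of u] in eventually_elim)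
   fix s :: real assume su: "s \<noteq> u"
   show "?f s u = (\<integral>\<^sup>+t. k1 u t * k2 t s \<partial>lborel)"
   proof (cases "-1 < s \<and> s < c")
    case True
    have "?f s u = ennreal ((1 + s) powr e * ?q (c - s)) *
     (\<integral>\<^sup>+t\<in>{-1<..<min s u}. ennreal (((1 + s) * (1 + u)) powr (- e) * ?W t * ?q (s - t) * ?q (u - t)) \<partial>lborel)"
     unfolding zonal_kernel_def e_def using True u c su by (subst nn_integral_Copson) auto
    also have "\<dots> = (\<integral>\<^sup>+t. ennreal ((1 + s) powr e * ?q (c - s)) *
      (ennreal (((1 + s) * (1 + u)) powr (- e) * ?W t * ?q (s - t) * ?q (u - t)) * indicator {-1<..<min s u} t) \<partial>lborel)"
     by (rule nn_integral_cmult[symmetric]) measurable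
    also have "\<dots> = (\<integral>\<^sup>+t. k1 u t * k2 t s \<partial>lborel)"
    proof (rule nn_integral_cong)
     fix t :: real
     show "ennreal ((1 + s) powr e * ?q (c - s)) *
      (ennreal (((1 + s) * (1 + u)) powr (- e) * ?W t * ?q (s - t) * ?q (u - t)) * indicator {-1<..<min s u} t) = k1 u t * k2 t s"
     proof (cases "-1 < t \<and> t < s \<and> t < u")
      case lt: True
      have s1: "(1 + s) powr e * (1 + s) powr (- e) = 1" using True by (simp add: powr_add[symmetric])
      have "(1 + s) powr e * ?q (c - s) * (((1 + s) * (1 + u)) powr (- e) * ?W t * ?q (s - t) * ?q (u - t))
       = ((1 + s) powr e * (1 + s) powr (- e)) * (((1 + u) powr (- e) * ?W t * ?q (u - t)) * (?q (s - t) * ?q (c - s)))"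
       unfolding powr_mult by (simp only: mult_ac)
      then show ?thesis unfolding s1 k1_def k2_def using lt True by (simp add: ennreal_mult[symmetric])
     next
      case False
      then have "t \<notin> {-1<..<min s u}" and "k1 u t * k2 t s = 0" by (auto simp: k1_def k2_def)
      then show ?thesis by simp
     qed
    qed
    finally show ?thesis .
   next
    case False
    have z: "k1 u t * k2 t s = 0" for t using False by (auto simp: k1_def k2_def)
    show ?thesis unfolding z using False by auto
   qed
  qed
  also have "\<dots> = (\<integral>\<^sup>+t. \<integral>\<^sup>+s. k1 u t * k2 t s \<partial>lborel \<partial>lborel)" by (rule lborel_pair.Fubini') measurable
  also have "\<dots> = (\<integral>\<^sup>+t. ennreal pi * k1 u t \<partial>lborel)"
  proof (rule nn_integral_cong)
   fix t :: real
   have "(\<integral>\<^sup>+s. k1 u t * k2 t s \<partial>lborel) = k1 u t * (\<integral>\<^sup>+s. k2 t s \<partial>lborel)" by (rule nn_integral_cmult) measurable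
   also have "\<dots> = ennreal pi * k1 u t"
   proof (cases "t < c")
    case True
    have "(\<integral>\<^sup>+s. k2 t s \<partial>lborel) = (\<integral>\<^sup>+s\<in>{t<..<c}. ennreal (?q (s - t) * ?q (c - s)) \<partial>lborel)"
     unfolding k2_def by (rule nn_integral_cong) (simp add: indicator_def)
    then show ?thesis using nn_integral_Abel[OF True] by (simp add: mult.commute)
   qed (simp add: k1_def)
   finally show "(\<integral>\<^sup>+s. k1 u t * k2 t s \<partial>lborel) = ennreal pi * k1 u t" .
  qed
  finally show "(\<integral>\<^sup>+s. ?f s u \<partial>lborel) = (\<integral>\<^sup>+t. ennreal pi * k1 u t \<partial>lborel)" .
 qed
 also have "\<dots> = (\<integral>\<^sup>+u. ennreal ((1 + u) powr (- e)) * (\<integral>\<^sup>+t\<in>{..<u}. ennreal pi * ennreal (?W t) * indicator {-1<..<c} t * ennreal (?q (u - t)) \<partial>lborel) \<partial>m)"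
 proof (rule nn_integral_cong)
  fix u :: real
  have "(\<integral>\<^sup>+t. ennreal pi * k1 u t \<partial>lborel) = (\<integral>\<^sup>+t. ennreal ((1 + u) powr (- e)) * (ennreal pi * ennreal (?W t) * indicator {-1<..<c} t * ennreal (?q (u - t)) * indicator {..<u} t) \<partial>lborel)"
   by (rule nn_integral_cong) (simp add: k1_def indicator_def ennreal_mult mult_ac)
  also have "\<dots> = ennreal ((1 + u) powr (- e)) * (\<integral>\<^sup>+t\<in>{..<u}. ennreal pi * ennreal (?W t) * indicator {-1<..<c} t * ennreal (?q (u - t)) \<partial>lborel)"
   by (rule nn_integral_cmult) measurable
  finally show "(\<integral>\<^sup>+t. ennreal pi * k1 u t \<partial>lborel) = ennreal ((1 + u) powr (- e)) * (\<integral>\<^sup>+t\<in>{..<u}. ennreal pi * ennreal (?W t) * indicator {-1<..<c} t * ennreal (?q (u - t)) \<partial>lborel)" .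
 qed
 also have "\<dots> = (\<integral>\<^sup>+t. ennreal pi * ennreal (?W t) * indicator {-1<..<c} t * upper_moment D m t \<partial>lborel)"
  unfolding e_def by (rule nn_integral_upper_moment[symmetric]) measurable
 also have "\<dots> = (\<integral>\<^sup>+t. ennreal pi * (ennreal (?W t) * upper_moment D m t * indicator {-1<..<c} t) \<partial>lborel)"
  by (rule nn_integral_cong) (simp add: mult_ac)
 also have "\<dots> = ennreal pi * (\<integral>\<^sup>+t\<in>{-1<..<c}. ennreal (?W t) * upper_moment D m t \<partial>lborel)"
  using upper_moment_measurable by (intro nn_integral_cmult) simp
 finally show ?thesis unfolding e_def .
qed

text \<open>Since no mass lies above a, cutting the t-integral off at a loses nothing, and the Abel
  kernel between v and u again integrates to pi. The result is a weighted tail of m.\<close>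

lemma Abel_transform_upper_moment:
 assumes m1: "AE u in m. u \<le> a"
 shows "(\<integral>\<^sup>+t\<in>{v<..<a}. upper_moment D m t * ennreal ((t - v) powr (-1/2)) \<partial>lborel)
  = ennreal pi * (\<integral>\<^sup>+u\<in>{v<..}. ennreal ((1 + u) powr (- ((D - 3) / 2))) \<partial>m)"
proof -
 note sets_m[measurable_cong]
 let ?w = "\<lambda>u. ennreal ((1 + u) powr (- ((D - 3) / 2)))"
 have "(\<integral>\<^sup>+t\<in>{v<..<a}. upper_moment D m t * ennreal ((t - v) powr (-1/2)) \<partial>lborel)
  = (\<integral>\<^sup>+t. ennreal ((t - v) powr (-1/2)) * indicator {v<..<a} t * upper_moment D m t \<partial>lborel)"
  by (rule nn_integral_cong) (simp add: mult_ac)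
 also have "\<dots> = (\<integral>\<^sup>+u. ?w u * (\<integral>\<^sup>+t\<in>{..<u}. ennreal ((t - v) powr (-1/2)) * indicator {v<..<a} t * ennreal ((u - t) powr (-1/2)) \<partial>lborel) \<partial>m)"
  by (rule nn_integral_upper_moment) measurable
 also have "\<dots> = (\<integral>\<^sup>+u. ennreal pi * (?w u * indicator {v<..} u) \<partial>m)"
 proof (rule nn_integral_cong_AE, use m1 in eventually_elim)
  fix u assume u: "u \<le> a"
  have "(\<integral>\<^sup>+t\<in>{..<u}. ennreal ((t - v) powr (-1/2)) * indicator {v<..<a} t * ennreal ((u - t) powr (-1/2)) \<partial>lborel)
   = (\<integral>\<^sup>+t\<in>{v<..<u}. ennreal ((t - v) powr (-1/2) * (u - t) powr (-1/2)) \<partial>lborel)"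
   using u by (intro nn_integral_cong) (auto simp: indicator_def ennreal_mult)
  also have "\<dots> = ennreal pi * indicator {v<..} u"
  proof (cases "v < u")
   case True
   then show ?thesis using nn_integral_Abel[OF True] by simp
  next
   case False
   then have "{v<..<u} = {}" by auto
   then show ?thesis using False by simp
  qed
  finally show "?w u * (\<integral>\<^sup>+t\<in>{..<u}. ennreal ((t - v) powr (-1/2)) * indicator {v<..<a} t * ennreal ((u - t) powr (-1/2)) \<partial>lborel) = ennreal pi * (?w u * indicator {v<..} u)"
   by (simp add: mult_ac)
 qed
 also have "\<dots> = ennreal pi * (\<integral>\<^sup>+u\<in>{v<..}. ?w u \<partial>m)" by (rule nn_integral_cmult) measurable
 finally show ?thesis .
qed

end

lemma integrable_Abel_moment:
 assumes D: "D \<ge> 3" and C2: "C2_weighted a y y1 y2 K" and c: "-1 < c" "c < a"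
 shows "integrable unit_ivl (\<lambda>x. y (-1 + (1 + c) * x) * (x powr ((D - 1) / 2 - 1) * (1 - x) powr (1/2 - 1)))"
proof (rule Bochner_Integration.integrable_bound)
 let ?w = "\<lambda>x. x powr ((D - 1) / 2 - 1) * (1 - x) powr (1/2 - 1)"
 show "integrable unit_ivl (\<lambda>x. K * ?w x)"
  using D by (intro integrable_mult_right Beta_weight) auto
 have xm: "(\<lambda>x. x) \<in> borel_measurable unit_ivl" by (rule continuous_on_unit_ivl_measurable) (rule continuous_on_id)
 show "(\<lambda>x. y (-1 + (1 + c) * x) * ?w x) \<in> borel_measurable unit_ivl"
  using C2_weighted_scaled_measurable[OF D C2 c] xm by measurable
 show "AE x in unit_ivl. norm (y (-1 + (1 + c) * x) * ?w x) \<le> norm (K * ?w x)"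
 proof (rule AE_I2)
  fix x assume x: "x \<in> space unit_ivl"
  have "\<bar>y (-1 + (1 + c) * x)\<bar> \<le> K" using C2_weightedD(3)[OF C2] unit_ivl_scaled[of x c a] x c by simp
  then show "norm (y (-1 + (1 + c) * x) * ?w x) \<le> norm (K * ?w x)"
   by (auto simp: abs_mult intro!: mult_right_mono)
 qed
qed

lemma ennreal_cmult_cancel:
 assumes "c > 0" "ennreal c * x = ennreal (c * y)" "0 \<le> y"
 shows "x = ennreal y"
 using assms by (simp add: ennreal_mult ennreal_mult_cancel_left)

text \<open>Two Abel transforms invert the zonal potential: the potential \<open>y\<close> on the cap is turned into \<open>Abel_g\<close> by
 the first one, and \<open>Abel_g\<close> into the distribution function of the heights by the second.\<close>

lemma height_law_density:
 fixes m :: "real measure"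
 assumes D: "D \<ge> 3" and a: "-1 < a" "a < 1" and C2: "C2_weighted a y y1 y2 K"
  and m: "sets m = sets borel" "finite_measure m" and conc: "AE u in m. -1 < u \<and> u \<le> a"
  and y0: "AE s in lborel. s \<in> {-1<..<a} \<longrightarrow> 0 \<le> y s" and \<kappa>: "\<kappa> > 0"
  and pot: "AE s in lborel. s \<in> {-1<..<a} \<longrightarrow> ennreal \<kappa> * (\<integral>\<^sup>+u. zonal_kernel D s u \<partial>m) = ennreal (pi * y s)"
  and B': "\<And>v. -1 < v \<Longrightarrow> v < a \<Longrightarrow> (upper_Abel a (Abel_g D y y1) has_real_derivative B' v) (at v)"
 shows "\<And>v. -1 < v \<Longrightarrow> v < a \<Longrightarrow> B' v \<le> 0"
  and "m = density lborel (\<lambda>v. ennreal ((1 + v) powr ((D - 3) / 2) * (- B' v) / (pi * \<kappa>) * indicator {-1<..<a} v))"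
proof -
 note m(1)[measurable_cong]
 interpret m: finite_measure m by (rule m(2))
 note ums[measurable] = upper_moment_measurable[OF m]
 define e where "e = (D - 3) / 2"
 define G where "G = Abel_g D y y1"
 define L where "L = lower_Abel D y"
 define B where "B = upper_Abel a G"
 define S where "S = upper_moment D m"
 define W where "W = Copson_weight D"
 let ?WS = "\<lambda>A. \<integral>\<^sup>+t\<in>A. ennreal (W t) * S t \<partial>lborel"
 have Wm [measurable]: "W \<in> borel_measurable borel" by (simp add: W_def)
 have Sm [measurable]: "S \<in> borel_measurable borel" by (simp add: S_def)
 obtain G' where nice: "nice_on a G G'" using nice_on_Abel_g[OF D C2 a(2)] by (auto simp: G_def)
 have dG: "(G has_real_derivative G' c) (at c)" if "-1 < c" "c < a" for c
  using nice that by (auto simp: nice_on_def)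
 have dL: "(L has_real_derivative W c * G c) (at c)" if "-1 < c" "c < a" for c
  unfolding L_def W_def G_def by (rule lower_Abel_derivative[OF D C2 a(2) that])
 have W0: "W t > 0" if "-1 < t" "t < a" for t using that a by (simp add: W_def Copson_weight_def)
 have first: "ennreal \<kappa> * ?WS {-1<..<c} = ennreal (L c)" "0 \<le> L c" if c: "-1 < c" "c < a" for c
 proof -
  let ?f = "\<lambda>s. y s * (1 + s) powr e * (c - s) powr (-1/2)"
  have si: "set_integrable lborel {-1..c} ?f"
   using integrable_Abel_moment[OF D C2 c] lower_Abel_scaled(2)[OF c(1), of y D] by (simp add: e_def)
  have nn: "AE s in lborel. 0 \<le> indicator {-1..c} s *\<^sub>R ?f s"
   using y0 AE_lborel_singleton[of "-1"] by eventually_elim (use c in \<open>auto simp: indicator_def\<close>)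
  have Lc: "(\<integral>s. indicator {-1..c} s *\<^sub>R ?f s \<partial>lborel) = L c" by (simp add: L_def lower_Abel_def set_lebesgue_integral_def e_def)
  show "0 \<le> L c" unfolding Lc[symmetric] by (rule integral_nonneg_AE[OF nn])
  have "ennreal \<kappa> * (ennreal pi * ?WS {-1<..<c}) =
   ennreal \<kappa> * (\<integral>\<^sup>+s\<in>{-1<..<c}. ennreal ((1 + s) powr e * (c - s) powr (-1/2)) * (\<integral>\<^sup>+u. zonal_kernel D s u \<partial>m) \<partial>lborel)"
  proof -
   have "AE u in m. -1 < u \<and> u < 1" using conc by eventually_elim (use a in auto)
   from Abel_transform_zonal[OF m this c(1), of D] c a show ?thesis by (simp add: W_def S_def e_def)
  qed
  also have "\<dots> = (\<integral>\<^sup>+s. ennreal \<kappa> * (ennreal ((1 + s) powr e * (c - s) powr (-1/2)) * (\<integral>\<^sup>+u. zonal_kernel D s u \<partial>m) * indicator {-1<..<c} s) \<partial>lborel)"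
   by (rule nn_integral_cmult[symmetric]) measurable
  also have "\<dots> = (\<integral>\<^sup>+s. ennreal pi * ennreal (indicator {-1..c} s *\<^sub>R ?f s) \<partial>lborel)"
  proof (rule nn_integral_cong_AE, use pot y0 AE_lborel_singleton[of "-1"] AE_lborel_singleton[of c] in eventually_elim)
   fix s assume s: "s \<in> {-1<..<a} \<longrightarrow> ennreal \<kappa> * (\<integral>\<^sup>+u. zonal_kernel D s u \<partial>m) = ennreal (pi * y s)"
    "s \<in> {-1<..<a} \<longrightarrow> 0 \<le> y s" "s \<noteq> -1" "s \<noteq> c"
   show "ennreal \<kappa> * (ennreal ((1 + s) powr e * (c - s) powr (-1/2)) * (\<integral>\<^sup>+u. zonal_kernel D s u \<partial>m) * indicator {-1<..<c} s)
    = ennreal pi * ennreal (indicator {-1..c} s *\<^sub>R ?f s)"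
   proof (cases "s \<in> {-1<..<c}")
    case True
    then have s': "s \<in> {-1<..<a}" using c by auto
    let ?Z = "\<integral>\<^sup>+u. zonal_kernel D s u \<partial>m"
    have "ennreal \<kappa> * (ennreal ((1 + s) powr e * (c - s) powr (-1/2)) * ?Z * indicator {-1<..<c} s)
     = ennreal ((1 + s) powr e * (c - s) powr (-1/2)) * (ennreal \<kappa> * ?Z)" using True by (simp add: mult_ac)
    also have "\<dots> = ennreal ((1 + s) powr e * (c - s) powr (-1/2)) * ennreal (pi * y s)" using s(1) s' by simp
    also have "\<dots> = ennreal ((1 + s) powr e * (c - s) powr (-1/2) * (pi * y s))" by (rule ennreal_mult'[symmetric]) simp
    also have "(1 + s) powr e * (c - s) powr (-1/2) * (pi * y s) = pi * ?f s" by simp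
    also have "ennreal (pi * ?f s) = ennreal pi * ennreal (?f s)" by (rule ennreal_mult') simp
    finally show ?thesis using True by simp
   next
    case False
    then show ?thesis using s(3,4) by (auto simp: indicator_def)
   qed
  qed
  also have "\<dots> = ennreal pi * (\<integral>\<^sup>+s. ennreal (indicator {-1..c} s *\<^sub>R ?f s) \<partial>lborel)"
   using si by (intro nn_integral_cmult) (auto simp: set_integrable_def)
  also have "(\<integral>\<^sup>+s. ennreal (indicator {-1..c} s *\<^sub>R ?f s) \<partial>lborel) = ennreal (L c)"
   unfolding Lc[symmetric] using si nn by (intro nn_integral_eq_integral) (auto simp: set_integrable_def)
  finally have "ennreal pi * (ennreal \<kappa> * ?WS {-1<..<c}) = ennreal pi * ennreal (L c)"
   by (simp add: mult_ac)
  then show "ennreal \<kappa> * ?WS {-1<..<c} = ennreal (L c)"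
   by (simp add: ennreal_mult_cancel_left)
 qed
 have incr: "ennreal \<kappa> * ?WS {c<..d} = ennreal (L d - L c)" "L c \<le> L d"
  if cd: "-1 < c" "c < d" "d < a" for c d
 proof -
  have "?WS {-1<..<d} =
   (\<integral>\<^sup>+t. ennreal (W t) * S t * indicator {-1<..<c} t + ennreal (W t) * S t * indicator {c<..d} t \<partial>lborel)"
  proof (rule nn_integral_cong_AE, use AE_lborel_singleton[of c] AE_lborel_singleton[of d] in eventually_elim)
   fix t :: real assume "t \<noteq> c" "t \<noteq> d"
   then show "ennreal (W t) * S t * indicator {-1<..<d} t = ennreal (W t) * S t * indicator {-1<..<c} t + ennreal (W t) * S t * indicator {c<..d} t"
    using cd by (auto simp: indicator_def)
  qed
  also have "\<dots> = ?WS {-1<..<c} + ?WS {c<..d}"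
   by (rule nn_integral_add) measurable
  finally have "ennreal (L d) = ennreal (L c) + ennreal \<kappa> * ?WS {c<..d}"
   using first(1)[of c] first(1)[of d] cd by (simp add: distrib_left)
  moreover from this have "ennreal (L c) \<le> ennreal (L d)" by simp
  then show "L c \<le> L d" using first(2)[of d] cd by (simp add: ennreal_le_iff)
  ultimately show "ennreal \<kappa> * ?WS {c<..d} = ennreal (L d - L c)"
   using first(2)[of c] cd by (simp add: ennreal_minus[symmetric])
 qed
 \<comment> \<open>Increments of L are integrals of non-negative functions, so L is nondecreasing
   and its derivative W * G cannot be negative. The sign is required before integrals of G can be
   taken in \<open>ennreal\<close>.\<close>
 have G0: "G c \<ge> 0" if c: "-1 < c" "c < a" for c
 proof -
  have "W c * G c \<ge> 0"
  proof (rule ccontr)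
   assume "\<not> W c * G c \<ge> 0"
   then have "W c * G c < 0" by simp
   from DERIV_neg_dec_right[OF dL[OF c] this] obtain h where h: "h > 0" "\<And>x. 0 < x \<Longrightarrow> x < h \<Longrightarrow> L c > L (c + x)" by blast
   define x where "x = min (h / 2) ((a - c) / 2)"
   have "0 < x" "x < h" "c + x < a" using h(1) c by (auto simp: x_def min_def field_simps)
   then show False using h(2)[of x] incr(2)[of c "c + x"] c by auto
  qed
  then show ?thesis using W0[OF c] by (simp add: zero_le_mult_iff)
 qed
 define Gi where "Gi t = G t * indicator {-1<..<a} t" for t
 have Gi [measurable]: "Gi \<in> borel_measurable borel"
 proof -
  have "continuous_on {-1<..<a} G" using dG by (auto intro!: continuous_at_imp_continuous_on DERIV_isCont)
  then have "(\<lambda>x. indicator {-1<..<a} x *\<^sub>R G x) \<in> borel_measurable borel"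
   by (intro borel_measurable_continuous_on_indicator) auto
  then show ?thesis unfolding Gi_def by (simp add: mult.commute)
 qed
 \<comment> \<open>Both functions have the integral L d - L c over (c, d], one by the first Abel
   transform and the other by the fundamental theorem; so they agree almost everywhere.\<close>
 have SG: "AE t in lborel. t \<in> {-1<..<a} \<longrightarrow> ennreal \<kappa> * (ennreal (W t) * S t) = ennreal (W t * Gi t)"
 proof (rule AE_eq_from_integrals)
  fix c d assume cd: "-1 < c" "c < d" "d < a"
  have "(\<integral>\<^sup>+t\<in>{c<..d}. ennreal \<kappa> * (ennreal (W t) * S t) \<partial>lborel) = (\<integral>\<^sup>+t. ennreal \<kappa> * (ennreal (W t) * S t * indicator {c<..d} t) \<partial>lborel)"
   by (rule nn_integral_cong) (simp add: mult_ac)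
  also have "\<dots> = ennreal \<kappa> * ?WS {c<..d}" by (rule nn_integral_cmult) measurable
  also have "\<dots> = ennreal (L d - L c)" by (rule incr(1)[OF cd])
  finally have l: "(\<integral>\<^sup>+t\<in>{c<..d}. ennreal \<kappa> * (ennreal (W t) * S t) \<partial>lborel) = ennreal (L d - L c)" .
  have "(\<integral>\<^sup>+t\<in>{c..d}. ennreal (W t * Gi t) \<partial>lborel) = ennreal (L d - L c)"
  proof (rule nn_integral_FTC_Icc)
   fix x assume "x \<in> {c..d}"
   then have x: "-1 < x" "x < a" using cd by auto
   then show "(L has_real_derivative W x * Gi x) (at x)" using dL[OF x] by (simp add: Gi_def)
   show "0 \<le> W x * Gi x" using W0[OF x] G0[OF x] x by (simp add: Gi_def)
  qed (use cd in auto)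
  moreover have "(\<integral>\<^sup>+t\<in>{c<..d}. ennreal (W t * Gi t) \<partial>lborel) = (\<integral>\<^sup>+t\<in>{c..d}. ennreal (W t * Gi t) \<partial>lborel)"
   by (rule nn_integral_cong_AE, use AE_lborel_singleton[of c] in eventually_elim) (auto simp: indicator_def)
  ultimately show "(\<integral>\<^sup>+t\<in>{c<..d}. ennreal \<kappa> * (ennreal (W t) * S t) \<partial>lborel) = (\<integral>\<^sup>+t\<in>{c<..d}. ennreal (W t * Gi t) \<partial>lborel)"
   using l by simp
  show "(\<integral>\<^sup>+t\<in>{c<..d}. ennreal \<kappa> * (ennreal (W t) * S t) \<partial>lborel) \<noteq> \<infinity>" unfolding l by simp
 qed (use a in auto)
 define T where "T v = (\<integral>\<^sup>+u\<in>{v<..}. ennreal ((1 + u) powr (- e)) \<partial>m)" for v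
 have second: "ennreal (pi * \<kappa>) * T v = ennreal (B v)" "0 \<le> B v" if v: "-1 < v" "v < a" for v
 proof -
  let ?g = "\<lambda>t. G t * (t - v) powr (-1/2)"
  have si: "set_integrable lborel {v..a} ?g" by (rule nice_on_upper_Abel(3)[OF nice v])
  have nn: "AE t in lborel. 0 \<le> indicator {v..a} t *\<^sub>R ?g t"
   using AE_lborel_singleton[of a] by eventually_elim (use v G0 in \<open>auto simp: indicator_def\<close>)
  have Bv: "(\<integral>t. indicator {v..a} t *\<^sub>R ?g t \<partial>lborel) = B v" by (simp add: B_def upper_Abel_def set_lebesgue_integral_def)
  show "0 \<le> B v" unfolding Bv[symmetric] by (rule integral_nonneg_AE[OF nn])
  have "AE u in m. u \<le> a" using conc by eventually_elim auto
  from Abel_transform_upper_moment[OF m this, where D = D and v = v]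
  have "ennreal pi * T v = (\<integral>\<^sup>+t\<in>{v<..<a}. S t * ennreal ((t - v) powr (-1/2)) \<partial>lborel)" by (simp add: T_def S_def e_def)
  from arg_cong[OF this, of "\<lambda>x. ennreal \<kappa> * x"]
  have "ennreal (pi * \<kappa>) * T v = ennreal \<kappa> * (\<integral>\<^sup>+t\<in>{v<..<a}. S t * ennreal ((t - v) powr (-1/2)) \<partial>lborel)"
   using \<kappa> by (simp only: ennreal_mult[OF less_imp_le[OF pi_gt_zero] less_imp_le[OF \<kappa>]] mult_ac)
  also have "\<dots> = (\<integral>\<^sup>+t. ennreal \<kappa> * (S t * ennreal ((t - v) powr (-1/2)) * indicator {v<..<a} t) \<partial>lborel)"
   by (rule nn_integral_cmult[symmetric]) measurable
  also have "\<dots> = (\<integral>\<^sup>+t. ennreal (indicator {v..a} t *\<^sub>R ?g t) \<partial>lborel)"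
  proof (rule nn_integral_cong_AE, use SG AE_lborel_singleton[of v] AE_lborel_singleton[of a] in eventually_elim)
   fix t :: real assume st: "t \<in> {-1<..<a} \<longrightarrow> ennreal \<kappa> * (ennreal (W t) * S t) = ennreal (W t * Gi t)" "t \<noteq> v" "t \<noteq> a"
   show "ennreal \<kappa> * (S t * ennreal ((t - v) powr (-1/2)) * indicator {v<..<a} t) = ennreal (indicator {v..a} t *\<^sub>R ?g t)"
   proof (cases "t \<in> {v<..<a}")
    case True
    then have t': "-1 < t" "t < a" using v by auto
    have "ennreal (W t) * (ennreal \<kappa> * S t) = ennreal (W t * G t)" using st t' by (simp add: Gi_def mult_ac)
    then have "ennreal \<kappa> * S t = ennreal (G t)" using W0[OF t'] G0[OF t'] by (rule_tac ennreal_cmult_cancel) auto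
    then have "ennreal \<kappa> * (S t * ennreal ((t - v) powr (-1/2))) = ennreal (G t) * ennreal ((t - v) powr (-1/2))"
     by (simp add: mult.assoc[symmetric])
    then show ?thesis using True G0[OF t'] by (simp add: ennreal_mult)
   next
    case False
    then show ?thesis using st by (auto simp: indicator_def)
   qed
  qed
  also have "\<dots> = ennreal (B v)"
   unfolding Bv[symmetric] using si nn by (intro nn_integral_eq_integral) (auto simp: set_integrable_def)
  finally show "ennreal (pi * \<kappa>) * T v = ennreal (B v)" .
 qed
 have dB: "(B has_real_derivative B' v) (at v)" if "-1 < v" "v < a" for v
  unfolding B_def G_def by (rule B'[OF that])
 \<comment> \<open>The law with the weight under which T is an honest tail function: its mass on (c,
   d] is T c - T d. The weight is positive above -1 and is divided out at the end.\<close>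
 let ?mw = "density m (\<lambda>u. ennreal ((1 + u) powr (- e)) * indicator {-1<..} u)"
 have mw: "emeasure ?mw {c<..d} = ennreal (B c - B d) / ennreal (pi * \<kappa>)" "B d \<le> B c" if cd: "-1 < c" "c < d" "d < a" for c d
 proof -
  have "T c = (\<integral>\<^sup>+u. ennreal ((1 + u) powr (- e)) * indicator {c<..d} u + ennreal ((1 + u) powr (- e)) * indicator {d<..} u \<partial>m)"
   unfolding T_def using cd by (intro nn_integral_cong) (auto simp: indicator_def)
  also have "\<dots> = (\<integral>\<^sup>+u\<in>{c<..d}. ennreal ((1 + u) powr (- e)) \<partial>m) + T d"
   unfolding T_def by (rule nn_integral_add) measurable
  also have "(\<integral>\<^sup>+u\<in>{c<..d}. ennreal ((1 + u) powr (- e)) \<partial>m) = emeasure ?mw {c<..d}"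
   using cd by (subst emeasure_density) (auto intro!: nn_integral_cong simp: indicator_def m(1))
  finally have "ennreal (B c) = ennreal (pi * \<kappa>) * emeasure ?mw {c<..d} + ennreal (B d)"
   using second(1)[of c] second(1)[of d] cd by (simp add: distrib_left)
  moreover from this have "ennreal (B d) \<le> ennreal (B c)" by simp
  then show "B d \<le> B c" using second(2)[of c] cd by (simp add: ennreal_le_iff)
  ultimately have "ennreal (pi * \<kappa>) * emeasure ?mw {c<..d} = ennreal (B c - B d)"
   using second(2)[of d] cd by (simp add: ennreal_minus[symmetric])
  then show "emeasure ?mw {c<..d} = ennreal (B c - B d) / ennreal (pi * \<kappa>)"
   using \<kappa> by (metis ennreal_mult_divide_eq mult.commute ennreal_eq_0_iff ennreal_neq_top mult_pos_pos not_le pi_gt_zero)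
 qed
 show B'0: "B' v \<le> 0" if v: "-1 < v" "v < a" for v
 proof (rule ccontr)
  assume "\<not> B' v \<le> 0"
  then have "B' v > 0" by simp
  from DERIV_pos_inc_right[OF dB[OF v] this] obtain h where h: "h > 0" "\<And>x. 0 < x \<Longrightarrow> x < h \<Longrightarrow> B v < B (v + x)" by blast
  define x where "x = min (h / 2) ((a - v) / 2)"
  have "0 < x" "x < h" "v + x < a" using h(1) v by (auto simp: x_def min_def field_simps)
  then show False using h(2)[of x] mw(2)[of v "v + x"] v by auto
 qed
 have dm [measurable]: "(\<lambda>v. B' v * indicator {-1<..<a} v) \<in> borel_measurable borel"
  using dB by (rule derivative_measurable)
 define b where "b v = - (B' v * indicator {-1<..<a} v) / (pi * \<kappa>)" for v
 have bm [measurable]: "b \<in> borel_measurable borel" unfolding b_def[abs_def] by measurable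
 let ?db = "density lborel (\<lambda>v. ennreal (b v))"
 let ?I = "- {-1<..<a}"
 have "?mw = ?db"
 proof (rule measure_eqI_Ioo[OF _ _ a(1)])
  fix c d assume cd: "-1 < c" "c < d" "d < a"
  have "(\<integral>\<^sup>+v\<in>{c..d}. ennreal (b v) \<partial>lborel) = ennreal ((- B d / (pi * \<kappa>)) - (- B c / (pi * \<kappa>)))"
  proof (rule nn_integral_FTC_Icc)
   fix x assume "x \<in> {c..d}"
   then have x: "-1 < x" "x < a" using cd by auto
   show "((\<lambda>v. - B v / (pi * \<kappa>)) has_real_derivative b x) (at x)"
    unfolding b_def using x \<kappa> by (auto intro!: derivative_eq_intros dB)
   show "0 \<le> b x" using B'0[OF x] \<kappa> by (simp add: b_def indicator_def divide_nonpos_pos)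
  qed (use cd in auto)
  also have "(- B d / (pi * \<kappa>)) - (- B c / (pi * \<kappa>)) = (B c - B d) / (pi * \<kappa>)" by (simp add: diff_divide_distrib)
  also have "(\<integral>\<^sup>+v\<in>{c..d}. ennreal (b v) \<partial>lborel) = emeasure ?db {c<..d}"
  proof -
   have "(\<integral>\<^sup>+v\<in>{c..d}. ennreal (b v) \<partial>lborel) = (\<integral>\<^sup>+v\<in>{c<..d}. ennreal (b v) \<partial>lborel)"
    by (rule nn_integral_cong_AE, use AE_lborel_singleton[of c] in eventually_elim) (auto simp: indicator_def)
   then show ?thesis by (subst emeasure_density) auto
  qed
  finally show "emeasure ?mw {c<..d} = emeasure ?db {c<..d}"
   unfolding mw(1)[OF cd] using \<kappa> mw(2)[OF cd] by (simp add: divide_ennreal)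
  show "emeasure ?mw {c<..d} \<noteq> \<infinity>" unfolding mw(1)[OF cd] using \<kappa> mw(2)[OF cd] by (simp add: divide_ennreal)
 next
  \<comment> \<open>There is no atom at \<open>a\<close>: the mass above \<open>v\<close> is at most \<open>B v\<close> up to a factor, which tends to \<open>0\<close> as \<open>v\<close> tends to \<open>a\<close>.\<close>
  have Bl: "(B \<longlongrightarrow> 0) (at_left a)" unfolding B_def by (rule nice_on_upper_Abel(2)[OF nice a(1)])
  have small: "emeasure ?mw ?I \<le> ennreal \<epsilon>" if \<epsilon>: "\<epsilon> > 0" for \<epsilon>
  proof -
   have "eventually (\<lambda>v. B v < pi * \<kappa> * \<epsilon>) (at_left a)" using order_tendstoD(2)[OF Bl, of "pi * \<kappa> * \<epsilon>"] \<epsilon> \<kappa> by simp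
   moreover have "eventually (\<lambda>v. v > -1) (at_left a)" using a eventually_at_left_real by (auto simp: eventually_at_left_field)
   moreover have "eventually (\<lambda>v. v < a) (at_left a)" by (auto simp: eventually_at_left_field intro: exI[of _ "a - 1"])
   ultimately have "eventually (\<lambda>v. B v < pi * \<kappa> * \<epsilon> \<and> -1 < v \<and> v < a) (at_left a)" by eventually_elim auto
   then obtain v where v: "B v < pi * \<kappa> * \<epsilon>" "-1 < v" "v < a"
    using eventually_happens[of _ "at_left a"] trivial_limit_at_left_real by blast
   have "emeasure ?mw ?I = (\<integral>\<^sup>+u. ennreal ((1 + u) powr (- e)) * indicator {-1<..} u * indicator ?I u \<partial>m)"
    by (rule emeasure_density) (auto simp: m(1))
   also have "\<dots> \<le> T v" unfolding T_def using v by (intro nn_integral_mono) (auto simp: indicator_def)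
   finally have "ennreal (pi * \<kappa>) * emeasure ?mw ?I \<le> ennreal (pi * \<kappa>) * T v" by (rule mult_left_mono) simp
   also have "\<dots> \<le> ennreal (pi * \<kappa>) * ennreal \<epsilon>"
    unfolding second(1)[OF v(2,3)] using v \<kappa> \<epsilon> by (subst ennreal_mult[symmetric]) (auto intro!: ennreal_leI)
   finally show ?thesis using \<kappa> by (subst (asm) ennreal_mult_le_mult_iff) auto
  qed
  have "emeasure ?mw ?I \<le> 0"
  proof (rule ennreal_le_epsilon)
   fix \<epsilon> :: real assume "0 < \<epsilon>"
   from small[OF this] show "emeasure ?mw ?I \<le> 0 + ennreal \<epsilon>" by (simp only: add_0_left)
  qed
  then show "emeasure ?mw ?I = 0" by (simp only: le_zero_eq)
  have "emeasure ?db ?I = (\<integral>\<^sup>+v. ennreal (b v) * indicator ?I v \<partial>lborel)"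
   by (rule emeasure_density) auto
  also have "\<dots> = (\<integral>\<^sup>+(v::real). 0 \<partial>lborel)" by (rule nn_integral_cong) (auto simp: b_def indicator_def)
  finally show "emeasure ?db ?I = 0" by simp
 qed (simp_all add: m(1))
 moreover have "m = density ?mw (\<lambda>u. ennreal ((1 + u) powr e))"
 proof -
  have "density ?mw (\<lambda>u. ennreal ((1 + u) powr e)) = density m (\<lambda>u. ennreal ((1 + u) powr (- e)) * indicator {-1<..} u * ennreal ((1 + u) powr e))"
   by (rule density_density_eq) measurable
  also have "\<dots> = density m (\<lambda>_. 1)"
  proof (rule density_cong)
   show "AE u in m. ennreal ((1 + u) powr (- e)) * indicator {-1<..} u * ennreal ((1 + u) powr e) = 1"
    using conc by eventually_elim (simp add: ennreal_mult[symmetric] powr_add[symmetric])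
  qed measurable
  finally show ?thesis by (simp add: density_1)
 qed
 ultimately have "m = density ?db (\<lambda>u. ennreal ((1 + u) powr e))" by simp
 also have "\<dots> = density lborel (\<lambda>v. ennreal (b v) * ennreal ((1 + v) powr e))" by (rule density_density_eq) measurable
 also have "\<dots> = density lborel (\<lambda>v. ennreal ((1 + v) powr ((D - 3) / 2) * (- B' v) / (pi * \<kappa>) * indicator {-1<..<a} v))"
  by (rule arg_cong[where f = "density lborel"])
   (auto simp: fun_eq_iff b_def e_def indicator_def ennreal_mult'[symmetric] mult_ac ennreal_mult''[symmetric])
 finally show "m = density lborel (\<lambda>v. ennreal ((1 + v) powr ((D - 3) / 2) * (- B' v) / (pi * \<kappa>) * indicator {-1<..<a} v))" .
qed

section \<open>Rotationally invariant fields\<close>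

definition meridian :: "'n \<Rightarrow> 'n \<Rightarrow> real \<Rightarrow> real ^ 'n" where
 "meridian k j \<theta> = cos \<theta> *\<^sub>R axis k 1 + sin \<theta> *\<^sub>R axis j 1"

lemma meridian_nth:
 assumes "k \<noteq> j"
 shows "meridian k j \<theta> $ k = cos \<theta>"
 using assms by (simp add: meridian_def axis_def)

lemma meridian_in_sphere:
 fixes k j :: "'n::finite"
 assumes "k \<noteq> j"
 shows "meridian k j \<theta> \<in> sphere 0 1"
proof -
 have "meridian k j \<theta> \<bullet> meridian k j \<theta> = (cos \<theta>)\<^sup>2 + (sin \<theta>)\<^sup>2"
  using assms by (simp add: meridian_def inner_add_left inner_add_right inner_axis_axis power2_eq_square)
 then show ?thesis by (simp add: norm_eq_1)
qed

lemma polar_angle_meridian: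
 "k \<noteq> j \<Longrightarrow> 0 \<le> \<theta> \<Longrightarrow> \<theta> \<le> pi \<Longrightarrow> polar_angle k (meridian k j \<theta>) = \<theta>"
 by (simp add: polar_angle_def meridian_nth arccos_cos)

lemma sphere_nth_bounds:
 fixes x :: "real^'n::finite"
 assumes "x \<in> sphere 0 1"
 shows "-1 \<le> x $ k" "x $ k \<le> 1"
 using component_le_norm_cart[of x k] assms by auto

lemma cos_polar_angle:
 fixes x :: "real^'n::finite"
 shows "x \<in> sphere 0 1 \<Longrightarrow> cos (polar_angle k x) = x $ k"
 using sphere_nth_bounds[of x k] by (simp add: polar_angle_def)

text \<open>A reflection that fixes the axis maps the meridian point to y. If the determinant is -1,
  the sign of a third coordinate i is changed beforehand, which does not move the meridian plane:
  here d \<ge> 3 enters. Where the radius w of the parallel vanishes there is no direction to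
  rotate, and y is the meridian point itself.\<close>

lemma rotation_to_meridian:
 fixes k j :: "'n::finite" and y :: "real^'n"
 assumes n: "CARD('n) \<ge> 3" and kj: "k \<noteq> j" and y: "y \<in> sphere 0 1"
 shows "y = meridian k j (polar_angle k y) \<or>
  (\<exists>A. rotation_matrix A \<and> A *v axis k 1 = axis k 1 \<and> y = A *v meridian k j (polar_angle k y))"
proof -
 define u where "u = y $ k"
 define w where "w = sin (polar_angle k y)"
 have b: "-1 \<le> u" "u \<le> 1" using sphere_nth_bounds[OF y, of k] by (auto simp: u_def)
 have cu: "cos (polar_angle k y) = u" using cos_polar_angle[OF y] by (simp add: u_def)
 have w2: "w\<^sup>2 = 1 - u\<^sup>2" using sin_squared_eq[of "polar_angle k y"] by (simp add: w_def cu)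
 define ek ej :: "real^'n" where e: "ek = axis k 1" "ej = axis j 1"
 have y0: "meridian k j (polar_angle k y) = u *\<^sub>R ek + w *\<^sub>R ej" by (simp add: meridian_def cu e w_def)
 have ee: "norm ek = 1" "norm ej = 1" "ek \<bullet> ej = 0" "ek \<bullet> ek = 1" "ej \<bullet> ej = 1"
  using kj by (simp_all add: e inner_axis_axis)
 have ix: "x \<bullet> ek = x $ k" "x \<bullet> ej = x $ j" for x by (simp_all add: e inner_axis)
 have yy: "y \<bullet> y = 1" using y by (simp add: norm_eq_1)
 have n2: "(y - u *\<^sub>R ek) \<bullet> (y - u *\<^sub>R ek) = w\<^sup>2"
  using ee yy ix[of y] w2 by (simp add: inner_diff_left inner_diff_right inner_commute[of ek y] u_def[symmetric] power2_eq_square)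
 show ?thesis
 proof (cases "w = 0")
  case True
  then have "y - u *\<^sub>R ek = 0" using n2 by simp
  then have "y = meridian k j (polar_angle k y)" unfolding y0 True by simp
  then show ?thesis ..
 next
  case False
  define p where "p = (1 / w) *\<^sub>R (y - u *\<^sub>R ek)"
  have "p \<bullet> p = 1" using n2 False unfolding p_def by (simp add: power2_eq_square)
  then have p1: "norm p = 1" by (simp add: norm_eq_1)
  have pk: "ek \<bullet> p = 0" using ee ix[of y] by (simp add: p_def inner_diff_right inner_commute[of ek y] u_def)
  obtain T where T: "orthogonal_transformation T" "T ek = ek" "T ej = p"
   using orthogonal_transformation_fixing[OF ee(2) p1 ee(3) pk] .
  have lin: "linear T" using T(1) by (rule orthogonal_transformation_linear)
  have Ty: "T (u *\<^sub>R ek + w *\<^sub>R ej) = y" using False by (simp add: linear_add[OF lin] linear_cmul[OF lin] T p_def)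
  define A where "A = matrix T"
  have om: "orthogonal_matrix A" using T(1) orthogonal_transformation_matrix by (auto simp: A_def)
  have "Vector_Spaces.linear (*s) (*s) T" using lin by (simp add: linear_def scalar_mult_eq_scaleR)
  then have AT: "A *v x = T x" for x by (simp add: A_def matrix_works)
  have "\<exists>A'. rotation_matrix A' \<and> A' *v ek = ek \<and> y = A' *v (u *\<^sub>R ek + w *\<^sub>R ej)"
  proof (cases "det A = 1")
   case True
   then show ?thesis using om T(2) Ty by (intro exI[of _ A]) (simp add: rotation_matrix_def AT)
  next
   case False
   then have dA: "det A = -1" using det_orthogonal_matrix[OF om] by simp
   obtain i where i: "i \<noteq> k" "i \<noteq> j"
   proof -
    have "card {k, j} < CARD('n)" using n card_insert_le_m1[of 2 "{j}" k] by (cases "k = j") auto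
    then have "{k, j} \<noteq> UNIV" by auto
    then show ?thesis using that by blast
   qed
   define S :: "real^'n^'n" where "S = (\<chi> a b. if a = b then (if a = i then -1 else 1) else 0)"
   have "det S = (\<Prod>a\<in>UNIV. if a = i then -1 else 1)" by (subst det_diagonal) (auto simp: S_def)
   also have "\<dots> = -1" by simp
   finally have dS: "det S = -1" .
   have Sx: "(S *v x) $ b = (if b = i then - x $ b else x $ b)" for x b
    by (simp add: S_def matrix_vector_mult_def if_distrib[of "\<lambda>z. z * _"] if_distribR cong: if_cong)
   have oS: "orthogonal_matrix S"
   proof -
    have "transpose S ** S = mat 1"
     by (auto simp: S_def transpose_def matrix_matrix_mult_def mat_def vec_eq_iff if_distrib[of "\<lambda>z. z * _"] if_distribR cong: if_cong)
    then show ?thesis by (simp add: orthogonal_matrix)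
   qed
   have Sk: "S *v ek = ek" "S *v ej = ej" using i by (auto simp: vec_eq_iff Sx e axis_def)
   have S2: "S *v (u *\<^sub>R ek + w *\<^sub>R ej) = u *\<^sub>R ek + w *\<^sub>R ej"
    using Sk by (simp add: matrix_vector_right_distrib matrix_vector_mult_scaleR)
   show ?thesis
   proof (intro exI[of _ "A ** S"] conjI)
    show "rotation_matrix (A ** S)" unfolding rotation_matrix_def
     using om oS orthogonal_matrix_mul[of A S] by (simp add: det_mul dA dS)
    show "(A ** S) *v ek = ek" by (simp add: matrix_vector_mul_assoc[symmetric] Sk AT T)
    show "y = (A ** S) *v (u *\<^sub>R ek + w *\<^sub>R ej)"
     by (simp add: matrix_vector_mul_assoc[symmetric] S2 AT Ty del: vector_add_component)
   qed
  qed
  then show ?thesis unfolding y0 e by blast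
 qed
qed

context
 fixes k j :: "'n::finite" and Q :: "real^'n \<Rightarrow> ennreal"
 assumes n: "CARD('n) \<ge> 3" and kj: "k \<noteq> j" and inv: "rotation_invariant k Q"
begin

lemma rotation_invariant_meridian:
 assumes y: "y \<in> sphere 0 1"
 shows "Q y = Q (meridian k j (polar_angle k y))"
proof -
 have "Q (A *v meridian k j \<theta>) = Q (meridian k j \<theta>)"
  if "rotation_matrix A" "A *v axis k 1 = axis k 1" for A \<theta>
  using inv that meridian_in_sphere[OF kj] by (auto simp: rotation_invariant_def)
 then show ?thesis using rotation_to_meridian[OF n kj y] by metis
qed

lemma polar_profile_eq:
 assumes x: "x \<in> sphere 0 1"
 shows "polar_profile k Q (polar_angle k x) = enn2real (Q x)"
proof -
 let ?P = "\<lambda>z. z \<in> sphere 0 1 \<and> polar_angle k z = polar_angle k x"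
 have "?P (SOME z. ?P z)" by (rule someI[of ?P x]) (use x in auto)
 then have "Q (SOME z. ?P z) = Q x" using rotation_invariant_meridian x by metis
 then show ?thesis by (simp add: polar_profile_def)
qed

lemma polar_profile_meridian:
 "0 \<le> \<theta> \<Longrightarrow> \<theta> \<le> pi \<Longrightarrow> polar_profile k Q \<theta> = enn2real (Q (meridian k j \<theta>))"
 using polar_profile_eq[OF meridian_in_sphere[OF kj], of \<theta>] polar_angle_meridian[OF kj] by simp

end

text \<open>The chain rule along a great circle, applied twice. The second derivative of the circle
  is minus the circle, which explains the first-order term in \<open>g2\<close>.\<close>

lemma C2_on_meridian:
 fixes k j :: "'n::finite"
 assumes U: "open U" "C2_on U h" and \<theta>0: "meridian k j \<theta>0 \<in> U"
 shows "\<exists>\<delta>>0. \<exists>g1 g2 C. \<forall>\<theta>. \<bar>\<theta> - \<theta>0\<bar> < \<delta> \<longrightarrow> meridian k j \<theta> \<in> U \<and>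
  ((\<lambda>\<theta>. h (meridian k j \<theta>)) has_real_derivative g1 \<theta>) (at \<theta>) \<and> (g1 has_real_derivative g2 \<theta>) (at \<theta>) \<and>
  \<bar>h (meridian k j \<theta>)\<bar> \<le> C \<and> \<bar>g1 \<theta>\<bar> \<le> C \<and> \<bar>g2 \<theta>\<bar> \<le> C"
proof -
 let ?\<gamma> = "meridian k j"
 define \<gamma>1 where "\<gamma>1 \<theta> = (- sin \<theta>) *\<^sub>R axis k 1 + cos \<theta> *\<^sub>R (axis j 1 :: real^'n)" for \<theta>
 obtain D D2 where D: "\<And>x. x \<in> U \<Longrightarrow> (h has_derivative blinfun_apply (D x)) (at x)"
  "\<And>x. x \<in> U \<Longrightarrow> (D has_derivative blinfun_apply (D2 x)) (at x)" and cD2: "continuous_on U D2"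
  using U(2) unfolding C2_on_def by auto
 have d\<gamma>: "(?\<gamma> has_derivative (\<lambda>t. t *\<^sub>R \<gamma>1 \<theta>)) (at \<theta>)" for \<theta>
  unfolding meridian_def[abs_def] \<gamma>1_def by (auto intro!: derivative_eq_intros simp: scaleR_add_right scaleR_diff_right)
 have d\<gamma>1: "(\<gamma>1 has_derivative (\<lambda>t. t *\<^sub>R (- ?\<gamma> \<theta>))) (at \<theta>)" for \<theta>
  unfolding meridian_def \<gamma>1_def[abs_def] by (auto intro!: derivative_eq_intros simp: scaleR_add_right scaleR_diff_right)
 have c\<gamma>: "continuous_on UNIV ?\<gamma>" "continuous_on UNIV \<gamma>1"
  unfolding meridian_def[abs_def] \<gamma>1_def[abs_def] by (intro continuous_intros)+
 have "open (?\<gamma> -` U)" using U(1) c\<gamma>(1) by (auto intro: open_vimage)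
 then obtain r where r: "r > 0" "ball \<theta>0 r \<subseteq> ?\<gamma> -` U" using openE[of "?\<gamma> -` U" \<theta>0] \<theta>0 by auto
 \<comment> \<open>Half the radius, so that the closed interval of this size still maps into U and
   compactness supplies the bounds.\<close>
 define \<delta> where "\<delta> = r / 2"
 have inU: "?\<gamma> \<theta> \<in> U" if "\<bar>\<theta> - \<theta>0\<bar> \<le> \<delta>" for \<theta>
 proof -
  have "\<theta> \<in> ball \<theta>0 r" using r(1) that by (simp add: dist_real_def \<delta>_def abs_minus_commute)
  then show ?thesis using r(2) by auto
 qed
 define g1 where "g1 \<theta> = D (?\<gamma> \<theta>) (\<gamma>1 \<theta>)" for \<theta>
 define g2 where "g2 \<theta> = D2 (?\<gamma> \<theta>) (\<gamma>1 \<theta>) (\<gamma>1 \<theta>) - D (?\<gamma> \<theta>) (?\<gamma> \<theta>)" for \<theta>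
 have dh: "((\<lambda>\<theta>. h (?\<gamma> \<theta>)) has_real_derivative g1 \<theta>) (at \<theta>)" if t: "\<bar>\<theta> - \<theta>0\<bar> \<le> \<delta>" for \<theta>
 proof -
  have "((\<lambda>\<theta>. h (?\<gamma> \<theta>)) has_derivative (\<lambda>t. D (?\<gamma> \<theta>) (t *\<^sub>R \<gamma>1 \<theta>))) (at \<theta>)"
   by (rule has_derivative_compose[OF d\<gamma> D(1)[OF inU[OF t]]])
  then show ?thesis unfolding has_field_derivative_def g1_def
   by (rule has_derivative_eq_rhs) (simp add: fun_eq_iff blinfun.scaleR_right)
 qed
 have dD: "((\<lambda>\<theta>. D (?\<gamma> \<theta>)) has_derivative (\<lambda>t. D2 (?\<gamma> \<theta>) (t *\<^sub>R \<gamma>1 \<theta>))) (at \<theta>)" if t: "\<bar>\<theta> - \<theta>0\<bar> \<le> \<delta>" for \<theta>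
  by (rule has_derivative_compose[OF d\<gamma> D(2)[OF inU[OF t]]])
 have dg1: "(g1 has_real_derivative g2 \<theta>) (at \<theta>)" if t: "\<bar>\<theta> - \<theta>0\<bar> \<le> \<delta>" for \<theta>
 proof -
  have "((\<lambda>\<theta>. D (?\<gamma> \<theta>) (\<gamma>1 \<theta>)) has_derivative (\<lambda>t. D (?\<gamma> \<theta>) (t *\<^sub>R (- ?\<gamma> \<theta>)) + D2 (?\<gamma> \<theta>) (t *\<^sub>R \<gamma>1 \<theta>) (\<gamma>1 \<theta>))) (at \<theta>)"
   using bounded_bilinear.FDERIV[OF bounded_bilinear_blinfun_apply dD[OF t] d\<gamma>1] .
  then show ?thesis unfolding has_field_derivative_def g1_def[abs_def] g2_def
   by (rule has_derivative_eq_rhs)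
    (simp add: fun_eq_iff blinfun.scaleR_right blinfun.scaleR_left blinfun.minus_right algebra_simps)
 qed
 let ?I = "{\<theta>0 - \<delta>..\<theta>0 + \<delta>}"
 have I: "\<theta> \<in> ?I \<Longrightarrow> \<bar>\<theta> - \<theta>0\<bar> \<le> \<delta>" for \<theta> by auto
 have ch: "continuous_on ?I (\<lambda>\<theta>. h (?\<gamma> \<theta>))"
  by (intro continuous_at_imp_continuous_on ballI) (rule DERIV_isCont[OF dh[OF I]])
 have cg1: "continuous_on ?I g1"
  by (intro continuous_at_imp_continuous_on ballI) (rule DERIV_isCont[OF dg1[OF I]])
 have cD: "continuous_on ?I (\<lambda>\<theta>. D (?\<gamma> \<theta>))"
  using dD I by (intro continuous_at_imp_continuous_on ballI) (metis has_derivative_continuous)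
 have cg2: "continuous_on ?I g2"
 proof -
  have "continuous_on ?I (\<lambda>\<theta>. D2 (?\<gamma> \<theta>))"
   by (rule continuous_on_compose2[OF cD2]) (use I inU c\<gamma> in \<open>auto intro: continuous_on_subset\<close>)
  then show ?thesis unfolding g2_def[abs_def] using cD c\<gamma>
   by (intro continuous_intros) (auto intro: continuous_on_subset)
 qed
 have bd: "\<exists>C. \<forall>\<theta>\<in>?I. \<bar>f \<theta>\<bar> \<le> C" if "continuous_on ?I f" for f :: "real \<Rightarrow> real"
  using compact_imp_bounded[OF compact_continuous_image[OF that compact_Icc]] by (auto simp: bounded_iff)
 obtain C0 C1 C2 where C: "\<forall>\<theta>\<in>?I. \<bar>h (?\<gamma> \<theta>)\<bar> \<le> C0" "\<forall>\<theta>\<in>?I. \<bar>g1 \<theta>\<bar> \<le> C1" "\<forall>\<theta>\<in>?I. \<bar>g2 \<theta>\<bar> \<le> C2"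
  using bd[OF ch] bd[OF cg1] bd[OF cg2] by blast
 have "\<delta> > 0" using r by (simp add: \<delta>_def)
 moreover have "?\<gamma> \<theta> \<in> U \<and>
  ((\<lambda>\<theta>. h (?\<gamma> \<theta>)) has_real_derivative g1 \<theta>) (at \<theta>) \<and> (g1 has_real_derivative g2 \<theta>) (at \<theta>) \<and>
  \<bar>h (?\<gamma> \<theta>)\<bar> \<le> max C0 (max C1 C2) \<and> \<bar>g1 \<theta>\<bar> \<le> max C0 (max C1 C2) \<and> \<bar>g2 \<theta>\<bar> \<le> max C0 (max C1 C2)"
  if "\<bar>\<theta> - \<theta>0\<bar> < \<delta>" for \<theta>
 proof -
  have t: "\<theta> \<in> ?I" "\<bar>\<theta> - \<theta>0\<bar> \<le> \<delta>" using that by auto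
  have "\<bar>h (?\<gamma> \<theta>)\<bar> \<le> C0" "\<bar>g1 \<theta>\<bar> \<le> C1" "\<bar>g2 \<theta>\<bar> \<le> C2" using C t(1) by blast+
  then show ?thesis using inU[OF t(2)] dh[OF t(2)] dg1[OF t(2)] by auto
 qed
 ultimately show ?thesis by blast
qed

text \<open>The local extension h agrees with Q on U \<inter> N only. Shrinking U by an ambient open
  set that cuts N out of the sphere makes them agree on the whole trace of the new U on the
  sphere.\<close>

lemma C2_on_sphere_continuous:
 fixes N :: "(real^'n::finite) set"
 assumes N: "openin (top_of_set (sphere 0 1)) N" and C2: "C2_on_sphere N Q" and p: "p \<in> N"
 obtains U h where "open U" "p \<in> U" "C2_on U h" "continuous_on U h"
  "\<And>x. x \<in> U \<Longrightarrow> x \<in> sphere 0 1 \<Longrightarrow> 0 \<le> h x \<and> Q x = ennreal (h x)"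
proof -
 obtain O' where O: "open O'" "N = sphere 0 1 \<inter> O'" using N by (auto simp: openin_open)
 from C2[unfolded C2_on_sphere_def, rule_format, OF p]
 obtain U h where U: "open U" "p \<in> U" "C2_on U h" and hU: "\<forall>x\<in>U \<inter> N. Q x < \<infinity> \<and> enn2real (Q x) = h x"
  by (elim exE conjE)
 show ?thesis
 proof (rule that[of "U \<inter> O'" h])
  show "open (U \<inter> O')" "p \<in> U \<inter> O'" using U O p by auto
  obtain D D2 where D: "\<forall>x\<in>U. (h has_derivative blinfun_apply (D x)) (at x) \<and> (D has_derivative blinfun_apply (D2 x)) (at x)"
   "continuous_on U D2" using U(3) unfolding C2_on_def by (elim exE conjE)
  show "C2_on (U \<inter> O') h" unfolding C2_on_def
  proof (rule exI[of _ D], rule exI[of _ D2], rule conjI)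
   show "\<forall>x\<in>U \<inter> O'. (h has_derivative blinfun_apply (D x)) (at x) \<and> (D has_derivative blinfun_apply (D2 x)) (at x)"
    using D(1) by blast
   show "continuous_on (U \<inter> O') D2" by (rule continuous_on_subset[OF D(2)]) simp
  qed
  show "continuous_on (U \<inter> O') h"
  proof (rule continuous_at_imp_continuous_on, rule ballI)
   fix x assume "x \<in> U \<inter> O'"
   then have "(h has_derivative blinfun_apply (D x)) (at x)" using D(1) by blast
   then show "isCont h x" by (rule has_derivative_continuous)
  qed
  fix x assume "x \<in> U \<inter> O'" "x \<in> sphere 0 1"
  then have "Q x < \<infinity> \<and> enn2real (Q x) = h x" using hU O(2) by blast
  then show "0 \<le> h x \<and> Q x = ennreal (h x)" using enn2real_nonneg[of "Q x"] ennreal_enn2real[of "Q x"] by simp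
 qed
qed

text \<open>Local bounds become uniform by compactness of [\<alpha>, pi]. Taking \<open>q1\<close>
  and \<open>q2\<close> as global derivatives makes the local data from different meridian pieces
  fit together. The pole \<theta> = pi serves as a centre of a neighbourhood, but the derivatives
  are asserted only below it.\<close>

lemma polar_profile_C2:
 fixes k :: "'n::finite"
 assumes n: "CARD('n) \<ge> 3" and inv: "rotation_invariant k Q"
  and N: "openin (top_of_set (sphere 0 1)) N" and C2: "C2_on_sphere N Q"
  and cap: "south_cap k \<alpha> \<subseteq> N" and \<alpha>: "0 < \<alpha>"
 obtains q1 q2 C where "\<And>\<theta>. \<alpha> < \<theta> \<Longrightarrow> \<theta> < pi \<Longrightarrow> (polar_profile k Q has_real_derivative q1 \<theta>) (at \<theta>) \<and>
   (q1 has_real_derivative q2 \<theta>) (at \<theta>) \<and> \<bar>polar_profile k Q \<theta>\<bar> \<le> C \<and> \<bar>q1 \<theta>\<bar> \<le> C \<and> \<bar>q2 \<theta>\<bar> \<le> C"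
proof -
 obtain j where kj: "k \<noteq> j" using other_coordinate[OF n] .
 define q where "q = polar_profile k Q"
 define q1 where "q1 = deriv q"
 define q2 where "q2 = deriv q1"
 have loc: "\<exists>\<delta>>0. \<exists>C. \<forall>\<theta>. \<bar>\<theta> - \<theta>0\<bar> < \<delta> \<longrightarrow> 0 < \<theta> \<longrightarrow> \<theta> < pi \<longrightarrow> (q has_real_derivative q1 \<theta>) (at \<theta>) \<and>
   (q1 has_real_derivative q2 \<theta>) (at \<theta>) \<and> \<bar>q \<theta>\<bar> \<le> C \<and> \<bar>q1 \<theta>\<bar> \<le> C \<and> \<bar>q2 \<theta>\<bar> \<le> C"
  if \<theta>0: "\<theta>0 \<in> {\<alpha>..pi}" for \<theta>0
 proof -
  have "meridian k j \<theta>0 \<in> N"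
   using cap \<theta>0 \<alpha> meridian_in_sphere[OF kj, of \<theta>0] polar_angle_meridian[OF kj, of \<theta>0] by (auto simp: south_cap_def)
  from C2_on_sphere_continuous[OF N C2 this] obtain U h where U: "open U" "meridian k j \<theta>0 \<in> U" "C2_on U h"
   "\<And>x. x \<in> U \<Longrightarrow> x \<in> sphere 0 1 \<Longrightarrow> 0 \<le> h x \<and> Q x = ennreal (h x)" by metis
  define g where "g = (\<lambda>\<theta>. h (meridian k j \<theta>))"
  obtain \<delta> g1 g2 C where \<delta>: "\<delta> > 0" and g: "\<And>\<theta>. \<bar>\<theta> - \<theta>0\<bar> < \<delta> \<Longrightarrow> meridian k j \<theta> \<in> U \<and>
  (g has_real_derivative g1 \<theta>) (at \<theta>) \<and> (g1 has_real_derivative g2 \<theta>) (at \<theta>) \<and>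
  \<bar>g \<theta>\<bar> \<le> C \<and> \<bar>g1 \<theta>\<bar> \<le> C \<and> \<bar>g2 \<theta>\<bar> \<le> C"
   using C2_on_meridian[OF U(1,3,2)] unfolding g_def by metis
  \<comment> \<open>The curve g also runs past the pole, whereas the profile is described by the
    meridian only for angles between 0 and pi; hence the intersection.\<close>
  define J where "J = {\<theta>0 - \<delta><..<\<theta>0 + \<delta>} \<inter> {0<..<pi}"
  have J: "open J" "\<theta> \<in> J \<longleftrightarrow> \<bar>\<theta> - \<theta>0\<bar> < \<delta> \<and> 0 < \<theta> \<and> \<theta> < pi" for \<theta> by (auto simp: J_def)
  have qg: "q \<theta> = g \<theta>" if "\<theta> \<in> J" for \<theta>
  proof -
   have t: "meridian k j \<theta> \<in> U" "0 \<le> \<theta>" "\<theta> \<le> pi" using that g by (auto simp: J)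
   from U(4)[OF t(1) meridian_in_sphere[OF kj]] show ?thesis
    unfolding q_def g_def polar_profile_meridian[OF n kj inv t(2,3)] by simp
  qed
  have dq: "(q has_real_derivative g1 \<theta>) (at \<theta>)" if "\<theta> \<in> J" for \<theta>
  proof (rule has_field_derivative_transform_within_open[of g _ \<theta> J])
   show "(g has_real_derivative g1 \<theta>) (at \<theta>)" using g[of \<theta>] that unfolding J(2) by blast
   show "g x = q x" if "x \<in> J" for x using qg[OF that] by (rule sym)
  qed (rule J(1), rule that)
  have q1g: "q1 \<theta> = g1 \<theta>" if "\<theta> \<in> J" for \<theta> unfolding q1_def by (rule DERIV_imp_deriv[OF dq[OF that]])
  have dq1: "(q1 has_real_derivative g2 \<theta>) (at \<theta>)" if "\<theta> \<in> J" for \<theta>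
  proof (rule has_field_derivative_transform_within_open[of g1 _ \<theta> J])
   show "(g1 has_real_derivative g2 \<theta>) (at \<theta>)" using g[of \<theta>] that unfolding J(2) by blast
   show "g1 x = q1 x" if "x \<in> J" for x using q1g[OF that] by (rule sym)
  qed (rule J(1), rule that)
  have q2g: "q2 \<theta> = g2 \<theta>" if "\<theta> \<in> J" for \<theta> unfolding q2_def by (rule DERIV_imp_deriv[OF dq1[OF that]])
  show ?thesis
  proof (rule exI[of _ \<delta>], intro conjI, rule \<delta>, rule exI[of _ C], intro allI impI conjI)
   fix \<theta> assume t: "\<bar>\<theta> - \<theta>0\<bar> < \<delta>" "0 < \<theta>" "\<theta> < pi"
   then have tJ: "\<theta> \<in> J" by (simp add: J)
   show "(q has_real_derivative q1 \<theta>) (at \<theta>)" "(q1 has_real_derivative q2 \<theta>) (at \<theta>)"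
    using dq[OF tJ] dq1[OF tJ] by (simp_all add: q1g[OF tJ] q2g[OF tJ])
   show "\<bar>q \<theta>\<bar> \<le> C" "\<bar>q1 \<theta>\<bar> \<le> C" "\<bar>q2 \<theta>\<bar> \<le> C"
    using g[OF t(1)] by (simp_all add: qg[OF tJ] q1g[OF tJ] q2g[OF tJ])
  qed
 qed
 then obtain \<delta> Cf where \<delta>: "\<And>\<theta>0. \<theta>0 \<in> {\<alpha>..pi} \<Longrightarrow> \<delta> \<theta>0 > 0" and
  loc': "\<And>\<theta>0 \<theta>. \<theta>0 \<in> {\<alpha>..pi} \<Longrightarrow> \<bar>\<theta> - \<theta>0\<bar> < \<delta> \<theta>0 \<Longrightarrow> 0 < \<theta> \<Longrightarrow> \<theta> < pi \<Longrightarrow> (q has_real_derivative q1 \<theta>) (at \<theta>) \<and>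
   (q1 has_real_derivative q2 \<theta>) (at \<theta>) \<and> \<bar>q \<theta>\<bar> \<le> Cf \<theta>0 \<and> \<bar>q1 \<theta>\<bar> \<le> Cf \<theta>0 \<and> \<bar>q2 \<theta>\<bar> \<le> Cf \<theta>0"
  by metis
 obtain F where F: "F \<subseteq> {\<alpha>..pi}" "finite F" "{\<alpha>..pi} \<subseteq> (\<Union>\<theta>0\<in>F. ball \<theta>0 (\<delta> \<theta>0))"
  by (rule compactE_image[of "{\<alpha>..pi}" "{\<alpha>..pi}" "\<lambda>\<theta>0. ball \<theta>0 (\<delta> \<theta>0)"]) (use \<delta> in auto)
 define C where "C = Max (insert 0 (Cf ` F))"
 show ?thesis
 proof (rule that[of q1 q2 C])
  fix \<theta> assume t: "\<alpha> < \<theta>" "\<theta> < pi"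
  then obtain \<theta>0 where \<theta>0: "\<theta>0 \<in> F" "\<bar>\<theta> - \<theta>0\<bar> < \<delta> \<theta>0"
  proof -
   have "\<theta> \<in> {\<alpha>..pi}" using t by simp
   then obtain \<theta>0 where "\<theta>0 \<in> F" "\<theta> \<in> ball \<theta>0 (\<delta> \<theta>0)" using F(3) by blast
   then show ?thesis using that[of \<theta>0] by (simp add: dist_real_def abs_minus_commute)
  qed
  have "Cf \<theta>0 \<le> C" unfolding C_def using F(2) \<theta>0(1) by (intro Max_ge) auto
  then show "(polar_profile k Q has_real_derivative q1 \<theta>) (at \<theta>) \<and>
   (q1 has_real_derivative q2 \<theta>) (at \<theta>) \<and> \<bar>polar_profile k Q \<theta>\<bar> \<le> C \<and> \<bar>q1 \<theta>\<bar> \<le> C \<and> \<bar>q2 \<theta>\<bar> \<le> C"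
   using loc'[of \<theta>0 \<theta>] \<theta>0 t F(1) \<alpha> unfolding q_def[symmetric] by fastforce
 qed
qed

lemma C2_weighted_arccos:
 assumes q: "\<And>\<theta>. \<alpha> < \<theta> \<Longrightarrow> \<theta> < pi \<Longrightarrow> (q has_real_derivative q1 \<theta>) (at \<theta>) \<and>
   (q1 has_real_derivative q2 \<theta>) (at \<theta>) \<and> \<bar>q \<theta>\<bar> \<le> C \<and> \<bar>q1 \<theta>\<bar> \<le> C \<and> \<bar>q2 \<theta>\<bar> \<le> C"
  and \<alpha>: "0 < \<alpha>" "\<alpha> < pi"
 shows "\<exists>y2 K. C2_weighted (cos \<alpha>) (\<lambda>s. q (arccos s)) (\<lambda>s. - q1 (arccos s) / sqrt (1 - s\<^sup>2)) y2 K"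
proof -
 define a where "a = cos \<alpha>"
 have a: "-1 < a" "a < 1"
  using cos_monotone_0_pi[of 0 \<alpha>] cos_monotone_0_pi[of \<alpha> pi] \<alpha> by (auto simp: a_def)
 define y2 where "y2 s = q2 (arccos s) / (1 - s\<^sup>2) - q1 (arccos s) * s / (sqrt (1 - s\<^sup>2) * (1 - s\<^sup>2))" for s
 \<comment> \<open>The three entries are the bounds obtained below for the function itself and for
   its weighted first and second derivatives.\<close>
 define K where "K = max C (max (C / (1 - a)) (C * (2 / (1 - a)) + C * (1 / (1 - a)\<^sup>2)))"
 have "C2_weighted a (\<lambda>s. q (arccos s)) (\<lambda>s. - q1 (arccos s) / sqrt (1 - s\<^sup>2)) y2 K"
  unfolding C2_weighted_def
 proof (intro ballI)
  fix s assume "s \<in> {-1<..<a}"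
  then have s: "-1 < s" "s < a" "s < 1" using a by auto
  define \<theta> where "\<theta> = arccos s"
  have "arccos a < \<theta>" unfolding \<theta>_def using s a by (intro arccos_less_arccos) auto
  then have t: "\<alpha> < \<theta>" "\<theta> < pi" using \<alpha> s arccos_less_mono[of s "-1"] by (auto simp: a_def arccos_cos \<theta>_def)
  note q' = q[OF t]
  have C0: "C \<ge> 0" using q' by linarith
  define w where "w = sqrt (1 - s\<^sup>2)"
  have s2: "1 - s\<^sup>2 > 0" using s by (simp add: abs_square_less_1 abs_less_iff)
  have w: "w > 0" "w\<^sup>2 = 1 - s\<^sup>2" "w \<le> 1" using s2 by (auto simp: w_def)
  have y2w: "y2 s = q2 \<theta> / w\<^sup>2 - q1 \<theta> * s / (w * w\<^sup>2)" using s2 by (simp add: y2_def \<theta>_def w_def)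
  have d: "(arccos has_real_derivative - (1 / w)) (at s)"
   using DERIV_arccos[of s] s by (simp add: w_def inverse_eq_divide)
  have d0: "((\<lambda>s. q (arccos s)) has_real_derivative q1 \<theta> * (- (1 / w))) (at s)"
   by (rule DERIV_chain2[where f = q and g = arccos, OF _ d]) (use q' in \<open>simp add: \<theta>_def\<close>)
  have d1: "((\<lambda>s. q1 (arccos s)) has_real_derivative q2 \<theta> * (- (1 / w))) (at s)"
   by (rule DERIV_chain2[where f = q1 and g = arccos, OF _ d]) (use q' in \<open>simp add: \<theta>_def\<close>)
  have dw: "((\<lambda>s. sqrt (1 - s\<^sup>2)) has_real_derivative - s / w) (at s)"
   using s2 by (auto intro!: derivative_eq_intros simp: w_def field_simps)
  have "((\<lambda>s. - q1 (arccos s) / sqrt (1 - s\<^sup>2)) has_real_derivative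
   ((- (q2 \<theta> * (- (1 / w)))) * sqrt (1 - s\<^sup>2) - (- q1 (arccos s)) * (- s / w)) / (sqrt (1 - s\<^sup>2) * sqrt (1 - s\<^sup>2))) (at s)"
   using w(1) by (intro DERIV_divide DERIV_minus d1 dw) (simp add: w_def)
  also have "((- (q2 \<theta> * (- (1 / w)))) * sqrt (1 - s\<^sup>2) - (- q1 (arccos s)) * (- s / w)) / (sqrt (1 - s\<^sup>2) * sqrt (1 - s\<^sup>2)) = y2 s"
   unfolding y2w w_def[symmetric] \<theta>_def[symmetric] using w(1) by (simp add: field_simps power2_eq_square)
  finally have d2: "((\<lambda>s. - q1 (arccos s) / sqrt (1 - s\<^sup>2)) has_real_derivative y2 s) (at s)" .
  \<comment> \<open>\<open>1 + s\<close> is of the order \<open>w\<^sup>2\<close>, which absorbs the singularities of \<open>arccos\<close> at \<open>-1\<close>.\<close>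
  have "(1 - a) * (1 + s) \<le> (1 - s) * (1 + s)" using s by (intro mult_right_mono) auto
  also have "\<dots> = w\<^sup>2" using w(2) by (simp add: power2_eq_square algebra_simps)
  finally have sw: "1 + s \<le> w\<^sup>2 / (1 - a)" using a by (simp add: field_simps)
  have b1: "(1 + s) * (1 / w) \<le> 1 / (1 - a)"
  proof -
   have "(1 + s) * (1 / w) \<le> w\<^sup>2 / (1 - a) * (1 / w)" using sw w(1) by (intro mult_right_mono) auto
   also have "\<dots> = w / (1 - a)" using w(1) by (simp add: power2_eq_square)
   also have "\<dots> \<le> 1 / (1 - a)" using w(1,3) a by (intro divide_right_mono) auto
   finally show ?thesis .
  qed
  have b2: "(1 + s)\<^sup>2 * (1 / w\<^sup>2) \<le> 2 / (1 - a)"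
  proof -
   have "(1 + s)\<^sup>2 * (1 / w\<^sup>2) = (1 + s) * ((1 + s) * (1 / w\<^sup>2))" by (simp add: power2_eq_square)
   also have "\<dots> \<le> 2 * (w\<^sup>2 / (1 - a) * (1 / w\<^sup>2))" using s w(1) sw a by (intro mult_mono mult_right_mono) auto
   also have "\<dots> = 2 / (1 - a)" using w(1) by simp
   finally show ?thesis .
  qed
  have b3: "(1 + s)\<^sup>2 * (1 / (w * w\<^sup>2)) \<le> 1 / (1 - a)\<^sup>2"
  proof -
   have "(1 + s)\<^sup>2 \<le> (w\<^sup>2 / (1 - a))\<^sup>2" using sw s by (intro power_mono) auto
   then have "(1 + s)\<^sup>2 * (1 / (w * w\<^sup>2)) \<le> (w\<^sup>2 / (1 - a))\<^sup>2 * (1 / (w * w\<^sup>2))" using w(1) by (intro mult_right_mono) auto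
   also have "\<dots> = w / (1 - a)\<^sup>2" using w(1) by (simp add: power2_eq_square)
   also have "\<dots> \<le> 1 / (1 - a)\<^sup>2" using w(1,3) a by (intro divide_right_mono) auto
   finally show ?thesis .
  qed
  have "(1 + s) * \<bar>- q1 \<theta> / w\<bar> \<le> K"
  proof -
   have "(1 + s) * \<bar>- q1 \<theta> / w\<bar> = \<bar>q1 \<theta>\<bar> * ((1 + s) * (1 / w))" using w(1) by (simp add: abs_divide)
   also have "\<dots> \<le> C * (1 / (1 - a))" using q' b1 s w(1) C0 by (intro mult_mono) auto
   finally show ?thesis by (simp add: K_def)
  qed
  moreover have "(1 + s)\<^sup>2 * \<bar>y2 s\<bar> \<le> K"
  proof -
   have "\<bar>y2 s\<bar> \<le> \<bar>q2 \<theta> / w\<^sup>2\<bar> + \<bar>q1 \<theta> * s / (w * w\<^sup>2)\<bar>"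
    unfolding y2w by (rule abs_triangle_ineq4)
   also have "\<dots> = \<bar>q2 \<theta>\<bar> * (1 / w\<^sup>2) + \<bar>q1 \<theta>\<bar> * \<bar>s\<bar> * (1 / (w * w\<^sup>2))"
    using w(1) by (simp add: abs_mult abs_divide)
   also have "\<dots> \<le> C * (1 / w\<^sup>2) + C * 1 * (1 / (w * w\<^sup>2))"
    using q' s w(1) C0 by (intro add_mono mult_mono mult_right_mono) auto
   finally have "(1 + s)\<^sup>2 * \<bar>y2 s\<bar> \<le> (1 + s)\<^sup>2 * (C * (1 / w\<^sup>2) + C * 1 * (1 / (w * w\<^sup>2)))" by (intro mult_left_mono) auto
   also have "\<dots> = C * ((1 + s)\<^sup>2 * (1 / w\<^sup>2)) + C * ((1 + s)\<^sup>2 * (1 / (w * w\<^sup>2)))" by (simp add: algebra_simps)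
   also have "\<dots> \<le> C * (2 / (1 - a)) + C * (1 / (1 - a)\<^sup>2)" using b2 b3 C0 by (intro add_mono mult_left_mono)
   finally show ?thesis by (simp add: K_def)
  qed
  moreover have "\<bar>q \<theta>\<bar> \<le> K" unfolding K_def by (rule max.coboundedI1) (use q' in blast)
  ultimately show "((\<lambda>s. q (arccos s)) has_real_derivative - q1 (arccos s) / sqrt (1 - s\<^sup>2)) (at s) \<and>
   ((\<lambda>s. - q1 (arccos s) / sqrt (1 - s\<^sup>2)) has_real_derivative y2 s) (at s) \<and>
   \<bar>q (arccos s)\<bar> \<le> K \<and> (1 + s) * \<bar>- q1 (arccos s) / sqrt (1 - s\<^sup>2)\<bar> \<le> K \<and> (1 + s)\<^sup>2 * \<bar>y2 s\<bar> \<le> K"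
   using d0 d2 unfolding \<theta>_def w_def by simp
 qed
 then show ?thesis unfolding a_def by blast
qed

section \<open>Zonal measures\<close>

lemma height_times_riesz_kernel_measurable:
 fixes \<phi> :: "real \<Rightarrow> ennreal" and k :: "'n::finite"
 assumes "\<phi> \<in> borel_measurable borel"
 shows "(\<lambda>(x, z :: real^'n). \<phi> (x $ k) * riesz_kernel x z) \<in> borel_measurable (borel \<Otimes>\<^sub>M borel)"
proof -
 have "(\<lambda>x::real^'n. x $ k) \<in> borel_measurable borel" by measurable
 from measurable_compose[OF measurable_fst measurable_compose[OF this assms]]
 have "(\<lambda>p. \<phi> (fst p $ k)) \<in> borel_measurable (borel \<Otimes>\<^sub>M (borel :: (real^'n) measure))" .
 moreover have "(\<lambda>p::(real^'n) \<times> (real^'n). riesz_kernel (fst p) (snd p)) \<in> borel_measurable (borel \<Otimes>\<^sub>M borel)"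
  using riesz_kernel_measurable by (simp add: split_beta')
 ultimately have "(\<lambda>p. \<phi> (fst p $ k) * riesz_kernel (fst p) (snd p)) \<in> borel_measurable (borel \<Otimes>\<^sub>M (borel :: (real^'n) measure))"
  by measurable
 then show ?thesis by (simp add: split_beta')
qed

lemma height_measurable:
 fixes M :: "(real^'n) measure"
 assumes "M \<in> sphere_fin"
 shows "(\<lambda>x. x $ k) \<in> borel_measurable M"
 using assms by (rule sphere_fin_borel_measurable) measurable

lemma riesz_kernel_section_measurable: "riesz_kernel y \<in> borel_measurable borel"
 using measurable_Pair2[OF riesz_kernel_measurable, of y] by simp

lemma zonal_measure_eqI:
 fixes \<mu> :: "(real^'n) measure" and Q :: "real^'n \<Rightarrow> ennreal" and f :: "real \<Rightarrow> real"
 assumes n: "CARD('n) \<ge> 3" and \<mu>: "\<mu> \<in> sphere_prob" and f [measurable]: "f \<in> borel_measurable borel"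
  and height: "distr \<mu> borel (\<lambda>x. x $ k) = density lborel (\<lambda>v. ennreal (2 * half_sphere_area (CARD('n) - 1)) *
    (ennreal (f v) * ennreal ((1 - v\<^sup>2) powr ((real CARD('n) - 3) / 2)) * indicator {-1<..<1} v))"
  and h [measurable]: "h \<in> borel_measurable borel"
  and Q: "Q \<in> borel_measurable sphere_borel" "\<And>x. x \<in> sphere 0 1 \<Longrightarrow> f (x $ k) \<noteq> 0 \<Longrightarrow> Q x = h (x $ k)"
  and fin: "energy \<mu> + (\<integral>\<^sup>+x. Q x \<partial>\<mu>) < \<infinity>"
  and frost: "AE x in surface_measure. f (x $ k) \<noteq> 0 \<longrightarrow> potential \<mu> x + Q x = energy \<mu> + (\<integral>\<^sup>+x. Q x \<partial>\<mu>)"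
 shows "\<mu> = density surface_measure (\<lambda>x. ennreal (f (x $ k)))"
proof -
 let ?D = "real CARD('n)"
 define \<nu> :: "(real^'n) measure" where "\<nu> = density surface_measure (\<lambda>x. ennreal (f (x $ k)))"
 define w where "w v = ennreal ((1 - v\<^sup>2) powr ((?D - 3) / 2))" for v :: real
 have [measurable]: "w \<in> borel_measurable borel" unfolding w_def[abs_def] by measurable
 have \<mu>f: "\<mu> \<in> sphere_fin" using \<mu> sphere_prob_fin by auto
 have km [measurable]: "(\<lambda>x. x $ k) \<in> borel_measurable \<mu>" by (rule height_measurable[OF \<mu>f])
 have sm [measurable]: "(\<lambda>x::real^'n. x $ k) \<in> borel_measurable surface_measure" by (rule height_measurable[OF surface_measure_fin[OF n]])
 have "(\<lambda>x. ennreal (f (x $ k))) \<in> borel_measurable (surface_measure :: (real^'n) measure)" by measurable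
 note fm = this
 have nu_int: "(\<integral>\<^sup>+x. g x \<partial>\<nu>) = (\<integral>\<^sup>+x. ennreal (f (x $ k)) * g x \<partial>surface_measure)"
  if "g \<in> borel_measurable sphere_borel" for g
  unfolding \<nu>_def using that fm by (intro nn_integral_density) (auto cong: measurable_cong_sets)
 have hsb: "(\<lambda>x::real^'n. \<phi> (x $ k)) \<in> borel_measurable sphere_borel" if [measurable]: "\<phi> \<in> borel_measurable borel" for \<phi> :: "real \<Rightarrow> ennreal"
  by (rule measurable_sphere_borelI) measurable
 have same: "(\<integral>\<^sup>+x. \<phi> (x $ k) \<partial>\<nu>) = (\<integral>\<^sup>+x. \<phi> (x $ k) \<partial>\<mu>)" if \<phi> [measurable]: "\<phi> \<in> borel_measurable borel" for \<phi>
 proof -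
  have "(\<integral>\<^sup>+x. \<phi> (x $ k) \<partial>\<nu>) = (\<integral>\<^sup>+x. ennreal (f (x $ k)) * \<phi> (x $ k) \<partial>surface_measure)"
   by (rule nu_int[OF hsb[OF \<phi>]])
  also have "\<dots> = ennreal (2 * half_sphere_area (CARD('n) - 1)) * (\<integral>\<^sup>+s\<in>{-1<..<1}. (ennreal (f s) * \<phi> s) * w s \<partial>lborel)"
   unfolding w_def by (rule nn_integral_surface_height[OF n, of "\<lambda>s. ennreal (f s) * \<phi> s"]) measurable
  also have "\<dots> = (\<integral>\<^sup>+s. ennreal (2 * half_sphere_area (CARD('n) - 1)) * (((ennreal (f s) * \<phi> s) * w s) * indicator {-1<..<1} s) \<partial>lborel)"
   by (rule nn_integral_cmult[symmetric]) measurable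
  also have "\<dots> = (\<integral>\<^sup>+s. ennreal (2 * half_sphere_area (CARD('n) - 1)) * (ennreal (f s) * w s * indicator {-1<..<1} s) * \<phi> s \<partial>lborel)"
   by (rule nn_integral_cong) (simp add: mult_ac)
  also have "\<dots> = (\<integral>\<^sup>+s. \<phi> s \<partial>distr \<mu> borel (\<lambda>x. x $ k))"
   unfolding height w_def by (rule nn_integral_density[symmetric]) measurable
  also have "\<dots> = (\<integral>\<^sup>+x. \<phi> (x $ k) \<partial>\<mu>)" by (rule nn_integral_distr) measurable
  finally show ?thesis .
 qed
 interpret \<mu>: prob_space \<mu> using \<mu> by (auto simp: sphere_prob_def)
 have nu1: "emeasure \<nu> (space \<nu>) = 1" using same[of "\<lambda>_. 1"] \<mu>.emeasure_space_1 by simp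
 have \<nu>f: "\<nu> \<in> sphere_fin" using nu1 by (auto simp: sphere_fin_def \<nu>_def intro!: finite_measureI)
 define P where "P u = ennreal (2 * half_sphere_area (CARD('n) - 2)) *
  (\<integral>\<^sup>+s\<in>{-1<..<1}. ennreal (f s) * ennreal ((1 - s\<^sup>2) powr ((?D - 3) / 2)) * zonal_kernel (?D) s u \<partial>lborel)" for u
 have Pm [measurable]: "P \<in> borel_measurable borel" unfolding P_def[abs_def] by measurable
 have pot: "potential \<nu> y = P (y $ k)" if y: "y \<in> sphere 0 1" "y $ k \<in> {-1<..<1}" for y
 proof -
  have r: "(\<lambda>x. riesz_kernel y x) \<in> borel_measurable sphere_borel"
   by (rule measurable_sphere_borelI) (rule riesz_kernel_section_measurable)
  have "potential \<nu> y = (\<integral>\<^sup>+x. ennreal (f (x $ k)) * riesz_kernel x y \<partial>surface_measure)"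
   unfolding potential_def nu_int[OF r] by (simp add: riesz_kernel_commute[of y])
  also have "\<dots> = P (y $ k)" unfolding P_def using y by (intro nn_integral_riesz_kernel_surface[OF n]) auto
  finally show ?thesis .
 qed
 have inside_\<mu>: "AE x in \<mu>. x $ k \<in> {-1<..<1}"
 proof -
  have "AE v in distr \<mu> borel (\<lambda>x. x $ k). v \<in> {-1<..<1}"
   unfolding height by (subst AE_density) (auto simp: indicator_def)
  then show ?thesis by (subst (asm) AE_distr_iff) auto
 qed
 have inside_\<nu>: "AE x in \<nu>. x $ k \<in> {-1<..<1}"
 proof -
  have km\<nu>: "(\<lambda>x. x $ k) \<in> borel_measurable \<nu>" by (rule height_measurable[OF \<nu>f])
  have "(\<integral>\<^sup>+x. indicator (- {-1<..<1}) (x $ k) \<partial>\<nu>) = (\<integral>\<^sup>+x. indicator (- {-1<..<1}) (x $ k) \<partial>\<mu>)" by (rule same) simp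
  also have "\<dots> = (\<integral>\<^sup>+x. 0 \<partial>\<mu>)"
   by (rule nn_integral_cong_AE, use inside_\<mu> in eventually_elim) (auto simp: indicator_def)
  finally have z: "(\<integral>\<^sup>+x. indicator (- {-1<..<1}) (x $ k) \<partial>\<nu>) = 0" by simp
  have "(\<lambda>x. indicator (- {-1<..<1}) (x $ k) :: ennreal) \<in> borel_measurable \<nu>" using km\<nu> by measurable
  from nn_integral_0_iff_AE[OF this] z have "AE x in \<nu>. indicator (- {-1<..<1}) (x $ k) = (0::ennreal)" by simp
  then show ?thesis by eventually_elim (auto simp: indicator_def split: if_splits)
 qed
 have sp: "AE x in \<mu>. x \<in> sphere 0 1" "AE x in \<nu>. x \<in> sphere 0 1"
  using AE_space[of \<mu>] AE_space[of \<nu>] sphere_fin_space[OF \<mu>f] sphere_fin_space[OF \<nu>f] by auto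
 have m1: "mutual_energy \<mu> \<nu> = energy \<nu>"
 proof -
  have "mutual_energy \<mu> \<nu> = (\<integral>\<^sup>+x. P (x $ k) \<partial>\<mu>)"
   unfolding mutual_energy_def by (rule nn_integral_cong_AE, use inside_\<mu> sp(1) in eventually_elim) (rule pot)
  also have "\<dots> = (\<integral>\<^sup>+x. P (x $ k) \<partial>\<nu>)" by (rule same[symmetric]) measurable
  also have "\<dots> = energy \<nu>"
   unfolding energy_eq mutual_energy_def by (rule nn_integral_cong_AE, use inside_\<nu> sp(2) in eventually_elim) (rule pot[symmetric])
  finally show ?thesis .
 qed
 have f_\<nu>: "AE x in \<nu>. f (x $ k) \<noteq> 0" unfolding \<nu>_def by (subst AE_density) auto
 have IQ: "(\<integral>\<^sup>+x. Q x \<partial>\<nu>) = (\<integral>\<^sup>+x. Q x \<partial>\<mu>)"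
 proof -
  have f_\<mu>: "AE x in \<mu>. f (x $ k) \<noteq> 0"
  proof -
   have "AE v in distr \<mu> borel (\<lambda>x. x $ k). f v \<noteq> 0"
    unfolding height by (subst AE_density) auto
   then show ?thesis by (subst (asm) AE_distr_iff) auto
  qed
  have "(\<integral>\<^sup>+x. Q x \<partial>\<nu>) = (\<integral>\<^sup>+x. h (x $ k) \<partial>\<nu>)"
   by (rule nn_integral_cong_AE, use f_\<nu> sp(2) in eventually_elim) (rule Q(2))
  also have "\<dots> = (\<integral>\<^sup>+x. h (x $ k) \<partial>\<mu>)" by (rule same) measurable
  also have "\<dots> = (\<integral>\<^sup>+x. Q x \<partial>\<mu>)"
   by (rule nn_integral_cong_AE, use f_\<mu> sp(1) in eventually_elim) (rule Q(2)[symmetric])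
  finally show ?thesis .
 qed
 \<comment> \<open>The integral of the field is subtracted from both sides at the end, which in
   \<open>ennreal\<close> requires that it be finite.\<close>
 have m2: "mutual_energy \<nu> \<mu> = energy \<mu>"
 proof -
  let ?E = "energy \<mu>" and ?I = "\<integral>\<^sup>+x. Q x \<partial>\<mu>"
  have "AE x in \<nu>. potential \<mu> x + Q x = ?E + ?I"
  proof -
   have "AE x in surface_measure. 0 < ennreal (f (x $ k)) \<longrightarrow> potential \<mu> x + Q x = ?E + ?I"
    using frost by eventually_elim auto
   then show ?thesis unfolding \<nu>_def by (subst AE_density) auto
  qed
  then have "(\<integral>\<^sup>+x. potential \<mu> x + Q x \<partial>\<nu>) = (\<integral>\<^sup>+x. ?E + ?I \<partial>\<nu>)" by (rule nn_integral_cong_AE)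
  also have "\<dots> = ?E + ?I" using nu1 by simp
  also have "(\<integral>\<^sup>+x. potential \<mu> x + Q x \<partial>\<nu>) = mutual_energy \<nu> \<mu> + ?I"
   unfolding mutual_energy_def IQ[symmetric] using Q(1)
   by (intro nn_integral_add) (simp_all add: sphere_fin_measurable_iff[OF \<nu>f] measurable_sphere_borelI[OF potential_measurable[OF \<mu>f]])
  finally have eq: "mutual_energy \<nu> \<mu> + ?I = ?E + ?I" .
  have "?I \<noteq> \<top>" using fin by (auto simp: top_unique)
  with eq show ?thesis unfolding add.commute[of _ ?I] by (simp add: ennreal_add_left_cancel)
 qed
 have c: "mutual_energy \<mu> \<nu> = mutual_energy \<nu> \<mu>" by (rule mutual_energy_commute[OF \<mu>f \<nu>f])
 have "energy \<mu> < \<infinity>" using fin by (auto simp: less_top[symmetric] top_unique)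
 then have "\<mu> = \<nu>" using m1 m2 c by (intro energy_strictly_positive[OF n \<mu>f \<nu>f]) auto
 then show ?thesis unfolding \<nu>_def .
qed

text \<open>As \<mu> is not known to be symmetric, its potential at a single point is not a zonal
  integral. It is therefore tested against functions of the height over the surface measure; after
  exchanging the integrals the average over parallels acts on the other variable and only the
  heights of \<mu> remain. The bound K makes the test integrals finite, so that they determine the
  functions almost everywhere.\<close>

lemma zonal_potential:
 fixes \<mu> :: "(real^'n) measure" and y :: "real \<Rightarrow> real"
 assumes n: "CARD('n) \<ge> 3" and \<mu>f: "\<mu> \<in> sphere_fin" and inside: "AE x in \<mu>. -1 < x $ k \<and> x $ k < 1"
  and a: "-1 < a" "a < 1" and ym [measurable]: "y \<in> borel_measurable borel" and K: "\<And>s. -1 < s \<Longrightarrow> s < a \<Longrightarrow> y s \<le> K"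
  and pot: "AE x in surface_measure. x $ k \<in> {-1<..<a} \<longrightarrow> potential \<mu> x = ennreal (y (x $ k))"
 shows "AE s in lborel. s \<in> {-1<..<a} \<longrightarrow>
  ennreal (half_sphere_area (CARD('n) - 2)) * (\<integral>\<^sup>+u. zonal_kernel (real CARD('n)) s u \<partial>distr \<mu> borel (\<lambda>x. x $ k))
   = ennreal (half_sphere_area (CARD('n) - 1) * y s)"
proof -
 let ?D = "real CARD('n)"
 define w where "w v = ennreal ((1 - v\<^sup>2) powr ((?D - 3) / 2))" for v :: real
 have [measurable]: "w \<in> borel_measurable borel" unfolding w_def[abs_def] by measurable
 let ?Y = "\<lambda>\<phi>. \<integral>\<^sup>+s\<in>{-1<..<1}. (\<phi> s * ennreal (y s)) * w s \<partial>lborel"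
 define A where "A = half_sphere_area (CARD('n) - 2)"
 define B where "B = half_sphere_area (CARD('n) - 1)"
 have AB: "A > 0" "B > 0" using n by (auto simp: A_def B_def half_sphere_area_pos)
 have km [measurable]: "(\<lambda>x. x $ k) \<in> borel_measurable \<mu>" by (rule height_measurable[OF \<mu>f])
 let ?\<sigma> = "surface_measure :: (real^'n) measure"
 have \<sigma>f: "?\<sigma> \<in> sphere_fin" by (rule surface_measure_fin[OF n])
 interpret \<mu>: sigma_finite_measure \<mu> by (rule sphere_fin_sigma_finite[OF \<mu>f])
 interpret \<sigma>: sigma_finite_measure ?\<sigma> by (rule sphere_fin_sigma_finite[OF \<sigma>f])
 interpret p1: pair_sigma_finite ?\<sigma> \<mu> ..
 interpret p2: pair_sigma_finite lborel \<mu> ..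
 define Z where "Z s = (\<integral>\<^sup>+x. zonal_kernel (?D) s (x $ k) \<partial>\<mu>)" for s
 have Zm [measurable]: "Z \<in> borel_measurable borel" unfolding Z_def[abs_def] by measurable
 have Zd: "(\<integral>\<^sup>+u. zonal_kernel (?D) s u \<partial>distr \<mu> borel (\<lambda>x. x $ k)) = Z s" for s
  unfolding Z_def by (rule nn_integral_distr) measurable
 have test: "ennreal A * (\<integral>\<^sup>+s\<in>{-1<..<1}. \<phi> s * w s * Z s \<partial>lborel) = ennreal B * ?Y \<phi>"
  if \<phi> [measurable]: "\<phi> \<in> borel_measurable borel" and \<phi>0: "\<And>s. s \<notin> {-1<..<a} \<Longrightarrow> \<phi> s = 0" for \<phi> :: "real \<Rightarrow> ennreal"
 proof -
  have L: "(\<integral>\<^sup>+x. \<phi> (x $ k) * potential \<mu> x \<partial>?\<sigma>) = ennreal (2 * B) * ?Y \<phi>"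
  proof -
   have "(\<integral>\<^sup>+x. \<phi> (x $ k) * potential \<mu> x \<partial>?\<sigma>) = (\<integral>\<^sup>+x. \<phi> (x $ k) * ennreal (y (x $ k)) \<partial>?\<sigma>)"
   proof (rule nn_integral_cong_AE, use pot in eventually_elim)
    fix x :: "real^'n" assume "x $ k \<in> {-1<..<a} \<longrightarrow> potential \<mu> x = ennreal (y (x $ k))"
    then show "\<phi> (x $ k) * potential \<mu> x = \<phi> (x $ k) * ennreal (y (x $ k))"
     using \<phi>0[of "x $ k"] by (cases "x $ k \<in> {-1<..<a}") (simp_all only: mult_zero_left simp_thms)
   qed
   also have "\<dots> = ennreal (2 * B) * ?Y \<phi>"
    unfolding w_def B_def by (rule nn_integral_surface_height[OF n, of "\<lambda>s. \<phi> s * ennreal (y s)"]) measurable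
   finally show ?thesis .
  qed
  have "(\<integral>\<^sup>+x. \<phi> (x $ k) * potential \<mu> x \<partial>?\<sigma>) = (\<integral>\<^sup>+x. \<integral>\<^sup>+z. \<phi> (x $ k) * riesz_kernel x z \<partial>\<mu> \<partial>?\<sigma>)"
  proof (rule nn_integral_cong)
   fix x :: "real^'n"
   have "riesz_kernel x \<in> borel_measurable \<mu>"
    by (rule sphere_fin_borel_measurable[OF \<mu>f]) (rule riesz_kernel_section_measurable)
   then show "\<phi> (x $ k) * potential \<mu> x = (\<integral>\<^sup>+z. \<phi> (x $ k) * riesz_kernel x z \<partial>\<mu>)"
    unfolding potential_def by (rule nn_integral_cmult[symmetric])
  qed
  also have "\<dots> = (\<integral>\<^sup>+z. \<integral>\<^sup>+x. \<phi> (x $ k) * riesz_kernel x z \<partial>?\<sigma> \<partial>\<mu>)"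
  proof (rule p1.Fubini'[symmetric])
   show "(\<lambda>(x, z). \<phi> (x $ k) * riesz_kernel x z) \<in> borel_measurable (?\<sigma> \<Otimes>\<^sub>M \<mu>)"
    by (rule sphere_fin_borel_measurable_pair[OF \<sigma>f \<mu>f]) (rule height_times_riesz_kernel_measurable[OF \<phi>])
  qed
  also have "\<dots> = (\<integral>\<^sup>+z. ennreal (2 * A) * (\<integral>\<^sup>+s\<in>{-1<..<1}. \<phi> s * w s * zonal_kernel (?D) s (z $ k) \<partial>lborel) \<partial>\<mu>)"
  proof (rule nn_integral_cong_AE, use inside AE_space in eventually_elim)
   fix z assume z: "-1 < z $ k \<and> z $ k < 1" "z \<in> space \<mu>"
   then have "z \<in> sphere 0 1" using sphere_fin_space[OF \<mu>f] by simp
   then show "(\<integral>\<^sup>+x. \<phi> (x $ k) * riesz_kernel x z \<partial>?\<sigma>) = ennreal (2 * A) * (\<integral>\<^sup>+s\<in>{-1<..<1}. \<phi> s * w s * zonal_kernel (?D) s (z $ k) \<partial>lborel)"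
    unfolding A_def w_def using z by (intro nn_integral_riesz_kernel_surface[OF n]) auto
  qed
  also have "\<dots> = ennreal (2 * A) * (\<integral>\<^sup>+z. \<integral>\<^sup>+s. \<phi> s * w s * zonal_kernel (?D) s (z $ k) * indicator {-1<..<1} s \<partial>lborel \<partial>\<mu>)"
   by (rule nn_integral_cmult) measurable
  also have "(\<integral>\<^sup>+z. \<integral>\<^sup>+s. \<phi> s * w s * zonal_kernel (?D) s (z $ k) * indicator {-1<..<1} s \<partial>lborel \<partial>\<mu>)
   = (\<integral>\<^sup>+s. \<integral>\<^sup>+z. \<phi> s * w s * zonal_kernel (?D) s (z $ k) * indicator {-1<..<1} s \<partial>\<mu> \<partial>lborel)"
   by (rule p2.Fubini') measurable
  also have "\<dots> = (\<integral>\<^sup>+s\<in>{-1<..<1}. \<phi> s * w s * Z s \<partial>lborel)"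
  proof (rule nn_integral_cong)
   fix s :: real
   have "(\<integral>\<^sup>+z. \<phi> s * w s * zonal_kernel (?D) s (z $ k) * indicator {-1<..<1} s \<partial>\<mu>) = (\<integral>\<^sup>+z. \<phi> s * w s * indicator {-1<..<1} s * zonal_kernel (?D) s (z $ k) \<partial>\<mu>)"
    by (rule nn_integral_cong) (simp add: mult_ac)
   also have "\<dots> = \<phi> s * w s * indicator {-1<..<1} s * Z s" unfolding Z_def by (rule nn_integral_cmult) measurable
   finally show "(\<integral>\<^sup>+z. \<phi> s * w s * zonal_kernel (?D) s (z $ k) * indicator {-1<..<1} s \<partial>\<mu>) = \<phi> s * w s * Z s * indicator {-1<..<1} s"
    by (simp add: mult_ac)
  qed
  finally have "ennreal (2 * A) * (\<integral>\<^sup>+s\<in>{-1<..<1}. \<phi> s * w s * Z s \<partial>lborel) = ennreal (2 * B) * ?Y \<phi>"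
   unfolding L by simp
  then have "ennreal 2 * (ennreal A * (\<integral>\<^sup>+s\<in>{-1<..<1}. \<phi> s * w s * Z s \<partial>lborel)) = ennreal 2 * (ennreal B * ?Y \<phi>)"
   using ennreal_mult'[of 2 A] ennreal_mult'[of 2 B] by (simp only: mult.assoc)
  then show ?thesis by (subst (asm) ennreal_mult_cancel_left) auto
 qed
 have "AE s in lborel. s \<in> {-1<..<a} \<longrightarrow> ennreal A * (w s * Z s) = ennreal B * (ennreal (y s) * w s)"
 proof (rule AE_eq_from_integrals[OF _ _ a(1)])
  fix c d assume cd: "-1 < c" "c < d" "d < a"
  have i: "(\<integral>\<^sup>+s\<in>{-1<..<1}. indicator {c<..d} s * h s * h' s \<partial>lborel) = (\<integral>\<^sup>+s\<in>{c<..d}. h s * h' s \<partial>lborel)" for h h' :: "real \<Rightarrow> ennreal"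
   using cd a by (intro nn_integral_cong) (auto simp: indicator_def)
  have cm: "(\<integral>\<^sup>+s\<in>{c<..d}. C * h s \<partial>lborel) = C * (\<integral>\<^sup>+s\<in>{c<..d}. h s \<partial>lborel)" if [measurable]: "h \<in> borel_measurable borel" for C and h :: "real \<Rightarrow> ennreal"
   unfolding mult.assoc by (rule nn_integral_cmult) measurable
  have "ennreal A * (\<integral>\<^sup>+s\<in>{c<..d}. w s * Z s \<partial>lborel) = ennreal B * (\<integral>\<^sup>+s\<in>{c<..d}. ennreal (y s) * w s \<partial>lborel)"
  proof -
   have "ennreal A * (\<integral>\<^sup>+s\<in>{-1<..<1}. indicator {c<..d} s * w s * Z s \<partial>lborel) = ennreal B * (\<integral>\<^sup>+s\<in>{-1<..<1}. indicator {c<..d} s * ennreal (y s) * w s \<partial>lborel)"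
    by (rule test) (use cd in \<open>auto simp: indicator_def\<close>)
   then show ?thesis unfolding i .
  qed
  then show eq: "(\<integral>\<^sup>+s\<in>{c<..d}. ennreal A * (w s * Z s) \<partial>lborel) = (\<integral>\<^sup>+s\<in>{c<..d}. ennreal B * (ennreal (y s) * w s) \<partial>lborel)"
   by (subst (1 2) cm) simp_all
  have "(\<integral>\<^sup>+s\<in>{c<..d}. ennreal A * (w s * Z s) \<partial>lborel) = ennreal B * (\<integral>\<^sup>+s\<in>{c<..d}. ennreal (y s) * w s \<partial>lborel)"
   unfolding eq by (rule cm) measurable
  also have "\<dots> \<le> ennreal B * (\<integral>\<^sup>+s\<in>{c<..d}. ennreal K \<partial>lborel)"
  proof (intro mult_left_mono nn_integral_mono)
   fix s :: real
   show "ennreal (y s) * w s * indicator {c<..d} s \<le> ennreal K * indicator {c<..d} s"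
   proof (cases "s \<in> {c<..d}")
    case True
    then have s: "-1 < s" "s < a" using cd by auto
    have "1 - s\<^sup>2 \<ge> 0" using s a by (simp add: abs_square_le_1 abs_le_iff)
    then have "(1 - s\<^sup>2) powr ((?D - 3) / 2) \<le> 1" using n by (intro powr_le1) auto
    then have "w s \<le> 1" unfolding w_def by (simp add: ennreal_le_1)
    then have "ennreal (y s) * w s \<le> ennreal K * 1" using K[OF s] by (intro mult_mono ennreal_leI) auto
    then show ?thesis using True by simp
   qed simp
  qed simp
  also have "\<dots> < \<infinity>" using cd by (subst nn_integral_cmult_indicator) (auto simp: ennreal_mult_less_top)
  finally show "(\<integral>\<^sup>+s\<in>{c<..d}. ennreal A * (w s * Z s) \<partial>lborel) \<noteq> \<infinity>" by simp
 qed measurable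
 then show ?thesis
 proof eventually_elim
  fix s assume s: "s \<in> {-1<..<a} \<longrightarrow> ennreal A * (w s * Z s) = ennreal B * (ennreal (y s) * w s)"
  show "s \<in> {-1<..<a} \<longrightarrow> ennreal (half_sphere_area (CARD('n) - 2)) * (\<integral>\<^sup>+u. zonal_kernel (?D) s u \<partial>distr \<mu> borel (\<lambda>x. x $ k))
   = ennreal (half_sphere_area (CARD('n) - 1) * y s)"
  proof
   assume s': "s \<in> {-1<..<a}"
   have "1 - s\<^sup>2 > 0" using s' a by (simp add: abs_square_less_1 abs_less_iff)
   then have w: "w s \<noteq> 0" "w s \<noteq> \<top>" by (auto simp: w_def)
   have "w s * (ennreal A * Z s) = w s * (ennreal B * ennreal (y s))" using s s' by (simp add: mult_ac)
   then have "ennreal A * Z s = ennreal B * ennreal (y s)" using w by (simp add: ennreal_mult_cancel_left)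
   then show "ennreal (half_sphere_area (CARD('n) - 2)) * (\<integral>\<^sup>+u. zonal_kernel (?D) s u \<partial>distr \<mu> borel (\<lambda>x. x $ k))
   = ennreal (half_sphere_area (CARD('n) - 1) * y s)"
    unfolding Zd A_def[symmetric] B_def[symmetric] using AB by (simp add: ennreal_mult')
  qed
 qed
qed

section \<open>Passage to polar angles\<close>

text \<open>Measurability of f is not assumed: on the closed interval f differs from g in at most
  the two end points, where \<open>aux_g\<close> and similar expressions are uncontrolled, so it is
  inherited.\<close>

lemma LBINT_cong_Ioo:
 fixes f g :: "real \<Rightarrow> real"
 assumes g: "(\<lambda>x. g x * indicator {p<..<q} x) \<in> borel_measurable borel" and eq: "\<And>x. p < x \<Longrightarrow> x < q \<Longrightarrow> f x = g x"
 shows "(LBINT x:{p..q}. f x) = (LBINT x. g x * indicator {p<..<q} x)"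
proof -
 let ?h = "\<lambda>x. if x = p then indicator {p..q} p *\<^sub>R f p else if x = q then indicator {p..q} q *\<^sub>R f q else g x * indicator {p<..<q} x"
 have "(\<lambda>x. indicator {p..q} x *\<^sub>R f x) = ?h"
  using eq by (auto simp: fun_eq_iff indicator_def)
 moreover have "(LBINT x. ?h x) = (LBINT x. g x * indicator {p<..<q} x)"
 proof (rule integral_cong_AE)
  show "?h \<in> borel_measurable lborel" using g by measurable
  show "AE x in lborel. ?h x = g x * indicator {p<..<q} x"
   using AE_lborel_singleton[of p] AE_lborel_singleton[of q] by eventually_elim simp
 qed (use g in simp)
 ultimately show ?thesis by (simp add: set_lebesgue_integral_def)
qed

lemma distr_cos:
 assumes "0 \<le> \<zeta>" "\<zeta> < \<eta>" "\<eta> \<le> pi"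
 shows "distr (density lborel (\<lambda>\<theta>. ennreal (sin \<theta> * indicator {\<zeta><..<\<eta>} \<theta>))) borel cos
  = density lborel (\<lambda>u. ennreal (indicator {cos \<eta><..<cos \<zeta>} u))"
proof (rule measure_eqI)
 fix A :: "real set" assume "A \<in> sets (distr (density lborel (\<lambda>\<theta>. ennreal (sin \<theta> * indicator {\<zeta><..<\<eta>} \<theta>))) borel cos)"
 then have A [measurable]: "A \<in> sets borel" by simp
 have [measurable]: "cos \<in> borel_measurable (borel :: real measure)"
  by (intro borel_measurable_continuous_onI continuous_intros)
 let ?M = "density lborel (\<lambda>\<theta>. ennreal (sin \<theta> * indicator {\<zeta><..<\<eta>} \<theta>))"
 have "emeasure (distr ?M borel cos) A = (\<integral>\<^sup>+u. indicator A u \<partial>distr ?M borel cos)" by simp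
 also have "\<dots> = (\<integral>\<^sup>+\<theta>. indicator A (cos \<theta>) \<partial>?M)" by (rule nn_integral_distr) measurable
 also have "\<dots> = (\<integral>\<^sup>+\<theta>. ennreal (sin \<theta> * indicator {\<zeta><..<\<eta>} \<theta>) * indicator A (cos \<theta>) \<partial>lborel)"
  by (rule nn_integral_density) measurable
 also have "\<dots> = (\<integral>\<^sup>+\<theta>\<in>{\<zeta><..<\<eta>}. indicator A (- (- cos \<theta>)) * ennreal (sin \<theta>) \<partial>lborel)"
  by (rule nn_integral_cong) (auto simp: indicator_def)
 also have "\<dots> = (\<integral>\<^sup>+x\<in>{- cos \<zeta><..<- cos \<eta>}. indicator A (- x) \<partial>lborel)"
 proof (rule nn_integral_subst_Ioo[where g = "\<lambda>\<theta>. - cos \<theta>", symmetric])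
  show "((\<lambda>\<theta>. - cos \<theta>) has_real_derivative sin x) (at x)" for x by (auto intro!: derivative_eq_intros)
  show "sin x \<ge> 0" if "x \<in> {\<zeta>..\<eta>}" for x using that assms by (intro sin_ge_zero) auto
 qed (use assms in \<open>auto intro!: continuous_intros\<close>)
 also have "\<dots> = ennreal \<bar>-1\<bar> * (\<integral>\<^sup>+u. indicator A (- (0 + (-1) * u)) * indicator {- cos \<zeta><..<- cos \<eta>} (0 + (-1) * u) \<partial>lborel)"
  by (rule nn_integral_real_affine) auto
 also have "\<dots> = (\<integral>\<^sup>+u. ennreal (indicator {cos \<eta><..<cos \<zeta>} u) * indicator A u \<partial>lborel)"
  by (simp, rule nn_integral_cong) (auto simp: indicator_def)
 also have "\<dots> = emeasure (density lborel (\<lambda>u. ennreal (indicator {cos \<eta><..<cos \<zeta>} u))) A"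
  by (rule emeasure_density[symmetric]) auto
 finally show "emeasure (distr ?M borel cos) A = emeasure (density lborel (\<lambda>u. ennreal (indicator {cos \<eta><..<cos \<zeta>} u))) A" .
qed simp

text \<open>Argued through the image measure of sin \<theta> d\<theta> under cosine. This needs
  measurability alone, so the equality also holds when neither side is integrable and both are 0 by
  convention.\<close>

lemma LBINT_cos_substitution:
 fixes f h :: "real \<Rightarrow> real"
 assumes \<zeta>: "0 \<le> \<zeta>" "\<zeta> < \<eta>" "\<eta> \<le> pi"
  and h: "(\<lambda>u. h u * indicator {cos \<eta><..<cos \<zeta>} u) \<in> borel_measurable borel"
  and eq: "\<And>\<theta>. \<zeta> < \<theta> \<Longrightarrow> \<theta> < \<eta> \<Longrightarrow> f \<theta> = h (cos \<theta>) * sin \<theta>"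
 shows "(LBINT \<theta>:{\<zeta>..\<eta>}. f \<theta>) = (LBINT u:{cos \<eta>..cos \<zeta>}. h u)"
proof -
 define h' where "h' u = h u * indicator {cos \<eta><..<cos \<zeta>} u" for u
 have h'm [measurable]: "h' \<in> borel_measurable borel" using h by (simp add: h'_def[abs_def])
 have cm [measurable]: "cos \<in> borel_measurable (borel :: real measure)"
  by (intro borel_measurable_continuous_onI continuous_intros)
 have in_I: "cos \<theta> \<in> {cos \<eta><..<cos \<zeta>}" if "\<zeta> < \<theta>" "\<theta> < \<eta>" for \<theta>
  using that \<zeta> cos_monotone_0_pi[of \<zeta> \<theta>] cos_monotone_0_pi[of \<theta> \<eta>] by auto
 let ?M = "density lborel (\<lambda>\<theta>. ennreal (sin \<theta> * indicator {\<zeta><..<\<eta>} \<theta>))"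
 have "(LBINT \<theta>:{\<zeta>..\<eta>}. f \<theta>) = (LBINT \<theta>. (h' (cos \<theta>) * sin \<theta>) * indicator {\<zeta><..<\<eta>} \<theta>)"
 proof (rule LBINT_cong_Ioo)
  show "(\<lambda>\<theta>. h' (cos \<theta>) * sin \<theta> * indicator {\<zeta><..<\<eta>} \<theta>) \<in> borel_measurable borel" by measurable
  show "f \<theta> = h' (cos \<theta>) * sin \<theta>" if "\<zeta> < \<theta>" "\<theta> < \<eta>" for \<theta>
   using eq[OF that] in_I[OF that] by (simp add: h'_def)
 qed
 also have "\<dots> = (LBINT \<theta>. (sin \<theta> * indicator {\<zeta><..<\<eta>} \<theta>) *\<^sub>R h' (cos \<theta>))"
  by (rule Bochner_Integration.integral_cong) auto
 also have "\<dots> = integral\<^sup>L ?M (\<lambda>\<theta>. h' (cos \<theta>))"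
 proof (rule integral_density[symmetric])
  show "AE \<theta> in lborel. 0 \<le> sin \<theta> * indicator {\<zeta><..<\<eta>} \<theta>"
  proof (rule AE_I2)
   fix \<theta> show "0 \<le> sin \<theta> * indicator {\<zeta><..<\<eta>} \<theta>"
    using sin_ge_zero[of \<theta>] \<zeta> by (auto simp: indicator_def)
  qed
 qed measurable
 also have "\<dots> = integral\<^sup>L (distr ?M borel cos) h'" by (rule integral_distr[symmetric]) measurable
 also have "\<dots> = (LBINT u. indicator {cos \<eta><..<cos \<zeta>} u *\<^sub>R h' u)"
  unfolding distr_cos[OF \<zeta>] by (rule integral_density) auto
 also have "\<dots> = (LBINT u. h u * indicator {cos \<eta><..<cos \<zeta>} u)"
  by (rule Bochner_Integration.integral_cong) (auto simp: h'_def indicator_def)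
 also have "\<dots> = (LBINT u:{cos \<eta>..cos \<zeta>}. h u)"
  by (rule LBINT_cong_Ioo[OF h, symmetric]) simp
 finally show ?thesis .
qed

section \<open>The functions \<open>aux_g\<close> and \<open>aux_F\<close> in the height
  variable\<close>

lemma power_eq_powr_square:
 fixes x :: real
 assumes "x > 0"
 shows "x ^ m = (x\<^sup>2) powr (real m / 2)"
proof -
 have "(x powr 2) powr (real m / 2) = x powr real m" by (simp add: powr_powr del: powr_numeral)
 then show ?thesis using assms by (simp add: powr_realpow)
qed

lemma half_angle_powers:
 assumes \<zeta>: "0 < \<zeta>" "\<zeta> < pi"
 shows "cos (\<zeta> / 2) ^ m = ((1 + cos \<zeta>) / 2) powr (real m / 2)"
  and "sin (\<zeta> / 2) ^ m = ((1 - cos \<zeta>) / 2) powr (real m / 2)"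
  and "tan (\<zeta> / 2) ^ m = (1 - cos \<zeta>) powr (real m / 2) * (1 + cos \<zeta>) powr (- (real m / 2))"
  and "sin \<zeta> ^ m = (1 - (cos \<zeta>)\<^sup>2) powr (real m / 2)"
proof -
 have c: "cos (\<zeta> / 2) > 0" "sin (\<zeta> / 2) > 0" "sin \<zeta> > 0"
  using \<zeta> by (auto intro: cos_gt_zero sin_gt_zero)
 have c2: "(cos (\<zeta> / 2))\<^sup>2 = (1 + cos \<zeta>) / 2" using cos_double_cos[of "\<zeta> / 2"] by (simp add: field_simps)
 have s2: "(sin (\<zeta> / 2))\<^sup>2 = (1 - cos \<zeta>) / 2" using cos_double_sin[of "\<zeta> / 2"] by (simp add: field_simps)
 show 1: "cos (\<zeta> / 2) ^ m = ((1 + cos \<zeta>) / 2) powr (real m / 2)"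
  using power_eq_powr_square[OF c(1), of m] by (simp add: c2)
 show 2: "sin (\<zeta> / 2) ^ m = ((1 - cos \<zeta>) / 2) powr (real m / 2)"
  using power_eq_powr_square[OF c(2), of m] by (simp add: s2)
 have "(cos (\<zeta> / 2))\<^sup>2 > 0" using c(1) by simp
 then have p: "1 + cos \<zeta> > 0" unfolding c2 by simp
 have "(sin (\<zeta> / 2))\<^sup>2 > 0" using c(2) by simp
 then have q: "1 - cos \<zeta> > 0" unfolding s2 by simp
 have "tan (\<zeta> / 2) ^ m = sin (\<zeta> / 2) ^ m / cos (\<zeta> / 2) ^ m" by (simp add: tan_def power_divide)
 also have "\<dots> = (((1 - cos \<zeta>) / 2) / ((1 + cos \<zeta>) / 2)) powr (real m / 2)"
  unfolding 1 2 using p q by (subst powr_divide) auto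
 also have "((1 - cos \<zeta>) / 2) / ((1 + cos \<zeta>) / 2) = (1 - cos \<zeta>) / (1 + cos \<zeta>)"
  using mult_divide_mult_cancel_right[of "1/2::real" "1 - cos \<zeta>" "1 + cos \<zeta>"] by simp
 also have "((1 - cos \<zeta>) / (1 + cos \<zeta>)) powr (real m / 2) = (1 - cos \<zeta>) powr (real m / 2) * (1 + cos \<zeta>) powr (- (real m / 2))"
 proof (subst powr_divide)
  show "(1 - cos \<zeta>) powr (real m / 2) / (1 + cos \<zeta>) powr (real m / 2) = (1 - cos \<zeta>) powr (real m / 2) * (1 + cos \<zeta>) powr (- (real m / 2))"
   unfolding powr_minus[of _ "real m / 2"] by (rule divide_inverse)
 qed
 finally show "tan (\<zeta> / 2) ^ m = (1 - cos \<zeta>) powr (real m / 2) * (1 + cos \<zeta>) powr (- (real m / 2))" .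
 show "sin \<zeta> ^ m = (1 - (cos \<zeta>)\<^sup>2) powr (real m / 2)"
  using power_eq_powr_square[OF c(3), of m] by (simp add: sin_squared_eq)
qed

lemma divide_sqrt_eq_powr: "x > 0 \<Longrightarrow> (y::real) / sqrt x = y * x powr (-1/2)"
 by (simp add: powr_minus_divide powr_half_sqrt)

context
 fixes n :: nat and \<alpha> K :: real and q y1 y2 :: "real \<Rightarrow> real"
 assumes n: "n \<ge> 3" and \<alpha>: "0 < \<alpha>" "\<alpha> < pi"
  and C2: "C2_weighted (cos \<alpha>) (\<lambda>s. q (arccos s)) y1 y2 K"
begin

lemma cos_in_cap: "\<alpha> < \<zeta> \<Longrightarrow> \<zeta> < pi \<Longrightarrow> -1 < cos \<zeta> \<and> cos \<zeta> < cos \<alpha>"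
 using \<alpha> cos_monotone_0_pi[of \<alpha> \<zeta>] cos_monotone_0_pi[of \<zeta> pi] by simp

lemma cap_bounds: "-1 < cos \<alpha>" "cos \<alpha> < 1"
 using \<alpha> cos_monotone_0_pi[of 0 \<alpha>] cos_monotone_0_pi[of \<alpha> pi] by simp_all

text \<open>The power of cos(\<theta>/2) supplies (1+s)^e and the power of 2, so the integral is a
  lower Abel transform at cos \<zeta>. Its derivative brings in the Copson weight and -sin \<zeta>;
  together with the power of the tangent these multiply to -1, which is the reason for the tangent
  in g.\<close>

lemma aux_g_eq:
 assumes \<zeta>: "\<alpha> < \<zeta>" "\<zeta> < pi"
 shows "aux_g n q \<zeta> = - (2 powr (- ((real n - 3) / 2)) * Abel_g (real n) (\<lambda>s. q (arccos s)) y1 (cos \<zeta>))"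
proof -
 define e where "e = (real n - 3) / 2"
 have ne: "real (n - 3) / 2 = e" using n by (simp add: e_def of_nat_diff)
 define qt where "qt = (\<lambda>s. q (arccos s))"
 have D3: "real n \<ge> 3" using n by simp
 define L where "L = lower_Abel (real n) qt"
 have inner: "(LBINT \<theta>:{x..pi}. q \<theta> * cos (\<theta> / 2) ^ (n - 3) * sin \<theta> / sqrt (cos x - cos \<theta>)) = 2 powr (- e) * L (cos x)"
  if x: "\<alpha> < x" "x < pi" for x
 proof -
  define c where "c = cos x"
  have c: "-1 < c" "c < cos \<alpha>" using cos_in_cap[OF x] by (auto simp: c_def)
  define h where "h u = 2 powr (- e) * (qt u * (1 + u) powr e * (c - u) powr (-1/2))" for u
  have cont: "continuous_on {-1<..<c} qt"
   unfolding qt_def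
   by (intro continuous_at_imp_continuous_on ballI, rule DERIV_isCont[OF C2_weightedD(1)[OF C2]]) (use c in auto)
  have "continuous_on {-1<..<c} h" unfolding h_def[abs_def]
   by (intro continuous_intros cont) auto
  then have hm: "(\<lambda>u. h u * indicator {-1<..<c} u) \<in> borel_measurable borel"
   using borel_measurable_continuous_on_indicator[of "{-1<..<c}" h] by (simp add: mult.commute)
  have "(LBINT \<theta>:{x..pi}. q \<theta> * cos (\<theta> / 2) ^ (n - 3) * sin \<theta> / sqrt (cos x - cos \<theta>)) = (LBINT u:{cos pi..cos x}. h u)"
  proof (rule LBINT_cos_substitution)
   show "(\<lambda>u. h u * indicator {cos pi<..<cos x} u) \<in> borel_measurable borel" using hm by (simp add: c_def)
   fix \<theta> assume t: "x < \<theta>" "\<theta> < pi"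
   have t0: "0 < \<theta>" using t x \<alpha> by simp
   have cc: "cos \<theta> < c" "-1 < cos \<theta>" using t x \<alpha> cos_monotone_0_pi[of x \<theta>] cos_monotone_0_pi[of \<theta> pi] by (auto simp: c_def)
   have "q \<theta> = qt (cos \<theta>)" using t t0 by (simp add: qt_def arccos_cos)
   moreover have "cos (\<theta> / 2) ^ (n - 3) = 2 powr (- e) * (1 + cos \<theta>) powr e"
    unfolding half_angle_powers(1)[OF t0 t(2)] ne using cc by (subst powr_divide) (auto simp: powr_minus field_simps)
   ultimately show "q \<theta> * cos (\<theta> / 2) ^ (n - 3) * sin \<theta> / sqrt (cos x - cos \<theta>) = h (cos \<theta>) * sin \<theta>"
    using divide_sqrt_eq_powr[of "cos x - cos \<theta>"] cc by (simp add: h_def c_def[symmetric])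
  qed (use x \<alpha> in auto)
  also have "\<dots> = 2 powr (- e) * L c"
   unfolding L_def lower_Abel_def h_def e_def by (simp add: c_def)
  finally show ?thesis by (simp add: c_def)
 qed
 define c where "c = cos \<zeta>"
 have c: "-1 < c" "c < cos \<alpha>" using cos_in_cap[OF \<zeta>] by (auto simp: c_def)
 have c1: "c < 1" using c cap_bounds by simp
 define G where "G = Abel_g (real n) qt y1 c"
 have dL: "(L has_real_derivative Copson_weight (real n) c * G) (at (cos \<zeta>))"
  unfolding L_def G_def c_def[symmetric] qt_def by (rule lower_Abel_derivative[OF D3 C2 cap_bounds(2) c])
 have "((\<lambda>x. L (cos x)) has_real_derivative Copson_weight (real n) c * G * (- sin \<zeta>)) (at \<zeta>)"
  by (rule DERIV_chain2[where f = L and g = cos, OF dL DERIV_cos])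
 then have "((\<lambda>x. 2 powr (- e) * L (cos x)) has_real_derivative 2 powr (- e) * (Copson_weight (real n) c * G * (- sin \<zeta>))) (at \<zeta>)"
  by (rule DERIV_cmult)
 then have "((\<lambda>x. LBINT \<theta>:{x..pi}. q \<theta> * cos (\<theta> / 2) ^ (n - 3) * sin \<theta> / sqrt (cos x - cos \<theta>)) has_real_derivative
   2 powr (- e) * (Copson_weight (real n) c * G * (- sin \<zeta>))) (at \<zeta>)"
  by (rule has_field_derivative_transform_within_open[of _ _ _ "{\<alpha><..<pi}"]) (use \<zeta> inner in auto)
 then have "aux_g n q \<zeta> = tan (\<zeta> / 2) ^ (n - 3) * (2 powr (- e) * (Copson_weight (real n) c * G * (- sin \<zeta>)))"
  unfolding aux_g_def by (subst DERIV_imp_deriv) auto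
 also have "\<dots> = - (2 powr (- e) * G) * (tan (\<zeta> / 2) ^ (n - 3) * Copson_weight (real n) c * sin \<zeta>)" by simp
 also have "tan (\<zeta> / 2) ^ (n - 3) * Copson_weight (real n) c * sin \<zeta> = 1"
 proof -
  have z0: "0 < \<zeta>" using \<zeta> \<alpha> by simp
  have e2: "(real n - 4) / 2 = e - 1/2" "- ((real n - 2) / 2) = - (e + 1/2)" by (auto simp: e_def field_simps)
  have s: "sin \<zeta> = (1 - c) powr (1/2) * (1 + c) powr (1/2)"
  proof -
   have "sin \<zeta> = (1 - c\<^sup>2) powr (1/2)" using half_angle_powers(4)[OF z0 \<zeta>(2), of 1] by (simp add: c_def)
   also have "1 - c\<^sup>2 = (1 - c) * (1 + c)" by (simp add: power2_eq_square algebra_simps)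
   finally show ?thesis using c c1 by (simp add: powr_mult)
  qed
  have "tan (\<zeta> / 2) ^ (n - 3) * Copson_weight (real n) c * sin \<zeta>
   = ((1 - c) powr e * (1 - c) powr (- (e + 1/2)) * (1 - c) powr (1/2)) * ((1 + c) powr (- e) * (1 + c) powr (e - 1/2) * (1 + c) powr (1/2))"
   unfolding half_angle_powers(3)[OF z0 \<zeta>(2)] ne Copson_weight_def e2 s c_def[symmetric] by (simp only: mult_ac)
  also have "\<dots> = 1" unfolding powr_add[symmetric] using c c1 by simp
  finally show ?thesis .
 qed
 finally show ?thesis unfolding G_def c_def e_def qt_def by simp
qed

text \<open>The minus sign of \<open>aux_g_eq\<close> meets that of the derivative of cosine, the
  power of 2 cancels against the half-angle power in front, and 1 / sin \<eta> removes the remaining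
  sine.\<close>

lemma aux_F_eq:
 assumes B': "\<And>v. -1 < v \<Longrightarrow> v < cos \<alpha> \<Longrightarrow>
   (upper_Abel (cos \<alpha>) (Abel_g (real n) (\<lambda>s. q (arccos s)) y1) has_real_derivative B' v) (at v)"
  and \<eta>: "\<alpha> < \<eta>" "\<eta> < pi"
 shows "aux_F n q \<alpha> \<eta> = Gamma ((real n - 2) / 2) / (2 * pi powr ((real n + 2) / 2)) *
  ((1 - cos \<eta>) powr (- ((real n - 3) / 2)) * B' (cos \<eta>))"
proof -
 define e where "e = (real n - 3) / 2"
 have ne: "real (n - 3) / 2 = e" using n by (simp add: e_def of_nat_diff)
 have D3: "real n \<ge> 3" using n by simp
 define a where "a = cos \<alpha>"
 define G where "G = Abel_g (real n) (\<lambda>s. q (arccos s)) y1"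
 define B where "B = upper_Abel a G"
 obtain G' where nice: "nice_on a G G'" using nice_on_Abel_g[OF D3 C2 cap_bounds(2)] by (auto simp: G_def a_def)
 have cG: "continuous_on {-1<..<a} G"
  using nice by (intro continuous_at_imp_continuous_on ballI) (auto simp: nice_on_def intro: DERIV_isCont)
 have inner: "(LBINT \<zeta>:{\<alpha>..x}. aux_g n q \<zeta> * sin \<zeta> / sqrt (cos \<zeta> - cos x)) = - (2 powr (- e)) * B (cos x)"
  if x: "\<alpha> < x" "x < pi" for x
 proof -
  define v where "v = cos x"
  have v: "-1 < v" "v < a" using cos_in_cap[OF x] by (auto simp: v_def a_def)
  define h where "h u = - (2 powr (- e)) * (G u * (u - v) powr (-1/2))" for u
  have "continuous_on {v<..<a} h" unfolding h_def[abs_def] using v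
   by (intro continuous_intros continuous_on_subset[OF cG]) auto
  then have hm: "(\<lambda>u. h u * indicator {v<..<a} u) \<in> borel_measurable borel"
   using borel_measurable_continuous_on_indicator[of "{v<..<a}" h] by (simp add: mult.commute)
  have "(LBINT \<zeta>:{\<alpha>..x}. aux_g n q \<zeta> * sin \<zeta> / sqrt (cos \<zeta> - cos x)) = (LBINT u:{cos x..cos \<alpha>}. h u)"
  proof (rule LBINT_cos_substitution)
   show "(\<lambda>u. h u * indicator {cos x<..<cos \<alpha>} u) \<in> borel_measurable borel" using hm by (simp add: v_def a_def)
   fix \<zeta> assume z: "\<alpha> < \<zeta>" "\<zeta> < x"
   then have zp: "\<zeta> < pi" using x by simp
   have cc: "cos \<zeta> > v" using z x \<alpha> cos_monotone_0_pi[of \<zeta> x] by (auto simp: v_def)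
   show "aux_g n q \<zeta> * sin \<zeta> / sqrt (cos \<zeta> - cos x) = h (cos \<zeta>) * sin \<zeta>"
    unfolding aux_g_eq[OF z(1) zp] h_def v_def[symmetric] G_def[symmetric] e_def[symmetric]
    using divide_sqrt_eq_powr[of "cos \<zeta> - v"] cc by simp
  qed (use x \<alpha> in auto)
  also have "\<dots> = - (2 powr (- e)) * B v"
   unfolding B_def upper_Abel_def h_def set_integral_mult_right by (simp add: v_def a_def)
  finally show ?thesis by (simp add: v_def)
 qed
 define v where "v = cos \<eta>"
 have v: "-1 < v" "v < a" using cos_in_cap[OF \<eta>] by (auto simp: v_def a_def)
 have v1: "v < 1" using v cap_bounds by (simp add: a_def)
 have dB: "(B has_real_derivative B' v) (at (cos \<eta>))"
  using B'[of v] v unfolding B_def G_def v_def a_def by simp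
 have "((\<lambda>x. B (cos x)) has_real_derivative B' v * (- sin \<eta>)) (at \<eta>)"
  by (rule DERIV_chain2[where f = B and g = cos, OF dB DERIV_cos])
 then have "((\<lambda>x. - (2 powr (- e)) * B (cos x)) has_real_derivative - (2 powr (- e)) * (B' v * (- sin \<eta>))) (at \<eta>)"
  by (rule DERIV_cmult)
 then have "((\<lambda>x. LBINT \<zeta>:{\<alpha>..x}. aux_g n q \<zeta> * sin \<zeta> / sqrt (cos \<zeta> - cos x)) has_real_derivative
   - (2 powr (- e)) * (B' v * (- sin \<eta>))) (at \<eta>)"
  by (rule has_field_derivative_transform_within_open[of _ _ _ "{\<alpha><..<pi}"]) (use \<eta> inner in auto)
 then have d: "deriv (\<lambda>x. LBINT \<zeta>:{\<alpha>..x}. aux_g n q \<zeta> * sin \<zeta> / sqrt (cos \<zeta> - cos x)) \<eta> = 2 powr (- e) * B' v * sin \<eta>"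
  by (subst DERIV_imp_deriv) (auto simp: mult.assoc)
 have e0: "0 < \<eta>" using \<eta> \<alpha> by simp
 have s: "sin \<eta> > 0" using e0 \<eta> by (intro sin_gt_zero)
 have hs: "(1 / sin (\<eta> / 2)) ^ (n - 3) = 2 powr e * (1 - v) powr (- e)"
 proof -
  have "(1 / sin (\<eta> / 2)) ^ (n - 3) = 1 / ((1 - v) / 2) powr e"
   unfolding power_one_over half_angle_powers(2)[OF e0 \<eta>(2)] ne v_def by simp
  also have "\<dots> = 2 powr e * (1 - v) powr (- e)"
   using v1 by (subst powr_divide) (auto simp: powr_minus field_simps)
  finally show ?thesis .
 qed
 let ?c = "Gamma ((real n - 2) / 2) / (2 * pi powr ((real n + 2) / 2))"
 have "aux_F n q \<alpha> \<eta> = ?c * (1 / sin \<eta>) * (2 powr e * (1 - v) powr (- e)) * (2 powr (- e) * B' v * sin \<eta>)"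
  unfolding aux_F_def d hs ..
 also have "\<dots> = ?c * ((2 powr e * 2 powr (- e)) * ((1 - v) powr (- e) * B' v))" using s by simp
 also have "(2::real) powr e * 2 powr (- e) = 1" by (simp add: powr_add[symmetric])
 finally show ?thesis by (simp add: v_def e_def)
qed

end

text \<open>The whole chain of transforms is linear. On a constant the moment is a Beta value, so
  \<open>Abel_g\<close> becomes a multiple of (1 - \<tau>)^((D-2)/2), for which the second transform
  is explicit.\<close>

lemma upper_Abel_affine:
 assumes D: "D \<ge> 3" and C2: "C2_weighted a q q1 q2 K" and a: "a < 1" and v: "-1 < v" "v < a"
 shows "upper_Abel a (Abel_g D (\<lambda>s. F - q s) (\<lambda>s. - q1 s)) v =
  F * ((D - 2) / 2 * Beta ((D - 1) / 2) (1/2)) * upper_Abel a (\<lambda>\<tau>. (1 - \<tau>) powr ((D - 2) / 2)) v - upper_Abel a (Abel_g D q q1) v"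
proof -
 define p where "p = (D - 2) / 2"
 define \<beta> where "\<beta> = Beta ((D - 1) / 2) (1/2)"
 have p: "p > 0" using D by (simp add: p_def)
 let ?w = "\<lambda>x. x powr ((D - 1) / 2 - 1) * (1 - x) powr (1/2 - 1)"
 have W: "integrable unit_ivl ?w" "(\<integral>x. ?w x \<partial>unit_ivl) = \<beta>"
  using D unfolding \<beta>_def by (intro Beta_weight; simp)+
 have g: "Abel_g D (\<lambda>s. F - q s) (\<lambda>s. - q1 s) c = F * (p * \<beta>) * (1 - c) powr p - Abel_g D q q1 c" if c: "-1 < c" "c < a" for c
 proof -
  let ?s = "\<lambda>x. -1 + (1 + c) * x"
  have "Abel_moment D 0 (\<lambda>s. F - q s) c = (\<integral>x. F * ?w x - q (?s x) * ?w x \<partial>unit_ivl)"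
   unfolding Abel_moment_def by (rule Bochner_Integration.integral_cong) (simp_all add: algebra_simps)
  also have "\<dots> = F * \<beta> - (\<integral>x. q (?s x) * ?w x \<partial>unit_ivl)"
   unfolding W(2)[symmetric] using integrable_Abel_moment[OF D C2 c] W(1)
   by (subst Bochner_Integration.integral_diff) auto
  finally have m0: "Abel_moment D 0 (\<lambda>s. F - q s) c = F * \<beta> - Abel_moment D 0 q c" by (simp add: Abel_moment_def)
  have m1: "Abel_moment D 1 (\<lambda>s. - q1 s) c = - Abel_moment D 1 q1 c" by (simp add: Abel_moment_def)
  show ?thesis unfolding Abel_g_def m0 m1 p_def[symmetric] by (simp add: algebra_simps)
 qed
 obtain G' where nice: "nice_on a (Abel_g D q q1) G'" using nice_on_Abel_g[OF D C2 a] by auto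
 let ?E = "\<lambda>\<tau>. (1 - \<tau>) powr p * (\<tau> - v) powr (-1/2)" and ?H = "\<lambda>\<tau>. Abel_g D q q1 \<tau> * (\<tau> - v) powr (-1/2)"
 have iH: "set_integrable lborel {v..a} ?H" by (rule nice_on_upper_Abel(3)[OF nice v])
 have iE: "set_integrable lborel {v..a} ?E"
 proof -
  have "set_integrable lborel {v<..<a} ?E" by (rule upper_Abel_power(1)[OF p v(2) a])
  moreover have "AE \<tau> in lborel. indicator {v<..<a} \<tau> *\<^sub>R ?E \<tau> = indicator {v..a} \<tau> *\<^sub>R ?E \<tau>"
   using AE_lborel_singleton[of v] AE_lborel_singleton[of a] by eventually_elim (auto simp: indicator_def)
  ultimately show ?thesis unfolding set_integrable_def
   by (subst integrable_cong_AE[symmetric]) auto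
 qed
 let ?F = "\<lambda>\<tau>. F * (p * \<beta>) * ?E \<tau> - ?H \<tau>"
 have iF: "set_integrable lborel {v..a} ?F" by (intro set_integral_diff(1) set_integrable_mult_right iE iH)
 have "upper_Abel a (Abel_g D (\<lambda>s. F - q s) (\<lambda>s. - q1 s)) v = (LBINT \<tau>. ?F \<tau> * indicator {v<..<a} \<tau>)"
  unfolding upper_Abel_def
 proof (rule LBINT_cong_Ioo)
  have "set_integrable lborel {v<..<a} ?F" by (rule set_integrable_subset[OF iF]) auto
  then show "(\<lambda>\<tau>. ?F \<tau> * indicator {v<..<a} \<tau>) \<in> borel_measurable borel"
   using borel_measurable_integrable by (fastforce simp: set_integrable_def mult.commute)
  show "Abel_g D (\<lambda>s. F - q s) (\<lambda>s. - q1 s) \<tau> * (\<tau> - v) powr (-1/2) = ?F \<tau>" if "v < \<tau>" "\<tau> < a" for \<tau>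
   using that v by (simp add: g algebra_simps)
 qed
 also have "\<dots> = (LBINT \<tau>:{v..a}. ?F \<tau>)"
 proof (rule LBINT_cong_Ioo[symmetric])
  have "set_integrable lborel {v<..<a} ?F" by (rule set_integrable_subset[OF iF]) auto
  then show "(\<lambda>\<tau>. ?F \<tau> * indicator {v<..<a} \<tau>) \<in> borel_measurable borel"
   using borel_measurable_integrable by (fastforce simp: set_integrable_def mult.commute)
 qed simp
 also have "\<dots> = (LBINT \<tau>:{v..a}. F * (p * \<beta>) * ?E \<tau>) - (LBINT \<tau>:{v..a}. ?H \<tau>)"
  by (intro set_integral_diff(2) set_integrable_mult_right iE iH)
 also have "\<dots> = F * (p * \<beta>) * upper_Abel a (\<lambda>\<tau>. (1 - \<tau>) powr p) v - upper_Abel a (Abel_g D q q1) v"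
  by (simp add: upper_Abel_def)
 finally show ?thesis by (simp add: p_def \<beta>_def)
qed

section \<open>The equilibrium density\<close>

lemma sphere_south_pole_eq:
 fixes x :: "real^'n::finite"
 assumes "x \<in> sphere 0 1" "x $ k = -1"
 shows "x = - axis k 1"
proof -
 have "(x + axis k 1) \<bullet> (x + axis k 1) = 0"
  using assms norm_eq_1[of x]
  by (simp add: inner_add_left inner_add_right inner_axis inner_axis_axis inner_commute[of "axis k 1" x])
 then show ?thesis by (simp add: eq_neg_iff_add_eq_0)
qed

text \<open>The South Pole belongs to the cap, but finite energy leaves no mass on it. The strict
  inequality is needed because the zonal formulas fail at height -1.\<close>

lemma sphere_supp_height:
 fixes \<mu> :: "(real^'n) measure"
 assumes n: "CARD('n) \<ge> 3" and \<mu>: "\<mu> \<in> sphere_fin" and fin: "energy \<mu> < \<infinity>"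
  and supp: "sphere_supp \<mu> = south_cap k \<alpha>" and \<alpha>: "0 < \<alpha>" "\<alpha> \<le> pi"
 shows "AE x in \<mu>. -1 < x $ k \<and> x $ k \<le> cos \<alpha>"
proof -
 let ?p = "- axis k 1 :: real^'n"
 have "emeasure \<mu> {?p} = 0"
  by (rule energy_zero_on_singletons[OF n \<mu> fin]) simp
 moreover have "{?p} \<in> sets \<mu>"
  using sphere_fin_sets[OF \<mu>] by (auto simp: sets_restrict_space sphere_borel_def image_iff intro!: bexI[of _ "{?p}"])
 ultimately have "AE x in \<mu>. x \<noteq> ?p" by (intro AE_I[of _ _ "{?p}"]) auto
 then show ?thesis using sphere_supp_null[OF \<mu>]
 proof eventually_elim
  fix x assume x: "x \<noteq> ?p" "x \<in> sphere_supp \<mu>"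
  then have xs: "x \<in> sphere 0 1" "\<alpha> \<le> polar_angle k x" "polar_angle k x \<le> pi" by (auto simp: supp south_cap_def)
  have "x $ k \<noteq> -1" using sphere_south_pole_eq[OF xs(1)] x(1) by auto
  moreover have "x $ k \<le> cos \<alpha>"
   using cos_monotone_0_pi_le[of \<alpha> "polar_angle k x"] cos_polar_angle[OF xs(1), of k] xs \<alpha> by simp
  ultimately show "-1 < x $ k \<and> x $ k \<le> cos \<alpha>" using sphere_nth_bounds[OF xs(1), of k] by simp
 qed
qed

text \<open>Identifies the prefactor of F: each of the two Abel inversions contributes one factor
  pi, the parallels the remaining constant.\<close>

lemma half_sphere_area_constant:
 assumes "n \<ge> 3"
 shows "1 / (2 * pi\<^sup>2 * half_sphere_area (n - 2)) = Gamma ((real n - 2) / 2) / (2 * pi powr ((real n + 2) / 2))"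
proof -
 have "pi powr ((real n + 2) / 2) = pi powr ((real n - 2) / 2) * pi powr 2"
  unfolding powr_add[symmetric] by (simp add: field_simps)
 then show ?thesis using assms by (simp add: half_sphere_area_def of_nat_diff)
qed

text \<open>Integrate the density against the weight of the heights: total mass equals C times the
  mass of \<open>cap_hyp\<close> plus the integral of F, and this is solved for C. Non-negativity of
  the full density turns the mass condition into integrability; that of F then follows by
  subtraction.\<close>

lemma const_C_eq:
 fixes n :: nat
 assumes n: "n \<ge> 3" and \<alpha>: "0 < \<alpha>" "\<alpha> < pi"
  and Fm: "(\<lambda>v. r v * indicator {-1<..<cos \<alpha>} v) \<in> borel_measurable borel"
  and F: "\<And>\<eta>. \<alpha> < \<eta> \<Longrightarrow> \<eta> < pi \<Longrightarrow> aux_F n q \<alpha> \<eta> = r (cos \<eta>)"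
  and f: "\<And>v. -1 < v \<Longrightarrow> v < cos \<alpha> \<Longrightarrow> 0 \<le> C * cap_hyp (real n) (cos \<alpha>) v + r v"
  and mass: "(\<integral>\<^sup>+v\<in>{-1<..<cos \<alpha>}. ennreal ((C * cap_hyp (real n) (cos \<alpha>) v + r v) * (1 - v\<^sup>2) powr ((real n - 3) / 2)) \<partial>lborel)
   = ennreal (1 / (2 * half_sphere_area (n - 1)))"
 shows "const_C n q \<alpha> = C"
proof -
 define a where "a = cos \<alpha>"
 have a: "-1 < a" "a < 1" using cos_monotone_0_pi[of 0 \<alpha>] cos_monotone_0_pi[of \<alpha> pi] \<alpha> by (auto simp: a_def)
 define D where "D = real n"
 have D: "D \<ge> 3" using n by (simp add: D_def)
 define w where "w v = (1 - v\<^sup>2) powr ((D - 3) / 2)" for v :: real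
 have wm [measurable]: "w \<in> borel_measurable borel" unfolding w_def[abs_def] by measurable
 define ri where "ri v = r v * indicator {-1<..<a} v" for v
 have rm [measurable]: "ri \<in> borel_measurable borel" using Fm by (simp add: ri_def[abs_def] a_def)
 define h where "h v = cap_hyp D a v * w v * indicator {-1<..<a} v" for v
 define g where "g v = (C * cap_hyp D a v * indicator {-1<..<a} v + ri v) * w v" for v
 define IB where "IB = inc_Beta ((1 + a) / 2) ((D - 2) / 2) (D / 2)"
 define k1 where "k1 = 2 powr (D - 2) * sqrt pi * Gamma ((D - 1) / 2) / Gamma (D / 2 - 1)"
 define \<omega> where "\<omega> = 1 / (2 * half_sphere_area (n - 1))"
 have k1: "k1 > 0" unfolding k1_def using D by (intro divide_pos_pos mult_pos_pos Gamma_real_pos) auto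
 have \<omega>: "\<omega> > 0" unfolding \<omega>_def using n half_sphere_area_pos[of "n - 1"] by simp
 have IB: "IB > 0" unfolding IB_def using a D by (intro inc_Beta_pos) auto
 have h0: "h v \<ge> 0" for v using cap_hyp_nonneg[of D v a] D a by (auto simp: h_def w_def indicator_def)
 have g0: "g v \<ge> 0" for v using f[of v] by (auto simp: g_def ri_def w_def a_def D_def indicator_def)
 have hm [measurable]: "h \<in> borel_measurable borel" unfolding h_def[abs_def] by measurable
 have gm [measurable]: "g \<in> borel_measurable borel" unfolding g_def[abs_def] by measurable
 have "(\<integral>\<^sup>+v. ennreal (h v) \<partial>lborel) = (\<integral>\<^sup>+v\<in>{-1<..<a}. ennreal (cap_hyp D a v * (1 - v\<^sup>2) powr ((D - 3) / 2)) \<partial>lborel)"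
  by (rule nn_integral_cong) (simp add: h_def w_def indicator_def)
 also have "\<dots> = ennreal (k1 * IB)" unfolding k1_def IB_def by (rule nn_integral_cap_hyp[OF D a])
 finally have "has_bochner_integral lborel h (k1 * IB)"
  using k1 IB h0 by (intro has_bochner_integral_nn_integral) auto
 then have H: "integrable lborel h" "(LBINT v. h v) = k1 * IB" by (auto simp: has_bochner_integral_iff)
 have "(\<integral>\<^sup>+v. ennreal (g v) \<partial>lborel) = (\<integral>\<^sup>+v\<in>{-1<..<a}. ennreal ((C * cap_hyp D a v + r v) * (1 - v\<^sup>2) powr ((D - 3) / 2)) \<partial>lborel)"
  by (rule nn_integral_cong) (simp add: g_def w_def ri_def indicator_def)
 also have "\<dots> = ennreal \<omega>" unfolding \<omega>_def a_def D_def by (rule mass)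
 finally have "has_bochner_integral lborel g \<omega>"
  using \<omega> g0 by (intro has_bochner_integral_nn_integral) auto
 then have G: "integrable lborel g" "(LBINT v. g v) = \<omega>" by (auto simp: has_bochner_integral_iff)
 have "(LBINT \<eta>:{\<alpha>..pi}. aux_F n q \<alpha> \<eta> * sin \<eta> ^ (n - 2)) = (LBINT v:{cos pi..cos \<alpha>}. r v * w v)"
 proof (rule LBINT_cos_substitution)
  have "(\<lambda>u. ri u * w u) \<in> borel_measurable borel" by measurable
  then show "(\<lambda>u. r u * w u * indicator {cos pi<..<cos \<alpha>} u) \<in> borel_measurable borel" by (simp add: ri_def a_def mult_ac)
  fix \<eta> assume \<eta>: "\<alpha> < \<eta>" "\<eta> < pi"
  have "sin \<eta> ^ (n - 2) = sin \<eta> * sin \<eta> ^ (n - 3)" using n by (metis Suc_diff_le diff_Suc_Suc numeral_2_eq_2 numeral_3_eq_3 power_Suc)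
  also have "sin \<eta> ^ (n - 3) = w (cos \<eta>)"
   using half_angle_powers(4)[of \<eta> "n - 3"] \<eta> \<alpha> n by (simp add: w_def D_def of_nat_diff)
  finally show "aux_F n q \<alpha> \<eta> * sin \<eta> ^ (n - 2) = r (cos \<eta>) * w (cos \<eta>) * sin \<eta>" using F[OF \<eta>] by simp
 qed (use \<alpha> in auto)
 also have "\<dots> = (LBINT v. r v * w v * indicator {-1<..<a} v)"
 proof -
  have "(\<lambda>u. ri u * w u) \<in> borel_measurable borel" by measurable
  then have "(\<lambda>u. r u * w u * indicator {-1<..<a} u) \<in> borel_measurable borel" by (simp add: ri_def mult_ac)
  from LBINT_cong_Ioo[OF this, of "\<lambda>u. r u * w u"] show ?thesis by (simp add: a_def)
 qed
 also have "\<dots> = (LBINT v. g v - C * h v)"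
  by (rule Bochner_Integration.integral_cong) (auto simp: g_def h_def ri_def algebra_simps)
 also have "\<dots> = \<omega> - C * (k1 * IB)"
  using H G by (subst Bochner_Integration.integral_diff) auto
 finally have I: "(LBINT \<eta>:{\<alpha>..pi}. aux_F n q \<alpha> \<eta> * sin \<eta> ^ (n - 2)) = \<omega> - C * (k1 * IB)" .
 have c: "(cos (\<alpha> / 2))\<^sup>2 = (1 + a) / 2" using cos_double_cos[of "\<alpha> / 2"] by (simp add: a_def field_simps)
 have w1: "Gamma ((real n - 1) / 2) / (2 * pi powr ((real n - 1) / 2)) = \<omega>"
  using n by (simp add: \<omega>_def half_sphere_area_def of_nat_diff)
 have p2: "(2::real) ^ (n - 2) = 2 powr (D - 2)" using n by (simp add: D_def powr_realpow[symmetric] of_nat_diff)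
 have w2: "Gamma (real n / 2 - 1) / (2 ^ (n - 2) * sqrt pi * Gamma ((real n - 1) / 2)) = inverse k1"
  unfolding k1_def p2 D_def[symmetric] by (rule inverse_divide[symmetric])
 have "const_C n q \<alpha> = inverse k1 * inverse IB * (\<omega> - (\<omega> - C * (k1 * IB)))"
  unfolding const_C_def I w1 w2 c IB_def D_def ..
 also have "\<dots> = C" using k1 IB by (simp add: field_simps)
 finally show ?thesis .
qed

theorem theorem1p4:
 fixes k :: "'n::finite"
  and Q :: "real ^ 'n \<Rightarrow> ennreal"
  and \<mu> :: "(real ^ 'n) measure"
  and N :: "(real ^ 'n) set"
  and \<alpha> :: real
 assumes "CARD('n) \<ge> 3"
  and "external_field Q"
  and "rotation_invariant k Q"
  and "equilibrium_measure Q \<mu>"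
  and "openin (top_of_set (sphere 0 1)) N"
  and "sphere_supp \<mu> \<subseteq> N"
  and "C2_on_sphere N Q"
  and "0 < \<alpha>" and "\<alpha> \<le> pi"
  and "sphere_supp \<mu> = south_cap k \<alpha>"
 shows "\<exists>f :: real \<Rightarrow> real.
     f \<in> borel_measurable borel \<and> (\<forall>\<eta>. 0 \<le> f \<eta>) \<and>
     \<mu> = density surface_measure (\<lambda>x. ennreal (f (polar_angle k x))) \<and>
     (AE \<eta> in lborel. \<eta> \<in> {\<alpha>..pi} \<longrightarrow>
       f \<eta> = cap_density CARD('n) (polar_profile k Q) \<alpha> \<eta>)"
proof -
 let ?n = "CARD('n)" and ?IQ = "\<integral>\<^sup>+x. Q x \<partial>\<mu>"
 let ?A = "half_sphere_area (?n - 2)" and ?B = "half_sphere_area (?n - 1)"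
 define D where "D = real ?n"
 define e where "e = (D - 3) / 2"
 note n = assms(1)
 have D: "D \<ge> 3" using n by (simp add: D_def)
 have \<mu>: "\<mu> \<in> sphere_prob" using assms(4) by (simp add: equilibrium_measure_def)
 then have \<mu>f: "\<mu> \<in> sphere_fin" using sphere_prob_fin by auto
 interpret \<mu>: prob_space \<mu> using \<mu> by (auto simp: sphere_prob_def)
 note C2loc = C2_on_sphere_continuous[OF assms(5,7)]
 have cont: "\<exists>U h. open U \<and> p \<in> U \<and> continuous_on U h \<and> (\<forall>x\<in>U \<inter> sphere 0 1. 0 \<le> h x \<and> Q x = ennreal (h x))"
  if p: "p \<in> sphere_supp \<mu>" for p
 proof -
  have "p \<in> N" using p assms(6) by blast
  from C2loc[OF this] obtain U h where "open U" "p \<in> U" "continuous_on U h"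
   "\<And>x. x \<in> U \<Longrightarrow> x \<in> sphere 0 1 \<Longrightarrow> 0 \<le> h x \<and> Q x = ennreal (h x)" by metis
  then show ?thesis by (intro exI[of _ U] exI[of _ h]) auto
 qed
 have frost: "energy \<mu> + ?IQ < \<infinity>"
  "AE x in surface_measure. x \<in> sphere_supp \<mu> \<longrightarrow> potential \<mu> x + Q x = energy \<mu> + ?IQ"
  by (rule frostman[OF n assms(2,4)], rule cont, assumption)+
 define E where "E = energy \<mu> + ?IQ"
 define F0 where "F0 = enn2real E"
 have E: "E = ennreal F0" "F0 \<ge> 0" using frost(1) by (auto simp: E_def F0_def ennreal_enn2real)
 have efin: "energy \<mu> < \<infinity>" using frost(1) by (auto simp: less_top[symmetric] top_unique)
 have conc: "AE x in \<mu>. -1 < x $ k \<and> x $ k \<le> cos \<alpha>"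
  by (rule sphere_supp_height[OF n \<mu>f efin assms(10,8,9)])
 \<comment> \<open>For \<alpha> = pi all heights would have to be \<le> -1 and > -1 at once.\<close>
 have "\<alpha> \<noteq> pi"
 proof
  assume "\<alpha> = pi"
  have "AE x in \<mu>. False" using conc
  proof (rule eventually_mono)
   fix x assume "-1 < x $ k \<and> x $ k \<le> cos \<alpha>"
   then have "-1 < x $ k" "x $ k \<le> -1" using \<open>\<alpha> = pi\<close> by simp_all
   then show False by linarith
  qed
  then show False by simp
 qed
 then have \<alpha>: "0 < \<alpha>" "\<alpha> < pi" using assms(8,9) by auto
 define a where "a = cos \<alpha>"
 have a: "-1 < a" "a < 1" using cos_monotone_0_pi[of 0 \<alpha>] cos_monotone_0_pi[of \<alpha> pi] \<alpha> by (auto simp: a_def)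
 obtain j where kj: "k \<noteq> j" using other_coordinate[OF n] .
 define q where "q = polar_profile k Q"
 define qt where "qt = (\<lambda>s. q (arccos s))"
 have cap: "south_cap k \<alpha> \<subseteq> N" using assms(6,10) by simp
 obtain q1 q2 C where "\<And>\<theta>. \<alpha> < \<theta> \<Longrightarrow> \<theta> < pi \<Longrightarrow> (q has_real_derivative q1 \<theta>) (at \<theta>) \<and>
   (q1 has_real_derivative q2 \<theta>) (at \<theta>) \<and> \<bar>q \<theta>\<bar> \<le> C \<and> \<bar>q1 \<theta>\<bar> \<le> C \<and> \<bar>q2 \<theta>\<bar> \<le> C"
  using polar_profile_C2[OF n assms(3,5,7) cap \<alpha>(1)] unfolding q_def by metis
 from C2_weighted_arccos[OF this \<alpha>] obtain y1 y2 K where C2: "C2_weighted a qt y1 y2 K"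
  unfolding a_def qt_def by blast
 have K0: "K \<ge> 0"
 proof -
  have "-1 < (a - 1) / 2" "(a - 1) / 2 < a" using a by auto
  from C2_weightedD(3)[OF C2 this] show ?thesis by linarith
 qed
 have in_supp: "x \<in> sphere_supp \<mu>" if x: "x \<in> sphere 0 1" "x $ k < a" for x
 proof -
  have "\<alpha> \<le> polar_angle k x"
   using x cos_polar_angle[OF x(1), of k] cos_monotone_0_pi[of "polar_angle k x" \<alpha>] \<alpha> arccos_lbound[of "x $ k"] sphere_nth_bounds[OF x(1), of k]
   by (force simp: a_def polar_angle_def)
  moreover have "polar_angle k x \<le> pi" using arccos_ubound[of "x $ k"] sphere_nth_bounds[OF x(1), of k] by (simp add: polar_angle_def)
  ultimately show ?thesis using x by (auto simp: assms(10) south_cap_def)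
 qed
 have Qx: "Q x = ennreal (qt (x $ k))" "0 \<le> qt (x $ k)" if x: "x \<in> sphere 0 1" "x $ k < a" for x
 proof -
  have "x \<in> N" using in_supp[OF x] assms(6) by blast
  from C2loc[OF this] obtain U h where "x \<in> U"
   "\<And>z. z \<in> U \<Longrightarrow> z \<in> sphere 0 1 \<Longrightarrow> 0 \<le> h z \<and> Q z = ennreal (h z)" by metis
  then have "0 \<le> h x" "Q x = ennreal (h x)" using x by auto
  moreover have "enn2real (Q x) = qt (x $ k)"
   using polar_profile_eq[OF n kj assms(3) x(1)] by (simp add: qt_def q_def polar_angle_def)
  ultimately show "Q x = ennreal (qt (x $ k))" "0 \<le> qt (x $ k)" by auto
 qed
 \<comment> \<open>The potential of \<mu> on the cap as dictated by Frostman's condition, a function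
   of height with the unknown constant F0.\<close>
 define y where "y s = F0 - qt s" for s
 have C2y: "C2_weighted a y (\<lambda>s. - y1 s) (\<lambda>s. - y2 s) (F0 + K)"
  unfolding C2_weighted_def
 proof (intro ballI conjI)
  fix s assume s: "s \<in> {-1<..<a}"
  then have s': "-1 < s" "s < a" by auto
  note b = C2_weightedD[OF C2 s']
  show "(y has_real_derivative - y1 s) (at s)" unfolding y_def[abs_def] by (auto intro!: derivative_eq_intros b(1))
  show "((\<lambda>s. - y1 s) has_real_derivative - y2 s) (at s)" by (rule DERIV_minus[OF b(2)])
  show "\<bar>y s\<bar> \<le> F0 + K" "(1 + s) * \<bar>- y1 s\<bar> \<le> F0 + K" "(1 + s)\<^sup>2 * \<bar>- y2 s\<bar> \<le> F0 + K"
   using b E(2) by (auto simp: y_def)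
 qed
 have cqt: "continuous_on {-1<..<a} qt"
  by (intro continuous_at_imp_continuous_on ballI, rule DERIV_isCont[OF C2_weightedD(1)[OF C2]]) auto
 \<comment> \<open>Outside the cap the profile need not be measurable; cutting it off there yields
   Borel functions on the whole line.\<close>
 define qi where "qi s = qt s * indicator {-1<..<a} s" for s
 have qim [measurable]: "qi \<in> borel_measurable borel"
  using borel_measurable_continuous_on_indicator[OF _ cqt] by (simp add: qi_def[abs_def] mult.commute)
 define yi where "yi s = F0 - qi s" for s
 have yim [measurable]: "yi \<in> borel_measurable borel" unfolding yi_def[abs_def] by measurable
 have yi: "yi s = y s" "qi s = qt s" if "s \<in> {-1<..<a}" for s using that by (auto simp: yi_def y_def qi_def)
 let ?\<sigma> = "surface_measure :: (real^'n) measure"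
 have pot: "AE x in ?\<sigma>. x $ k \<in> {-1<..<a} \<longrightarrow> potential \<mu> x + ennreal (qt (x $ k)) = ennreal F0"
  using frost(2) AE_space
 proof eventually_elim
  fix x :: "real^'n" assume x: "x \<in> sphere_supp \<mu> \<longrightarrow> potential \<mu> x + Q x = energy \<mu> + ?IQ" "x \<in> space ?\<sigma>"
  show "x $ k \<in> {-1<..<a} \<longrightarrow> potential \<mu> x + ennreal (qt (x $ k)) = ennreal F0"
  proof
   assume "x $ k \<in> {-1<..<a}"
   moreover have "x \<in> sphere 0 1" using x(2) by simp
   ultimately show "potential \<mu> x + ennreal (qt (x $ k)) = ennreal F0"
    using x(1) in_supp[of x] Qx(1)[of x] E(1) by (simp add: E_def)
  qed
 qed
 have pot': "AE x in ?\<sigma>. x $ k \<in> {-1<..<a} \<longrightarrow> potential \<mu> x = ennreal (yi (x $ k)) \<and> 0 \<le> yi (x $ k)"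
  using pot AE_space
 proof eventually_elim
  fix x :: "real^'n" assume x: "x $ k \<in> {-1<..<a} \<longrightarrow> potential \<mu> x + ennreal (qt (x $ k)) = ennreal F0" "x \<in> space ?\<sigma>"
  show "x $ k \<in> {-1<..<a} \<longrightarrow> potential \<mu> x = ennreal (yi (x $ k)) \<and> 0 \<le> yi (x $ k)"
  proof
   assume xk: "x $ k \<in> {-1<..<a}"
   have q0: "0 \<le> qt (x $ k)" using Qx(2)[of x] x(2) xk by simp
   have eq: "potential \<mu> x + ennreal (qt (x $ k)) = ennreal F0" using x(1) xk by blast
   then have "ennreal (qt (x $ k)) \<le> ennreal F0" by (metis add.commute le_iff_add)
   then have le: "qt (x $ k) \<le> F0" using E(2) by (simp add: ennreal_le_iff)
   have "ennreal F0 = ennreal (yi (x $ k)) + ennreal (qt (x $ k))"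
    using le q0 by (simp add: yi(1)[OF xk] y_def ennreal_plus[symmetric] del: ennreal_plus)
   then have "ennreal (qt (x $ k)) + potential \<mu> x = ennreal (qt (x $ k)) + ennreal (yi (x $ k))"
    using eq by (simp add: add.commute)
   then show "potential \<mu> x = ennreal (yi (x $ k)) \<and> 0 \<le> yi (x $ k)"
    using le by (simp add: ennreal_add_left_cancel yi(1)[OF xk] y_def)
  qed
 qed
 \<comment> \<open>Non-negativity is known almost everywhere on the sphere. The height formula,
   applied to the indicator of the exceptional heights, transfers it to Lebesgue measure on the
   line; the weight is positive inside (-1, 1).\<close>
 have y0: "AE s in lborel. s \<in> {-1<..<a} \<longrightarrow> 0 \<le> y s"
 proof -
  let ?\<phi> = "\<lambda>s. indicator {-1<..<a} s * indicator {s. yi s < 0} s :: ennreal"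
  have "ennreal (2 * ?B) * (\<integral>\<^sup>+s\<in>{-1<..<1}. ?\<phi> s * ennreal ((1 - s\<^sup>2) powr ((real ?n - 3) / 2)) \<partial>lborel)
   = (\<integral>\<^sup>+x. ?\<phi> (x $ k) \<partial>?\<sigma>)"
   by (rule nn_integral_surface_height[OF n, symmetric]) measurable
  also have "\<dots> = (\<integral>\<^sup>+x. 0 \<partial>?\<sigma>)"
   by (rule nn_integral_cong_AE, use pot' in eventually_elim) (auto simp: indicator_def)
  finally have "(\<integral>\<^sup>+s\<in>{-1<..<1}. ?\<phi> s * ennreal ((1 - s\<^sup>2) powr ((real ?n - 3) / 2)) \<partial>lborel) = 0"
   using half_sphere_area_pos[of "?n - 1"] n by simp
  then have "AE s in lborel. ?\<phi> s * ennreal ((1 - s\<^sup>2) powr ((real ?n - 3) / 2)) * indicator {-1<..<1} s = 0"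
   by (subst (asm) nn_integral_0_iff_AE) measurable
  then show ?thesis
  proof eventually_elim
   fix s assume s: "?\<phi> s * ennreal ((1 - s\<^sup>2) powr ((real ?n - 3) / 2)) * indicator {-1<..<1} s = 0"
   show "s \<in> {-1<..<a} \<longrightarrow> 0 \<le> y s"
   proof (rule impI, rule ccontr)
    assume sa: "s \<in> {-1<..<a}" and "\<not> 0 \<le> y s"
    then have "?\<phi> s = 1" "s \<in> {-1<..<1}" using a yi(1)[OF sa] by (auto simp: indicator_def)
    moreover have "1 - s\<^sup>2 > 0" using sa a by (simp add: abs_square_less_1 abs_less_iff)
    ultimately show False using s by simp
   qed
  qed
 qed
 \<comment> \<open>Brings the averaged potential equation to the form of
   \<open>height_law_density\<close>, by multiplying it with pi / ?B.\<close>
 define \<kappa> where "\<kappa> = pi * ?A / ?B"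
 have ha: "?A > 0" "?B > 0"
  using n by (auto intro: half_sphere_area_pos)
 have \<kappa>: "\<kappa> > 0" using ha by (simp add: \<kappa>_def)
 define m where "m = distr \<mu> borel (\<lambda>x. x $ k)"
 have km [measurable]: "(\<lambda>x. x $ k) \<in> borel_measurable \<mu>" by (rule height_measurable[OF \<mu>f])
 have m: "sets m = sets borel" "finite_measure m"
  unfolding m_def by (auto intro!: \<mu>.finite_measure_distr)
 have concm: "AE u in m. -1 < u \<and> u \<le> a"
  unfolding m_def using conc by (subst AE_distr_iff) (auto simp: a_def)
 have potm: "AE s in lborel. s \<in> {-1<..<a} \<longrightarrow> ennreal \<kappa> * (\<integral>\<^sup>+u. zonal_kernel D s u \<partial>m) = ennreal (pi * y s)"
 proof -
  have "AE s in lborel. s \<in> {-1<..<a} \<longrightarrow>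
  ennreal (?A) * (\<integral>\<^sup>+u. zonal_kernel (real ?n) s u \<partial>distr \<mu> borel (\<lambda>x. x $ k))
   = ennreal (?B * yi s)"
  proof (rule zonal_potential[OF n \<mu>f _ a yim])
   show "AE x in \<mu>. -1 < x $ k \<and> x $ k < 1" using conc by eventually_elim (use a in \<open>auto simp: a_def\<close>)
   show "yi s \<le> F0 + K" if "-1 < s" "s < a" for s
    using C2_weightedD(3)[OF C2y that] yi(1)[of s] that by simp
   show "AE x in ?\<sigma>. x $ k \<in> {-1<..<a} \<longrightarrow> potential \<mu> x = ennreal (yi (x $ k))"
    using pot' by eventually_elim blast
  qed
  then show ?thesis
  proof eventually_elim
   fix s assume s: "s \<in> {-1<..<a} \<longrightarrow>
   ennreal (?A) * (\<integral>\<^sup>+u. zonal_kernel (real ?n) s u \<partial>distr \<mu> borel (\<lambda>x. x $ k))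
    = ennreal (?B * yi s)"
   show "s \<in> {-1<..<a} \<longrightarrow> ennreal \<kappa> * (\<integral>\<^sup>+u. zonal_kernel D s u \<partial>m) = ennreal (pi * y s)"
   proof
    assume sa: "s \<in> {-1<..<a}"
    let ?c = "pi / ?B"
    have c: "?c \<ge> 0" using ha by simp
    have "ennreal \<kappa> = ennreal ?c * ennreal (?A)"
     unfolding ennreal_mult'[OF c, symmetric] by (simp add: \<kappa>_def)
    then have "ennreal \<kappa> * (\<integral>\<^sup>+u. zonal_kernel D s u \<partial>m) = ennreal ?c * ennreal (?B * yi s)"
     using s sa by (simp add: m_def D_def mult.assoc)
    also have "\<dots> = ennreal (pi * y s)"
     unfolding ennreal_mult'[OF c, symmetric] using ha by (simp add: yi(1)[OF sa])
    finally show "ennreal \<kappa> * (\<integral>\<^sup>+u. zonal_kernel D s u \<partial>m) = ennreal (pi * y s)" .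
   qed
  qed
 qed
 obtain G' where nice: "nice_on a (Abel_g D qt y1) G'" using nice_on_Abel_g[OF D C2 a(2)] by auto
 from nice_on_upper_Abel(1)[OF nice] obtain Bq'
  where "\<forall>v\<in>{-1<..<a}. (upper_Abel a (Abel_g D qt y1) has_real_derivative Bq' v) (at v)" ..
 then have Bq': "\<And>v. -1 < v \<Longrightarrow> v < a \<Longrightarrow> (upper_Abel a (Abel_g D qt y1) has_real_derivative Bq' v) (at v)" by simp
 \<comment> \<open>\<open>Abel_g\<close> of the constant F0 is A times (1 - \<tau>) powr ((D - 2) /
   2).\<close>
 define A where "A = F0 * ((D - 2) / 2 * Beta ((D - 1) / 2) (1/2))"
 define B' where "B' v = A * (- ((1 - v) powr e * cap_hyp D a v)) - Bq' v" for v
 have dB: "(upper_Abel a (Abel_g D y (\<lambda>s. - y1 s)) has_real_derivative B' v) (at v)" if v: "-1 < v" "v < a" for v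
 proof -
  have "((\<lambda>v. A * upper_Abel a (\<lambda>\<tau>. (1 - \<tau>) powr ((D - 2) / 2)) v - upper_Abel a (Abel_g D qt y1) v) has_real_derivative B' v) (at v)"
   unfolding B'_def e_def by (intro DERIV_diff DERIV_cmult upper_Abel_power_derivative Bq' v) (use D a v in auto)
  then show ?thesis
   by (rule has_field_derivative_transform_within_open[of _ _ _ "{-1<..<a}"])
    (use v upper_Abel_affine[OF D C2 a(2)] in \<open>auto simp: A_def y_def[abs_def]\<close>)
 qed
 have law: "\<And>v. -1 < v \<Longrightarrow> v < a \<Longrightarrow> B' v \<le> 0"
  "m = density lborel (\<lambda>v. ennreal ((1 + v) powr ((D - 3) / 2) * (- B' v) / (pi * \<kappa>) * indicator {-1<..<a} v))"
  using height_law_density[OF D a C2y m concm y0 \<kappa> potm, of B'] dB by blast+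
 have B'm [measurable]: "(\<lambda>v. B' v * indicator {-1<..<a} v) \<in> borel_measurable borel"
  using dB by (rule derivative_measurable)
 define \<omega> where "\<omega> = 2 * ?B"
 have \<omega>: "\<omega> > 0" using ha by (simp add: \<omega>_def)
 \<comment> \<open>The prefactor of \<open>aux_F\<close>; it equals 1 / (pi * \<kappa> * \<omega>),
   the normalisation that passes from the law of heights to a density on the sphere.\<close>
 define c1 where "c1 = Gamma ((D - 2) / 2) / (2 * pi powr ((D + 2) / 2))"
 have c1: "1 / (pi * \<kappa> * \<omega>) = c1"
  using half_sphere_area_constant[OF n] ha by (simp add: c1_def D_def \<kappa>_def \<omega>_def power2_eq_square mult_ac)
 have c1p: "c1 > 0" unfolding c1[symmetric] using \<kappa> \<omega> by simp
 \<comment> \<open>The density of m divided by that of the heights under surface measure: (1 + v)^e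
   / (1 - v^2)^e = (1 - v)^(-e). The indicator makes the function vanish off the cap.\<close>
 define fv where "fv v = c1 * ((1 - v) powr (- e) * (- (B' v * indicator {-1<..<a} v)))" for v
 have fvm [measurable]: "fv \<in> borel_measurable borel" unfolding fv_def[abs_def] by measurable
 have fv0: "fv v \<ge> 0" for v
  using law(1)[of v] c1p by (cases "v \<in> {-1<..<a}") (auto simp: fv_def mult_le_0_iff)
 have fvz: "fv v \<noteq> 0 \<Longrightarrow> v \<in> {-1<..<a}" for v by (auto simp: fv_def indicator_def split: if_splits)
 have fvw: "\<omega> * (fv v * (1 - v\<^sup>2) powr e) = (1 + v) powr e * (- B' v) / (pi * \<kappa>)" if v: "v \<in> {-1<..<a}" for v
 proof -
  have v': "1 - v > 0" using v a by simp
  have "1 - v\<^sup>2 = (1 - v) * (1 + v)" by (simp add: power2_eq_square algebra_simps)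
  then have w: "(1 - v\<^sup>2) powr e = (1 - v) powr e * (1 + v) powr e" by (simp add: powr_mult)
  have "\<omega> * (fv v * (1 - v\<^sup>2) powr e) = (\<omega> * c1) * (((1 - v) powr (- e) * (1 - v) powr e) * ((1 + v) powr e * (- B' v)))"
   using v unfolding fv_def w by simp
  also have "(1 - v) powr (- e) * (1 - v) powr e = 1" using v' by (simp add: powr_add[symmetric])
  also have "\<omega> * c1 = 1 / (pi * \<kappa>)" unfolding c1[symmetric] using \<omega> by simp
  finally show ?thesis by simp
 qed
 have height: "m = density lborel (\<lambda>v. ennreal \<omega> * (ennreal (fv v) * ennreal ((1 - v\<^sup>2) powr e) * indicator {-1<..<1} v))"
 proof (rule trans[OF law(2)], rule arg_cong[where f = "density lborel"], rule ext)
  fix v :: real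
  show "ennreal ((1 + v) powr ((D - 3) / 2) * (- B' v) / (pi * \<kappa>) * indicator {-1<..<a} v)
   = ennreal \<omega> * (ennreal (fv v) * ennreal ((1 - v\<^sup>2) powr e) * indicator {-1<..<1} v)"
  proof (cases "v \<in> {-1<..<a}")
   case True
   then have "indicator {-1<..<1} v = (1::ennreal)" using a by simp
   moreover have "ennreal \<omega> * (ennreal (fv v) * ennreal ((1 - v\<^sup>2) powr e)) = ennreal (\<omega> * (fv v * (1 - v\<^sup>2) powr e))"
    using \<omega> fv0[of v] by (simp add: ennreal_mult)
   ultimately show ?thesis using True unfolding fvw[OF True] by (simp add: e_def)
  next
   case False
   then have "fv v = 0" using fvz by blast
   then show ?thesis using False by simp
  qed
 qed
 have \<mu>_eq: "\<mu> = density surface_measure (\<lambda>x. ennreal (fv (x $ k)))"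
 proof (rule zonal_measure_eqI[OF n \<mu> fvm, where h = "\<lambda>s. ennreal (qi s)"])
  show "distr \<mu> borel (\<lambda>x. x $ k) = density lborel (\<lambda>v. ennreal (2 * ?B) *
    (ennreal (fv v) * ennreal ((1 - v\<^sup>2) powr ((real ?n - 3) / 2)) * indicator {-1<..<1} v))"
   using height unfolding m_def \<omega>_def e_def D_def .
  show "Q \<in> borel_measurable sphere_borel" using assms(2) by (intro lsc_on_measurable) (simp add: external_field_def)
  show "Q x = ennreal (qi (x $ k))" if "x \<in> sphere 0 1" "fv (x $ k) \<noteq> 0" for x
   using fvz[OF that(2)] Qx(1)[OF that(1)] by (simp add: qi_def)
  show "energy \<mu> + ?IQ < \<infinity>" by (rule frost(1))
  show "AE x in surface_measure. fv (x $ k) \<noteq> 0 \<longrightarrow> potential \<mu> x + Q x = energy \<mu> + ?IQ"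
   using frost(2) AE_space
  proof eventually_elim
   fix x :: "real^'n" assume x: "x \<in> sphere_supp \<mu> \<longrightarrow> potential \<mu> x + Q x = energy \<mu> + ?IQ" "x \<in> space ?\<sigma>"
   show "fv (x $ k) \<noteq> 0 \<longrightarrow> potential \<mu> x + Q x = energy \<mu> + ?IQ"
    using x in_supp[of x] fvz[of "x $ k"] by auto
  qed
 qed measurable
 \<comment> \<open>The contribution of the field, with a plus sign: the potential contains the field
   negatively, and so does the density the derivative.\<close>
 define r where "r v = c1 * ((1 - v) powr (- e) * Bq' v)" for v
 have fvr: "fv v = c1 * A * cap_hyp D a v + r v" if v: "v \<in> {-1<..<a}" for v
 proof -
  have v': "1 - v > 0" using v a by simp
  have "fv v = c1 * A * ((1 - v) powr (- e) * (1 - v) powr e) * cap_hyp D a v + r v"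
   using v by (simp add: fv_def B'_def r_def algebra_simps)
  also have "(1 - v) powr (- e) * (1 - v) powr e = 1" using v' by (simp add: powr_add[symmetric])
  finally show ?thesis by simp
 qed
 have auxF: "aux_F ?n q \<alpha> \<eta> = r (cos \<eta>)" if "\<alpha> < \<eta>" "\<eta> < pi" for \<eta>
  unfolding r_def c1_def e_def D_def
  by (rule aux_F_eq[OF n \<alpha> C2[unfolded a_def qt_def] Bq'[unfolded a_def qt_def D_def] that])
 \<comment> \<open>The coefficient c1 * A still hides the unknown F0; total mass 1 identifies it
   with the explicit constant.\<close>
 have C: "const_C ?n q \<alpha> = c1 * A"
 proof (rule const_C_eq[OF n \<alpha> _ auxF])
  have "(\<lambda>v. Bq' v * indicator {-1<..<a} v) \<in> borel_measurable borel" using Bq' by (rule derivative_measurable)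
  then have "(\<lambda>v. c1 * ((1 - v) powr (- e) * (Bq' v * indicator {-1<..<a} v))) \<in> borel_measurable borel" by measurable
  then show "(\<lambda>v. r v * indicator {-1<..<cos \<alpha>} v) \<in> borel_measurable borel" by (simp add: r_def a_def mult.assoc)
  show "0 \<le> c1 * A * cap_hyp (real ?n) (cos \<alpha>) v + r v" if "-1 < v" "v < cos \<alpha>" for v
   using fvr[of v] fv0[of v] that by (simp add: a_def D_def)
  let ?g = "\<lambda>v. ennreal ((c1 * A * cap_hyp D a v + r v) * (1 - v\<^sup>2) powr e)"
  let ?J = "\<integral>\<^sup>+v\<in>{-1<..<a}. ?g v \<partial>lborel"
  have "1 = emeasure m (space m)"
   unfolding m_def using \<mu>.emeasure_space_1 by (simp add: emeasure_distr)
  also have "\<dots> = (\<integral>\<^sup>+v. ennreal \<omega> * (ennreal (fv v) * ennreal ((1 - v\<^sup>2) powr e) * indicator {-1<..<1} v) \<partial>lborel)"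
   unfolding height by (subst emeasure_density) auto
  also have "\<dots> = (\<integral>\<^sup>+v. ennreal \<omega> * (?g v * indicator {-1<..<a} v) \<partial>lborel)"
  proof (rule nn_integral_cong)
   fix v :: real
   show "ennreal \<omega> * (ennreal (fv v) * ennreal ((1 - v\<^sup>2) powr e) * indicator {-1<..<1} v)
    = ennreal \<omega> * (?g v * indicator {-1<..<a} v)"
   proof (cases "v \<in> {-1<..<a}")
    case True
    then have "indicator {-1<..<1} v = (1::ennreal)" using a by simp
    then show ?thesis using True fv0[of v] unfolding fvr[OF True] by (simp add: ennreal_mult)
   next
    case False
    then have "fv v = 0" using fvz by blast
   then show ?thesis using False by simp
   qed
  qed
  also have "\<dots> = ennreal \<omega> * ?J"
  proof (rule nn_integral_cmult)
   have "(\<lambda>v. ennreal (fv v * (1 - v\<^sup>2) powr e) * indicator {-1<..<a} v) \<in> borel_measurable lborel" by measurable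
   moreover have "(\<lambda>v. ennreal (fv v * (1 - v\<^sup>2) powr e) * indicator {-1<..<a} v) = (\<lambda>v. ?g v * indicator {-1<..<a} v)"
    using fvr by (auto simp: fun_eq_iff indicator_def)
   ultimately show "(\<lambda>v. ?g v * indicator {-1<..<a} v) \<in> borel_measurable lborel" by simp
  qed
  finally have one: "1 = ennreal \<omega> * ?J" .
  have "ennreal (1 / \<omega>) = ennreal (1 / \<omega>) * (ennreal \<omega> * ?J)"
   unfolding one[symmetric] by simp
  also have "\<dots> = ennreal (1 / \<omega> * \<omega>) * ?J"
   using \<omega> by (subst ennreal_mult) (auto simp: mult.assoc)
  also have "1 / \<omega> * \<omega> = 1" using \<omega> by simp
  finally show "(\<integral>\<^sup>+v\<in>{-1<..<cos \<alpha>}. ennreal ((c1 * A * cap_hyp (real ?n) (cos \<alpha>) v + r v) * (1 - v\<^sup>2) powr ((real ?n - 3) / 2)) \<partial>lborel)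
   = ennreal (1 / (2 * ?B))"
   unfolding \<omega>_def[symmetric] by (simp add: a_def D_def e_def)
 qed
 define f where "f \<eta> = fv (cos \<eta>)" for \<eta>
 show ?thesis
 proof (intro exI[of _ f] conjI allI)
  have "cos \<in> borel_measurable (borel :: real measure)"
   by (intro borel_measurable_continuous_onI continuous_intros)
  then show "f \<in> borel_measurable borel" unfolding f_def[abs_def] by measurable
  show "0 \<le> f \<eta>" for \<eta> unfolding f_def by (rule fv0)
  have sm: "(\<lambda>x::real^'n. x $ k) \<in> borel_measurable surface_measure" by (rule height_measurable[OF surface_measure_fin[OF n]])
  have fx: "fv (x $ k) = f (polar_angle k x)" if "x \<in> space ?\<sigma>" for x
   using that cos_polar_angle[of x k] by (simp add: f_def)
  have m1: "(\<lambda>x. ennreal (fv (x $ k))) \<in> borel_measurable ?\<sigma>" using sm by measurable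
  have "density ?\<sigma> (\<lambda>x. ennreal (fv (x $ k))) = density ?\<sigma> (\<lambda>x. ennreal (f (polar_angle k x)))"
  proof (rule density_cong[OF m1])
   show "(\<lambda>x. ennreal (f (polar_angle k x))) \<in> borel_measurable ?\<sigma>"
    using m1 by (rule measurable_cong[THEN iffD1, rotated]) (simp add: fx)
   show "AE x in ?\<sigma>. ennreal (fv (x $ k)) = ennreal (f (polar_angle k x))"
    by (rule AE_I2) (simp add: fx)
  qed
  then show "\<mu> = density surface_measure (\<lambda>x. ennreal (f (polar_angle k x)))" using \<mu>_eq by simp
  \<comment> \<open>The two end angles are discarded as null: at \<alpha> the density formula
    divides by zero, at pi the factor 1 / sin \<eta> of F does.\<close>
  show "AE \<eta> in lborel. \<eta> \<in> {\<alpha>..pi} \<longrightarrow> f \<eta> = cap_density ?n (polar_profile k Q) \<alpha> \<eta>"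
   using AE_lborel_singleton[of \<alpha>] AE_lborel_singleton[of pi]
  proof eventually_elim
   fix \<eta> :: real assume \<eta>': "\<eta> \<noteq> \<alpha>" "\<eta> \<noteq> pi"
   show "\<eta> \<in> {\<alpha>..pi} \<longrightarrow> f \<eta> = cap_density ?n (polar_profile k Q) \<alpha> \<eta>"
   proof
    assume "\<eta> \<in> {\<alpha>..pi}"
    then have \<eta>: "\<alpha> < \<eta>" "\<eta> < pi" using \<eta>' by auto
    then have v: "cos \<eta> \<in> {-1<..<a}"
     using \<alpha> cos_monotone_0_pi[of \<alpha> \<eta>] cos_monotone_0_pi[of \<eta> pi] by (simp add: a_def)
    show "f \<eta> = cap_density ?n (polar_profile k Q) \<alpha> \<eta>"
     unfolding f_def fvr[OF v] cap_density_def q_def[symmetric] C auxF[OF \<eta>] cap_hyp_def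
     by (simp add: a_def D_def mult.assoc)
   qed
  qed
 qed
qed

end
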